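(* Let $p\ge 2$ be an integer, $\varepsilon\in\{-1,1\}$, $\nu>0$ and $s\ge 3$. Suppose $u_0\in X^s(\mathbb{R}^2)$, $\partial_x^{-1}u_0\in L^1(\mathbb{R}^2)$, $\partial_x^{-1}\partial_y^m u_0\in L^1(\mathbb{R}^2)$ for some integer $m\ge 3$, and $\|u_0\|_{H^1}+\|\partial_x^2u_0\|_{L^2}+\|\partial_x^{-1}\partial_y u_0\|_{L^2}$ is sufficiently small. Let $j\in\{0,1,\dots,\min\{[s],m\}-3\}$ be such that $\partial_x^{-1}\partial_y^j u_0\in L^1(\mathbb{R}^2)$. Then for each non-negative integer $l$ there exist constants $C_\dagger>0$ and $T_\dagger>0$ such that the solution $u$ satisfies $$\big\|\partial_x^l\partial_y^j u(\cdot,\cdot,t)\big\|_{L^\infty(\mathbb{R}^2)}\ge C_\dagger|\mathcal{M}|\,t^{-\frac74-\frac l2},\qquad t\ge T_\dagger,$$ where $$\mathcal{M}:=\int_{\mathbb{R}^2}\partial_x^{-1}\partial_y^j u_0(x,y)\,dx\,dy-\frac{1}{p+1}\int_0^\infty\int_{\mathbb{R}^2}\partial_y^j\big(u^{p+1}(x,y,t)\big)\,dx\,dy\,dt .$$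
   Context: Fourier transform on $\mathbb{R}^2$: $\hat f(\xi,\eta)=\frac{1}{2\pi}\int_{\mathbb{R}^2}e^{-ix\xi-iy\eta}f(x,y)\,dx\,dy$, with inverse $\mathcal{F}^{-1}[g](x,y)=\frac{1}{2\pi}\int_{\mathbb{R}^2}e^{ix\xi+iy\eta}g\,d\xi\,d\eta$. For $s\ge0$, $X^s(\mathbb{R}^2)$ is the space of $f\in H^s(\mathbb{R}^2)$ with $\|f\|_{H^s}+\|\mathcal{F}^{-1}[\xi^{-1}\hat f(\xi,\eta)]\|_{H^s}<\infty$; $\partial_x^{-1}f:=\mathcal{F}^{-1}[(i\xi)^{-1}\hat f(\xi,\eta)]$. The Cauchy problem is $u_t+u^pu_x+u_{xxx}+\varepsilon\partial_x^{-1}u_{yy}-\nu u_{xx}=0$ for $(x,y)\in\mathbb{R}^2$, $t>0$, $u(x,y,0)=u_0(x,y)$; under the hypotheses it has a unique global solution $u\in C_b([0,\infty);X^s(\mathbb{R}^2))\cap L^2(0,\infty;H^s(\mathbb{R}^2))$ (known result of Molinet), called "the solution". Under these hypotheses the double integral in $\mathcal{M}$ converges absolutely, so $\mathcal{M}$ is a finite real number. *)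

theory Defs
  imports "HOL-Analysis.Analysis" "HOL-Probability.Essential_Supremum"
begin

type_synonym r2fun = "real \<times> real \<Rightarrow> real"

definition pdx :: "r2fun \<Rightarrow> r2fun" where
  "pdx f = (\<lambda>z. frechet_derivative f (at z) (1, 0))"

definition pdy :: "r2fun \<Rightarrow> r2fun" where
  "pdy f = (\<lambda>z. frechet_derivative f (at z) (0, 1))"

definition pd_word :: "bool list \<Rightarrow> r2fun \<Rightarrow> r2fun" where
  "pd_word ws f = foldr (\<lambda>b h. if b then pdx h else pdy h) ws f"

definition smooth2 :: "r2fun \<Rightarrow> bool" where
  "smooth2 f \<longleftrightarrow> (\<forall>ws z. pd_word ws f differentiable (at z)) \<and> (\<forall>ws. continuous_on UNIV (pd_word ws f))"

definition test_fun :: "r2fun \<Rightarrow> bool" where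
  "test_fun \<phi> \<longleftrightarrow> smooth2 \<phi> \<and> (\<exists>K. compact K \<and> (\<forall>z. z \<notin> K \<longrightarrow> \<phi> z = 0))"

definition fourier :: "(real \<times> real \<Rightarrow> complex) \<Rightarrow> real \<times> real \<Rightarrow> complex" where
  "fourier f = (\<lambda>(xi, eta). complex_of_real (1 / (2 * pi)) *
      (LINT z|lborel. cis (- (fst z * xi + snd z * eta)) * f z))"

definition L2c :: "(real \<times> real \<Rightarrow> complex) \<Rightarrow> bool" where
  "L2c f \<longleftrightarrow> f \<in> borel_measurable lborel \<and> integrable lborel (\<lambda>z. (cmod (f z))\<^sup>2)"

text \<open>g is the (Plancherel) Fourier transform of the L^2 function f, characterised by
  the duality  int f * hat(phi) = int g * phi  for all test functions phi.\<close>
definition is_FT :: "(real \<times> real \<Rightarrow> complex) \<Rightarrow> (real \<times> real \<Rightarrow> complex) \<Rightarrow> bool" where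
  "is_FT f g \<longleftrightarrow> L2c f \<and> L2c g \<and>
     (\<forall>\<phi>. test_fun \<phi> \<longrightarrow>
        (LINT z|lborel. f z * fourier (\<lambda>w. complex_of_real (\<phi> w)) z) =
        (LINT z|lborel. g z * complex_of_real (\<phi> z)))"

definition fourierL2 :: "r2fun \<Rightarrow> real \<times> real \<Rightarrow> complex" where
  "fourierL2 f = (SOME g. is_FT (\<lambda>z. complex_of_real (f z)) g)"

definition jbr :: "real \<times> real \<Rightarrow> real" where
  "jbr \<zeta> = 1 + (fst \<zeta>)\<^sup>2 + (snd \<zeta>)\<^sup>2"

definition L2norm :: "r2fun \<Rightarrow> real" where
  "L2norm f = sqrt (LINT z|lborel. (f z)\<^sup>2)"

definition Hs :: "real \<Rightarrow> r2fun set" where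
  "Hs s = {f. \<exists>g. is_FT (\<lambda>z. complex_of_real (f z)) g \<and>
      (\<integral>\<^sup>+\<zeta>. ennreal (jbr \<zeta> powr s * (cmod (g \<zeta>))\<^sup>2) \<partial>lborel) < \<infinity>}"

definition Hs_norm :: "real \<Rightarrow> r2fun \<Rightarrow> real" where
  "Hs_norm s f = sqrt (LINT \<zeta>|lborel. jbr \<zeta> powr s * (cmod (fourierL2 f \<zeta>))\<^sup>2)"

definition fmult :: "(real \<times> real \<Rightarrow> complex) \<Rightarrow> r2fun \<Rightarrow> r2fun" where
  "fmult m f = (SOME g. is_FT (\<lambda>z. complex_of_real (g z)) (\<lambda>\<zeta>. m \<zeta> * fourierL2 f \<zeta>))"

definition dxinv :: "r2fun \<Rightarrow> r2fun" where
  "dxinv f = fmult (\<lambda>\<zeta>. 1 / (\<i> * complex_of_real (fst \<zeta>))) f"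

definition Xs :: "real \<Rightarrow> r2fun set" where
  "Xs s = {f. f \<in> Hs s \<and> (\<exists>g. is_FT (\<lambda>z. complex_of_real (g z))
                 (\<lambda>\<zeta>. fourierL2 f \<zeta> / (\<i> * complex_of_real (fst \<zeta>))) \<and> g \<in> Hs s)}"

definition Xs_norm :: "real \<Rightarrow> r2fun \<Rightarrow> real" where
  "Xs_norm s f = Hs_norm s f + Hs_norm s (dxinv f)"

definition wderiv :: "nat \<Rightarrow> nat \<Rightarrow> r2fun \<Rightarrow> r2fun \<Rightarrow> bool" where
  "wderiv k j f g \<longleftrightarrow> g \<in> borel_measurable lborel \<and>
     (\<forall>K. compact K \<longrightarrow> set_integrable lborel K g) \<and>
     (\<forall>\<phi>. test_fun \<phi> \<longrightarrow>
        (LINT z|lborel. g z * \<phi> z) =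
        (-1) ^ (k + j) * (LINT z|lborel. f z * (pdx ^^ k) ((pdy ^^ j) \<phi>) z))"

definition wd :: "nat \<Rightarrow> nat \<Rightarrow> r2fun \<Rightarrow> r2fun" where
  "wd k j f = (SOME g. wderiv k j f g)"

definition Linf_deriv :: "nat \<Rightarrow> nat \<Rightarrow> r2fun \<Rightarrow> ereal" where
  "Linf_deriv k j f = (if \<exists>g. wderiv k j f g
      then esssup lborel (\<lambda>z. ereal \<bar>wd k j f z\<bar>) else \<infinity>)"

definition dxinv_dy_L1 :: "nat \<Rightarrow> r2fun \<Rightarrow> bool" where
  "dxinv_dy_L1 j f \<longleftrightarrow> (\<exists>h. wderiv 0 j (dxinv f) h \<and> integrable lborel h)"

definition Nop :: "nat \<Rightarrow> real \<Rightarrow> real \<Rightarrow> r2fun \<Rightarrow> r2fun" where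
  "Nop p \<epsilon> \<nu> f = (\<lambda>z.
      (f z) ^ p * fmult (\<lambda>\<zeta>. \<i> * complex_of_real (fst \<zeta>)) f z
    + fmult (\<lambda>\<zeta>. (\<i> * complex_of_real (fst \<zeta>)) ^ 3) f z
    + \<epsilon> * fmult (\<lambda>\<zeta>. (\<i> * complex_of_real (snd \<zeta>)) ^ 2 / (\<i> * complex_of_real (fst \<zeta>))) f z
    - \<nu> * fmult (\<lambda>\<zeta>. (\<i> * complex_of_real (fst \<zeta>)) ^ 2) f z)"

definition is_solution :: "nat \<Rightarrow> real \<Rightarrow> real \<Rightarrow> real \<Rightarrow> r2fun \<Rightarrow> (real \<Rightarrow> r2fun) \<Rightarrow> bool" where
  "is_solution p \<epsilon> \<nu> s u0 u \<longleftrightarrow>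
     (AE z in lborel. u 0 z = u0 z) \<and>
     (\<forall>t\<ge>0. u t \<in> Xs s) \<and>
     (\<exists>B. \<forall>t\<ge>0. Xs_norm s (u t) \<le> B) \<and>
     (\<forall>t\<ge>0. ((\<lambda>\<tau>. Xs_norm s (\<lambda>z. u \<tau> z - u t z)) \<longlongrightarrow> 0) (at t within {0..})) \<and>
     (\<integral>\<^sup>+t\<in>{0..}. ennreal ((Hs_norm s (u t))\<^sup>2) \<partial>lborel) < \<infinity> \<and>
     (\<forall>t\<ge>0. ((\<lambda>h. \<integral>\<^sup>+z. ennreal (((u (t + h) z - u t z) / h + Nop p \<epsilon> \<nu> (u t) z)\<^sup>2) \<partial>lborel)
               \<longlongrightarrow> 0) (at 0 within {-t..}))"

definition Mconst :: "nat \<Rightarrow> nat \<Rightarrow> r2fun \<Rightarrow> (real \<Rightarrow> r2fun) \<Rightarrow> real" where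
  "Mconst p j u0 u =
     (LINT z|lborel. wd 0 j (dxinv u0) z)
     - 1 / real (p + 1) *
       (LBINT t:{0..}. (LINT z|lborel. wd 0 j (\<lambda>w. (u t w) ^ (p + 1)) z))"

end

(* Since u solves the equation in X^s, Duhamel's formula holds for the Fourier transform: with the symbol
   S(xi, eta) = - nu xi^2 + i (xi^3 - eps eta^2 / xi) one has
     u^(t, zeta) = i xi e^(t S) ( w0^(zeta) - 1/(p+1) int_0^t e^(-tau S) (u^(p+1))^(tau, zeta) dtau ),   w0 = dxinv u0.
   Under the scaling xi = t^(-1/2) xi', eta = t^(-3/4) eta' the exponent t S converges and the bracket tends, boundedly,
   to its value at zeta = 0, that is to Mconst / (2 pi) when j = 0. Pairing d_x^l u(t) with a test function that is
   rescaled accordingly, and whose transform is concentrated where the limiting profile does not vanish, gives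
   the lower bound by duality. For j >= 1 the constant Mconst vanishes, being built from integrals of
   y-derivatives of integrable functions. *)
theory Submission
  imports Defs "HOL-Probability.Characteristic_Functions" "HOL-Probability.Sinc_Integral"
    "HOL-Computational_Algebra.Polynomial"
begin

text \<open>The data are accessible only by duality: \<open>is_FT\<close> and \<open>wderiv\<close>
  are tested against compactly supported smooth functions, while \<open>fourierL2\<close>,
  \<open>fmult\<close> and \<open>wd\<close> are choices by \<open>SOME\<close>. The L^2 theory of
  the transform that gives these choices a meaning is therefore built from Gaussian regularisation.
  Two obstacles shape the rest. The equation holds as an L^2 limit of difference quotients at each
  time, and \<open>symb\<close> is singular on xi = 0; Duhamel's formula is thus derived after
  integration over bounded frequency sets on which \<open>symb\<close> is bounded, and then almost
  everywhere by exhaustion. And a test function must have compact support in space, so its transform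
  cannot be cut off in frequency; it only decays fast enough to absorb |xi|^(l+1). Origin of the
  exponent: put b = t^(-1/2) and c = t^(-3/4). The dilated test function has L^1 norm of order 1/(b
  c), and the factor i xi together with l derivatives yields b^(l+1). The ratio b c b^(l+1) is
  t^(-7/4 - l/2).\<close>

section \<open>Products and affine substitutions for Lebesgue measure on the plane\<close>

lemma cis_measurable [measurable]: "cis \<in> borel_measurable borel"
  by (intro borel_measurable_continuous_onI continuous_intros)

lemma integrable_mult_bounded:
  fixes f g :: "'a \<Rightarrow> 'b::{real_normed_field, banach, second_countable_topology}"
  assumes f: "integrable M f" and g: "g \<in> borel_measurable M" and B: "\<And>x. norm (g x) \<le> B"
  shows "integrable M (\<lambda>x. g x * f x)"
proof (rule Bochner_Integration.integrable_bound)
  show "integrable M (\<lambda>x. B * norm (f x))" using f by simp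
  show "(\<lambda>x. g x * f x) \<in> borel_measurable M"
    using f g by simp
  show "AE x in M. norm (g x * f x) \<le> norm (B * norm (f x))"
  proof (rule AE_I2)
    fix x
    have "0 \<le> B" using B[of x] norm_ge_zero order_trans by blast
    then show "norm (g x * f x) \<le> norm (B * norm (f x))"
      using B[of x] by (simp add: norm_mult mult_right_mono)
  qed
qed

lemma integrable_tensor:
  fixes f :: "'a::euclidean_space \<Rightarrow> 'c::{real_normed_field, banach, second_countable_topology}"
    and g :: "'b::euclidean_space \<Rightarrow> 'c"
  assumes f: "integrable lborel f" and g: "integrable lborel g"
  shows "integrable (lborel \<Otimes>\<^sub>M lborel) (\<lambda>z. f (fst z) * g (snd z))"
proof -
  have [measurable]: "f \<in> borel_measurable borel" "g \<in> borel_measurable borel"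
    using f g by auto
  show ?thesis
    by (rule lborel_pair.Fubini_integrable) (use f g in \<open>auto simp: norm_mult\<close>)
qed

lemma
  fixes f g :: "real \<Rightarrow> 'c::{real_normed_field, banach, second_countable_topology}"
  assumes f: "integrable lborel f" and g: "integrable lborel g"
  shows integrable_tensor2: "integrable lborel (\<lambda>z. f (fst z) * g (snd z))"
    and integral_tensor2: "(LINT z|lborel. f (fst z) * g (snd z)) = (LINT x|lborel. f x) * (LINT y|lborel. g y)"
proof -
  have i: "integrable (lborel \<Otimes>\<^sub>M lborel) (\<lambda>z. f (fst z) * g (snd z))"
    by (rule integrable_tensor[OF f g])
  then show "integrable lborel (\<lambda>z. f (fst z) * g (snd z))" by (simp add: lborel_prod)
  show "(LINT z|lborel. f (fst z) * g (snd z)) = (LINT x|lborel. f x) * (LINT y|lborel. g y)"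
    using lborel_pair.integral_fst'[OF i] by (simp add: lborel_prod)
qed

lemma lborel_affine2:
  fixes a b t1 t2 :: real
  assumes "a \<noteq> 0" "b \<noteq> 0"
  shows "lborel = density (distr lborel borel (\<lambda>z. (t1 + a * fst z, t2 + b * snd z))) (\<lambda>_. ennreal \<bar>a * b\<bar>)"
proof -
  have B: "Basis = {(0::real,1::real), (1,0)}"
    by (simp add: Basis_prod_def)
  \<comment> \<open>The general rule takes one coefficient per basis vector: \<open>a\<close>
    belongs to (1, 0) and \<open>b\<close> to (0, 1).\<close>
  define c where "c = (\<lambda>j::real\<times>real. if j = (1,0) then a else b)"
  have "lborel = density (distr lborel borel (\<lambda>z. (t1,t2) + (\<Sum>j\<in>Basis. (c j * (z \<bullet> j)) *\<^sub>R j)))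
      (\<lambda>_. (\<Prod>j\<in>Basis. \<bar>c j\<bar>))"
    by (rule lborel_affine_euclidean) (use assms in \<open>auto simp: c_def\<close>)
  moreover have "(t1,t2) + (\<Sum>j\<in>Basis. (c j * (z \<bullet> j)) *\<^sub>R j) = (t1 + a * fst z, t2 + b * snd z)" for z
    by (cases z) (simp add: B c_def)
  moreover have "(\<Prod>j\<in>Basis. \<bar>c j\<bar>) = \<bar>a * b\<bar>"
    by (simp add: B c_def abs_mult)
  ultimately show ?thesis by simp
qed

text \<open>All three forms come from one description of \<open>lborel\<close> as a weighted image
  of itself. The equality of Bochner integrals asks only for measurability, so it also covers
  non-integrable functions, where both sides are 0.\<close>

lemma
  fixes a b t1 t2 :: real and f :: "real \<times> real \<Rightarrow> 'c::{banach, second_countable_topology}"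
  assumes ab: "a \<noteq> 0" "b \<noteq> 0"
  shows integrable_affine2: "integrable lborel f \<Longrightarrow> integrable lborel (\<lambda>z. f (t1 + a * fst z, t2 + b * snd z))"
    and integral_affine2: "f \<in> borel_measurable borel \<Longrightarrow>
      (LINT z|lborel. f (t1 + a * fst z, t2 + b * snd z)) = (LINT z|lborel. f z) /\<^sub>R \<bar>a * b\<bar>"
    and nn_integral_affine2: "h \<in> borel_measurable borel \<Longrightarrow>
      (\<integral>\<^sup>+z. h z \<partial>lborel) = ennreal \<bar>a * b\<bar> * (\<integral>\<^sup>+z. h (t1 + a * fst z, t2 + b * snd z) \<partial>lborel)"
proof -
  define T where "T = (\<lambda>z::real\<times>real. (t1 + a * fst z, t2 + b * snd z))"
  have T[measurable]: "T \<in> borel_measurable borel"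
    unfolding T_def borel_prod[symmetric] by measurable
  have L: "lborel = density (distr lborel borel T) (\<lambda>_. ennreal \<bar>a * b\<bar>)"
    using lborel_affine2[OF ab] by (simp add: T_def)
  show 1: "(\<integral>\<^sup>+z. h z \<partial>lborel) = ennreal \<bar>a * b\<bar> * (\<integral>\<^sup>+z. h (t1 + a * fst z, t2 + b * snd z) \<partial>lborel)"
    if [measurable]: "h \<in> borel_measurable borel" for h
    by (subst L) (simp add: nn_integral_density nn_integral_distr nn_integral_cmult, simp add: T_def)
  show "integrable lborel (\<lambda>z. f (t1 + a * fst z, t2 + b * snd z))" if f: "integrable lborel f"
  proof -
    have [measurable]: "f \<in> borel_measurable borel" using f by simp
    have "ennreal \<bar>a * b\<bar> * (\<integral>\<^sup>+z. norm (f (T z)) \<partial>lborel) < \<infinity>"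
      using f 1[of "\<lambda>z. ennreal (norm (f z))"] unfolding integrable_iff_bounded by (simp add: T_def)
    then have "(\<integral>\<^sup>+z. norm (f (T z)) \<partial>lborel) < \<infinity>"
      using ab by (auto simp: ennreal_mult_less_top)
    then have "integrable lborel (\<lambda>z. f (T z))"
      unfolding integrable_iff_bounded by simp
    then show ?thesis by (simp add: T_def)
  qed
  show "(LINT z|lborel. f (t1 + a * fst z, t2 + b * snd z)) = (LINT z|lborel. f z) /\<^sub>R \<bar>a * b\<bar>"
    if [measurable]: "f \<in> borel_measurable borel"
  proof -
    have "(LINT z|lborel. f z) = (LINT z|distr lborel borel T. \<bar>a * b\<bar> *\<^sub>R f z)"
      by (subst L) (simp add: integral_density)
    also have "\<dots> = \<bar>a * b\<bar> *\<^sub>R (LINT z|lborel. f (T z))"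
      by (simp add: integral_distr)
    finally show ?thesis using ab by (simp add: T_def)
  qed
qed

section \<open>The Fourier transform of integrable functions\<close>

lemma fourier_eq: "fourier f \<zeta> = of_real (1 / (2 * pi)) * (LINT z|lborel. cis (- (z \<bullet> \<zeta>)) * f z)"
  by (cases \<zeta>) (simp add: fourier_def inner_prod_def)

text \<open>Encoded as a reflected forward transform, so that bounds and continuity carry over
  without a second proof.\<close>

definition ifourier :: "(real \<times> real \<Rightarrow> complex) \<Rightarrow> real \<times> real \<Rightarrow> complex" where
  "ifourier f \<zeta> = fourier f (- \<zeta>)"

lemma ifourier_eq: "ifourier f \<zeta> = of_real (1 / (2 * pi)) * (LINT z|lborel. cis (z \<bullet> \<zeta>) * f z)"
  by (simp add: ifourier_def fourier_eq)

lemma integrable_cis_mult: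
  assumes "integrable M (f::_\<Rightarrow>complex)" "h \<in> borel_measurable M"
  shows "integrable M (\<lambda>z. cis (h z) * f z)"
  by (rule integrable_mult_bounded[where B=1]) (use assms in auto)

lemma norm_fourier_le: "norm (fourier f \<zeta>) \<le> (LINT z|lborel. norm (f z)) / (2 * pi)"
proof -
  have "norm (LINT z|lborel. cis (- (z \<bullet> \<zeta>)) * f z) \<le> (LINT z|lborel. norm (cis (- (z \<bullet> \<zeta>)) * f z))"
    by (rule integral_norm_bound)
  then show ?thesis
    by (simp add: fourier_eq norm_mult norm_divide divide_right_mono)
qed

lemma norm_ifourier_le: "norm (ifourier f \<zeta>) \<le> (LINT z|lborel. norm (f z)) / (2 * pi)"
  unfolding ifourier_def by (rule norm_fourier_le)

lemma tendsto_fourier: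
  assumes f: "integrable lborel f" and X: "X \<longlonglongrightarrow> \<zeta>"
  shows "(\<lambda>n. fourier f (X n)) \<longlonglongrightarrow> fourier f \<zeta>"
proof -
  have [measurable]: "f \<in> borel_measurable borel" using f by simp
  have "(\<lambda>n. LINT z|lborel. cis (- (z \<bullet> X n)) * f z) \<longlonglongrightarrow> (LINT z|lborel. cis (- (z \<bullet> \<zeta>)) * f z)"
  proof (rule integral_dominated_convergence)
    show "integrable lborel (\<lambda>z. norm (f z))" using f by simp
    show "AE z in lborel. (\<lambda>n. cis (- (z \<bullet> X n)) * f z) \<longlonglongrightarrow> cis (- (z \<bullet> \<zeta>)) * f z"
      by (intro AE_I2 tendsto_intros X)
  qed (auto simp: norm_mult)
  then show ?thesis unfolding fourier_eq by (intro tendsto_intros)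
qed

lemma continuous_fourier:
  assumes f: "integrable lborel f"
  shows "continuous_on UNIV (fourier f)"
  unfolding continuous_on_sequentially
  using tendsto_fourier[OF f] by (auto simp: o_def)

lemma continuous_ifourier:
  assumes f: "integrable lborel f"
  shows "continuous_on UNIV (ifourier f)"
  unfolding ifourier_def [abs_def]
  by (rule continuous_on_compose2[OF continuous_fourier[OF f]]) (auto intro!: continuous_intros)

lemma fourier_borel [measurable (raw)]: "integrable lborel f \<Longrightarrow> fourier f \<in> borel_measurable borel"
  by (intro borel_measurable_continuous_onI continuous_fourier)

lemma ifourier_borel [measurable (raw)]: "integrable lborel f \<Longrightarrow> ifourier f \<in> borel_measurable borel"
  by (intro borel_measurable_continuous_onI continuous_ifourier)

lemma fourier_cong_AE:
  assumes "AE z in lborel. f z = g z" "f \<in> borel_measurable borel" "g \<in> borel_measurable borel"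
  shows "fourier f = fourier g"
proof
  fix \<zeta>
  have [measurable]: "f \<in> borel_measurable borel" "g \<in> borel_measurable borel" using assms by auto
  show "fourier f \<zeta> = fourier g \<zeta>"
    unfolding fourier_eq using assms(1)
    by (intro arg_cong2[where f="(*)"] integral_cong_AE refl) auto
qed

lemma cnj_fourier: "cnj (fourier f \<zeta>) = ifourier (\<lambda>z. cnj (f z)) \<zeta>"
proof -
  have "cnj (LINT z|lborel. cis (- (z \<bullet> \<zeta>)) * f z) = (LINT z|lborel. cis (z \<bullet> \<zeta>) * cnj (f z))"
    by (subst Bochner_Integration.integral_cnj[symmetric]) (simp add: cis_cnj)
  then show ?thesis unfolding fourier_eq ifourier_eq by simp
qed

lemma fourier_add:
  "integrable lborel f \<Longrightarrow> integrable lborel g \<Longrightarrow> fourier (\<lambda>z. f z + g z) \<zeta> = fourier f \<zeta> + fourier g \<zeta>"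
  unfolding fourier_eq by (simp add: distrib_left integrable_cis_mult)

lemma fourier_diff:
  "integrable lborel f \<Longrightarrow> integrable lborel g \<Longrightarrow> fourier (\<lambda>z. f z - g z) \<zeta> = fourier f \<zeta> - fourier g \<zeta>"
  unfolding fourier_eq by (simp add: right_diff_distrib integrable_cis_mult)

lemma fourier_cmult: "fourier (\<lambda>z. c * f z) \<zeta> = c * fourier f \<zeta>"
  unfolding fourier_eq by (simp add: mult.left_commute)

text \<open>Fubini: the kernel has modulus 1, so the double integral is dominated by a product of
  integrable functions. This identity is the model for the duality that defines
  \<open>is_FT\<close>.\<close>

lemma fourier_multiplication_formula:
  assumes f: "integrable lborel f" and g: "integrable lborel g"
  shows "(LINT z|lborel. fourier f z * g z) = (LINT z|lborel. f z * fourier g z)"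
proof -
  have [measurable]: "f \<in> borel_measurable borel" "g \<in> borel_measurable borel" using f g by auto
  have i: "integrable (lborel \<Otimes>\<^sub>M lborel) (\<lambda>p. cis (- (fst p \<bullet> snd p)) * (f (fst p) * g (snd p)))"
    by (rule integrable_mult_bounded[where B=1, OF integrable_tensor[OF f g]]) auto
  have "(LINT z|lborel. LINT y|lborel. cis (- (y \<bullet> z)) * (f y * g z))
      = (LINT y|lborel. LINT z|lborel. cis (- (y \<bullet> z)) * (f y * g z))"
    by (rule lborel_pair.Fubini_integral) (use i in \<open>simp add: case_prod_unfold\<close>)
  then have "(LINT z|lborel. g z * (LINT y|lborel. cis (- (y \<bullet> z)) * f y))
      = (LINT y|lborel. f y * (LINT z|lborel. cis (- (y \<bullet> z)) * g z))"
    by (subst (1 2) integral_mult_right_zero[symmetric]) (simp add: ac_simps)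
  then show ?thesis
    by (simp add: fourier_eq inner_commute mult_ac)
qed

lemma lborel_integral_uminus2:
  fixes f :: "real \<times> real \<Rightarrow> 'c::{banach, second_countable_topology}"
  assumes "f \<in> borel_measurable borel"
  shows "(LINT z|lborel. f (- z)) = (LINT z|lborel. f z)"
  using integral_affine2[of "-1" "-1" f 0 0] assms by (simp add: uminus_prod_def)

lemma integrable_uminus2:
  fixes f :: "real \<times> real \<Rightarrow> 'c::{banach, second_countable_topology}"
  assumes "integrable lborel f"
  shows "integrable lborel (\<lambda>z. f (- z))"
  using integrable_affine2[of "-1" "-1" f 0 0] assms by (simp add: uminus_prod_def)

lemma ifourier_alt:
  assumes [measurable]: "f \<in> borel_measurable borel"
  shows "ifourier f \<zeta> = fourier (\<lambda>z. f (- z)) \<zeta>"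
  unfolding ifourier_eq fourier_eq
  using lborel_integral_uminus2[of "\<lambda>z. cis (z \<bullet> \<zeta>) * f z"] by simp

lemma ifourier_multiplication_formula:
  assumes f: "integrable lborel f" and g: "integrable lborel g"
  shows "(LINT z|lborel. ifourier f z * g z) = (LINT z|lborel. f z * ifourier g z)"
proof -
  have [measurable]: "f \<in> borel_measurable borel" "g \<in> borel_measurable borel" using f g by auto
  have "(LINT z|lborel. ifourier f z * g z) = (LINT z|lborel. fourier f z * g (- z))"
    using lborel_integral_uminus2[of "\<lambda>z. fourier f z * g (- z)"] f by (simp add: ifourier_def)
  also have "\<dots> = (LINT z|lborel. f z * fourier (\<lambda>z. g (- z)) z)"
    by (rule fourier_multiplication_formula) (use f g integrable_uminus2 in auto)
  finally show ?thesis by (simp add: ifourier_alt)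
qed

section \<open>Gaussian regularisation of Fourier inversion\<close>

text \<open>The standard normal density of the plane. It has mass 1, so its contractions form an
  approximate identity, and its transform is known from the characteristic function of the normal
  law.\<close>

definition gauss2 :: "real \<times> real \<Rightarrow> real" where
  "gauss2 w = std_normal_density (fst w) * std_normal_density (snd w)"

lemma gauss2_nonneg: "0 \<le> gauss2 w"
  by (simp add: gauss2_def)

lemma gauss2_borel [measurable]: "gauss2 \<in> borel_measurable borel"
  unfolding gauss2_def[abs_def] borel_prod[symmetric] by measurable

lemma gauss2_eq: "gauss2 w = exp (- (norm w)\<^sup>2 / 2) / (2 * pi)"
  unfolding gauss2_def std_normal_density_def
  by (cases w) (simp add: exp_add[symmetric] norm_Pair add_divide_distrib diff_divide_distrib)

lemma integrable_std_normal: "integrable lborel std_normal_density"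
  using integrable_std_normal_moment[of 0] by simp

lemma integrable_gauss2: "integrable lborel gauss2"
  unfolding gauss2_def[abs_def] by (rule integrable_tensor2[OF integrable_std_normal integrable_std_normal])

lemma integral_std_normal: "(LINT x|lborel. std_normal_density x) = 1"
  using integral_std_normal_moment_even[of 0] by simp

lemma integral_gauss2: "(LINT z|lborel. gauss2 z) = 1"
  unfolding gauss2_def[abs_def]
  by (subst integral_tensor2[OF integrable_std_normal integrable_std_normal]) (simp add: integral_std_normal)

lemma std_normal_characteristic:
  "(LINT x|lborel. of_real (std_normal_density x) * cis (t * x)) = of_real (exp (- t\<^sup>2 / 2))"
proof -
  have "(LINT x|density lborel (\<lambda>x. ennreal (std_normal_density x)). cis (t * x)) = of_real (exp (- t\<^sup>2 / 2))"
    using fun_cong[OF char_std_normal_distribution, of t] by (simp add: char_def cis_conv_exp mult.commute)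
  moreover have "(LINT x|density lborel (\<lambda>x. ennreal (std_normal_density x)). cis (t * x))
      = (LINT x|lborel. of_real (std_normal_density x) * cis (t * x))"
    by (subst integral_density) (auto simp: scaleR_conv_of_real)
  ultimately show ?thesis by simp
qed

lemma gauss2_characteristic:
  "(LINT w|lborel. of_real (gauss2 w) * cis (v \<bullet> w)) = of_real (exp (- (norm v)\<^sup>2 / 2))"
proof -
  have i: "integrable lborel (\<lambda>x. of_real (std_normal_density x) * cis (t * x))" for t
    using integrable_cis_mult[OF integrable_of_real[OF integrable_std_normal], of "\<lambda>x. t * x"]
    by (simp add: mult.commute)
  obtain v1 v2 where v: "v = (v1, v2)" by (cases v)
  have "(LINT w|lborel. of_real (gauss2 w) * cis (v \<bullet> w)) =
     (LINT w|lborel. (of_real (std_normal_density (fst w)) * cis (v1 * fst w))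
        * (of_real (std_normal_density (snd w)) * cis (v2 * snd w)))"
    by (rule Bochner_Integration.integral_cong) (auto simp: gauss2_def v inner_prod_def cis_mult[symmetric])
  also have "\<dots> = of_real (exp (- v1\<^sup>2 / 2)) * of_real (exp (- v2\<^sup>2 / 2))"
    by (subst integral_tensor2[OF i i]) (simp add: std_normal_characteristic)
  also have "\<dots> = of_real (exp (- (norm v)\<^sup>2 / 2))"
    by (simp add: v norm_Pair exp_add[symmetric] add_divide_distrib diff_divide_distrib flip: of_real_mult)
  finally show ?thesis .
qed

text \<open>A Gaussian damping factor in frequency, equal to a dilate of \<open>gauss2\<close> up to
  the factor 2 pi. It makes bounded functions integrable and tends to 1 as \<open>s\<close> tends to
  0.\<close>

definition gwt :: "real \<Rightarrow> real \<times> real \<Rightarrow> complex" where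
  "gwt s \<zeta> = of_real (exp (- (s * norm \<zeta>)\<^sup>2 / 2))"

lemma gwt_borel [measurable]: "gwt s \<in> borel_measurable borel"
  unfolding gwt_def[abs_def] by measurable

lemma norm_gwt_le: "norm (gwt s \<zeta>) \<le> 1"
  by (simp add: gwt_def)

lemma gwt_eq: "gwt s \<zeta> = of_real (2 * pi * gauss2 (s *\<^sub>R \<zeta>))"
  by (simp add: gwt_def gauss2_eq power_mult_distrib)

lemma scaleR_prod_eq: "s *\<^sub>R (z :: real \<times> real) = (0 + s * fst z, 0 + s * snd z)"
  by (cases z) simp

lemma integrable_scale2:
  fixes f :: "real \<times> real \<Rightarrow> 'c::{banach, second_countable_topology}"
  assumes "s \<noteq> 0" "integrable lborel f"
  shows "integrable lborel (\<lambda>z. f (s *\<^sub>R z))"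
  unfolding scaleR_prod_eq by (rule integrable_affine2) (use assms in auto)

lemma integral_scale2:
  fixes f :: "real \<times> real \<Rightarrow> 'c::{banach, second_countable_topology}"
  assumes "s \<noteq> 0" "f \<in> borel_measurable borel"
  shows "(LINT z|lborel. f (s *\<^sub>R z)) = (LINT z|lborel. f z) /\<^sub>R s\<^sup>2"
  unfolding scaleR_prod_eq by (subst integral_affine2) (use assms in \<open>auto simp: power2_eq_square\<close>)

lemma integrable_gwt: "s \<noteq> 0 \<Longrightarrow> integrable lborel (gwt s)"
  unfolding gwt_eq[abs_def]
  by (intro integrable_of_real integrable_mult_right integrable_scale2 integrable_gauss2)

text \<open>The substitution w = s zeta reduces this to the characteristic function; the result is
  again a Gaussian density, of width \<open>s\<close>, which produces the averages below.\<close>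

lemma integral_cis_gwt:
  assumes s: "s \<noteq> 0"
  shows "(LINT \<zeta>|lborel. cis (v \<bullet> \<zeta>) * gwt s \<zeta>) = of_real ((2 * pi)\<^sup>2 * gauss2 (v /\<^sub>R s) / s\<^sup>2)"
proof -
  let ?f = "\<lambda>w. of_real (gauss2 w) * cis ((v /\<^sub>R s) \<bullet> w)"
  have "(LINT \<zeta>|lborel. cis (v \<bullet> \<zeta>) * gwt s \<zeta>) = (LINT \<zeta>|lborel. of_real (2 * pi) * ?f (s *\<^sub>R \<zeta>))"
  proof (rule Bochner_Integration.integral_cong[OF refl])
    fix \<zeta> :: "real \<times> real"
    have "(v /\<^sub>R s) \<bullet> (s *\<^sub>R \<zeta>) = v \<bullet> \<zeta>"
      using s by (simp only: inner_scaleR_left inner_scaleR_right) simp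
    then show "cis (v \<bullet> \<zeta>) * gwt s \<zeta> = of_real (2 * pi) * ?f (s *\<^sub>R \<zeta>)"
      by (simp only: gwt_eq) simp
  qed
  also have "\<dots> = of_real (2 * pi) * (LINT \<zeta>|lborel. ?f (s *\<^sub>R \<zeta>))"
    by (rule integral_mult_right_zero)
  also have "(LINT \<zeta>|lborel. ?f (s *\<^sub>R \<zeta>)) = (LINT \<zeta>|lborel. ?f \<zeta>) /\<^sub>R s\<^sup>2"
    by (rule integral_scale2) (use s in auto)
  also have "(LINT \<zeta>|lborel. ?f \<zeta>) = of_real (exp (- (norm (v /\<^sub>R s))\<^sup>2 / 2))"
    by (rule gauss2_characteristic)
  also have "exp (- (norm (v /\<^sub>R s))\<^sup>2 / 2) = 2 * pi * gauss2 (v /\<^sub>R s)"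
    by (simp add: gauss2_eq)
  finally show ?thesis using s by (simp add: scaleR_conv_of_real power2_eq_square divide_simps)
qed

text \<open>Fourier inversion with damping: Fubini turns the damped inversion integral into an
  average of \<open>f\<close> around \<open>x\<close> at scale \<open>s\<close>. All inversion
  statements below arise from it by letting \<open>s\<close> tend to 0.\<close>

lemma fourier_gwt_ifourier:
  assumes f: "integrable lborel f" and s: "s \<noteq> 0"
  shows "fourier (\<lambda>\<zeta>. gwt s \<zeta> * ifourier f \<zeta>) x = (LINT w|lborel. of_real (gauss2 w) * f (x + s *\<^sub>R w))"
proof -
  have [measurable]: "f \<in> borel_measurable borel" using f by auto
  \<comment> \<open>The damping \<open>gwt\<close> is what makes this double integral converge
    absolutely; the oscillating factor has modulus 1.\<close>
  have i: "integrable (lborel \<Otimes>\<^sub>M lborel) (\<lambda>p. cis (snd p \<bullet> fst p - fst p \<bullet> x) * (gwt s (fst p) * f (snd p)))"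
    by (rule integrable_cis_mult[OF integrable_tensor[OF integrable_gwt[OF s] f]]) simp
  have "(LINT \<zeta>|lborel. cis (- (\<zeta> \<bullet> x)) * (gwt s \<zeta> * (LINT y|lborel. cis (y \<bullet> \<zeta>) * f y)))
     = (LINT \<zeta>|lborel. LINT y|lborel. cis (y \<bullet> \<zeta> - \<zeta> \<bullet> x) * (gwt s \<zeta> * f y))"
  proof (rule Bochner_Integration.integral_cong[OF refl])
    fix \<zeta>
    have "(LINT y|lborel. cis (y \<bullet> \<zeta> - \<zeta> \<bullet> x) * (gwt s \<zeta> * f y))
        = (LINT y|lborel. (cis (- (\<zeta> \<bullet> x)) * gwt s \<zeta>) * (cis (y \<bullet> \<zeta>) * f y))"
      by (rule Bochner_Integration.integral_cong[OF refl])
         (simp add: cis_divide[symmetric] cis_inverse[symmetric] divide_inverse del: cis_inverse)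
    then show "cis (- (\<zeta> \<bullet> x)) * (gwt s \<zeta> * (LINT y|lborel. cis (y \<bullet> \<zeta>) * f y))
        = (LINT y|lborel. cis (y \<bullet> \<zeta> - \<zeta> \<bullet> x) * (gwt s \<zeta> * f y))"
      by simp
  qed
  also have "\<dots> = (LINT y|lborel. LINT \<zeta>|lborel. cis (y \<bullet> \<zeta> - \<zeta> \<bullet> x) * (gwt s \<zeta> * f y))"
    by (rule lborel_pair.Fubini_integral[symmetric]) (use i in \<open>simp add: case_prod_unfold\<close>)
  also have "\<dots> = (LINT y|lborel. (LINT \<zeta>|lborel. cis ((y - x) \<bullet> \<zeta>) * gwt s \<zeta>) * f y)"
  proof (rule Bochner_Integration.integral_cong[OF refl])
    fix y
    have "y \<bullet> \<zeta> - \<zeta> \<bullet> x = (y - x) \<bullet> \<zeta>" for \<zeta>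
      by (simp add: inner_diff_left inner_commute[of _ x])
    then show "(LINT \<zeta>|lborel. cis (y \<bullet> \<zeta> - \<zeta> \<bullet> x) * (gwt s \<zeta> * f y))
        = (LINT \<zeta>|lborel. cis ((y - x) \<bullet> \<zeta>) * gwt s \<zeta>) * f y"
      by (simp only: mult.assoc[symmetric] integral_mult_left_zero)
  qed
  also have "\<dots> = (LINT y|lborel. of_real ((2 * pi)\<^sup>2 * gauss2 ((y - x) /\<^sub>R s) / s\<^sup>2) * f y)"
    by (simp add: integral_cis_gwt[OF s])
  also have "\<dots> = of_real ((2 * pi)\<^sup>2) * ((LINT y|lborel. of_real (gauss2 ((y - x) /\<^sub>R s)) * f y) /\<^sub>R s\<^sup>2)"
    by (subst integral_scaleR_right[symmetric], subst integral_mult_right_zero[symmetric])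
       (simp add: scaleR_conv_of_real divide_inverse mult_ac)
  also have "(LINT y|lborel. of_real (gauss2 ((y - x) /\<^sub>R s)) * f y) /\<^sub>R s\<^sup>2
      = (LINT w|lborel. of_real (gauss2 w) * f (x + s *\<^sub>R w))"
  proof -
    let ?g = "\<lambda>y. of_real (gauss2 ((y - x) /\<^sub>R s)) * f y"
    have "(fst x + s * fst w, snd x + s * snd w) = x + s *\<^sub>R w" for w
      by (cases x, cases w) simp
    then have "(LINT w|lborel. ?g (x + s *\<^sub>R w)) = (LINT y|lborel. ?g y) /\<^sub>R \<bar>s * s\<bar>"
      using integral_affine2[of s s ?g "fst x" "snd x"] s by simp
    then show ?thesis using s by (simp add: power2_eq_square)
  qed
  finally show ?thesis
    by (simp add: fourier_eq ifourier_eq mult_ac power2_eq_square)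
       (simp add: mult.assoc[symmetric] field_simps)?
qed

text \<open>The multiplication formula applied to \<open>gwt s\<close> times
  \<open>ifourier g\<close>: the damping supplies the integrability that \<open>ifourier g\<close>
  alone may lack.\<close>

lemma fourier_ifourier_gwt_pairing:
  assumes f: "integrable lborel f" and g: "integrable lborel g" and s: "s \<noteq> 0"
  shows "(LINT z|lborel. fourier f z * (gwt s z * ifourier g z))
     = (LINT x|lborel. f x * (LINT w|lborel. of_real (gauss2 w) * g (x + s *\<^sub>R w)))"
proof -
  have [measurable]: "g \<in> borel_measurable borel" using g by auto
  have i: "integrable lborel (\<lambda>z. gwt s z * ifourier g z)"
    using integrable_mult_bounded[OF integrable_gwt[OF s], of "ifourier g", OF _ norm_ifourier_le] g
    by (simp add: mult.commute)
  show ?thesis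
    by (subst fourier_multiplication_formula[OF f i]) (simp add: fourier_gwt_ifourier[OF g s])
qed

section \<open>Square-integrable functions, Gaussian correlations and Bessel's inequality\<close>

lemma cnj_measurable [measurable]: "cnj \<in> borel_measurable borel"
  by (intro borel_measurable_continuous_onI continuous_intros)

text \<open>True without integrability, because the Bochner integral of a non-integrable function is
  0.\<close>

lemma ennreal_norm_integral_le:
  fixes f :: "'a \<Rightarrow> 'b::{banach, second_countable_topology}"
  shows "ennreal (norm (integral\<^sup>L M f)) \<le> (\<integral>\<^sup>+x. norm (f x) \<partial>M)"
  by (cases "integrable M f") (auto simp: integral_norm_bound_ennreal not_integrable_integral_eq)

lemma L2c_iff: "L2c f \<longleftrightarrow> f \<in> borel_measurable borel \<and> (\<integral>\<^sup>+z. ennreal ((norm (f z))\<^sup>2) \<partial>lborel) < \<infinity>"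
  unfolding L2c_def integrable_iff_bounded by auto

lemma L2c_borel: "L2c f \<Longrightarrow> f \<in> borel_measurable borel"
  by (simp add: L2c_def)

text \<open>One domination rule that serves for sums, bounded multiples and functions that agree
  almost everywhere.\<close>

lemma L2c_bound:
  assumes "L2c f" "L2c g" and [measurable]: "h \<in> borel_measurable borel"
    and le: "AE z in lborel. (norm (h z))\<^sup>2 \<le> A * (norm (f z))\<^sup>2 + B * (norm (g z))\<^sup>2"
  shows "L2c h"
proof -
  have "integrable lborel (\<lambda>z. (norm (h z))\<^sup>2)"
  proof (rule Bochner_Integration.integrable_bound)
    show "integrable lborel (\<lambda>z. A * (norm (f z))\<^sup>2 + B * (norm (g z))\<^sup>2)"
      using assms(1,2) by (auto simp: L2c_def)
    show "AE z in lborel. norm ((norm (h z))\<^sup>2) \<le> norm (A * (norm (f z))\<^sup>2 + B * (norm (g z))\<^sup>2)"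
      using le by eventually_elim auto
  qed simp
  then show ?thesis by (simp add: L2c_def)
qed

lemma L2c_add:
  assumes "L2c f" "L2c g"
  shows "L2c (\<lambda>z. f z + g z)"
proof (rule L2c_bound[OF assms, where A=2 and B=2])
  show "(\<lambda>z. f z + g z) \<in> borel_measurable borel" using assms by (auto simp: L2c_def)
  show "AE z in lborel. (norm (f z + g z))\<^sup>2 \<le> 2 * (norm (f z))\<^sup>2 + 2 * (norm (g z))\<^sup>2"
  proof (rule AE_I2)
    fix z
    have "(norm (f z + g z))\<^sup>2 \<le> (norm (f z) + norm (g z))\<^sup>2"
      by (intro power_mono norm_triangle_ineq) auto
    also have "\<dots> \<le> 2 * (norm (f z))\<^sup>2 + 2 * (norm (g z))\<^sup>2"
      using sum_squares_bound[of "norm (f z)" "norm (g z)"] by (simp add: power2_sum)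
    finally show "(norm (f z + g z))\<^sup>2 \<le> 2 * (norm (f z))\<^sup>2 + 2 * (norm (g z))\<^sup>2" .
  qed
qed

lemma L2c_mult_bounded:
  assumes "L2c f" and [measurable]: "h \<in> borel_measurable borel" and B: "\<And>z. norm (h z) \<le> B"
  shows "L2c (\<lambda>z. h z * f z)"
proof (rule L2c_bound[OF assms(1,1), where A="B\<^sup>2" and B=0])
  show "(\<lambda>z. h z * f z) \<in> borel_measurable borel" using assms by (auto simp: L2c_def)
  show "AE z in lborel. (norm (h z * f z))\<^sup>2 \<le> B\<^sup>2 * (norm (f z))\<^sup>2 + 0 * (norm (f z))\<^sup>2"
    by (auto simp: norm_mult power_mult_distrib intro!: mult_right_mono power_mono B)
qed

lemma L2c_cmult: "L2c f \<Longrightarrow> L2c (\<lambda>z. c * f z)"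
  by (rule L2c_mult_bounded[where B="norm c"]) auto

lemma L2c_diff: "L2c f \<Longrightarrow> L2c g \<Longrightarrow> L2c (\<lambda>z. f z - g z)"
  using L2c_add[of f "\<lambda>z. (-1) * g z"] L2c_cmult[of g "-1"] by simp

lemma L2c_cnj: "L2c f \<Longrightarrow> L2c (\<lambda>z. cnj (f z))"
  by (auto simp: L2c_def)

lemma L2c_zero: "L2c (\<lambda>_. 0)"
  by (auto simp: L2c_def)

text \<open>From 2 |f g| \<le> |f|^2 + |g|^2.\<close>

lemma integrable_mult_L2:
  assumes f: "L2c f" and g: "L2c g"
  shows "integrable lborel (\<lambda>z. f z * g z)"
proof (rule Bochner_Integration.integrable_bound)
  show "integrable lborel (\<lambda>z. (norm (f z))\<^sup>2 + (norm (g z))\<^sup>2)"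
    using assms by (auto simp: L2c_def)
  show "AE z in lborel. norm (f z * g z) \<le> norm ((norm (f z))\<^sup>2 + (norm (g z))\<^sup>2)"
  proof (rule AE_I2)
    fix z
    have "2 * (norm (f z) * norm (g z)) \<le> (norm (f z))\<^sup>2 + (norm (g z))\<^sup>2"
      using sum_squares_bound[of "norm (f z)" "norm (g z)"] by simp
    moreover have "0 \<le> norm (f z) * norm (g z)" by simp
    ultimately have "norm (f z) * norm (g z) \<le> (norm (f z))\<^sup>2 + (norm (g z))\<^sup>2" by linarith
    then show "norm (f z * g z) \<le> norm ((norm (f z))\<^sup>2 + (norm (g z))\<^sup>2)"
      by (simp add: norm_mult)
  qed
qed (use assms in \<open>auto simp: L2c_def\<close>)

lemma Cauchy_Schwarz_integral:
  assumes [measurable]: "f \<in> borel_measurable borel" "g \<in> borel_measurable borel"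
  shows "(ennreal (norm (LINT z|lborel. f z * g z :: complex)))\<^sup>2
    \<le> (\<integral>\<^sup>+z. ennreal ((norm (f z))\<^sup>2) \<partial>lborel) * (\<integral>\<^sup>+z. ennreal ((norm (g z))\<^sup>2) \<partial>lborel)"
proof -
  have "(ennreal (norm (LINT z|lborel. f z * g z)))\<^sup>2 \<le> (\<integral>\<^sup>+z. ennreal (norm (f z)) * ennreal (norm (g z)) \<partial>lborel)\<^sup>2"
    using ennreal_norm_integral_le[of lborel "\<lambda>z. f z * g z"]
    by (intro power_mono) (simp_all add: norm_mult ennreal_mult)
  also have "\<dots> \<le> (\<integral>\<^sup>+z. (ennreal (norm (f z)))\<^sup>2 \<partial>lborel) * (\<integral>\<^sup>+z. (ennreal (norm (g z)))\<^sup>2 \<partial>lborel)"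
    by (rule Cauchy_Schwarz_nn_integral) auto
  finally show ?thesis by (simp add: ennreal_power)
qed

text \<open>The indicator of a bounded set is itself square integrable. This is the standard
  majorant whenever an L^2 function is restricted to a bounded set.\<close>

lemma integrable_norm_L2_bounded_set:
  assumes f: "L2c f" and A: "A \<in> sets borel" "bounded A"
  shows "integrable lborel (\<lambda>z. indicator A z * norm (f z))"
proof -
  have "emeasure lborel A < \<infinity>" using emeasure_bounded_finite[OF A(2)] by simp
  then have "L2c (indicator A :: _ \<Rightarrow> complex)"
    using A unfolding L2c_iff
    by (auto simp: indicator_def of_bool_def if_distrib[of norm] if_distrib[of "\<lambda>x. x\<^sup>2"] if_distrib[of ennreal] nn_integral_indicator[symmetric] cong: if_cong)
  from integrable_mult_L2[OF this f] have "integrable lborel (\<lambda>z. norm (indicator A z * f z))"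
    by (rule integrable_norm)
  moreover have "norm (indicator A z * f z) = indicator A z * norm (f z)" for z
    by (simp add: norm_mult indicator_def)
  ultimately show ?thesis by simp
qed

lemma nn_integral_translate2:
  fixes c :: "real \<times> real"
  assumes "h \<in> borel_measurable borel"
  shows "(\<integral>\<^sup>+z. h (z + c) \<partial>lborel) = (\<integral>\<^sup>+z. h z \<partial>lborel)"
  using nn_integral_affine2[of 1 1 h "fst c" "snd c"] assms by (simp add: plus_prod_def add.commute)

lemma integral_translate2:
  fixes h :: "real \<times> real \<Rightarrow> 'c::{banach, second_countable_topology}"
  assumes "h \<in> borel_measurable borel"
  shows "(LINT z|lborel. h (z + c)) = (LINT z|lborel. h z)"
  using integral_affine2[of 1 1 h "fst c" "snd c"] assms by (simp add: plus_prod_def add.commute)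

lemma integrable_translate2:
  fixes h :: "real \<times> real \<Rightarrow> 'c::{banach, second_countable_topology}"
  assumes "integrable lborel h"
  shows "integrable lborel (\<lambda>z. h (z + c))"
  using integrable_affine2[of 1 1 h "fst c" "snd c"] assms by (simp add: plus_prod_def add.commute)

lemma nn_integral_gauss2: "(\<integral>\<^sup>+w. ennreal (gauss2 w) \<partial>lborel) = 1"
  by (subst nn_integral_eq_integral) (auto simp: integrable_gauss2 integral_gauss2 gauss2_nonneg)

text \<open>After |f g| \<le> (|f|^2 + |g|^2) / 2, translation invariance makes the integral over
  \<open>x\<close> independent of \<open>w\<close>, and the Gaussian has mass 1. The bound does not
  depend on the scale \<open>s\<close>.\<close>

lemma nn_integral_gauss_correlation:
  fixes f g :: "real \<times> real \<Rightarrow> complex" and s :: real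
  assumes [measurable]: "f \<in> borel_measurable borel" "g \<in> borel_measurable borel"
  shows "(\<integral>\<^sup>+x. \<integral>\<^sup>+w. norm (of_real (gauss2 w) * (f x * g (x + s *\<^sub>R w))) \<partial>lborel \<partial>lborel)
    \<le> ((\<integral>\<^sup>+z. ennreal ((norm (f z))\<^sup>2) \<partial>lborel) + (\<integral>\<^sup>+z. ennreal ((norm (g z))\<^sup>2) \<partial>lborel)) / 2"
proof -
  let ?F = "\<lambda>x. ennreal ((norm (f x))\<^sup>2)" and ?G = "\<lambda>x. ennreal ((norm (g x))\<^sup>2)"
  have "(\<integral>\<^sup>+x. \<integral>\<^sup>+w. norm (of_real (gauss2 w) * (f x * g (x + s *\<^sub>R w))) \<partial>lborel \<partial>lborel)
    \<le> (\<integral>\<^sup>+x. \<integral>\<^sup>+w. ennreal (gauss2 w / 2) * (?F x + ?G (x + s *\<^sub>R w)) \<partial>lborel \<partial>lborel)"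
  proof (intro nn_integral_mono)
    fix x w
    have "norm (of_real (gauss2 w) * (f x * g (x + s *\<^sub>R w)))
        \<le> gauss2 w / 2 * ((norm (f x))\<^sup>2 + (norm (g (x + s *\<^sub>R w)))\<^sup>2)"
      using mult_left_mono[OF sum_squares_bound[of "norm (f x)" "norm (g (x + s *\<^sub>R w))"] gauss2_nonneg[of w]]
      by (simp add: norm_mult gauss2_nonneg)
    then have "ennreal (norm (of_real (gauss2 w) * (f x * g (x + s *\<^sub>R w))))
       \<le> ennreal (gauss2 w / 2 * ((norm (f x))\<^sup>2 + (norm (g (x + s *\<^sub>R w)))\<^sup>2))"
      by (rule ennreal_leI)
    also have "\<dots> = ennreal (gauss2 w / 2) * (?F x + ?G (x + s *\<^sub>R w))"
      by (subst ennreal_mult) (auto simp: gauss2_nonneg ennreal_plus)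
    finally show "ennreal (norm (of_real (gauss2 w) * (f x * g (x + s *\<^sub>R w))))
       \<le> ennreal (gauss2 w / 2) * (?F x + ?G (x + s *\<^sub>R w))" .
  qed
  also have "\<dots> = (\<integral>\<^sup>+w. \<integral>\<^sup>+x. ennreal (gauss2 w / 2) * (?F x + ?G (x + s *\<^sub>R w)) \<partial>lborel \<partial>lborel)"
    by (rule lborel_pair.Fubini'[symmetric]) simp
  also have "\<dots> = (\<integral>\<^sup>+w. ennreal (gauss2 w / 2) * (integral\<^sup>N lborel ?F + integral\<^sup>N lborel ?G) \<partial>lborel)"
    by (simp add: nn_integral_cmult nn_integral_add nn_integral_translate2[of ?G])
  also have "\<dots> = (\<integral>\<^sup>+w. ennreal (gauss2 w) * ((integral\<^sup>N lborel ?F + integral\<^sup>N lborel ?G) / 2) \<partial>lborel)"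
    by (intro nn_integral_cong) (simp add: ennreal_divide_times divide_ennreal[symmetric] gauss2_nonneg ennreal_times_divide)
  also have "\<dots> = (integral\<^sup>N lborel ?F + integral\<^sup>N lborel ?G) / 2"
    by (simp add: nn_integral_multc nn_integral_gauss2)
  finally show ?thesis .
qed

lemma gauss_correlation:
  fixes s :: real
  assumes f: "L2c f" and g: "L2c g"
  shows integrable_gauss_correlation:
      "integrable (lborel \<Otimes>\<^sub>M lborel) (\<lambda>(x, w). of_real (gauss2 w) * (f x * g (x + s *\<^sub>R w)))"
    and Fubini_gauss_correlation:
      "(LINT x|lborel. f x * (LINT w|lborel. of_real (gauss2 w) * g (x + s *\<^sub>R w)))
        = (LINT w|lborel. of_real (gauss2 w) * (LINT x|lborel. f x * g (x + s *\<^sub>R w)))"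
proof -
  have [measurable]: "f \<in> borel_measurable borel" "g \<in> borel_measurable borel"
    using f g by (auto simp: L2c_def)
  have fin: "((\<integral>\<^sup>+z. ennreal ((norm (f z))\<^sup>2) \<partial>lborel) + (\<integral>\<^sup>+z. ennreal ((norm (g z))\<^sup>2) \<partial>lborel)) / 2 < \<infinity>"
    using f g unfolding L2c_iff by (simp add: less_top[symmetric] ennreal_divide_eq_top_iff)
  show i: "integrable (lborel \<Otimes>\<^sub>M lborel) (\<lambda>(x, w). of_real (gauss2 w) * (f x * g (x + s *\<^sub>R w)))"
    unfolding integrable_iff_bounded
  proof
    have "(\<integral>\<^sup>+p. norm (case p of (x, w) \<Rightarrow> of_real (gauss2 w) * (f x * g (x + s *\<^sub>R w))) \<partial>(lborel \<Otimes>\<^sub>M lborel))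
       = (\<integral>\<^sup>+x. \<integral>\<^sup>+w. norm (of_real (gauss2 w) * (f x * g (x + s *\<^sub>R w))) \<partial>lborel \<partial>lborel)"
      by (subst lborel.nn_integral_fst[symmetric]) auto
    then show "(\<integral>\<^sup>+p. norm (case p of (x, w) \<Rightarrow> of_real (gauss2 w) * (f x * g (x + s *\<^sub>R w))) \<partial>(lborel \<Otimes>\<^sub>M lborel)) < \<infinity>"
      using nn_integral_gauss_correlation[of f g s] fin by (simp add: order_le_less_trans)
  qed simp
  have "(LINT x|lborel. f x * (LINT w|lborel. of_real (gauss2 w) * g (x + s *\<^sub>R w)))
     = (LINT x|lborel. LINT w|lborel. of_real (gauss2 w) * (f x * g (x + s *\<^sub>R w)))"
    by (subst integral_mult_right_zero[symmetric]) (simp add: mult_ac)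
  also have "\<dots> = (LINT w|lborel. LINT x|lborel. of_real (gauss2 w) * (f x * g (x + s *\<^sub>R w)))"
    by (rule lborel_pair.Fubini_integral[symmetric]) (use i in simp)
  finally show "(LINT x|lborel. f x * (LINT w|lborel. of_real (gauss2 w) * g (x + s *\<^sub>R w)))
        = (LINT w|lborel. of_real (gauss2 w) * (LINT x|lborel. f x * g (x + s *\<^sub>R w)))"
    by simp
qed

text \<open>The damped integral of |fourier f|^2 is a Gaussian correlation of \<open>f\<close> with
  its conjugate, hence bounded uniformly in the scale; Fatou's lemma then removes the damping. In
  \<open>ennreal\<close> the inequality makes sense for every integrable \<open>f\<close>, whether
  or not it is square integrable.\<close>

lemma Bessel_fourier:
  assumes f: "integrable lborel f"
  shows "(\<integral>\<^sup>+z. ennreal ((norm (fourier f z))\<^sup>2) \<partial>lborel) \<le> (\<integral>\<^sup>+z. ennreal ((norm (f z))\<^sup>2) \<partial>lborel)"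
proof -
  have [measurable]: "f \<in> borel_measurable borel" using f by auto
  let ?A = "\<integral>\<^sup>+z. ennreal ((norm (f z))\<^sup>2) \<partial>lborel"
  define s where "s n = 1 / real (Suc n)" for n
  let ?h = "\<lambda>n z. exp (- (s n * norm z)\<^sup>2 / 2) * (norm (fourier f z))\<^sup>2"
  have *: "(\<integral>\<^sup>+z. ennreal (?h n z) \<partial>lborel) \<le> ?A" for n
  proof -
    have sn: "s n \<noteq> 0" by (simp add: s_def)
    have eq: "fourier f z * (gwt (s n) z * ifourier (\<lambda>z. cnj (f z)) z) = of_real (?h n z)" for z
      using complex_norm_square[of "fourier f z"]
      by (simp add: cnj_fourier[symmetric] gwt_def mult_ac)
    have "integrable lborel (\<lambda>z. (fourier f z * ifourier (\<lambda>z. cnj (f z)) z) * gwt (s n) z)"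
    proof (rule integrable_mult_bounded[OF integrable_gwt[OF sn]])
      let ?K = "(LINT z|lborel. norm (f z)) / (2 * pi)"
      show "norm (fourier f z * ifourier (\<lambda>z. cnj (f z)) z) \<le> ?K * ?K" for z
        unfolding norm_mult
        by (rule mult_mono) (use norm_fourier_le[of f z] norm_ifourier_le[of "\<lambda>z. cnj (f z)" z] in simp_all)
      have "integrable lborel (\<lambda>z. cnj (f z))" using f by simp
      from fourier_borel[OF f] ifourier_borel[OF this]
      show "(\<lambda>z. fourier f z * ifourier (\<lambda>z. cnj (f z)) z) \<in> borel_measurable lborel" by simp
    qed
    then have "integrable lborel (\<lambda>z. complex_of_real (?h n z))"
      unfolding eq[symmetric] by (simp add: mult_ac)
    then have i: "integrable lborel (?h n)" using complex_of_real_integrable_eq by blast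
    have "(\<integral>\<^sup>+z. ennreal (?h n z) \<partial>lborel) = ennreal (LINT z|lborel. ?h n z)"
      by (rule nn_integral_eq_integral[OF i]) auto
    also have "\<dots> = ennreal (norm (LINT z|lborel. fourier f z * (gwt (s n) z * ifourier (\<lambda>z. cnj (f z)) z)))"
      by (simp add: eq del: of_real_mult of_real_power)
    also have "\<dots> = ennreal (norm (LINT x|lborel. LINT w|lborel. of_real (gauss2 w) * (f x * cnj (f (x + s n *\<^sub>R w)))))"
      using f by (subst fourier_ifourier_gwt_pairing[OF f _ sn], simp, subst integral_mult_right_zero[symmetric]) (simp add: mult_ac)
    also have "\<dots> \<le> (\<integral>\<^sup>+x. \<integral>\<^sup>+w. norm (of_real (gauss2 w) * (f x * cnj (f (x + s n *\<^sub>R w)))) \<partial>lborel \<partial>lborel)"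
      by (rule order_trans[OF ennreal_norm_integral_le nn_integral_mono[OF ennreal_norm_integral_le]])
    also have "\<dots> \<le> (?A + ?A) / 2"
      using nn_integral_gauss_correlation[of f "\<lambda>z. cnj (f z)" "s n"] by simp
    also have "(?A + ?A) / 2 = ?A"
      by (simp add: mult_2[symmetric] mult.commute[of 2] ennreal_mult_divide_eq)
    finally show ?thesis .
  qed
  have "(\<lambda>n. ?h n z) \<longlonglongrightarrow> exp (- (0 * norm z)\<^sup>2 / 2) * (norm (fourier f z))\<^sup>2" for z
    unfolding s_def by (intro tendsto_intros LIMSEQ_Suc[OF lim_1_over_n])
       simp
  then have lim: "(\<lambda>n. ennreal (?h n z)) \<longlonglongrightarrow> ennreal ((norm (fourier f z))\<^sup>2)" for z
    by (intro tendsto_ennrealI) simp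
  have "(\<integral>\<^sup>+z. ennreal ((norm (fourier f z))\<^sup>2) \<partial>lborel) = (\<integral>\<^sup>+z. liminf (\<lambda>n. ennreal (?h n z)) \<partial>lborel)"
    by (intro nn_integral_cong lim_imp_Liminf[OF _ lim, symmetric]) simp
  also have "\<dots> \<le> liminf (\<lambda>n. \<integral>\<^sup>+z. ennreal (?h n z) \<partial>lborel)"
    by (rule nn_integral_liminf) (use f in auto)
  also have "\<dots> \<le> ?A"
    by (intro Liminf_le always_eventually allI *)  simp
  finally show ?thesis .
qed

lemma Bessel_ifourier:
  assumes f: "integrable lborel f"
  shows "(\<integral>\<^sup>+z. ennreal ((norm (ifourier f z))\<^sup>2) \<partial>lborel) \<le> (\<integral>\<^sup>+z. ennreal ((norm (f z))\<^sup>2) \<partial>lborel)"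
proof -
  have "(\<integral>\<^sup>+z. ennreal ((norm (ifourier f z))\<^sup>2) \<partial>lborel) = (\<integral>\<^sup>+z. ennreal ((norm (fourier (\<lambda>z. cnj (f z)) z))\<^sup>2) \<partial>lborel)"
  proof (intro nn_integral_cong)
    fix z show "ennreal ((norm (ifourier f z))\<^sup>2) = ennreal ((norm (fourier (\<lambda>z. cnj (f z)) z))\<^sup>2)"
      using arg_cong[OF cnj_fourier[of "\<lambda>z. cnj (f z)" z], of norm] by simp
  qed
  also have "\<dots> \<le> (\<integral>\<^sup>+z. ennreal ((norm (f z))\<^sup>2) \<partial>lborel)"
    using Bessel_fourier[of "\<lambda>z. cnj (f z)"] f by simp
  finally show ?thesis .
qed

lemma L2c_fourier: "integrable lborel f \<Longrightarrow> L2c f \<Longrightarrow> L2c (fourier f)"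
  unfolding L2c_iff using Bessel_fourier[of f] by (auto intro: order_le_less_trans)

lemma L2c_ifourier: "integrable lborel f \<Longrightarrow> L2c f \<Longrightarrow> L2c (ifourier f)"
  unfolding L2c_iff using Bessel_ifourier[of f] by (auto intro: order_le_less_trans)

text \<open>Two nested dominated convergences. The outer one uses a bound on the correlation that is
  independent of the shift. In the inner one, |s n| \<le> 1 keeps the shifted support inside the
  ball of radius R + |w|, on which \<open>f\<close> is integrable.\<close>

lemma gauss_approximate_identity:
  fixes \<psi> :: "real \<times> real \<Rightarrow> complex"
  assumes f: "L2c f" and \<psi>: "continuous_on UNIV \<psi>" and supp: "\<And>z. norm z > R \<Longrightarrow> \<psi> z = 0"
    and L2: "L2c \<psi>" and C: "\<And>z. norm (\<psi> z) \<le> C" and s: "s \<longlonglongrightarrow> 0" and s1: "\<And>n. \<bar>s n\<bar> \<le> (1::real)"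
  shows "(\<lambda>n. LINT w|lborel. of_real (gauss2 w) * (LINT x|lborel. f x * \<psi> (x + s n *\<^sub>R w))) \<longlonglongrightarrow> (LINT x|lborel. f x * \<psi> x)"
proof -
  have [measurable]: "f \<in> borel_measurable borel" "\<psi> \<in> borel_measurable borel"
    using f L2 by (auto simp: L2c_def)
  define D where "D = (LINT z|lborel. (norm (f z))\<^sup>2) + (LINT z|lborel. (norm (\<psi> z))\<^sup>2)"
  have bd: "norm (LINT x|lborel. f x * \<psi> (x + c)) \<le> D" for c
  proof -
    have i: "integrable lborel (\<lambda>x. (norm (f x))\<^sup>2)" "integrable lborel (\<lambda>x. (norm (\<psi> (x + c)))\<^sup>2)"
      using f integrable_translate2[of "\<lambda>x. (norm (\<psi> x))\<^sup>2" c] L2 by (auto simp: L2c_def)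
    have "norm (LINT x|lborel. f x * \<psi> (x + c)) \<le> (LINT x|lborel. (norm (f x))\<^sup>2 + (norm (\<psi> (x + c)))\<^sup>2)"
    proof (rule Bochner_Integration.integral_norm_bound_integral)
      have "L2c (\<lambda>x. \<psi> (x + c))" using i(2) by (simp add: L2c_def)
      then show "integrable lborel (\<lambda>x. f x * \<psi> (x + c))" by (rule integrable_mult_L2[OF f])
      show "norm (f x * \<psi> (x + c)) \<le> (norm (f x))\<^sup>2 + (norm (\<psi> (x + c)))\<^sup>2" for x
        using sum_squares_bound[of "norm (f x)" "norm (\<psi> (x + c))"]
          mult_nonneg_nonneg[OF norm_ge_zero[of "f x"] norm_ge_zero[of "\<psi> (x + c)"]]
        unfolding norm_mult by linarith
    qed (use i in simp)
    also have "\<dots> = D"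
      using i integral_translate2[of "\<lambda>x. (norm (\<psi> x))\<^sup>2" c] by (simp add: D_def)
    finally show ?thesis .
  qed
  have "(\<lambda>n. LINT w|lborel. of_real (gauss2 w) * (LINT x|lborel. f x * \<psi> (x + s n *\<^sub>R w)))
     \<longlonglongrightarrow> (LINT w|lborel. of_real (gauss2 w) * (LINT x|lborel. f x * \<psi> x))"
  proof (rule integral_dominated_convergence)
    show "integrable lborel (\<lambda>w. gauss2 w * D)" using integrable_gauss2 by simp
    show "AE w in lborel. norm (of_real (gauss2 w) * (LINT x|lborel. f x * \<psi> (x + s n *\<^sub>R w))) \<le> gauss2 w * D" for n
      using bd by (auto simp: norm_mult gauss2_nonneg intro!: mult_left_mono)
    show "AE w in lborel. (\<lambda>n. of_real (gauss2 w) * (LINT x|lborel. f x * \<psi> (x + s n *\<^sub>R w)))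
       \<longlonglongrightarrow> of_real (gauss2 w) * (LINT x|lborel. f x * \<psi> x)"
    proof (intro AE_I2 tendsto_intros)
      fix w :: "real \<times> real"
      show "(\<lambda>n. LINT x|lborel. f x * \<psi> (x + s n *\<^sub>R w)) \<longlonglongrightarrow> (LINT x|lborel. f x * \<psi> x)"
      proof (rule integral_dominated_convergence)
        show "integrable lborel (\<lambda>x. C * (indicator (cball 0 (R + norm w)) x * norm (f x)))"
          by (intro integrable_mult_right integrable_norm_L2_bounded_set f) auto
        have "(\<lambda>n. \<psi> (x + s n *\<^sub>R w)) \<longlonglongrightarrow> \<psi> (x + 0 *\<^sub>R w)" for x
          by (rule continuous_on_tendsto_compose[OF \<psi>]) (auto intro!: tendsto_eq_intros s)
        then show "AE x in lborel. (\<lambda>n. f x * \<psi> (x + s n *\<^sub>R w)) \<longlonglongrightarrow> f x * \<psi> x"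
          by (intro AE_I2 tendsto_intros) simp
        show "AE x in lborel. norm (f x * \<psi> (x + s n *\<^sub>R w)) \<le> C * (indicator (cball 0 (R + norm w)) x * norm (f x))" for n
        proof (rule AE_I2)
          fix x :: "real \<times> real"
          have C0: "C \<ge> 0" using C[of 0] norm_ge_zero order_trans by blast
          show "norm (f x * \<psi> (x + s n *\<^sub>R w)) \<le> C * (indicator (cball 0 (R + norm w)) x * norm (f x))"
          proof (cases "norm x \<le> R + norm w")
            case True
            then show ?thesis using mult_left_mono[OF C[of "x + s n *\<^sub>R w"] norm_ge_zero[of "f x"]]
              by (simp add: norm_mult mult.commute)
          next
            case False
            have "norm x \<le> norm (x + s n *\<^sub>R w) + norm (s n *\<^sub>R w)"
              by (metis add_diff_cancel_right' norm_triangle_ineq4)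
            also have "norm (s n *\<^sub>R w) \<le> norm w"
              using mult_right_mono[OF s1[of n] norm_ge_zero[of w]] by simp
            finally have "norm (x + s n *\<^sub>R w) > R" using False by linarith
            then show ?thesis using C0 by (simp add: supp)
          qed
        qed
      qed auto
    qed
  qed auto
  moreover have "(LINT w|lborel. of_real (gauss2 w) * (LINT x|lborel. f x * \<psi> x)) = (LINT x|lborel. f x * \<psi> x)"
    by (simp add: integral_gauss2)
  ultimately show ?thesis by (simp add: integral_gauss2)
qed

section \<open>Smooth functions of one variable and bumps\<close>

text \<open>All iterated derivatives are carried as data, so that the n-th derivative is simply the
  entry \<open>F n\<close>.\<close>

definition jet :: "(nat \<Rightarrow> real \<Rightarrow> 'a::real_normed_vector) \<Rightarrow> bool" where
  "jet F \<longleftrightarrow> (\<forall>n x. (F n has_vector_derivative F (Suc n) x) (at x))"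

definition smooth1 :: "(real \<Rightarrow> 'a::real_normed_vector) \<Rightarrow> bool" where
  "smooth1 f \<longleftrightarrow> (\<exists>F. jet F \<and> F 0 = f)"

text \<open>Coinduction: in a class in which every member has a derivative in the class, a choice of
  derivatives can be iterated, and the iterates form a jet.\<close>

lemma smooth1_coinduct:
  assumes "S f" and step: "\<And>g. S g \<Longrightarrow> \<exists>g'. S g' \<and> (\<forall>x. (g has_vector_derivative g' x) (at x))"
  shows "smooth1 f"
proof -
  obtain d where d: "\<And>g. S g \<Longrightarrow> S (d g) \<and> (\<forall>x. (g has_vector_derivative d g x) (at x))"
    using step by metis
  have S: "S ((d ^^ n) f)" for n by (induction n) (use assms(1) d in auto)
  have "jet (\<lambda>n. (d ^^ n) f)" unfolding jet_def using d S by simp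
  then show ?thesis unfolding smooth1_def by (intro exI[of _ "\<lambda>n. (d ^^ n) f"]) simp
qed

lemma smooth1_derivative:
  assumes "smooth1 f"
  obtains f' where "smooth1 f'" "\<And>x. (f has_vector_derivative f' x) (at x)"
proof -
  obtain F where F: "jet F" "F 0 = f" using assms unfolding smooth1_def by auto
  have "jet (\<lambda>n. F (Suc n))" using F(1) by (simp add: jet_def)
  then have "smooth1 (F 1)" unfolding smooth1_def by force
  then show ?thesis using F that[of "F 1"] by (auto simp: jet_def)
qed

lemma smooth1_bounded_linear:
  assumes "smooth1 f" "bounded_linear L"
  shows "smooth1 (\<lambda>x. L (f x))"
proof (rule smooth1_coinduct[where S="\<lambda>h. \<exists>g. smooth1 g \<and> h = (\<lambda>x. L (g x))"])
  fix h assume "\<exists>g. smooth1 g \<and> h = (\<lambda>x. L (g x))"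
  then obtain g where g: "smooth1 g" "h = (\<lambda>x. L (g x))" by blast
  obtain g' where g': "smooth1 g'" "\<And>x. (g has_vector_derivative g' x) (at x)"
    using smooth1_derivative[OF g(1)] by metis
  show "\<exists>h'. (\<exists>g. smooth1 g \<and> h' = (\<lambda>x. L (g x))) \<and> (\<forall>x. (h has_vector_derivative h' x) (at x))"
    by (intro exI[of _ "\<lambda>x. L (g' x)"])
       (use g' g(2) bounded_linear.has_vector_derivative[OF assms(2)] in auto)
qed (use assms in auto)

text \<open>Single products are not closed under differentiation, but their finite sums are; this is
  the class used for the coinduction on products.\<close>

inductive sum_of_products :: "(real \<Rightarrow> 'a::real_normed_algebra) \<Rightarrow> bool" where
  base: "smooth1 f \<Longrightarrow> smooth1 g \<Longrightarrow> sum_of_products (\<lambda>x. f x * g x)"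
| add: "sum_of_products f \<Longrightarrow> sum_of_products g \<Longrightarrow> sum_of_products (\<lambda>x. f x + g x)"

lemma smooth1_mult:
  fixes f g :: "real \<Rightarrow> 'a::real_normed_algebra"
  assumes "smooth1 f" "smooth1 g"
  shows "smooth1 (\<lambda>x. f x * g x)"
proof (rule smooth1_coinduct[where S=sum_of_products])
  fix h :: "real \<Rightarrow> 'a" assume "sum_of_products h"
  then show "\<exists>h'. sum_of_products h' \<and> (\<forall>x. (h has_vector_derivative h' x) (at x))"
  proof induction
    case (base f g)
    obtain f' where f': "smooth1 f'" "\<And>x. (f has_vector_derivative f' x) (at x)"
      using smooth1_derivative[OF base(1)] by metis
    obtain g' where g': "smooth1 g'" "\<And>x. (g has_vector_derivative g' x) (at x)"
      using smooth1_derivative[OF base(2)] by metis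
    have "sum_of_products (\<lambda>x. f x * g' x + f' x * g x)"
      by (intro sum_of_products.intros base f'(1) g'(1))
    then show ?case
      by (intro exI[of _ "\<lambda>x. f x * g' x + f' x * g x"] conjI allI has_vector_derivative_mult f'(2) g'(2))
  next
    case (add f g)
    then obtain f' g' where "sum_of_products f'" "\<forall>x. (f has_vector_derivative f' x) (at x)"
        "sum_of_products g'" "\<forall>x. (g has_vector_derivative g' x) (at x)"
      by metis
    then show ?case
      by (intro exI[of _ "\<lambda>x. f' x + g' x"] conjI allI sum_of_products.add has_vector_derivative_add) auto
  qed
qed (rule sum_of_products.base[OF assms])

text \<open>The chain rule only brings out a factor \<open>c\<close>, so the scalar multiples of
  such compositions form a class closed under differentiation.\<close>

lemma smooth1_affine:
  assumes "smooth1 f"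
  shows "smooth1 (\<lambda>x. f (c * x + d))"
proof (rule smooth1_coinduct[where S="\<lambda>h. \<exists>g k. smooth1 g \<and> h = (\<lambda>x. k *\<^sub>R g (c * x + d))"])
  show "\<exists>g k. smooth1 g \<and> (\<lambda>x. f (c * x + d)) = (\<lambda>x. k *\<^sub>R g (c * x + d))"
    using assms by (intro exI[of _ f] exI[of _ 1]) simp
  fix h assume "\<exists>g k. smooth1 g \<and> h = (\<lambda>x. k *\<^sub>R g (c * x + d))"
  then obtain g k where g: "smooth1 g" "h = (\<lambda>x. k *\<^sub>R g (c * x + d))" by blast
  obtain g' where g': "smooth1 g'" "\<And>x. (g has_vector_derivative g' x) (at x)"
    using smooth1_derivative[OF g(1)] by metis
  have "(h has_vector_derivative (k * c) *\<^sub>R g' (c * x + d)) (at x)" for x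
  proof -
    have "((\<lambda>x. c * x + d) has_vector_derivative c) (at x)"
      by (auto intro!: derivative_eq_intros)
    from vector_diff_chain_at[OF this g'(2)] have "((\<lambda>x. g (c * x + d)) has_vector_derivative c *\<^sub>R g' (c * x + d)) (at x)"
      by (simp add: o_def)
    from bounded_linear.has_vector_derivative[OF bounded_linear_scaleR_right this, of k]
    show ?thesis by (simp add: g(2))
  qed
  then show "\<exists>h'. (\<exists>g k. smooth1 g \<and> h' = (\<lambda>x. k *\<^sub>R g (c * x + d))) \<and> (\<forall>x. (h has_vector_derivative h' x) (at x))"
    using g'(1) by (intro exI[of _ "\<lambda>x. (k * c) *\<^sub>R g' (c * x + d)"]) auto
qed

lemma smooth1_cis: "smooth1 (\<lambda>x. cis (c * x))"
proof (rule smooth1_coinduct[where S="\<lambda>h. \<exists>k. h = (\<lambda>x. k * cis (c * x))"])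
  show "\<exists>k. (\<lambda>x. cis (c * x)) = (\<lambda>x. k * cis (c * x))" by (intro exI[of _ 1]) simp
  fix h assume "\<exists>k. h = (\<lambda>x. k * cis (c * x))"
  then obtain k where k: "h = (\<lambda>x. k * cis (c * x))" by blast
  have "((\<lambda>x. k * cis (c * x)) has_vector_derivative (k * \<i> * c) * cis (c * x)) (at x)" for x
    unfolding has_vector_derivative_def
    by (rule derivative_eq_intros | simp add: scaleR_conv_of_real mult_ac)+
  then show "\<exists>h'. (\<exists>k. h' = (\<lambda>x. k * cis (c * x))) \<and> (\<forall>x. (h has_vector_derivative h' x) (at x))"
    unfolding k by (intro exI[of _ "\<lambda>x. (k * \<i> * c) * cis (c * x)"]) blast
qed

text \<open>The classical function that is flat at 0 and positive to the right of it.\<close>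

definition exp_inv :: "real \<Rightarrow> real" where
  "exp_inv x = (if x > 0 then exp (- (1 / x)) else 0)"

lemma poly_exp_tendsto_0: "((\<lambda>y::real. poly p y * exp (- y)) \<longlongrightarrow> 0) at_top"
proof -
  have "((\<lambda>y::real. \<Sum>i\<le>degree p. coeff p i * (y ^ i / exp y)) \<longlongrightarrow> (\<Sum>i\<le>degree p. coeff p i * 0)) at_top"
    by (intro tendsto_intros tendsto_power_div_exp_0)
  then show ?thesis
    by (simp add: poly_altdef sum_distrib_right exp_minus divide_inverse mult.assoc)
qed

text \<open>The functions p(1/x) exp(-1/x), extended by 0, are closed under differentiation as
  \<open>p\<close> ranges over the polynomials.\<close>

lemma smooth1_exp_inv: "smooth1 exp_inv"
proof (rule smooth1_coinduct[where S="\<lambda>h. \<exists>p. h = (\<lambda>x. if x > 0 then poly p (1 / x) * exp (- (1 / x)) else 0)"])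
  show "\<exists>p. exp_inv = (\<lambda>x. if x > 0 then poly p (1 / x) * exp (- (1 / x)) else 0)"
    by (intro exI[of _ 1]) (auto simp: exp_inv_def)
  fix h :: "real \<Rightarrow> real"
  assume "\<exists>p. h = (\<lambda>x. if x > 0 then poly p (1 / x) * exp (- (1 / x)) else 0)"
  then obtain p where h: "h = (\<lambda>x. if x > 0 then poly p (1 / x) * exp (- (1 / x)) else 0)" by blast
  \<comment> \<open>With y = 1/x and dy/dx = -y^2, differentiating p(y) exp(-y) gives y^2 (p(y) -
    p'(y)) exp(-y).\<close>
  define q where "q = [:0,0,1:] * (p - pderiv p)"
  define h' where "h' = (\<lambda>x::real. if x > 0 then poly q (1 / x) * exp (- (1 / x)) else 0)"
  have "(h has_real_derivative h' x) (at x)" for x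
  proof (cases x "0::real" rule: linorder_cases)
    case less
    have "((\<lambda>_. 0) has_real_derivative h' x) (at x)" using less by (simp add: h'_def)
    then show ?thesis
      by (rule has_field_derivative_transform_within_open[where S="{..<0}"]) (use less in \<open>simp_all add: h\<close>)
  next
    case greater
    have i: "((\<lambda>x. 1 / x) has_real_derivative - (1 / x\<^sup>2)) (at x)"
      using greater by (auto intro!: derivative_eq_intros simp: power2_eq_square)
    have "((\<lambda>x. poly p (1 / x) * exp (- (1 / x))) has_real_derivative
        poly (pderiv p) (1 / x) * - (1 / x\<^sup>2) * exp (- (1 / x)) + exp (- (1 / x)) * - (- (1 / x\<^sup>2)) * poly p (1 / x)) (at x)"
      by (intro DERIV_mult DERIV_chain2[OF poly_DERIV i] DERIV_chain2[OF DERIV_exp DERIV_minus[OF i]])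
    moreover have "poly (pderiv p) (1 / x) * - (1 / x\<^sup>2) * exp (- (1 / x)) + exp (- (1 / x)) * - (- (1 / x\<^sup>2)) * poly p (1 / x) = h' x"
      using greater by (simp add: h'_def q_def power2_eq_square algebra_simps)
    ultimately have "((\<lambda>x. poly p (1 / x) * exp (- (1 / x))) has_real_derivative h' x) (at x)" by simp
    then show ?thesis
      by (rule has_field_derivative_transform_within_open[where S="{0<..}"]) (use greater in \<open>simp_all add: h\<close>)
  next
    case equal
    \<comment> \<open>At 0 the difference quotient from the right is y p(y) exp(-y) with y = 1/x,
      and the exponential wins.\<close>
    have R: "((\<lambda>x. h x / x) \<longlongrightarrow> 0) (at_right 0)"
    proof -
      have "((\<lambda>x. poly ([:0,1:] * p) (inverse x) * exp (- inverse x)) \<longlongrightarrow> 0) (at_right (0::real))"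
        by (rule filterlim_compose[OF poly_exp_tendsto_0 filterlim_inverse_at_top_right])
      moreover have "\<forall>\<^sub>F x in at_right 0. poly ([:0,1:] * p) (inverse x) * exp (- inverse x) = h x / x"
        using eventually_at_right_less[of "0::real"] by eventually_elim (simp add: h field_simps)
      ultimately show ?thesis by (rule Lim_transform_eventually)
    qed
    have L: "((\<lambda>x. h x / x) \<longlongrightarrow> 0) (at_left 0)"
    proof (rule tendsto_eventually)
      show "\<forall>\<^sub>F x in at_left 0. h x / x = 0"
        unfolding eventually_at_filter by (intro always_eventually) (simp add: h)
    qed
    have "((\<lambda>x. h x / x) \<longlongrightarrow> 0) (at 0)" by (rule filterlim_split_at[OF L R])
    then show ?thesis using equal by (simp add: has_field_derivative_iff h h'_def)
  qed
  then show "\<exists>h'. (\<exists>p. h' = (\<lambda>x. if x > 0 then poly p (1 / x) * exp (- (1 / x)) else 0)) \<and> (\<forall>x. (h has_vector_derivative h' x) (at x))"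
    unfolding has_real_derivative_iff_has_vector_derivative h'_def by blast
qed

text \<open>The parameter \<open>r\<close> steepens the flanks: for growing \<open>r\<close> the
  bumps converge to the indicator of the open interval while their support stays fixed.\<close>

definition bump :: "real \<Rightarrow> real \<Rightarrow> real \<Rightarrow> real \<Rightarrow> real" where
  "bump a b r x = exp_inv (r * (x - a)) * exp_inv (r * (b - x))"

lemma exp_inv_bounds: "0 \<le> exp_inv x" "exp_inv x \<le> 1"
  by (auto simp: exp_inv_def)

lemma smooth1_bump: "smooth1 (bump a b r)"
proof -
  have "bump a b r = (\<lambda>x. exp_inv (r * x + - (r * a)) * exp_inv ((- r) * x + r * b))"
    by (simp add: bump_def[abs_def] algebra_simps)
  then show ?thesis using smooth1_mult[OF smooth1_affine[OF smooth1_exp_inv] smooth1_affine[OF smooth1_exp_inv]] by (simp only:)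
qed

lemma bump_bounds: "0 \<le> bump a b r x" "bump a b r x \<le> 1"
  unfolding bump_def by (auto intro!: mult_nonneg_nonneg mult_le_one exp_inv_bounds)

lemma bump_support: "r > 0 \<Longrightarrow> x \<notin> {a<..<b} \<Longrightarrow> bump a b r x = 0"
  by (auto simp: bump_def exp_inv_def zero_less_mult_iff)

lemma exp_inv_tendsto_1:
  assumes "0 < y" shows "(\<lambda>n. exp_inv (real (Suc n) * y)) \<longlonglongrightarrow> 1"
proof -
  have "(\<lambda>n. exp (- (1 / real (Suc n) * (1 / y)))) \<longlonglongrightarrow> exp (- (0 * (1 / y)))"
    by (intro tendsto_intros LIMSEQ_Suc[OF lim_1_over_n])
  then show ?thesis using assms by (simp add: exp_inv_def)
qed

lemma bump_tendsto_indicator: "(\<lambda>n. bump a b (real (Suc n)) x) \<longlonglongrightarrow> indicator {a<..<b} x"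
proof (cases "x \<in> {a<..<b}")
  case True
  then have "(\<lambda>n. exp_inv (real (Suc n) * (x - a)) * exp_inv (real (Suc n) * (b - x))) \<longlonglongrightarrow> 1 * 1"
    by (intro tendsto_mult exp_inv_tendsto_1) auto
  then show ?thesis using True by (simp add: bump_def)
next
  case False
  then show ?thesis by (simp add: bump_support del: greaterThanLessThan_iff)
qed

section \<open>Tensor products as test functions on the plane\<close>

lemma has_derivative_tensor:
  fixes A B A' B' :: "real \<Rightarrow> real"
  assumes "(A has_vector_derivative A' (fst z)) (at (fst z))" "(B has_vector_derivative B' (snd z)) (at (snd z))"
  shows "((\<lambda>z. A (fst z) * B (snd z)) has_derivative
     (\<lambda>h. A (fst z) * (snd h * B' (snd z)) + (fst h * A' (fst z)) * B (snd z))) (at z)"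
proof -
  have "((\<lambda>z. A (fst z)) has_derivative (\<lambda>h. fst h * A' (fst z))) (at z)"
    using has_derivative_compose[OF has_derivative_fst[OF has_derivative_ident], of A "\<lambda>h. h * A' (fst z)" z UNIV] assms(1)
    by (simp add: has_vector_derivative_def o_def)
  moreover have "((\<lambda>z. B (snd z)) has_derivative (\<lambda>h. snd h * B' (snd z))) (at z)"
    using has_derivative_compose[OF has_derivative_snd[OF has_derivative_ident], of B "\<lambda>h. h * B' (snd z)" z UNIV] assms(2)
    by (simp add: has_vector_derivative_def o_def)
  ultimately show ?thesis by (rule has_derivative_mult)
qed

text \<open>Each partial derivative raises one index and leaves the form unchanged, so every word of
  partial derivatives of a tensor product of jets is again such a product.\<close>

lemma
  assumes A: "jet A" and B: "jet B"
  shows differentiable_tensor: "(\<lambda>z. A i (fst z) * B j (snd z) :: real) differentiable (at z)"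
    and pdx_tensor: "pdx (\<lambda>z. A i (fst z) * B j (snd z)) = (\<lambda>z. A (Suc i) (fst z) * B j (snd z))"
    and pdy_tensor: "pdy (\<lambda>z. A i (fst z) * B j (snd z)) = (\<lambda>z. A i (fst z) * B (Suc j) (snd z))"
proof -
  have D: "((\<lambda>z. A i (fst z) * B j (snd z)) has_derivative
     (\<lambda>h. A i (fst z) * (snd h * B (Suc j) (snd z)) + (fst h * A (Suc i) (fst z)) * B j (snd z))) (at z)" for z
    by (rule has_derivative_tensor) (use A B in \<open>auto simp: jet_def\<close>)
  show "(\<lambda>z. A i (fst z) * B j (snd z)) differentiable (at z)"
    using D differentiable_def by blast
  show "pdx (\<lambda>z. A i (fst z) * B j (snd z)) = (\<lambda>z. A (Suc i) (fst z) * B j (snd z))"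
    unfolding pdx_def frechet_derivative_at[OF D, symmetric] by simp
  show "pdy (\<lambda>z. A i (fst z) * B j (snd z)) = (\<lambda>z. A i (fst z) * B (Suc j) (snd z))"
    unfolding pdy_def frechet_derivative_at[OF D, symmetric] by simp
qed

lemma pdx_power_tensor:
  assumes "jet A" "jet B"
  shows "(pdx ^^ k) (\<lambda>z. A i (fst z) * B j (snd z)) = (\<lambda>z. A (i + k) (fst z) * B j (snd z))"
  by (induction k) (simp_all add: pdx_tensor[OF assms])

lemma pdy_power_tensor:
  assumes "jet A" "jet B"
  shows "(pdy ^^ k) (\<lambda>z. A i (fst z) * B j (snd z)) = (\<lambda>z. A i (fst z) * B (j + k) (snd z))"
  by (induction k) (simp_all add: pdy_tensor[OF assms])

lemma pd_word_tensor:
  assumes "jet A" "jet B"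
  shows "\<exists>k l. pd_word ws (\<lambda>z. A i (fst z) * B j (snd z)) = (\<lambda>z. A k (fst z) * B l (snd z))"
proof (induction ws)
  case Nil
  then show ?case by (auto simp: pd_word_def)
next
  case (Cons w ws)
  then obtain k l where kl: "pd_word ws (\<lambda>z. A i (fst z) * B j (snd z)) = (\<lambda>z. A k (fst z) * B l (snd z))" by auto
  have "pd_word (w # ws) f = (if w then pdx (pd_word ws f) else pdy (pd_word ws f))" for f
    by (simp add: pd_word_def)
  then show ?case using kl by (auto simp: pdx_tensor[OF assms] pdy_tensor[OF assms])
qed

lemma test_fun_tensor:
  assumes A: "jet A" "\<And>x. \<bar>x\<bar> > R \<Longrightarrow> A 0 x = 0" and B: "jet B" "\<And>x. \<bar>x\<bar> > R \<Longrightarrow> B 0 x = 0"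
  shows "test_fun (\<lambda>z. A 0 (fst z) * B 0 (snd z))"
proof -
  have d: "pd_word ws (\<lambda>z. A 0 (fst z) * B 0 (snd z)) differentiable (at z)" for ws z
  proof -
    obtain k l where "pd_word ws (\<lambda>z. A 0 (fst z) * B 0 (snd z)) = (\<lambda>z. A k (fst z) * B l (snd z))"
      using pd_word_tensor[OF A(1) B(1), of ws 0 0] by blast
    then show ?thesis using differentiable_tensor[OF A(1) B(1), of k l z] by simp
  qed
  then have "smooth2 (\<lambda>z. A 0 (fst z) * B 0 (snd z))"
    unfolding smooth2_def
    by (auto intro!: differentiable_imp_continuous_on simp: differentiable_on_def differentiable_at_withinI)
  moreover have "compact ({-R..R} \<times> {-R..R})" by (intro compact_Times) auto
  moreover have "A 0 (fst z) * B 0 (snd z) = 0" if "z \<notin> {-R..R} \<times> {-R..R}" for z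
  proof -
    have "\<bar>fst z\<bar> > R \<or> \<bar>snd z\<bar> > R" using that by (cases z) auto
    then show ?thesis using A(2) B(2) by auto
  qed
  ultimately show ?thesis unfolding test_fun_def by blast
qed

lemma test_fun_bump: "r > 0 \<Longrightarrow> test_fun (\<lambda>z. bump a b r (fst z) * bump c d r (snd z))"
proof -
  assume r: "r > 0"
  obtain A B where A: "jet A" "A 0 = bump a b r" and B: "jet B" "B 0 = bump c d r"
    using smooth1_bump unfolding smooth1_def by metis
  let ?R = "\<bar>a\<bar> + \<bar>b\<bar> + \<bar>c\<bar> + \<bar>d\<bar>"
  have "test_fun (\<lambda>z. A 0 (fst z) * B 0 (snd z))"
    by (rule test_fun_tensor[where R="?R"]) (auto simp: A B intro!: bump_support r)
  then show ?thesis by (simp add: A B)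
qed

section \<open>From test functions to indicators, and the fundamental lemma of the calculus of
  variations\<close>

text \<open>A monotone class argument: indicators of boxes are limits of bumps, boxes form an
  intersection-stable generator of the Borel sets, and \<open>P\<close> passes through differences,
  sums and dominated limits. Smoothness of the tests thereby disappears from all later
  arguments.\<close>

lemma test_fun_closure_indicator:
  fixes P :: "(real \<times> real \<Rightarrow> real) \<Rightarrow> bool"
  assumes test: "\<And>\<phi>. test_fun \<phi> \<Longrightarrow> P \<phi>"
    and add: "\<And>f g. P f \<Longrightarrow> P g \<Longrightarrow> P (\<lambda>z. f z + g z)"
    and diff: "\<And>f g. P f \<Longrightarrow> P g \<Longrightarrow> P (\<lambda>z. f z - g z)"
    and lim: "\<And>s f B. (\<And>n. P (s n)) \<Longrightarrow> (\<And>n. s n \<in> borel_measurable borel) \<Longrightarrow> bounded B \<Longrightarrow> B \<in> sets borel \<Longrightarrow>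
        (\<And>n z. \<bar>s n z\<bar> \<le> indicator B z) \<Longrightarrow> (\<And>z. (\<lambda>n. s n z) \<longlonglongrightarrow> f z) \<Longrightarrow> P f"
    and A: "A \<in> sets borel" "bounded A"
  shows "P (indicator A)"
proof -
  \<comment> \<open>The difference of a test function with itself.\<close>
  have zero: "P (\<lambda>_. 0)"
    using test_fun_bump[of 1 0 0 0 0] test diff by force
  have box: "P (indicator (box u v))" for u v
  proof (rule lim[where B="box u v"])
    let ?s = "\<lambda>n z. bump (fst u) (fst v) (real (Suc n)) (fst z) * bump (snd u) (snd v) (real (Suc n)) (snd z)"
    have bx: "z \<in> box u v \<longleftrightarrow> fst z \<in> {fst u<..<fst v} \<and> snd z \<in> {snd u<..<snd v}" for z
      by (cases u, cases v, cases z) (auto simp: box_def Basis_prod_def)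
    have mb: "bump a b r \<in> borel_measurable borel" for a b r
    proof (rule borel_measurable_continuous_onI)
      obtain f' where "\<And>x. (bump a b r has_vector_derivative f' x) (at x)"
        using smooth1_derivative[OF smooth1_bump] by metis
      then show "continuous_on UNIV (bump a b r)"
        by (auto intro!: continuous_at_imp_continuous_on has_vector_derivative_continuous)
    qed
    show "P (?s n)" for n by (rule test[OF test_fun_bump]) simp
    show "?s n \<in> borel_measurable borel" for n
      using mb unfolding borel_prod[symmetric] by measurable
    show "bounded (box u v)" by simp
    show "\<bar>?s n z\<bar> \<le> indicator (box u v) z" for n z
    proof (cases "z \<in> box u v")
      case True
      then show ?thesis using bump_bounds by (simp add: abs_mult mult_le_one)
    next
      case False
      then have "?s n z = 0" unfolding bx using bump_support[of "real (Suc n)"] by fastforce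
      then show ?thesis by (simp only: abs_zero indicator_pos_le)
    qed
    have "(\<lambda>n. ?s n z) \<longlonglongrightarrow> indicator {fst u<..<fst v} (fst z) * indicator {snd u<..<snd v} (snd z)" for z
      by (intro tendsto_mult bump_tendsto_indicator)
    moreover have "indicator {fst u<..<fst v} (fst z) * indicator {snd u<..<snd v} (snd z) = (indicator (box u v) z :: real)" for z
      using bx[of z] by (auto simp: indicator_def)
    ultimately show "(\<lambda>n. ?s n z) \<longlonglongrightarrow> indicator (box u v) z" for z by simp
  qed simp
  obtain u v where uv: "A \<subseteq> box u v"
    using bounded_subset_box_symmetric[OF A(2)] by metis
  have "Int_stable (range (\<lambda>(a, b). box a b :: (real \<times> real) set))"
    by (auto simp: Int_stable_def box_Int_box)
  moreover have "range (\<lambda>(a, b). box a b :: (real \<times> real) set) \<subseteq> Pow UNIV" by simp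
  moreover have "A \<in> sigma_sets UNIV (range (\<lambda>(a, b). box a b))"
    using A(1) by (simp add: borel_eq_box)
  \<comment> \<open>Every set is intersected with one fixed box containing \<open>A\<close>, so that
    a complement becomes a difference of two indicators of bounded sets and unions are dominated by
    the box.\<close>
  ultimately have "P (indicator (A \<inter> box u v))"
  proof (induction rule: sigma_sets_induct_disjoint)
    case (basic C)
    then obtain p q where "C = box p q" by auto
    then show ?case using box by (simp only: box_Int_box)
  next
    case empty
    then show ?case using zero by (simp add: indicator_def[abs_def])
  next
    case (compl C)
    have "indicator ((UNIV - C) \<inter> box u v) = (\<lambda>z. indicator (box u v) z - indicator (C \<inter> box u v) z :: real)"
      by (auto simp: indicator_def)
    then show ?case using diff[OF box compl(2)] by simp
  next
    case (union C)
    have m: "C i \<in> sets borel" for i using union(2) by (auto simp: borel_eq_box)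
    let ?s = "\<lambda>n z. \<Sum>i<n. indicator (C i \<inter> box u v) z :: real"
    have s: "?s n z = indicator ((\<Union>i<n. C i) \<inter> box u v) z" for n z
    proof -
      have "disjoint_family_on (\<lambda>i. C i \<inter> box u v) {..<n}"
        using union(1) by (auto simp: disjoint_family_on_def)
      then have "indicator (\<Union>i<n. C i \<inter> box u v) z = ?s n z"
        by (rule indicator_UN_disjoint[OF finite_lessThan])
      then show ?thesis by simp
    qed
    show ?case
    proof (rule lim[where s="?s" and B="box u v"])
      show "P (?s n)" for n
      proof (induction n)
        case (Suc n)
        then show ?case using add[OF Suc union(3)[of n]] by simp
      qed (simp add: zero)
      show "?s n \<in> borel_measurable borel" for n using m by measurable
      show "\<bar>?s n z\<bar> \<le> indicator (box u v) z" for n z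
        unfolding s by (auto simp: indicator_def)
      show "(\<lambda>n. ?s n z) \<longlonglongrightarrow> indicator ((\<Union>i. C i) \<inter> box u v) z" for z
      proof -
        have "(\<lambda>n. indicator (\<Union>i<n. C i \<inter> box u v) z :: real) \<longlonglongrightarrow> indicator (\<Union>i. C i \<inter> box u v) z"
          by (rule LIMSEQ_indicator_UN)
        then show ?thesis unfolding s by (simp add: UN_simps(4))
      qed
    qed auto
  qed
  then show ?thesis using uv by (simp add: Int_absorb2)
qed

lemma test_fun_continuous: "test_fun \<phi> \<Longrightarrow> continuous_on UNIV \<phi>"
  unfolding test_fun_def smooth2_def by (auto dest!: spec[of _ "[]"] simp: pd_word_def)

lemma test_fun_borel: "test_fun \<phi> \<Longrightarrow> \<phi> \<in> borel_measurable borel"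
  by (intro borel_measurable_continuous_onI test_fun_continuous)

lemma continuous_compact_support_bounded:
  fixes \<phi> :: "'a::euclidean_space \<Rightarrow> 'b::real_normed_vector"
  assumes "continuous_on UNIV \<phi>" and R: "\<And>z. norm z > R \<Longrightarrow> \<phi> z = 0"
  obtains C where "\<And>z. norm (\<phi> z) \<le> C * indicator (cball 0 R) z" "C \<ge> 0"
proof -
  have "compact (\<phi> ` cball 0 R)"
    using assms(1) by (intro compact_continuous_image) (auto intro: continuous_on_subset)
  then obtain C where "\<forall>y\<in>\<phi> ` cball 0 R. norm y \<le> C"
    using compact_imp_bounded bounded_iff by metis
  then have C: "\<And>z. norm z \<le> R \<Longrightarrow> norm (\<phi> z) \<le> C" by simp
  show ?thesis
    by (rule that[of "\<bar>C\<bar>"]) (use C R in \<open>auto simp: indicator_def not_le intro: order_trans[OF _ abs_ge_self]\<close>)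
qed

lemma test_fun_support:
  assumes "test_fun \<phi>"
  obtains R where "\<And>z. norm z > R \<Longrightarrow> \<phi> z = 0"
proof -
  obtain K where K: "compact K" "\<And>z. z \<notin> K \<Longrightarrow> \<phi> z = 0" using assms unfolding test_fun_def by auto
  obtain R where R: "\<And>z. z \<in> K \<Longrightarrow> norm z \<le> R"
    using compact_imp_bounded[OF K(1)] by (auto simp: bounded_iff)
  show ?thesis by (rule that[of R]) (use K R in force)
qed

lemma test_fun_bounded:
  assumes "test_fun \<phi>"
  obtains C R where "\<And>z. \<bar>\<phi> z\<bar> \<le> C * indicator (cball 0 R) z" "C \<ge> 0"
proof -
  obtain R where "\<And>z. norm z > R \<Longrightarrow> \<phi> z = 0" by (metis test_fun_support[OF assms])
  from continuous_compact_support_bounded[OF test_fun_continuous[OF assms] this] that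
  show ?thesis by (metis real_norm_def)
qed

lemma integrable_bounded_support:
  fixes \<phi> :: "'a::euclidean_space \<Rightarrow> 'b::{banach, second_countable_topology}"
  assumes "\<phi> \<in> borel_measurable borel" "\<And>z. norm (\<phi> z) \<le> C * indicator B z" "B \<in> sets borel" "bounded B"
  shows "integrable lborel \<phi>"
proof (rule Bochner_Integration.integrable_bound)
  show "integrable lborel (\<lambda>z. C * indicator B z)"
    using assms emeasure_bounded_finite[OF assms(4)] by (intro integrable_mult_right integrable_real_indicator) auto
qed (use assms in \<open>auto intro!: AE_I2 intro: order_trans[OF _ abs_ge_self]\<close>)

lemma L2c_bounded_support:
  assumes "\<phi> \<in> borel_measurable borel" "\<And>z. norm (\<phi> z) \<le> C * indicator B z" "B \<in> sets borel" "bounded B"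
  shows "L2c \<phi>"
proof -
  have "(norm (\<phi> z))\<^sup>2 \<le> C\<^sup>2 * indicator B z" for z
    using power_mono[OF assms(2)[of z], of 2] by (cases "z \<in> B") simp_all
  then have "integrable lborel (\<lambda>z. (norm (\<phi> z))\<^sup>2)"
    using assms by (intro integrable_bounded_support[where B=B and C="C\<^sup>2"]) auto
  then show ?thesis using assms(1) by (simp add: L2c_def)
qed

lemma integrable_mult_bounded_support:
  fixes h :: "'a::euclidean_space \<Rightarrow> 'b::{banach, second_countable_topology}"
    and \<phi> :: "'a \<Rightarrow> real"
  assumes h: "h \<in> borel_measurable borel" "\<And>K. compact K \<Longrightarrow> set_integrable lborel K h"
    and \<phi>: "\<phi> \<in> borel_measurable borel" "\<And>z. \<bar>\<phi> z\<bar> \<le> C * indicator B z" "bounded B"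
  shows "integrable lborel (\<lambda>z. \<phi> z *\<^sub>R h z)"
proof -
  obtain R where R: "B \<subseteq> cball 0 R" using \<phi>(3) by (auto simp: bounded_iff subset_eq)
  have "set_integrable lborel (cball 0 R) h" by (rule h(2)) simp
  then have i: "integrable lborel (\<lambda>z. C * norm (indicator (cball 0 R) z *\<^sub>R h z))"
    unfolding set_integrable_def by (intro integrable_mult_right integrable_norm)
  show ?thesis
  proof (rule Bochner_Integration.integrable_bound[OF i])
    show "AE z in lborel. norm (\<phi> z *\<^sub>R h z) \<le> norm (C * norm (indicator (cball 0 R) z *\<^sub>R h z))"
    proof (rule AE_I2)
      fix z
      have "\<bar>\<phi> z\<bar> \<le> \<bar>C\<bar> * indicator (cball 0 R) z"
        using \<phi>(2)[of z] R abs_ge_self[of C] by (cases "z \<in> B") (auto simp: subset_eq)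
      from mult_right_mono[OF this norm_ge_zero[of "h z"]]
      show "norm (\<phi> z *\<^sub>R h z) \<le> norm (C * norm (indicator (cball 0 R) z *\<^sub>R h z))"
        by (simp add: abs_mult mult.assoc)
    qed
  qed (use h \<phi> in simp)
qed

text \<open>The vanishing extends from test functions to indicators of bounded Borel sets. Applied
  to the parts of a ball where \<open>h\<close> is positive or negative, it annihilates an integrand
  of constant sign.\<close>

lemma du_Bois_Reymond:
  fixes h :: "real \<times> real \<Rightarrow> real"
  assumes h: "h \<in> borel_measurable borel" "\<And>K. compact K \<Longrightarrow> set_integrable lborel K h"
    and 0: "\<And>\<phi>. test_fun \<phi> \<Longrightarrow> (LINT z|lborel. h z * \<phi> z) = 0"
  shows "AE z in lborel. h z = 0"
proof -
  \<comment> \<open>Integrability is part of \<open>P\<close>: without it neither additivity of the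
    integrals nor the closure under limits could be stated.\<close>
  define P where "P \<phi> \<longleftrightarrow> \<phi> \<in> borel_measurable borel \<and> integrable lborel (\<lambda>z. h z * \<phi> z) \<and> (LINT z|lborel. h z * \<phi> z) = 0"
    for \<phi> :: "real \<times> real \<Rightarrow> real"
  have P: "P (indicator A)" if A: "A \<in> sets borel" "bounded A" for A
  proof (rule test_fun_closure_indicator[of P, OF _ _ _ _ A])
    fix \<phi> assume t: "test_fun \<phi>"
    obtain C R where CR: "\<And>z. \<bar>\<phi> z\<bar> \<le> C * indicator (cball 0 R) z" using test_fun_bounded[OF t] by metis
    have "integrable lborel (\<lambda>z. \<phi> z *\<^sub>R h z)"
      by (rule integrable_mult_bounded_support[OF h test_fun_borel[OF t] CR]) auto
    then show "P \<phi>" using 0[OF t] test_fun_borel[OF t] by (simp add: P_def mult.commute)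
  next
    fix s f B assume s: "\<And>n. P (s n)" "bounded B" "B \<in> sets borel" "\<And>n z. \<bar>s n z\<bar> \<le> indicator B z" "\<And>z. (\<lambda>n. s n z) \<longlonglongrightarrow> f z"
    have [measurable]: "s n \<in> borel_measurable borel" for n using s(1) by (auto simp: P_def)
    have [measurable]: "f \<in> borel_measurable borel" by (rule borel_measurable_LIMSEQ_real[OF s(5)]) auto
    have "\<bar>f z\<bar> \<le> indicator B z" for z
      by (rule LIMSEQ_le_const2[OF tendsto_rabs[OF s(5)]]) (use s(4) in auto)
    then have fi: "integrable lborel (\<lambda>z. f z *\<^sub>R h z)"
      by (intro integrable_mult_bounded_support[OF h, where C=1 and B=B]) (use s in auto)
    have "(\<lambda>n. LINT z|lborel. h z * s n z) \<longlonglongrightarrow> (LINT z|lborel. h z * f z)"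
    proof (rule integral_dominated_convergence[where w="\<lambda>z. norm (indicator B z *\<^sub>R h z)"])
      show "integrable lborel (\<lambda>z. norm (indicator B z *\<^sub>R h z))"
        by (intro integrable_norm integrable_mult_bounded_support[OF h, where C=1 and B=B]) (use s in auto)
      show "AE z in lborel. norm (h z * s n z) \<le> norm (indicator B z *\<^sub>R h z)" for n
      proof (rule AE_I2)
        fix z show "norm (h z * s n z) \<le> norm (indicator B z *\<^sub>R h z)"
          using mult_left_mono[OF s(4)[of n z] abs_ge_zero[of "h z"]] by (simp add: abs_mult mult.commute)
      qed
      show "AE z in lborel. (\<lambda>n. h z * s n z) \<longlonglongrightarrow> h z * f z"
        by (intro AE_I2 tendsto_intros s)
    qed (use h in auto)
    moreover have "(LINT z|lborel. h z * s n z) = 0" for n using s(1) by (simp add: P_def)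
    ultimately show "P f" using fi by (simp add: P_def mult.commute LIMSEQ_const_iff)
  qed (auto simp: P_def algebra_simps)
  have [measurable]: "h \<in> borel_measurable borel" by fact
  have *: "AE z in lborel. h z * indicator {z \<in> cball 0 (real n). 0 < h z} z = 0" for n
  proof -
    have "P (indicator {z \<in> cball 0 (real n). 0 < h z})"
      by (rule P) (auto intro: bounded_subset[OF bounded_cball[of 0 "real n"]])
    then show ?thesis unfolding P_def
      by (subst integral_nonneg_eq_0_iff_AE[symmetric]) (auto simp: indicator_def)
  qed
  have **: "AE z in lborel. - h z * indicator {z \<in> cball 0 (real n). h z < 0} z = 0" for n
  proof -
    have "P (indicator {z \<in> cball 0 (real n). h z < 0})"
      by (rule P) (auto intro: bounded_subset[OF bounded_cball[of 0 "real n"]])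
    then show ?thesis unfolding P_def
      by (subst integral_nonneg_eq_0_iff_AE[symmetric]) (auto simp: indicator_def)
  qed
  from * have "AE z in lborel. \<forall>n. h z * indicator {z \<in> cball 0 (real n). 0 < h z} z = 0"
    unfolding AE_all_countable by blast
  moreover from ** have "AE z in lborel. \<forall>n. - h z * indicator {z \<in> cball 0 (real n). h z < 0} z = 0"
    unfolding AE_all_countable by blast
  ultimately show ?thesis
  proof eventually_elim
    case (elim z)
    obtain n where "norm z \<le> real n" using real_arch_simple by auto
    then show ?case using elim(1)[rule_format, of n] elim(2)[rule_format, of n]
      by (auto simp: indicator_def split: if_splits)
  qed
qed

section \<open>The Fourier transform on L^2: extension of the duality, uniqueness and
  inversion\<close>

lemma Cauchy_Schwarz_real:
  assumes f: "L2c f" and g: "L2c g"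
  shows "(norm (LINT z|lborel. f z * g z))\<^sup>2 \<le> (LINT z|lborel. (norm (f z))\<^sup>2) * (LINT z|lborel. (norm (g z))\<^sup>2)"
proof -
  have "(ennreal (norm (LINT z|lborel. f z * g z)))\<^sup>2
    \<le> (\<integral>\<^sup>+z. ennreal ((norm (f z))\<^sup>2) \<partial>lborel) * (\<integral>\<^sup>+z. ennreal ((norm (g z))\<^sup>2) \<partial>lborel)"
    by (rule Cauchy_Schwarz_integral) (use f g in \<open>auto simp: L2c_def\<close>)
  then show ?thesis
    using f g unfolding L2c_def
    by (simp add: nn_integral_eq_integral ennreal_power ennreal_mult[symmetric] integral_nonneg_AE)
qed

lemma Bessel_fourier_real:
  assumes "integrable lborel f" "L2c f"
  shows "(LINT z|lborel. (norm (fourier f z))\<^sup>2) \<le> (LINT z|lborel. (norm (f z))\<^sup>2)"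
  using Bessel_fourier[OF assms(1)] L2c_fourier[OF assms] assms(2) unfolding L2c_def
  by (simp add: nn_integral_eq_integral integral_nonneg_AE)

text \<open>Cauchy-Schwarz followed by Bessel's inequality: pairing with \<open>f\<close> on the
  transformed side is continuous in the L^2 norm of the test function.\<close>

lemma L2c_tendsto_fourier_pairing:
  assumes f: "L2c f" and s: "\<And>n. integrable lborel (s n)" "\<And>n. L2c (s n)"
    and \<phi>: "integrable lborel \<phi>" "L2c \<phi>"
    and lim: "(\<lambda>n. LINT z|lborel. (norm (s n z - \<phi> z))\<^sup>2) \<longlonglongrightarrow> 0"
  shows "(\<lambda>n. LINT z|lborel. f z * fourier (s n) z) \<longlonglongrightarrow> (LINT z|lborel. f z * fourier \<phi> z)"
proof -
  let ?d = "\<lambda>n. (LINT z|lborel. f z * fourier (s n) z) - (LINT z|lborel. f z * fourier \<phi> z)"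
  have "(norm (?d n))\<^sup>2 \<le> (LINT z|lborel. (norm (f z))\<^sup>2) * (LINT z|lborel. (norm (s n z - \<phi> z))\<^sup>2)" for n
  proof -
    have d: "integrable lborel (\<lambda>z. s n z - \<phi> z)" "L2c (\<lambda>z. s n z - \<phi> z)"
      using s \<phi> L2c_diff by auto
    have "?d n = (LINT z|lborel. f z * fourier (\<lambda>z. s n z - \<phi> z) z)"
      by (simp add: fourier_diff s \<phi> right_diff_distrib integrable_mult_L2 f L2c_fourier)
    then have "(norm (?d n))\<^sup>2 \<le> (LINT z|lborel. (norm (f z))\<^sup>2) * (LINT z|lborel. (norm (fourier (\<lambda>z. s n z - \<phi> z) z))\<^sup>2)"
      using Cauchy_Schwarz_real[OF f L2c_fourier[OF d]] by simp
    also have "\<dots> \<le> (LINT z|lborel. (norm (f z))\<^sup>2) * (LINT z|lborel. (norm (s n z - \<phi> z))\<^sup>2)"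
      by (intro mult_left_mono Bessel_fourier_real d integral_nonneg_AE) auto
    finally show ?thesis .
  qed
  moreover have "(\<lambda>n. (LINT z|lborel. (norm (f z))\<^sup>2) * (LINT z|lborel. (norm (s n z - \<phi> z))\<^sup>2)) \<longlonglongrightarrow> 0"
    using tendsto_mult_right_zero[OF lim] by simp
  ultimately have "(\<lambda>n. (norm (?d n))\<^sup>2) \<longlonglongrightarrow> 0"
    by (intro Lim_null_comparison[where f="\<lambda>n. (norm (?d n))\<^sup>2"] always_eventually) auto
  then have "(\<lambda>n. sqrt ((norm (?d n))\<^sup>2)) \<longlonglongrightarrow> sqrt 0" by (rule tendsto_real_sqrt)
  then have "?d \<longlonglongrightarrow> 0" by (simp add: tendsto_norm_zero_iff)
  then show ?thesis using Lim_null by blast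
qed

text \<open>\<open>is_FT\<close> tests only with real smooth functions of compact support. The
  identity is linear and stable under dominated limits, so it spreads to indicators of bounded sets,
  to truncated simple functions, and finally to all of L^1 intersected with L^2.\<close>

lemma is_FT_pairing:
  assumes FT: "is_FT f g" and \<phi>: "integrable lborel \<phi>" "L2c \<phi>"
  shows "(LINT z|lborel. f z * fourier \<phi> z) = (LINT z|lborel. g z * \<phi> z)"
proof -
  have f: "L2c f" and g: "L2c g" using FT by (auto simp: is_FT_def)
  define Q where "Q \<phi> \<longleftrightarrow> integrable lborel \<phi> \<and> L2c \<phi> \<and>
      (LINT z|lborel. f z * fourier \<phi> z) = (LINT z|lborel. g z * \<phi> z)" for \<phi>
  \<comment> \<open>The majorant lies in both L^1 and L^2: the left-hand side converges by L^2
    continuity of the pairing, the right-hand side by dominated convergence.\<close>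
  have Q_lim: "Q h" if s: "\<And>n. Q (s n)" and h: "h \<in> borel_measurable borel" and \<Psi>: "integrable lborel \<Psi>" "L2c (\<lambda>z. complex_of_real (\<Psi> z))"
    and le: "\<And>n z. norm (s n z) \<le> \<Psi> z" and lim: "\<And>z. (\<lambda>n. s n z) \<longlonglongrightarrow> h z" for s h \<Psi>
  proof -
    have leh: "norm (h z) \<le> \<Psi> z" for z
      by (rule LIMSEQ_le_const2[OF tendsto_norm[OF lim]]) (use le in auto)
    have \<Psi>0: "0 \<le> \<Psi> z" for z using le[of 0 z] norm_ge_zero order_trans by blast
    have si: "integrable lborel (s n)" "L2c (s n)" for n using s by (auto simp: Q_def)
    have [measurable]: "s n \<in> borel_measurable borel" for n using si by auto
    have hi: "integrable lborel h"
      by (rule Bochner_Integration.integrable_bound[OF \<Psi>(1)]) (use h leh \<Psi>0 in auto)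
    have hL: "L2c h"
      by (rule L2c_bound[OF \<Psi>(2) \<Psi>(2) h, where A=1 and B=0]) (use leh \<Psi>0 in \<open>auto intro!: power_mono\<close>)
    have "(\<lambda>n. LINT z|lborel. (norm (s n z - h z))\<^sup>2) \<longlonglongrightarrow> (LINT z|(lborel :: (real \<times> real) measure). (0::real))"
    proof (rule integral_dominated_convergence)
      show "integrable lborel (\<lambda>z. 4 * (\<Psi> z)\<^sup>2)" using \<Psi>(2) by (simp add: L2c_def)
      have "(\<lambda>n. (norm (s n z - h z))\<^sup>2) \<longlonglongrightarrow> (norm (h z - h z))\<^sup>2" for z
        by (intro tendsto_intros lim)
      then show "AE z in lborel. (\<lambda>n. (norm (s n z - h z))\<^sup>2) \<longlonglongrightarrow> 0" by simp
      show "AE z in lborel. norm ((norm (s n z - h z))\<^sup>2) \<le> 4 * (\<Psi> z)\<^sup>2" for n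
      proof (rule AE_I2)
        fix z
        have "norm (s n z - h z) \<le> 2 * \<Psi> z"
          using norm_triangle_ineq4[of "s n z" "h z"] le[of n z] leh[of z] by linarith
        from power_mono[OF this norm_ge_zero, of 2]
        show "norm ((norm (s n z - h z))\<^sup>2) \<le> 4 * (\<Psi> z)\<^sup>2" by (simp add: power_mult_distrib)
      qed
    qed (use h in auto)
    then have "(\<lambda>n. LINT z|lborel. f z * fourier (s n) z) \<longlonglongrightarrow> (LINT z|lborel. f z * fourier h z)"
      by (intro L2c_tendsto_fourier_pairing f si hi hL) simp
    moreover have "(\<lambda>n. LINT z|lborel. g z * s n z) \<longlonglongrightarrow> (LINT z|lborel. g z * h z)"
    proof (rule integral_dominated_convergence)
      show "integrable lborel (\<lambda>z. norm (g z * complex_of_real (\<Psi> z)))"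
        by (intro integrable_norm integrable_mult_L2 g \<Psi>)
      show "AE z in lborel. norm (g z * s n z) \<le> norm (g z * complex_of_real (\<Psi> z))" for n
        using le \<Psi>0 by (auto simp: norm_mult intro!: mult_left_mono)
    qed (use lim h g in \<open>auto simp: L2c_def intro!: AE_I2 tendsto_intros\<close>)
    moreover have "(LINT z|lborel. f z * fourier (s n) z) = (LINT z|lborel. g z * s n z)" for n
      using s by (simp add: Q_def)
    ultimately have "(LINT z|lborel. f z * fourier h z) = (LINT z|lborel. g z * h z)"
      using LIMSEQ_unique by simp
    then show ?thesis using hi hL by (simp add: Q_def)
  qed
  have Q_add: "Q (\<lambda>z. a z + b z)" if "Q a" "Q b" for a b
  proof -
    have ab: "integrable lborel a" "L2c a" "integrable lborel b" "L2c b" using that by (auto simp: Q_def)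
    have "(LINT z|lborel. f z * fourier (\<lambda>z. a z + b z) z) = (LINT z|lborel. f z * fourier a z) + (LINT z|lborel. f z * fourier b z)"
      by (simp add: fourier_add ab distrib_left integrable_mult_L2 f L2c_fourier)
    moreover have "(LINT z|lborel. g z * (a z + b z)) = (LINT z|lborel. g z * a z) + (LINT z|lborel. g z * b z)"
      by (simp add: ab distrib_left integrable_mult_L2 g)
    ultimately show ?thesis using that ab by (simp add: Q_def L2c_add)
  qed
  have Q_cmult: "Q (\<lambda>z. c * a z)" if "Q a" for a c
  proof -
    have "(LINT z|lborel. f z * fourier (\<lambda>z. c * a z) z) = c * (LINT z|lborel. f z * fourier a z)"
      by (simp add: fourier_cmult mult.left_commute)
    moreover have "(LINT z|lborel. g z * (c * a z)) = c * (LINT z|lborel. g z * a z)"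
      by (simp add: mult.left_commute)
    ultimately show ?thesis using that by (simp add: Q_def L2c_cmult)
  qed
  have Q_ind: "Q (\<lambda>z. complex_of_real (indicator A z))" if A: "A \<in> sets borel" "bounded A" for A
  proof (rule test_fun_closure_indicator[of "\<lambda>\<phi>. Q (\<lambda>z. complex_of_real (\<phi> z))", OF _ _ _ _ A])
    fix \<phi> assume t: "test_fun \<phi>"
    obtain C R where CR: "\<And>z. \<bar>\<phi> z\<bar> \<le> C * indicator (cball 0 R) z" using test_fun_bounded[OF t] by metis
    have m: "(\<lambda>z. complex_of_real (\<phi> z)) \<in> borel_measurable borel"
      using test_fun_borel[OF t] by simp
    have "integrable lborel (\<lambda>z. complex_of_real (\<phi> z))"
      by (rule integrable_bounded_support[OF m, of C "cball 0 R"]) (use CR in auto)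
    moreover have "L2c (\<lambda>z. complex_of_real (\<phi> z))"
      by (rule L2c_bounded_support[OF m, of C "cball 0 R"]) (use CR in auto)
    ultimately show "Q (\<lambda>z. complex_of_real (\<phi> z))"
      using FT t by (simp add: Q_def is_FT_def)
  next
    fix a b :: "real \<times> real \<Rightarrow> real"
    assume ab: "Q (\<lambda>z. complex_of_real (a z))" "Q (\<lambda>z. complex_of_real (b z))"
    show "Q (\<lambda>z. complex_of_real (a z + b z))" using Q_add[OF ab] by simp
    show "Q (\<lambda>z. complex_of_real (a z - b z))" using Q_add[OF ab(1) Q_cmult[OF ab(2), of "-1"]] by simp
  next
    fix s :: "nat \<Rightarrow> real \<times> real \<Rightarrow> real" and h B
    assume s: "\<And>n. Q (\<lambda>z. complex_of_real (s n z))" "\<And>n. s n \<in> borel_measurable borel" "bounded B" "B \<in> sets borel"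
      "\<And>n z. \<bar>s n z\<bar> \<le> indicator B z" "\<And>z. (\<lambda>n. s n z) \<longlonglongrightarrow> h z"
    have [measurable]: "s n \<in> borel_measurable borel" for n by fact
    have h: "h \<in> borel_measurable borel" by (rule borel_measurable_LIMSEQ_real[OF s(6)]) auto
    show "Q (\<lambda>z. complex_of_real (h z))"
    proof (rule Q_lim[OF s(1), where \<Psi>="indicator B"])
      show "integrable lborel (indicator B :: _ \<Rightarrow> real)"
        by (rule integrable_bounded_support[of _ 1 B]) (use s in auto)
      show "L2c (\<lambda>z. complex_of_real (indicator B z))"
        by (rule L2c_bounded_support[of _ 1 B]) (use s in auto)
    qed (use s h in \<open>auto intro!: tendsto_of_real\<close>)
  qed
  \<comment> \<open>The simple approximations are dominated by twice the function, which gives the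
    majorant for the last limit.\<close>
  obtain F where F: "\<And>i. simple_function lborel (F i)" "\<And>z. (\<lambda>i. F i z) \<longlonglongrightarrow> \<phi> z"
      "\<And>i z. norm (F i z) \<le> 2 * norm (\<phi> z)"
    using borel_measurable_implies_sequence_metric[of \<phi> lborel 0] \<phi>(1) by (auto simp: dist_norm)
  \<comment> \<open>Truncation to a ball makes the level sets bounded; a simple function has only
    finitely many of them.\<close>
  have QF: "Q (\<lambda>z. complex_of_real (indicator (cball 0 (real i)) z) * F i z)" for i
  proof -
    have fin: "finite (range (F i))" using F(1)[of i] by (simp add: simple_function_def)
    have m: "F i -` {y} \<in> sets borel" for y
    proof (cases "y \<in> range (F i)")
      case True
      then show ?thesis using F(1)[of i] by (auto simp: simple_function_def)
    next
      case False
      then have "F i -` {y} = {}" by auto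
      then show ?thesis by simp
    qed
    have "Q (\<lambda>z. \<Sum>y\<in>Y. y * complex_of_real (indicator (F i -` {y} \<inter> cball 0 (real i)) z))" if "finite Y" for Y
      using that
    proof induction
      case empty
      show ?case using L2c_zero by (simp add: Q_def fourier_eq)
    next
      case (insert y Y)
      have "Q (\<lambda>z. complex_of_real (indicator (F i -` {y} \<inter> cball 0 (real i)) z))"
        by (rule Q_ind) (use m in \<open>auto intro: bounded_subset[OF bounded_cball[of 0 "real i"]]\<close>)
      from Q_add[OF Q_cmult[OF this, of y] insert.IH] show ?case using insert.hyps by simp
    qed
    from this[OF fin] show ?thesis
    proof (rule arg_cong[where f=Q, THEN iffD1, rotated], intro ext)
      fix z
      have "(\<Sum>y\<in>range (F i). y * complex_of_real (indicator (F i -` {y} \<inter> cball 0 (real i)) z))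
         = (\<Sum>y\<in>range (F i). if y = F i z then y * complex_of_real (indicator (cball 0 (real i)) z) else 0)"
        by (rule sum.cong) (auto simp: indicator_def)
      also have "\<dots> = complex_of_real (indicator (cball 0 (real i)) z) * F i z"
        using fin by (simp add: sum.delta)
      finally show "(\<Sum>y\<in>range (F i). y * complex_of_real (indicator (F i -` {y} \<inter> cball 0 (real i)) z))
        = complex_of_real (indicator (cball 0 (real i)) z) * F i z" .
    qed
  qed
  have "Q \<phi>"
  proof (rule Q_lim[OF QF, where \<Psi>="\<lambda>z. 2 * norm (\<phi> z)"])
    show "\<phi> \<in> borel_measurable borel" using \<phi>(1) by auto
    show "integrable lborel (\<lambda>z. 2 * norm (\<phi> z))" using \<phi>(1) by simp
    show "L2c (\<lambda>z. complex_of_real (2 * norm (\<phi> z)))" using \<phi>(2) by (auto simp: L2c_def power_mult_distrib)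
    show "norm (complex_of_real (indicator (cball 0 (real i)) z) * F i z) \<le> 2 * norm (\<phi> z)" for i z
      using F(3)[of i z] by (auto simp: indicator_def)
    show "(\<lambda>i. complex_of_real (indicator (cball 0 (real i)) z) * F i z) \<longlonglongrightarrow> \<phi> z" for z
    proof (rule Lim_transform_eventually[OF F(2)])
      obtain N where N: "norm z \<le> real N" using real_arch_simple by auto
      show "\<forall>\<^sub>F i in sequentially. F i z = complex_of_real (indicator (cball 0 (real i)) z) * F i z"
        using eventually_ge_at_top[of N] by eventually_elim (use N in \<open>auto simp: indicator_def\<close>)
    qed
  qed
  then show ?thesis by (simp add: Q_def)
qed

lemma borel_complex_of_real:
  "h \<in> borel_measurable M \<Longrightarrow> (\<lambda>z. complex_of_real (h z)) \<in> borel_measurable M"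
  by simp

lemma integrable_indicator_mult:
  fixes f :: "'a \<Rightarrow> real"
  assumes "A \<in> sets M" "integrable M f"
  shows "integrable M (\<lambda>z. indicator A z * f z)"
  using integrable_real_mult_indicator[OF assms] by (simp add: mult.commute)

lemma is_FT_L2c: "is_FT f g \<Longrightarrow> L2c f" "is_FT f g \<Longrightarrow> L2c g"
  by (auto simp: is_FT_def)

text \<open>Packages the properties of a test function that the later proofs rely on, so that
  \<open>test_fun\<close> need not be unfolded again.\<close>

lemma is_FT_I:
  assumes "L2c f" "L2c g"
    "\<And>\<phi>. integrable lborel \<phi> \<Longrightarrow> L2c \<phi> \<Longrightarrow> continuous_on UNIV \<phi> \<Longrightarrow> (\<exists>R. \<forall>z. norm z > R \<longrightarrow> \<phi> z = 0) \<Longrightarrow>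
      (LINT z|lborel. f z * fourier \<phi> z) = (LINT z|lborel. g z * \<phi> z)"
  shows "is_FT f g"
  unfolding is_FT_def
proof (intro conjI allI impI assms)
  fix \<phi> assume t: "test_fun \<phi>"
  obtain C R where CR: "\<And>z. \<bar>\<phi> z\<bar> \<le> C * indicator (cball 0 R) z" using test_fun_bounded[OF t] by metis
  have m: "(\<lambda>z. complex_of_real (\<phi> z)) \<in> borel_measurable borel"
    using test_fun_borel[OF t] by simp
  show "integrable lborel (\<lambda>z. complex_of_real (\<phi> z))"
    by (rule integrable_bounded_support[OF m, of C "cball 0 R"]) (use CR in auto)
  show "L2c (\<lambda>z. complex_of_real (\<phi> z))"
    by (rule L2c_bounded_support[OF m, of C "cball 0 R"]) (use CR in auto)
  show "continuous_on UNIV (\<lambda>z. complex_of_real (\<phi> z))"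
    using test_fun_continuous[OF t] by (intro continuous_intros)
  obtain R where "\<And>z. norm z > R \<Longrightarrow> \<phi> z = 0" by (metis test_fun_support[OF t])
  then show "\<exists>R. \<forall>z. norm z > R \<longrightarrow> complex_of_real (\<phi> z) = 0" by auto
qed

lemma is_FT_cong_AE:
  assumes "is_FT f g" "AE z in lborel. f z = f' z" "AE z in lborel. g z = g' z"
    and m: "f' \<in> borel_measurable borel" "g' \<in> borel_measurable borel"
  shows "is_FT f' g'"
proof (rule is_FT_I)
  have fg: "L2c f" "L2c g" using assms(1) is_FT_L2c by auto
  note [measurable] = m fg[THEN L2c_borel]
  show "L2c f'" by (rule L2c_bound[OF fg(1) fg(1) m(1), where A=1 and B=0]) (use assms(2) in auto)
  show "L2c g'" by (rule L2c_bound[OF fg(2) fg(2) m(2), where A=1 and B=0]) (use assms(3) in auto)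
  fix \<phi> :: "real \<times> real \<Rightarrow> complex" assume \<phi>: "integrable lborel \<phi>" "L2c \<phi>"
  have "(LINT z|lborel. f' z * fourier \<phi> z) = (LINT z|lborel. f z * fourier \<phi> z)"
    by (rule integral_cong_AE) (use assms(2) \<phi> in auto)
  also have "\<dots> = (LINT z|lborel. g z * \<phi> z)" by (rule is_FT_pairing[OF assms(1) \<phi>])
  also have "\<dots> = (LINT z|lborel. g' z * \<phi> z)"
    by (rule integral_cong_AE) (use assms(3) \<phi> in auto)
  finally show "(LINT z|lborel. f' z * fourier \<phi> z) = (LINT z|lborel. g' z * \<phi> z)" .
qed

lemma is_FT_add:
  assumes "is_FT f g" "is_FT f' g'"
  shows "is_FT (\<lambda>z. f z + f' z) (\<lambda>z. g z + g' z)"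
proof (rule is_FT_I)
  note L = is_FT_L2c[OF assms(1)] is_FT_L2c[OF assms(2)]
  show "L2c (\<lambda>z. f z + f' z)" "L2c (\<lambda>z. g z + g' z)" using L L2c_add by auto
  fix \<phi> :: "real \<times> real \<Rightarrow> complex" assume \<phi>: "integrable lborel \<phi>" "L2c \<phi>"
  show "(LINT z|lborel. (f z + f' z) * fourier \<phi> z) = (LINT z|lborel. (g z + g' z) * \<phi> z)"
    using is_FT_pairing[OF assms(1) \<phi>] is_FT_pairing[OF assms(2) \<phi>]
    by (simp add: distrib_right integrable_mult_L2 L \<phi> L2c_fourier)
qed

lemma is_FT_cmult:
  assumes "is_FT f g"
  shows "is_FT (\<lambda>z. c * f z) (\<lambda>z. c * g z)"
proof (rule is_FT_I)
  note L = is_FT_L2c[OF assms(1)]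
  show "L2c (\<lambda>z. c * f z)" "L2c (\<lambda>z. c * g z)" using L L2c_cmult by auto
  fix \<phi> :: "real \<times> real \<Rightarrow> complex" assume \<phi>: "integrable lborel \<phi>" "L2c \<phi>"
  show "(LINT z|lborel. (c * f z) * fourier \<phi> z) = (LINT z|lborel. (c * g z) * \<phi> z)"
    using is_FT_pairing[OF assms(1) \<phi>] by (simp add: mult.assoc)
qed

lemma is_FT_diff:
  assumes "is_FT f g" "is_FT f' g'"
  shows "is_FT (\<lambda>z. f z - f' z) (\<lambda>z. g z - g' z)"
  using is_FT_add[OF assms(1) is_FT_cmult[OF assms(2), of "-1"]] by simp

lemma is_FT_zero: "is_FT (\<lambda>_. 0) (\<lambda>_. 0)"
  by (rule is_FT_I) (auto simp: L2c_zero)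

text \<open>The difference pairs to 0 with all of L^1 intersected with L^2, hence with its own
  conjugate cut off to a ball.\<close>

lemma is_FT_unique:
  assumes "is_FT f g" "is_FT f g'"
  shows "AE z in lborel. g z = g' z"
proof -
  have d: "is_FT (\<lambda>z. 0) (\<lambda>z. g z - g' z)" using is_FT_diff[OF assms] by simp
  let ?h = "\<lambda>z. g z - g' z"
  have L: "L2c ?h" using is_FT_L2c[OF d] by simp
  have [measurable]: "?h \<in> borel_measurable borel" using L by (simp add: L2c_def)
  have "AE z in lborel. indicator (cball 0 (real n)) z * (norm (?h z))\<^sup>2 = 0" for n
  proof -
    \<comment> \<open>Not a smooth function: it is admissible only because the duality has been
      extended by \<open>is_FT_pairing\<close>.\<close>
    let ?\<phi> = "\<lambda>z. of_real (indicator (cball 0 (real n)) z) * cnj (?h z)"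
    have m: "?\<phi> \<in> borel_measurable borel"
      using L2c_borel[OF L2c_cnj[OF L]] by (intro borel_measurable_times borel_complex_of_real borel_measurable_indicator) auto
    have \<phi>2: "L2c ?\<phi>" by (rule L2c_mult_bounded[OF L2c_cnj[OF L], where B=1]) (auto simp: indicator_def)
    have "integrable lborel (\<lambda>z. indicator (cball 0 (real n)) z * norm (?h z))"
      by (rule integrable_norm_L2_bounded_set[OF L]) auto
    then have \<phi>1: "integrable lborel ?\<phi>"
      by (rule Bochner_Integration.integrable_bound[OF _ _ AE_I2]) (use m in \<open>auto simp: norm_mult simp del: complex_cnj_diff\<close>)
    have "(LINT z|lborel. ?h z * ?\<phi> z) = 0"
      using is_FT_pairing[OF d \<phi>1 \<phi>2] by simp
    moreover have "?h z * ?\<phi> z = complex_of_real (indicator (cball 0 (real n)) z * (norm (?h z))\<^sup>2)" for z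
      using complex_norm_square[of "?h z"] by (simp add: mult_ac del: complex_cnj_diff)
    ultimately have 0: "(LINT z|lborel. indicator (cball 0 (real n)) z * (norm (?h z))\<^sup>2) = 0"
      by (simp del: of_real_mult of_real_power complex_cnj_diff)
    have "integrable lborel (\<lambda>z. indicator (cball 0 (real n)) z * (norm (?h z))\<^sup>2)"
      using L unfolding L2c_def by (intro integrable_indicator_mult) auto
    with 0 show ?thesis by (subst integral_nonneg_eq_0_iff_AE[symmetric]) auto
  qed
  then have "AE z in lborel. \<forall>n. indicator (cball 0 (real n)) z * (norm (?h z))\<^sup>2 = 0"
    unfolding AE_all_countable by blast
  then show ?thesis
  proof eventually_elim
    case (elim z)
    obtain n where "norm z \<le> real n" using real_arch_simple by auto
    with elim[rule_format, of n] show ?case by (simp add: indicator_def)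
  qed
qed

lemma is_FT_L1:
  assumes f: "integrable lborel f" "L2c f"
  shows "is_FT f (fourier f)"
proof (rule is_FT_I)
  fix \<phi> :: "real \<times> real \<Rightarrow> complex" assume \<phi>: "integrable lborel \<phi>" "L2c \<phi>"
  show "(LINT z|lborel. f z * fourier \<phi> z) = (LINT z|lborel. fourier f z * \<phi> z)"
    by (rule fourier_multiplication_formula[OF f(1) \<phi>(1), symmetric])
qed (use f L2c_fourier in auto)

text \<open>The duality for the conjugated and reflected test function, conjugated as a whole. It
  leads to the Hermitian symmetry of the transforms of real functions.\<close>

lemma is_FT_cnj:
  assumes FT: "is_FT f g"
  shows "is_FT (\<lambda>z. cnj (f z)) (\<lambda>\<zeta>. cnj (g (- \<zeta>)))"
proof (rule is_FT_I)
  note L = is_FT_L2c[OF FT]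
  note [measurable] = L[THEN L2c_borel]
  show "L2c (\<lambda>z. cnj (f z))" by (rule L2c_cnj[OF L(1)])
  have "integrable lborel (\<lambda>z. (norm (g (- z)))\<^sup>2)"
    by (rule integrable_uminus2[of "\<lambda>z. (norm (g z))\<^sup>2"]) (use L in \<open>simp add: L2c_def\<close>)
  then show "L2c (\<lambda>\<zeta>. cnj (g (- \<zeta>)))" by (simp add: L2c_def)
  fix \<phi> :: "real \<times> real \<Rightarrow> complex" assume \<phi>: "integrable lborel \<phi>" "L2c \<phi>"
  note [measurable] = \<phi>(2)[THEN L2c_borel]
  let ?\<psi> = "\<lambda>z. cnj (\<phi> (- z))"
  have \<psi>1: "integrable lborel ?\<psi>" using integrable_uminus2[OF \<phi>(1)] by simp
  have "integrable lborel (\<lambda>z. (norm (\<phi> (- z)))\<^sup>2)"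
    by (rule integrable_uminus2[of "\<lambda>z. (norm (\<phi> z))\<^sup>2"]) (use \<phi> in \<open>simp add: L2c_def\<close>)
  then have \<psi>2: "L2c ?\<psi>" by (simp add: L2c_def)
  have "fourier \<phi> z = cnj (fourier ?\<psi> z)" for z
    using ifourier_alt[of "\<lambda>z. \<phi> (- z)" z] by (simp add: cnj_fourier)
  then have "(LINT z|lborel. cnj (f z) * fourier \<phi> z) = (LINT z|lborel. cnj (f z * fourier ?\<psi> z))"
    by simp
  also have "\<dots> = cnj (LINT z|lborel. f z * fourier ?\<psi> z)"
    by (rule Bochner_Integration.integral_cnj)
  also have "\<dots> = cnj (LINT z|lborel. g z * ?\<psi> z)"
    by (simp only: is_FT_pairing[OF FT \<psi>1 \<psi>2])
  also have "\<dots> = (LINT z|lborel. cnj (g z * ?\<psi> z))"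
    by (rule Bochner_Integration.integral_cnj[symmetric])
  also have "\<dots> = (LINT z|lborel. cnj (g (- z)) * \<phi> z)"
    using lborel_integral_uminus2[of "\<lambda>z. cnj (g z * ?\<psi> z)"] by simp
  finally show "(LINT z|lborel. cnj (f z) * fourier \<phi> z) = (LINT z|lborel. cnj (g (- z)) * \<phi> z)" .
qed

lemma gwt_tendsto_1: "(\<lambda>n. gwt (1 / real (Suc n)) \<zeta>) \<longlonglongrightarrow> 1"
proof -
  have "(\<lambda>n. complex_of_real (exp (- (1 / real (Suc n) * norm \<zeta>)\<^sup>2 / 2))) \<longlonglongrightarrow> complex_of_real (exp (- (0 * norm \<zeta>)\<^sup>2 / 2))"
    by (intro tendsto_intros LIMSEQ_Suc[OF lim_1_over_n]) simp
  then show ?thesis by (simp add: gwt_def)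
qed

lemma tendsto_integral_gwt:
  assumes h: "integrable lborel (h :: _ \<Rightarrow> complex)"
  shows "(\<lambda>n. LINT z|lborel. gwt (1 / real (Suc n)) z * h z) \<longlonglongrightarrow> (LINT z|lborel. h z)"
proof (rule integral_dominated_convergence)
  show "integrable lborel (\<lambda>z. norm (h z))" using h by simp
  show "AE z in lborel. norm (gwt (1 / real (Suc n)) z * h z) \<le> norm (h z)" for n
    using norm_gwt_le by (auto simp: norm_mult intro!: AE_I2 mult_left_le_one_le)
  show "AE z in lborel. (\<lambda>n. gwt (1 / real (Suc n)) z * h z) \<longlonglongrightarrow> h z"
    using tendsto_mult[OF gwt_tendsto_1 tendsto_const] by auto
qed (use h in auto)

text \<open>The sign of \<open>c\<close> is left free because the two applications shift in opposite
  directions, with c = 1 and c = -1.\<close>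

lemma approximate_identity_seq:
  assumes f: "L2c f" and \<psi>: "continuous_on UNIV \<psi>" "L2c \<psi>" "\<exists>R. \<forall>z. norm z > R \<longrightarrow> \<psi> z = 0" and c: "\<bar>c\<bar> \<le> 1"
  shows "(\<lambda>n. LINT w|lborel. of_real (gauss2 w) * (LINT x|lborel. f x * \<psi> (x + (c / real (Suc n)) *\<^sub>R w)))
      \<longlonglongrightarrow> (LINT x|lborel. f x * \<psi> x)"
proof -
  obtain R where R: "\<And>z. norm z > R \<Longrightarrow> \<psi> z = 0" using \<psi>(3) by blast
  obtain C where C: "\<And>z. norm (\<psi> z) \<le> C * indicator (cball 0 R) z" "C \<ge> 0"
    using continuous_compact_support_bounded[OF \<psi>(1) R] by metis
  show ?thesis
  proof (rule gauss_approximate_identity[OF f \<psi>(1) R \<psi>(2), where C=C])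
    have "(\<lambda>n. c * (1 / real (Suc n))) \<longlonglongrightarrow> c * 0"
      by (intro tendsto_intros LIMSEQ_Suc[OF lim_1_over_n])
    then show "(\<lambda>n. c / real (Suc n)) \<longlonglongrightarrow> 0" by simp
    show "norm (\<psi> z) \<le> C" for z using C(1)[of z] C(2) by (cases "z \<in> cball 0 R") auto
    show "\<bar>c / real (Suc n)\<bar> \<le> 1" for n using c by (simp add: abs_divide divide_le_eq)
  qed
qed

text \<open>The duality read backwards, with the inverse transform on the test side. The damped
  \<open>ifourier \<psi>\<close> is an admissible test function whose transform is a Gaussian
  average of \<open>\<psi>\<close>; the scale then tends to 0. This form carries the solution to the
  frequency side.\<close>

lemma is_FT_dual:
  assumes FT: "is_FT f g" and \<psi>: "integrable lborel \<psi>" "continuous_on UNIV \<psi>" "L2c \<psi>" "\<exists>R. \<forall>z. norm z > R \<longrightarrow> \<psi> z = 0"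
  shows "(LINT z|lborel. f z * \<psi> z) = (LINT z|lborel. g z * ifourier \<psi> z)"
proof (rule LIMSEQ_unique)
  note L = is_FT_L2c[OF FT]
  let ?s = "\<lambda>n. 1 / real (Suc n)"
  let ?\<phi> = "\<lambda>n z. gwt (?s n) z * ifourier \<psi> z"
  have i: "L2c (ifourier \<psi>)" by (rule L2c_ifourier[OF \<psi>(1,3)])
  have \<phi>2: "L2c (?\<phi> n)" for n by (rule L2c_mult_bounded[OF i _ norm_gwt_le]) simp
  have \<phi>1: "integrable lborel (?\<phi> n)" for n
  proof -
    have "?s n \<noteq> 0" by simp
    from integrable_mult_bounded[OF integrable_gwt[OF this] _ norm_ifourier_le, of \<psi>] \<psi>(1)
    show ?thesis by (simp add: mult.commute)
  qed
  have eq: "(LINT w|lborel. of_real (gauss2 w) * (LINT x|lborel. f x * \<psi> (x + (1 / real (Suc n)) *\<^sub>R w)))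
     = (LINT z|lborel. gwt (?s n) z * (g z * ifourier \<psi> z))" for n
  proof -
    have "(LINT z|lborel. gwt (?s n) z * (g z * ifourier \<psi> z)) = (LINT z|lborel. g z * ?\<phi> n z)"
      by (simp add: mult.left_commute)
    also have "\<dots> = (LINT z|lborel. f z * fourier (?\<phi> n) z)"
      by (rule is_FT_pairing[OF FT \<phi>1 \<phi>2, symmetric])
    also have "\<dots> = (LINT x|lborel. f x * (LINT w|lborel. of_real (gauss2 w) * \<psi> (x + ?s n *\<^sub>R w)))"
      by (subst fourier_gwt_ifourier[OF \<psi>(1)]) auto
    also have "\<dots> = (LINT w|lborel. of_real (gauss2 w) * (LINT x|lborel. f x * \<psi> (x + ?s n *\<^sub>R w)))"
      by (rule Fubini_gauss_correlation[OF L(1) \<psi>(3)])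
    finally show ?thesis by simp
  qed
  show "(\<lambda>n. LINT w|lborel. of_real (gauss2 w) * (LINT x|lborel. f x * \<psi> (x + (1 / real (Suc n)) *\<^sub>R w)))
      \<longlonglongrightarrow> (LINT x|lborel. f x * \<psi> x)"
    by (rule approximate_identity_seq[OF L(1) \<psi>(2,3,4)]) simp
  show "(\<lambda>n. LINT w|lborel. of_real (gauss2 w) * (LINT x|lborel. f x * \<psi> (x + (1 / real (Suc n)) *\<^sub>R w)))
      \<longlonglongrightarrow> (LINT z|lborel. g z * ifourier \<psi> z)"
    unfolding eq by (rule tendsto_integral_gwt[OF integrable_mult_L2[OF L(2) i]])
qed

text \<open>The same damping argument for functions in L^1 and L^2, showing that the explicit
  inverse integral satisfies the definition by duality.\<close>

lemma is_FT_ifourier: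
  assumes g: "integrable lborel g" "L2c g"
  shows "is_FT (ifourier g) g"
proof (rule is_FT_I)
  have i: "L2c (ifourier g)" by (rule L2c_ifourier[OF g])
  then show "L2c (ifourier g)" "L2c g" using g by auto
  fix \<phi> :: "real \<times> real \<Rightarrow> complex"
  assume \<phi>: "integrable lborel \<phi>" "L2c \<phi>" "continuous_on UNIV \<phi>" "\<exists>R. \<forall>z. norm z > R \<longrightarrow> \<phi> z = 0"
  let ?s = "\<lambda>n. 1 / real (Suc n)"
  have eq: "(LINT z|lborel. gwt (?s n) z * (ifourier g z * fourier \<phi> z))
     = (LINT w|lborel. of_real (gauss2 w) * (LINT y|lborel. g y * \<phi> (y + (- 1 / real (Suc n)) *\<^sub>R w)))" for n
  proof -
    have "(LINT z|lborel. gwt (?s n) z * (ifourier g z * fourier \<phi> z))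
        = (LINT z|lborel. fourier \<phi> z * (gwt (?s n) z * ifourier g z))"
      by (simp add: mult_ac)
    also have "\<dots> = (LINT x|lborel. \<phi> x * (LINT w|lborel. of_real (gauss2 w) * g (x + ?s n *\<^sub>R w)))"
      by (rule fourier_ifourier_gwt_pairing[OF \<phi>(1) g(1)]) simp
    also have "\<dots> = (LINT w|lborel. of_real (gauss2 w) * (LINT x|lborel. \<phi> x * g (x + ?s n *\<^sub>R w)))"
      by (rule Fubini_gauss_correlation[OF \<phi>(2) g(2)])
    \<comment> \<open>A translation moves the shift from \<open>g\<close> to \<open>\<phi>\<close>:
      only \<open>\<phi>\<close> is continuous with bounded support, as the approximate identity
      requires.\<close>
    also have "\<dots> = (LINT w|lborel. of_real (gauss2 w) * (LINT y|lborel. g y * \<phi> (y + (- 1 / real (Suc n)) *\<^sub>R w)))"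
    proof (rule Bochner_Integration.integral_cong[OF refl])
      fix w :: "real \<times> real"
      have [measurable]: "g \<in> borel_measurable borel" "\<phi> \<in> borel_measurable borel"
        using g \<phi> by auto
      have "(LINT x|lborel. \<phi> x * g (x + ?s n *\<^sub>R w))
          = (LINT y|lborel. \<phi> (y + - (?s n *\<^sub>R w)) * g (y + - (?s n *\<^sub>R w) + ?s n *\<^sub>R w))"
        by (rule integral_translate2[symmetric]) measurable
      then show "of_real (gauss2 w) * (LINT x|lborel. \<phi> x * g (x + ?s n *\<^sub>R w))
         = of_real (gauss2 w) * (LINT y|lborel. g y * \<phi> (y + (- 1 / real (Suc n)) *\<^sub>R w))"
        by (simp add: mult.commute)
    qed
    finally show ?thesis .
  qed
  show "(LINT z|lborel. ifourier g z * fourier \<phi> z) = (LINT z|lborel. g z * \<phi> z)"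
  proof (rule LIMSEQ_unique)
    show "(\<lambda>n. LINT z|lborel. gwt (?s n) z * (ifourier g z * fourier \<phi> z)) \<longlonglongrightarrow> (LINT z|lborel. ifourier g z * fourier \<phi> z)"
      by (intro tendsto_integral_gwt integrable_mult_L2 i L2c_fourier \<phi>)
    show "(\<lambda>n. LINT z|lborel. gwt (?s n) z * (ifourier g z * fourier \<phi> z)) \<longlonglongrightarrow> (LINT z|lborel. g z * \<phi> z)"
      unfolding eq by (rule approximate_identity_seq[OF g(2) \<phi>(3,2,4)]) simp
  qed
qed

text \<open>\<open>f\<close> and \<open>ifourier g\<close> have the same integral against every test
  function, by \<open>is_FT_dual\<close> and the multiplication formula; the fundamental lemma is
  then applied to real and imaginary parts.\<close>

lemma is_FT_inversion:
  assumes FT: "is_FT f g" and g: "integrable lborel g"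
  shows "AE z in lborel. f z = ifourier g z"
proof -
  note L = is_FT_L2c[OF FT]
  note [measurable] = L[THEN L2c_borel]
  have [measurable]: "ifourier g \<in> borel_measurable borel" using g by simp
  let ?h = "\<lambda>z. f z - ifourier g z"
  have loc: "set_integrable lborel K ?h" if K: "compact K" for K
  proof -
    have Kb: "K \<in> sets borel" "bounded K" using K by (auto intro: borel_compact compact_imp_bounded)
    have "integrable lborel (\<lambda>z. indicator K z * norm (f z) + (LINT z|lborel. norm (g z)) / (2 * pi) * indicator K z)"
      using Kb by (intro Bochner_Integration.integrable_add integrable_norm_L2_bounded_set[OF L(1)] integrable_mult_right integrable_real_indicator)
        (use emeasure_bounded_finite[OF Kb(2)] in auto)
    then show ?thesis unfolding set_integrable_def
    proof (rule Bochner_Integration.integrable_bound)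
      show "AE z in lborel. norm (indicator K z *\<^sub>R ?h z) \<le> norm (indicator K z * norm (f z) + (LINT z|lborel. norm (g z)) / (2 * pi) * indicator K z)"
      proof (rule AE_I2)
        fix z
        have "norm (?h z) \<le> norm (f z) + (LINT z|lborel. norm (g z)) / (2 * pi)"
          using norm_triangle_ineq4[of "f z" "ifourier g z"] norm_ifourier_le[of g z] by linarith
        then show "norm (indicator K z *\<^sub>R ?h z) \<le> norm (indicator K z * norm (f z) + (LINT z|lborel. norm (g z)) / (2 * pi) * indicator K z)"
          by (auto simp: indicator_def)
      qed
    qed (use Kb in measurable)
  qed
  have 0: "(LINT z|lborel. ?h z * complex_of_real (\<phi> z)) = 0 \<and> integrable lborel (\<lambda>z. ?h z * complex_of_real (\<phi> z))" if t: "test_fun \<phi>" for \<phi>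
  proof -
    obtain C R where CR: "\<And>z. \<bar>\<phi> z\<bar> \<le> C * indicator (cball 0 R) z" using test_fun_bounded[OF t] by metis
    have m[measurable]: "(\<lambda>z. complex_of_real (\<phi> z)) \<in> borel_measurable borel"
      using test_fun_borel[OF t] by simp
    have \<phi>1: "integrable lborel (\<lambda>z. complex_of_real (\<phi> z))"
      by (rule integrable_bounded_support[OF m, of C "cball 0 R"]) (use CR in auto)
    have \<phi>2: "L2c (\<lambda>z. complex_of_real (\<phi> z))"
      by (rule L2c_bounded_support[OF m, of C "cball 0 R"]) (use CR in auto)
    have \<phi>3: "continuous_on UNIV (\<lambda>z. complex_of_real (\<phi> z))"
      using test_fun_continuous[OF t] by (intro continuous_intros)
    obtain R' where R': "\<And>z. norm z > R' \<Longrightarrow> \<phi> z = 0" by (metis test_fun_support[OF t])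
    have i1: "integrable lborel (\<lambda>z. f z * complex_of_real (\<phi> z))" by (rule integrable_mult_L2[OF L(1) \<phi>2])
    have i2: "integrable lborel (\<lambda>z. ifourier g z * complex_of_real (\<phi> z))"
      by (rule integrable_mult_bounded[OF \<phi>1 _ norm_ifourier_le]) simp
    have "(LINT z|lborel. f z * complex_of_real (\<phi> z)) = (LINT z|lborel. g z * ifourier (\<lambda>z. complex_of_real (\<phi> z)) z)"
      by (rule is_FT_dual[OF FT \<phi>1 \<phi>3 \<phi>2]) (use R' in auto)
    also have "\<dots> = (LINT z|lborel. ifourier g z * complex_of_real (\<phi> z))"
      by (rule ifourier_multiplication_formula[OF g \<phi>1, symmetric])
    finally show ?thesis using i1 i2 by (simp add: left_diff_distrib)
  qed
  have "AE z in lborel. Re (?h z) = 0"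
  proof (rule du_Bois_Reymond)
    show "set_integrable lborel K (\<lambda>z. Re (?h z))" if "compact K" for K
      using integrable_Re[OF loc[OF that, unfolded set_integrable_def]] unfolding set_integrable_def by simp
    show "(LINT z|lborel. Re (?h z) * \<phi> z) = 0" if "test_fun \<phi>" for \<phi>
      using integral_Re[of lborel "\<lambda>z. ?h z * complex_of_real (\<phi> z)"] 0[OF that] by simp
  qed measurable
  moreover have "AE z in lborel. Im (?h z) = 0"
  proof (rule du_Bois_Reymond)
    show "set_integrable lborel K (\<lambda>z. Im (?h z))" if "compact K" for K
      using integrable_Im[OF loc[OF that, unfolded set_integrable_def]] unfolding set_integrable_def by simp
    show "(LINT z|lborel. Im (?h z) * \<phi> z) = 0" if "test_fun \<phi>" for \<phi>
      using integral_Im[of lborel "\<lambda>z. ?h z * complex_of_real (\<phi> z)"] 0[OF that] by simp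
  qed measurable
  ultimately show ?thesis by eventually_elim (simp add: complex_eq_iff)
qed

section \<open>Surjectivity of the transform on L^2\<close>

lemma is_FT_sum:
  assumes "finite I" "\<And>i. i \<in> I \<Longrightarrow> is_FT (f i) (g i)"
  shows "is_FT (\<lambda>z. \<Sum>i\<in>I. f i z) (\<lambda>z. \<Sum>i\<in>I. g i z)"
  using assms by (induction I rule: finite_induct) (auto intro: is_FT_add is_FT_zero)

lemma tendsto_of_norm_square_le:
  fixes x :: "nat \<Rightarrow> 'a::real_normed_vector"
  assumes "\<And>n. (norm (x n - l))\<^sup>2 \<le> b n" "b \<longlonglongrightarrow> 0"
  shows "x \<longlonglongrightarrow> l"
proof -
  have "(\<lambda>n. (norm (x n - l))\<^sup>2) \<longlonglongrightarrow> 0"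
    by (rule Lim_null_comparison[OF always_eventually assms(2)]) (use assms(1) in auto)
  from tendsto_real_sqrt[OF this] show ?thesis
    by (simp add: tendsto_norm_zero_iff LIM_zero_iff)
qed

lemma Bessel_ifourier_real:
  assumes "integrable lborel f" "L2c f"
  shows "(LINT z|lborel. (norm (ifourier f z))\<^sup>2) \<le> (LINT z|lborel. (norm (f z))\<^sup>2)"
  using Bessel_ifourier[OF assms(1)] L2c_ifourier[OF assms] assms(2) unfolding L2c_def
  by (simp add: nn_integral_eq_integral integral_nonneg_AE)

lemma L2c_tail_tendsto_0:
  assumes G: "L2c G"
  shows "(\<lambda>n. LINT z|lborel. indicator {z. norm z > real n} z * (norm (G z))\<^sup>2) \<longlonglongrightarrow> 0"
proof -
  have [measurable]: "G \<in> borel_measurable borel" using G by (rule L2c_borel)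
  have "(\<lambda>n. LINT z|lborel. indicator {z. norm z > real n} z * (norm (G z))\<^sup>2)
     \<longlonglongrightarrow> (LINT z|(lborel :: (real \<times> real) measure). (0::real))"
  proof (rule integral_dominated_convergence)
    show "integrable lborel (\<lambda>z. (norm (G z))\<^sup>2)" using G by (simp add: L2c_def)
    show "AE z in lborel. (\<lambda>n. indicator {z. norm z > real n} z * (norm (G z))\<^sup>2) \<longlonglongrightarrow> 0"
    proof (intro AE_I2 tendsto_eventually)
      fix z :: "real \<times> real"
      obtain N where N: "norm z \<le> real N" using real_arch_simple by auto
      show "\<forall>\<^sub>F n in sequentially. indicator {z. norm z > real n} z * (norm (G z))\<^sup>2 = 0"
        using eventually_ge_at_top[of N] by eventually_elim (use N in \<open>auto simp: indicator_def\<close>)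
    qed
  qed (auto simp: indicator_def)
  then show ?thesis by simp
qed

text \<open>Cauchy-Schwarz with the weights (1/2)^k, whose sum is the constant 2. A weighted square
  bound is thus turned into absolute convergence, with control of the square of the sum.\<close>

lemma summable_of_weighted_squares:
  fixes a :: "nat \<Rightarrow> real"
  assumes a: "\<And>k. 0 \<le> a k" and S: "summable (\<lambda>k. 2 ^ k * (a k)\<^sup>2)"
  shows "summable a" "(\<Sum>k. a k)\<^sup>2 \<le> 2 * (\<Sum>k. 2 ^ k * (a k)\<^sup>2)"
proof -
  have le: "a k \<le> (1 / 2) ^ k + 2 ^ k * (a k)\<^sup>2" for k
  proof -
    have "2 * ((1 / 2) ^ k * (2 ^ k * a k)) \<le> ((1 / 2) ^ k) * (1 + (2 ^ k * a k)\<^sup>2)"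
      using sum_squares_bound[of 1 "2 ^ k * a k"] by (simp add: mult_left_mono)
    moreover have "(1 / 2) ^ k * (2 ^ k * a k) = a k" by (simp add: power_one_over)
    moreover have "((1 / 2) ^ k) * (1 + (2 ^ k * a k)\<^sup>2) = (1 / 2) ^ k + 2 ^ k * (a k)\<^sup>2"
      by (simp add: power_one_over power2_eq_square field_simps)
    ultimately show ?thesis using a[of k] by linarith
  qed
  show sa: "summable a"
    by (rule summable_comparison_test'[OF summable_add[OF _ S], of "\<lambda>k. (1 / 2) ^ k" 0])
       (use le a in auto)
  have part: "(\<Sum>k<n. a k)\<^sup>2 \<le> 2 * (\<Sum>k. 2 ^ k * (a k)\<^sup>2)" for n
  proof -
    let ?b = "\<lambda>k. sqrt ((1 / 2) ^ k)" and ?c = "\<lambda>k. sqrt (2 ^ k) * a k"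
    have "(\<Sum>k<n. a k) = (\<Sum>k<n. ?b k * ?c k)"
      by (rule sum.cong) (simp_all add: real_sqrt_mult[symmetric] mult.assoc[symmetric] power_mult_distrib[symmetric])
    then have "(\<Sum>k<n. a k)\<^sup>2 \<le> (\<Sum>k<n. (?b k)\<^sup>2) * (\<Sum>k<n. (?c k)\<^sup>2)"
      by (simp only: Cauchy_Schwarz_ineq_sum)
    also have "(\<Sum>k<n. (?b k)\<^sup>2) = (\<Sum>k<n. (1 / 2) ^ k)" by simp
    also have "(\<Sum>k<n. (?c k)\<^sup>2) = (\<Sum>k<n. 2 ^ k * (a k)\<^sup>2)" by (simp add: power_mult_distrib)
    also have "(\<Sum>k<n. (1 / 2 :: real) ^ k) * (\<Sum>k<n. 2 ^ k * (a k)\<^sup>2) \<le> 2 * (\<Sum>k. 2 ^ k * (a k)\<^sup>2)"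
    proof (rule mult_mono)
      have "(\<Sum>k<n. (1 / 2 :: real) ^ k) \<le> (\<Sum>k. (1 / 2) ^ k)" by (rule sum_le_suminf) auto
      also have "\<dots> = 2" using suminf_geometric[of "1 / 2 :: real"] by simp
      finally show "(\<Sum>k<n. (1 / 2 :: real) ^ k) \<le> 2" .
      show "(\<Sum>k<n. 2 ^ k * (a k)\<^sup>2) \<le> (\<Sum>k. 2 ^ k * (a k)\<^sup>2)" by (rule sum_le_suminf[OF S]) auto
    qed (auto intro!: sum_nonneg)
    finally show ?thesis .
  qed
  have "(\<lambda>n. (\<Sum>k<n. a k)\<^sup>2) \<longlonglongrightarrow> (\<Sum>k. a k)\<^sup>2"
    by (intro tendsto_power summable_LIMSEQ sa)
  then show "(\<Sum>k. a k)\<^sup>2 \<le> 2 * (\<Sum>k. 2 ^ k * (a k)\<^sup>2)"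
    by (rule LIMSEQ_le_const2) (use part in auto)
qed

text \<open>Existence of the inverse transform on \<open>L\<^sup>2\<close>: cut \<open>G\<close> into annuli whose \<open>L\<^sup>2\<close> masses decay geometrically and sum the
  inverse transforms of the pieces; this replaces completeness of \<open>L\<^sup>2\<close>.\<close>
lemma is_FT_exists:
  assumes G: "L2c G"
  shows "\<exists>f. is_FT f G"
proof -
  have Gm[measurable]: "G \<in> borel_measurable borel" using G by (rule L2c_borel)
  let ?T = "\<lambda>n. LINT z|lborel. indicator {z. norm z > real n} z * (norm (G z))\<^sup>2"
  have "\<exists>n. ?T n < (1 / 4) ^ k" for k :: nat
    using order_tendstoD(2)[OF L2c_tail_tendsto_0[OF G], of "(1 / 4) ^ k"]
    by (auto simp: eventually_sequentially)
  then obtain r :: "nat \<Rightarrow> nat" where r: "\<And>k. ?T (r k) < (1 / 4) ^ k" by metis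
  \<comment> \<open>Partial sums make the radii increasing while \<open>R k\<close> still dominates
    \<open>r k\<close>.\<close>
  define R where "R k = (\<Sum>i\<le>k. r i)" for k
  have Rr: "r k \<le> R k" for k unfolding R_def by (rule member_le_sum) auto
  have RS: "R k \<le> R (Suc k)" for k by (simp add: R_def)
  define A where "A k = (if k = 0 then {z :: real \<times> real. norm z \<le> real (R 0)}
      else {z. real (R (k - 1)) < norm z \<and> norm z \<le> real (R k)})" for k
  have Am[measurable]: "A k \<in> sets borel" for k by (auto simp: A_def)
  have A_sub: "A k \<subseteq> cball 0 (real (R k))" for k by (auto simp: A_def)
  have Ab: "bounded (A k)" for k by (rule bounded_subset[OF bounded_cball A_sub])
  have A_sum: "(\<Sum>k<Suc n. indicator (A k) z) = (indicator {z. norm z \<le> real (R n)} z :: complex)" for n z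
  proof (induction n)
    case (Suc n)
    have "real (R n) \<le> real (R (Suc n))" using RS[of n] by simp
    moreover have "(\<Sum>k<Suc (Suc n). indicator (A k) z) = (indicator {z. norm z \<le> real (R n)} z + indicator (A (Suc n)) z :: complex)"
      by (subst sum.lessThan_Suc) (simp only: Suc)
    ultimately show ?case by (auto simp: A_def indicator_def)
  qed (simp add: A_def)
  define Gk where "Gk k z = indicator (A k) z * G z" for k z
  have Gk2: "L2c (Gk k)" for k unfolding Gk_def
    by (rule L2c_mult_bounded[OF G, where B=1]) (auto simp: indicator_def)
  have Gk1: "integrable lborel (Gk k)" for k
    by (rule Bochner_Integration.integrable_bound[OF integrable_norm_L2_bounded_set[OF G Am Ab] _ AE_I2])
       (use L2c_borel[OF Gk2] in \<open>auto simp: Gk_def norm_mult indicator_def\<close>)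
  define h where "h k = ifourier (Gk k)" for k
  have hFT: "is_FT (h k) (Gk k)" for k unfolding h_def by (rule is_FT_ifourier[OF Gk1 Gk2])
  have h2: "L2c (h k)" for k using hFT is_FT_L2c by blast
  have hm[measurable]: "h k \<in> borel_measurable borel" for k using h2 by (rule L2c_borel)
  \<comment> \<open>The piece with index \<open>Suc k\<close> lies beyond the radius
    \<open>R k\<close>, hence the shift; the piece with index 0 is not small.\<close>
  have hb: "(LINT z|lborel. (norm (h (Suc k) z))\<^sup>2) \<le> (1 / 4) ^ k" for k
  proof -
    have "(LINT z|lborel. (norm (h (Suc k) z))\<^sup>2) \<le> (LINT z|lborel. (norm (Gk (Suc k) z))\<^sup>2)"
      unfolding h_def by (rule Bessel_ifourier_real[OF Gk1 Gk2])
    also have "\<dots> \<le> ?T (r k)"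
    proof (rule integral_mono)
      show "integrable lborel (\<lambda>z. (norm (Gk (Suc k) z))\<^sup>2)" using Gk2 by (simp add: L2c_def)
      show "integrable lborel (\<lambda>z. indicator {z. norm z > real (r k)} z * (norm (G z))\<^sup>2)"
        using G unfolding L2c_def by (intro integrable_indicator_mult) auto
      have "real (r k) \<le> real (R k)" using Rr by simp
      then show "(norm (Gk (Suc k) z))\<^sup>2 \<le> indicator {z. norm z > real (r k)} z * (norm (G z))\<^sup>2" for z
        by (auto simp: Gk_def A_def indicator_def)
    qed
    finally show ?thesis using r[of k] by linarith
  qed
  \<comment> \<open>Masses of order 4^(-k) leave room for the weight 2^k: the integral of
    \<open>S\<close> is finite, so \<open>S\<close> is finite almost everywhere.\<close>
  define S where "S z = (\<Sum>k. ennreal (2 ^ k * (norm (h k z))\<^sup>2))" for z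
  have "(\<integral>\<^sup>+z. S z \<partial>lborel) < \<infinity>"
  proof -
    have nn: "(\<integral>\<^sup>+z. ennreal (2 ^ k * (norm (h k z))\<^sup>2) \<partial>lborel) = ennreal (2 ^ k * (LINT z|lborel. (norm (h k z))\<^sup>2))" for k
      using h2[of k] by (subst nn_integral_eq_integral) (auto simp: L2c_def)
    have sm: "summable (\<lambda>k. 2 ^ k * (LINT z|lborel. (norm (h k z))\<^sup>2))"
    proof (rule summable_Suc_iff[THEN iffD1], rule summable_comparison_test')
      show "summable (\<lambda>k. 2 * (1 / 2 :: real) ^ k)" by (intro summable_mult) simp
      show "norm (2 ^ Suc k * (LINT z|lborel. (norm (h (Suc k) z))\<^sup>2)) \<le> 2 * (1 / 2) ^ k" if "k \<ge> 0" for k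
      proof -
        have "2 ^ k * (1 / 4) ^ k = (1 / 2 :: real) ^ k" by (subst power_mult_distrib[symmetric]) simp
        then show ?thesis
          using mult_left_mono[OF hb[of k], of "2 ^ Suc k"] by (simp add: integral_nonneg_AE abs_mult mult.assoc)
      qed
    qed
    have "(\<integral>\<^sup>+z. S z \<partial>lborel) = (\<Sum>k. ennreal (2 ^ k * (LINT z|lborel. (norm (h k z))\<^sup>2)))"
      unfolding S_def by (subst nn_integral_suminf) (auto simp: nn)
    also have "\<dots> < \<infinity>"
      by (subst suminf_ennreal2[OF _ sm]) (auto simp: integral_nonneg_AE)
    finally show ?thesis .
  qed
  moreover have Sm[measurable]: "S \<in> borel_measurable borel" unfolding S_def[abs_def] by measurable
  ultimately have AES: "AE z in lborel. S z \<noteq> \<infinity>" by (intro nn_integral_PInf_AE) auto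
  have AEsum: "AE z in lborel. summable (\<lambda>k. 2 ^ k * (norm (h k z))\<^sup>2)"
    using AES
  proof eventually_elim
    case (elim z)
    then show ?case unfolding S_def by (intro summable_suminf_not_top) auto
  qed
  \<comment> \<open>Since \<Psi>^2 \<le> 2 S almost everywhere, \<Psi> is a square-integrable
    majorant of all partial sums at once.\<close>
  define \<Psi> where "\<Psi> z = (\<Sum>k. norm (h k z))" for z
  have \<Psi>m[measurable]: "\<Psi> \<in> borel_measurable borel" unfolding \<Psi>_def[abs_def] by measurable
  have "AE z in lborel. ennreal ((norm (complex_of_real (\<Psi> z)))\<^sup>2) \<le> 2 * S z"
    using AEsum
  proof eventually_elim
    case (elim z)
    have "ennreal ((norm (complex_of_real (\<Psi> z)))\<^sup>2) \<le> ennreal (2 * (\<Sum>k. 2 ^ k * (norm (h k z))\<^sup>2))"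
      using summable_of_weighted_squares(2)[OF _ elim] by (intro ennreal_leI) (simp add: \<Psi>_def)
    also have "\<dots> = 2 * S z"
      unfolding S_def by (subst suminf_ennreal2[OF _ elim]) (auto simp: ennreal_mult suminf_nonneg[OF elim])
    finally show ?case .
  qed
  then have "(\<integral>\<^sup>+z. ennreal ((norm (complex_of_real (\<Psi> z)))\<^sup>2) \<partial>lborel) \<le> (\<integral>\<^sup>+z. 2 * S z \<partial>lborel)"
    by (rule nn_integral_mono_AE)
  also have "\<dots> < \<infinity>"
    using \<open>(\<integral>\<^sup>+z. S z \<partial>lborel) < \<infinity>\<close> by (simp add: nn_integral_cmult ennreal_mult_less_top)
  finally have \<Psi>2: "L2c (\<lambda>z. complex_of_real (\<Psi> z))" by (simp add: L2c_iff)
  define f where "f z = (\<Sum>k. h k z)" for z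
  have fm[measurable]: "f \<in> borel_measurable borel" unfolding f_def[abs_def] by measurable
  define F where "F n z = (\<Sum>k<Suc n. h k z)" for n z
  have Flim: "AE z in lborel. (\<lambda>n. F n z) \<longlonglongrightarrow> f z \<and> (\<forall>n. norm (F n z) \<le> \<Psi> z) \<and> norm (f z) \<le> \<Psi> z"
    using AEsum
  proof eventually_elim
    case (elim z)
    have s: "summable (\<lambda>k. norm (h k z))" by (rule summable_of_weighted_squares(1)[OF _ elim]) simp
    have l: "(\<lambda>n. F n z) \<longlonglongrightarrow> f z"
      unfolding F_def f_def by (rule LIMSEQ_Suc[OF summable_LIMSEQ[OF summable_norm_cancel[OF s]]])
    have b: "norm (F n z) \<le> \<Psi> z" for n
      unfolding F_def \<Psi>_def by (rule order_trans[OF norm_sum sum_le_suminf[OF s]]) auto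
    show ?case using l b summable_norm[OF s] by (auto simp: f_def \<Psi>_def)
  qed
  have Fm[measurable]: "F n \<in> borel_measurable borel" for n unfolding F_def[abs_def] by measurable
  have f2: "L2c f"
    by (rule L2c_bound[OF \<Psi>2 \<Psi>2 fm, where A=1 and B=0]) (use Flim in \<open>eventually_elim, auto intro!: power_mono simp: power2_abs\<close>)
  have FG: "is_FT (F n) (\<lambda>z. indicator {z. norm z \<le> real (R n)} z * G z)" for n
  proof -
    have "is_FT (F n) (\<lambda>z. \<Sum>k<Suc n. Gk k z)"
      unfolding F_def by (rule is_FT_sum) (use hFT in auto)
    moreover have "(\<Sum>k<Suc n. Gk k z) = indicator {z. norm z \<le> real (R n)} z * G z" for z
      unfolding Gk_def sum_distrib_right[symmetric] A_sum ..
    ultimately show ?thesis by simp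
  qed
  have "is_FT f G"
  proof (rule is_FT_I[OF f2 G])
    fix \<phi> :: "real \<times> real \<Rightarrow> complex" assume \<phi>: "integrable lborel \<phi>" "L2c \<phi>"
    note [measurable] = L2c_borel[OF \<phi>(2)]
    have \<phi>F: "L2c (fourier \<phi>)" by (rule L2c_fourier[OF \<phi>])
    note [measurable] = L2c_borel[OF \<phi>F]
    have 1: "(\<lambda>n. LINT z|lborel. F n z * fourier \<phi> z) \<longlonglongrightarrow> (LINT z|lborel. f z * fourier \<phi> z)"
    proof (rule integral_dominated_convergence)
      show "integrable lborel (\<lambda>z. norm (complex_of_real (\<Psi> z) * fourier \<phi> z))"
        by (intro integrable_norm integrable_mult_L2 \<Psi>2 \<phi>F)
      show "AE z in lborel. norm (F n z * fourier \<phi> z) \<le> norm (complex_of_real (\<Psi> z) * fourier \<phi> z)" for n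
        using Flim
      proof eventually_elim
        case (elim z)
        then have "norm (F n z) \<le> \<bar>\<Psi> z\<bar>" using abs_ge_self order_trans by blast
        then show ?case by (simp add: norm_mult mult_right_mono)
      qed
      show "AE z in lborel. (\<lambda>n. F n z * fourier \<phi> z) \<longlonglongrightarrow> f z * fourier \<phi> z"
        using Flim by eventually_elim (auto intro!: tendsto_intros)
    qed auto
    have eq: "(LINT z|lborel. F n z * fourier \<phi> z) = (LINT z|lborel. indicator {z. norm z \<le> real (R n)} z * (G z * \<phi> z))" for n
      using is_FT_pairing[OF FG \<phi>, of n] by (simp add: mult.assoc)
    \<comment> \<open>On the frequency side only the tail of \<open>G\<close> beyond
      \<open>R n\<close> is missing, and Cauchy-Schwarz bounds it by the mass chosen for
      \<open>r n\<close>.\<close>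
    have "(norm ((LINT z|lborel. indicator {z. norm z \<le> real (R n)} z * (G z * \<phi> z)) - (LINT z|lborel. G z * \<phi> z)))\<^sup>2
        \<le> (1 / 4) ^ n * (LINT z|lborel. (norm (\<phi> z))\<^sup>2)" for n
    proof -
      let ?H = "\<lambda>z. indicator {z. norm z > real (R n)} z * G z"
      have H2: "L2c ?H" by (rule L2c_mult_bounded[OF G, where B=1]) (auto simp: indicator_def)
      have I2: "L2c (\<lambda>z. indicator {z. norm z \<le> real (R n)} z * G z)" by (rule L2c_mult_bounded[OF G, where B=1]) (auto simp: indicator_def)
      have "(LINT z|lborel. G z * \<phi> z) - (LINT z|lborel. indicator {z. norm z \<le> real (R n)} z * (G z * \<phi> z))
          = (LINT z|lborel. G z * \<phi> z - indicator {z. norm z \<le> real (R n)} z * (G z * \<phi> z))"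
        using integrable_mult_L2[OF I2 \<phi>(2)] integrable_mult_L2[OF G \<phi>(2)]
        by (subst Bochner_Integration.integral_diff) (simp_all add: mult.assoc)
      also have "\<dots> = (LINT z|lborel. ?H z * \<phi> z)"
        by (rule Bochner_Integration.integral_cong) (auto simp: indicator_def)
      finally have "(norm ((LINT z|lborel. indicator {z. norm z \<le> real (R n)} z * (G z * \<phi> z)) - (LINT z|lborel. G z * \<phi> z)))\<^sup>2
         = (norm (LINT z|lborel. ?H z * \<phi> z))\<^sup>2" by (subst norm_minus_commute) (simp only:)
      also have "\<dots> \<le> (LINT z|lborel. (norm (?H z))\<^sup>2) * (LINT z|lborel. (norm (\<phi> z))\<^sup>2)"
        by (rule Cauchy_Schwarz_real[OF H2 \<phi>(2)])
      also have "\<dots> \<le> (1 / 4) ^ n * (LINT z|lborel. (norm (\<phi> z))\<^sup>2)"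
      proof (rule mult_right_mono)
        have "(LINT z|lborel. (norm (?H z))\<^sup>2) \<le> ?T (r n)"
        proof (rule integral_mono)
          show "integrable lborel (\<lambda>z. (norm (?H z))\<^sup>2)" using H2 by (simp add: L2c_def)
          show "integrable lborel (\<lambda>z. indicator {z. norm z > real (r n)} z * (norm (G z))\<^sup>2)"
            using G unfolding L2c_def by (intro integrable_indicator_mult) auto
          have "real (r n) \<le> real (R n)" using Rr by simp
          then show "(norm (?H z))\<^sup>2 \<le> indicator {z. norm z > real (r n)} z * (norm (G z))\<^sup>2" for z
            by (auto simp: indicator_def)
        qed
        then show "(LINT z|lborel. (norm (?H z))\<^sup>2) \<le> (1 / 4) ^ n" using r[of n] by linarith
      qed (simp add: integral_nonneg_AE)
      finally show ?thesis .
    qed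
    moreover have "(\<lambda>n. (1 / 4) ^ n * (LINT z|lborel. (norm (\<phi> z))\<^sup>2)) \<longlonglongrightarrow> 0"
      by (intro tendsto_mult_left_zero LIMSEQ_realpow_zero) auto
    ultimately have 2: "(\<lambda>n. LINT z|lborel. F n z * fourier \<phi> z) \<longlonglongrightarrow> (LINT z|lborel. G z * \<phi> z)"
      unfolding eq by (rule tendsto_of_norm_square_le)
    show "(LINT z|lborel. f z * fourier \<phi> z) = (LINT z|lborel. G z * \<phi> z)"
      by (rule LIMSEQ_unique[OF 1 2])
  qed
  then show ?thesis by blast
qed

section \<open>Real functions and Fourier multipliers\<close>

definition hermitian_AE :: "(real \<times> real \<Rightarrow> complex) \<Rightarrow> bool" where
  "hermitian_AE G \<longleftrightarrow> (AE \<zeta> in lborel. cnj (G (- \<zeta>)) = G \<zeta>)"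

text \<open>Averaging an inverse transform with its conjugate averages \<open>G\<close> with its
  Hermitian reflection, which leaves \<open>G\<close> unchanged.\<close>

lemma is_FT_exists_real:
  assumes G: "L2c G" and herm: "hermitian_AE G"
  shows "\<exists>f :: r2fun. is_FT (\<lambda>z. complex_of_real (f z)) G"
proof -
  obtain f where f: "is_FT f G" using is_FT_exists[OF G] by blast
  have "is_FT (\<lambda>z. (1 / 2) * (f z + cnj (f z))) (\<lambda>\<zeta>. (1 / 2) * (G \<zeta> + cnj (G (- \<zeta>))))"
    by (rule is_FT_cmult[OF is_FT_add[OF f is_FT_cnj[OF f]]])
  then have "is_FT (\<lambda>z. complex_of_real (Re (f z))) G"
  proof (rule is_FT_cong_AE)
    show "AE z in lborel. 1 / 2 * (f z + cnj (f z)) = complex_of_real (Re (f z))"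
      by (intro AE_I2) (simp add: complex_eq_iff)
    show "AE z in lborel. 1 / 2 * (G z + cnj (G (- z))) = G z"
      using herm unfolding hermitian_AE_def by eventually_elim simp
    show "(\<lambda>x. complex_of_real (Re (f x))) \<in> borel_measurable borel" "G \<in> borel_measurable borel"
      using is_FT_L2c[OF f, THEN L2c_borel] by auto
  qed
  then show ?thesis by (intro exI[of _ "\<lambda>z. Re (f z)"])
qed

lemma is_FT_real_hermitian:
  fixes f :: r2fun
  assumes "is_FT (\<lambda>z. complex_of_real (f z)) g"
  shows "hermitian_AE g"
  using is_FT_unique[OF is_FT_cnj[OF assms], of g] assms unfolding hermitian_AE_def by simp

lemma fourierL2_is_FT:
  assumes "is_FT (\<lambda>z. complex_of_real (f z)) g"
  shows "is_FT (\<lambda>z. complex_of_real (f z)) (fourierL2 f)"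
  unfolding fourierL2_def by (rule someI[where P="is_FT (\<lambda>z. complex_of_real (f z))", OF assms])

lemma fourierL2_AE_eq:
  assumes "is_FT (\<lambda>z. complex_of_real (f z)) g"
  shows "AE z in lborel. fourierL2 f z = g z"
  by (rule is_FT_unique[OF fourierL2_is_FT[OF assms] assms])

text \<open>Justifies the \<open>SOME\<close> in \<open>fmult\<close>: a Hermitian multiplier
  preserves Hermitian symmetry, so a real function with the required transform exists.\<close>

lemma fmult_is_FT:
  assumes f: "is_FT (\<lambda>z. complex_of_real (f z)) g" and m: "m \<in> borel_measurable borel"
    and L2: "L2c (\<lambda>\<zeta>. m \<zeta> * g \<zeta>)" and herm: "\<And>\<zeta>. cnj (m (- \<zeta>)) = m \<zeta>"
  shows "is_FT (\<lambda>z. complex_of_real (fmult m f z)) (\<lambda>\<zeta>. m \<zeta> * fourierL2 f \<zeta>)"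
    and "is_FT (\<lambda>z. complex_of_real (fmult m f z)) (\<lambda>\<zeta>. m \<zeta> * g \<zeta>)"
proof -
  have "hermitian_AE (\<lambda>\<zeta>. m \<zeta> * g \<zeta>)"
    using is_FT_real_hermitian[OF f] unfolding hermitian_AE_def by eventually_elim (simp add: herm)
  then obtain q :: r2fun where q: "is_FT (\<lambda>z. complex_of_real (q z)) (\<lambda>\<zeta>. m \<zeta> * g \<zeta>)"
    using is_FT_exists_real[OF L2] by blast
  have F: "is_FT (\<lambda>z. complex_of_real (f z)) (fourierL2 f)" by (rule fourierL2_is_FT[OF f])
  have [measurable]: "fourierL2 f \<in> borel_measurable borel" "g \<in> borel_measurable borel"
    using is_FT_L2c[OF F] is_FT_L2c[OF f] L2c_borel by auto
  note [measurable] = m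
  have AE: "AE \<zeta> in lborel. m \<zeta> * g \<zeta> = m \<zeta> * fourierL2 f \<zeta>"
    using fourierL2_AE_eq[OF f] by eventually_elim simp
  have "is_FT (\<lambda>z. complex_of_real (q z)) (\<lambda>\<zeta>. m \<zeta> * fourierL2 f \<zeta>)"
    by (rule is_FT_cong_AE[OF q _ AE]) (use is_FT_L2c[OF q, THEN L2c_borel] in auto)
  then show 1: "is_FT (\<lambda>z. complex_of_real (fmult m f z)) (\<lambda>\<zeta>. m \<zeta> * fourierL2 f \<zeta>)"
    unfolding fmult_def
    by (rule someI[where P="\<lambda>q. is_FT (\<lambda>z. complex_of_real (q z)) (\<lambda>\<zeta>. m \<zeta> * fourierL2 f \<zeta>)"])
  show "is_FT (\<lambda>z. complex_of_real (fmult m f z)) (\<lambda>\<zeta>. m \<zeta> * g \<zeta>)"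
    by (rule is_FT_cong_AE[OF 1]) (use AE is_FT_L2c[OF 1, THEN L2c_borel] in auto)
qed

section \<open>Differentiation and the forward transform\<close>

lemma fourier_translate:
  assumes [measurable]: "f \<in> borel_measurable borel"
  shows "fourier (\<lambda>z. f (z + c)) \<zeta> = cis (c \<bullet> \<zeta>) * fourier f \<zeta>"
proof -
  have "(LINT z|lborel. cis (- (z \<bullet> \<zeta>)) * f (z + c)) = (LINT z|lborel. cis (- ((z - c) \<bullet> \<zeta>)) * f z)"
    using integral_translate2[of "\<lambda>z. cis (- ((z - c) \<bullet> \<zeta>)) * f z" c] by simp
  also have "\<dots> = (LINT z|lborel. cis (c \<bullet> \<zeta>) * (cis (- (z \<bullet> \<zeta>)) * f z))"
    by (rule Bochner_Integration.integral_cong) (auto simp: cis_mult inner_diff_left mult.assoc[symmetric])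
  finally show ?thesis by (simp add: fourier_eq)
qed

lemma has_vector_derivative_direction_shift:
  fixes h :: "'a::real_normed_vector \<Rightarrow> 'b::real_normed_vector"
  assumes d: "\<And>z. ((\<lambda>r. h (z + r *\<^sub>R e)) has_vector_derivative h' z) (at 0)"
  shows "((\<lambda>r. h (z + r *\<^sub>R e)) has_vector_derivative h' (z + s *\<^sub>R e)) (at s)"
proof -
  have "((\<lambda>r. h (z + s *\<^sub>R e + (r - s) *\<^sub>R e)) has_vector_derivative 1 *\<^sub>R h' (z + s *\<^sub>R e)) (at s)"
  proof -
    have "((\<lambda>r. r - s) has_vector_derivative 1) (at s)" by (auto intro!: derivative_eq_intros)
    moreover have "((\<lambda>r. h (z + s *\<^sub>R e + r *\<^sub>R e)) has_vector_derivative h' (z + s *\<^sub>R e)) (at (s - s))"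
      using d[of "z + s *\<^sub>R e"] by simp
    ultimately show ?thesis
      using vector_diff_chain_at[of "\<lambda>r. r - s" 1 s "\<lambda>r. h (z + s *\<^sub>R e + r *\<^sub>R e)" "h' (z + s *\<^sub>R e)"]
      by (simp only: o_def)
  qed
  moreover have "z + s *\<^sub>R e + (r - s) *\<^sub>R e = z + r *\<^sub>R e" for r
    by (simp add: algebra_simps)
  ultimately show ?thesis by simp
qed

text \<open>No decay of \<open>h\<close> is available to discard boundary terms. Instead the
  increment of \<open>h\<close> along \<open>e\<close> is transformed in two ways: by translation,
  and as the integral of \<open>h'\<close> over the segment. A suitable step length then gives the
  formula.\<close>

lemma fourier_directional_derivative:
  fixes h h' :: "real \<times> real \<Rightarrow> complex"
  assumes h: "integrable lborel h" and h': "integrable lborel h'" "continuous_on UNIV h'"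
    and d: "\<And>z. ((\<lambda>r. h (z + r *\<^sub>R e)) has_vector_derivative h' z) (at 0)"
  shows "fourier h' \<zeta> = \<i> * of_real (e \<bullet> \<zeta>) * fourier h \<zeta>"
proof -
  have [measurable]: "h \<in> borel_measurable borel" "h' \<in> borel_measurable borel" using h h' by auto
  let ?k = "e \<bullet> \<zeta>"
  \<comment> \<open>The transform of averaging over the segment of length \<open>r\<close>: each
    translate of \<open>h'\<close> contributes only a phase.\<close>
  define J where "J r = (LINT s|lborel. indicator {0..r} s *\<^sub>R cis (s * ?k))" for r :: real
  have iJ: "integrable lborel (\<lambda>s. indicator {0..r} s *\<^sub>R cis (s * ?k))" for r :: real
    by (rule integrable_bounded_support[of _ 1 "{0..r}"]) (auto simp: indicator_def)
  have main: "(cis (r * ?k) - 1) * fourier h \<zeta> = J r * fourier h' \<zeta>" if r: "r \<ge> 0" for r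
  proof -
    have ftc: "h (z + r *\<^sub>R e) - h z = (LINT s|lborel. indicator {0..r} s *\<^sub>R h' (z + s *\<^sub>R e))" for z
    proof -
      have "(LINT s|lborel. indicator {0..r} s *\<^sub>R h' (z + s *\<^sub>R e)) = h (z + r *\<^sub>R e) - h (z + 0 *\<^sub>R e)"
      proof (rule integral_FTC_Icc[OF r])
        show "((\<lambda>r. h (z + r *\<^sub>R e)) has_vector_derivative h' (z + s *\<^sub>R e)) (at s within {0..r})" for s
          by (rule has_vector_derivative_at_within[OF has_vector_derivative_direction_shift[OF d]])
        show "continuous_on {0..r} (\<lambda>s. h' (z + s *\<^sub>R e))"
          by (rule continuous_on_compose2[OF h'(2)]) (auto intro!: continuous_intros)
      qed
      then show ?thesis by simp
    qed
    \<comment> \<open>The translates of \<open>h'\<close> all have the same L^1 norm, so the double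
      integral is bounded by \<open>r\<close> times that norm.\<close>
    have i: "integrable (lborel \<Otimes>\<^sub>M lborel) (\<lambda>(s, z). cis (- (z \<bullet> \<zeta>)) * (indicator {0..r} s *\<^sub>R h' (z + s *\<^sub>R e)))"
    proof (rule lborel_pair.Fubini_integrable)
      have "(LINT z|lborel. norm (h' (z + s *\<^sub>R e))) = (LINT z|lborel. norm (h' z))" for s
        using integral_translate2[of "\<lambda>z. norm (h' z)" "s *\<^sub>R e"] by simp
      then have "(\<lambda>s. LINT z|lborel. norm (case (s, z) of (s, z) \<Rightarrow> cis (- (z \<bullet> \<zeta>)) * (indicator {0..r} s *\<^sub>R h' (z + s *\<^sub>R e))))
         = (\<lambda>s. indicator {0..r} s * (LINT z|lborel. norm (h' z)))"
        by (simp add: norm_mult)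
      moreover have "integrable lborel (\<lambda>s. indicator {0..r} s * (LINT z|lborel. norm (h' z)))"
        by (intro integrable_mult_left integrable_real_indicator) (use r in auto)
      ultimately show "integrable lborel (\<lambda>s. LINT z|lborel. norm (case (s, z) of (s, z) \<Rightarrow> cis (- (z \<bullet> \<zeta>)) * (indicator {0..r} s *\<^sub>R h' (z + s *\<^sub>R e))))"
        by simp
      have "integrable lborel (\<lambda>z. cis (- (z \<bullet> \<zeta>)) * (indicator {0..r} s *\<^sub>R h' (z + s *\<^sub>R e)))" for s
        by (intro integrable_cis_mult integrable_scaleR_right integrable_translate2 h') auto
      then show "AE s in lborel. integrable lborel (\<lambda>z. case (s, z) of (s, z) \<Rightarrow> cis (- (z \<bullet> \<zeta>)) * (indicator {0..r} s *\<^sub>R h' (z + s *\<^sub>R e)))"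
        by simp
    qed (simp add: case_prod_unfold)
    have "(cis (r * ?k) - 1) * fourier h \<zeta> = fourier (\<lambda>z. h (z + r *\<^sub>R e) - h z) \<zeta>"
      by (subst fourier_diff) (use h integrable_translate2[OF h] fourier_translate[of h "r *\<^sub>R e" \<zeta>] in \<open>auto simp: left_diff_distrib\<close>)
    also have "\<dots> = of_real (1 / (2 * pi)) * (LINT z|lborel. LINT s|lborel. cis (- (z \<bullet> \<zeta>)) * (indicator {0..r} s *\<^sub>R h' (z + s *\<^sub>R e)))"
      unfolding fourier_eq ftc by (simp only: integral_mult_right_zero)
    also have "(LINT z|lborel. LINT s|lborel. cis (- (z \<bullet> \<zeta>)) * (indicator {0..r} s *\<^sub>R h' (z + s *\<^sub>R e)))
       = (LINT s|lborel. LINT z|lborel. cis (- (z \<bullet> \<zeta>)) * (indicator {0..r} s *\<^sub>R h' (z + s *\<^sub>R e)))"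
      by (rule lborel_pair.Fubini_integral) (rule i)
    also have "of_real (1 / (2 * pi)) * \<dots> = (LINT s|lborel. indicator {0..r} s *\<^sub>R fourier (\<lambda>z. h' (z + s *\<^sub>R e)) \<zeta>)"
      by (subst integral_mult_right_zero[symmetric], rule Bochner_Integration.integral_cong[OF refl]) (simp add: fourier_eq)
    also have "\<dots> = (LINT s|lborel. (indicator {0..r} s *\<^sub>R cis (s * ?k)) * fourier h' \<zeta>)"
      by (simp add: fourier_translate)
    also have "\<dots> = J r * fourier h' \<zeta>"
      unfolding J_def by (rule integral_mult_left_zero)
    finally show ?thesis .
  qed
  show ?thesis
  proof (cases "?k = 0")
    case True
    have "J 1 = 1" using True by (simp add: J_def scaleR_conv_of_real)
    then show ?thesis using main[of 1] True by simp
  next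
    case False
    \<comment> \<open>With this step the phase is -1, so the factor \<open>cis (r * ?k) - 1\<close>
      equals -2 and can be cancelled.\<close>
    define r where "r = pi / \<bar>?k\<bar>"
    have r: "r \<ge> 0" by (simp add: r_def)
    have "r * ?k = pi \<or> r * ?k = - pi" using False by (auto simp: r_def abs_if)
    then have c: "cis (r * ?k) = -1" by (auto simp: cis.ctr complex_eq_iff)
    have "\<i> * of_real ?k * J r = (LINT s|lborel. indicator {0..r} s *\<^sub>R (\<i> * of_real ?k * cis (s * ?k)))"
      unfolding J_def by (subst integral_mult_right_zero[symmetric]) (simp add: mult_ac)
    also have "\<dots> = cis (r * ?k) - cis (0 * ?k)"
    proof (rule integral_FTC_Icc[OF r])
      show "((\<lambda>s. cis (s * ?k)) has_vector_derivative \<i> * of_real ?k * cis (s * ?k)) (at s within {0..r})" for s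
        unfolding has_vector_derivative_def
        by (rule derivative_eq_intros | simp add: scaleR_conv_of_real mult_ac)+
    qed (auto intro!: continuous_intros)
    finally have "\<i> * of_real ?k * J r = cis (r * ?k) - 1" by simp
    then have "(cis (r * ?k) - 1) * (\<i> * of_real ?k * fourier h \<zeta>) = (cis (r * ?k) - 1) * fourier h' \<zeta>"
      using main[OF r] by (metis (no_types, lifting) mult.assoc mult.left_commute)
    then show ?thesis using c by simp
  qed
qed

text \<open>The previous formula at frequency 0.\<close>

lemma integral_directional_derivative_eq_0:
  fixes h h' :: "real \<times> real \<Rightarrow> real"
  assumes h: "integrable lborel h" and h': "integrable lborel h'" "continuous_on UNIV h'"
    and d: "\<And>z. ((\<lambda>r. h (z + r *\<^sub>R e)) has_vector_derivative h' z) (at 0)"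
  shows "(LINT z|lborel. h' z) = 0"
proof -
  have "fourier (\<lambda>z. complex_of_real (h' z)) 0 = \<i> * of_real (e \<bullet> 0) * fourier (\<lambda>z. complex_of_real (h z)) 0"
  proof (rule fourier_directional_derivative)
    show "((\<lambda>r. complex_of_real (h (z + r *\<^sub>R e))) has_vector_derivative complex_of_real (h' z)) (at 0)" for z
      by (rule bounded_linear.has_vector_derivative[OF bounded_linear_of_real d])
  qed (use h h' in \<open>auto intro!: continuous_intros\<close>)
  then show ?thesis by (simp add: fourier_eq)
qed

lemma test_fun_pd:
  assumes "test_fun \<phi>"
  shows "test_fun (pdx \<phi>)" "test_fun (pdy \<phi>)"
proof -
  obtain R where R: "\<And>z. norm z > R \<Longrightarrow> \<phi> z = 0" by (metis test_fun_support[OF assms])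
  have w: "pd_word ws (pdx \<phi>) = pd_word (ws @ [True]) \<phi>" "pd_word ws (pdy \<phi>) = pd_word (ws @ [False]) \<phi>" for ws
    by (simp_all add: pd_word_def)
  have s: "smooth2 (pdx \<phi>)" "smooth2 (pdy \<phi>)"
    using assms unfolding test_fun_def smooth2_def w by blast+
  have "frechet_derivative \<phi> (at z) = (\<lambda>_. 0)" if z: "z \<notin> cball 0 R" for z
  proof -
    have "((\<lambda>_. 0) has_derivative (\<lambda>_. 0)) (at z)" by simp
    then have "(\<phi> has_derivative (\<lambda>_. 0)) (at z)"
      by (rule has_derivative_transform_within_open[OF _ open_Compl[OF closed_cball[of 0 R]]]) (use z in \<open>simp_all add: R\<close>)
    from frechet_derivative_at[OF this] show ?thesis by simp
  qed
  then have "pdx \<phi> z = 0" "pdy \<phi> z = 0" if "z \<notin> cball 0 R" for z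
    using that by (simp_all add: pdx_def pdy_def del: mem_cball)
  then show "test_fun (pdx \<phi>)" "test_fun (pdy \<phi>)"
    unfolding test_fun_def using s compact_cball[of "0 :: real \<times> real" R] by blast+
qed

lemma test_fun_directional:
  assumes "test_fun \<phi>"
  shows "((\<lambda>r. \<phi> (z + r *\<^sub>R (1, 0))) has_vector_derivative pdx \<phi> z) (at 0)"
    and "((\<lambda>r. \<phi> (z + r *\<^sub>R (0, 1))) has_vector_derivative pdy \<phi> z) (at 0)"
proof -
  have "\<phi> differentiable (at z)"
  proof -
    have "\<forall>ws z. pd_word ws \<phi> differentiable (at z)" using assms unfolding test_fun_def smooth2_def by blast
    from this[rule_format, of "[]" z] show ?thesis by (simp add: pd_word_def)
  qed
  then have D: "(\<phi> has_derivative frechet_derivative \<phi> (at z)) (at z)" by (simp add: frechet_derivative_works)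
  have lin: "linear (frechet_derivative \<phi> (at z))" using has_derivative_linear[OF D] .
  have "((\<lambda>r. \<phi> (z + r *\<^sub>R v)) has_vector_derivative frechet_derivative \<phi> (at z) v) (at 0)" for v
  proof -
    have "((\<lambda>r. z + r *\<^sub>R v) has_derivative (\<lambda>r. r *\<^sub>R v)) (at 0)"
      by (auto intro!: derivative_eq_intros)
    from has_derivative_compose[OF this, of \<phi> "frechet_derivative \<phi> (at z)"] D
    show ?thesis by (simp add: has_vector_derivative_def linear_scale[OF lin])
  qed
  then show "((\<lambda>r. \<phi> (z + r *\<^sub>R (1, 0))) has_vector_derivative pdx \<phi> z) (at 0)"
    "((\<lambda>r. \<phi> (z + r *\<^sub>R (0, 1))) has_vector_derivative pdy \<phi> z) (at 0)"
    unfolding pdx_def pdy_def by blast+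
qed

lemma integrable_continuous_mult_test_fun:
  assumes "continuous_on UNIV f" "test_fun \<phi>"
  shows "integrable lborel (\<lambda>z. f z * \<phi> z)"
proof -
  obtain R where R: "\<And>z. norm z > R \<Longrightarrow> \<phi> z = 0" by (metis test_fun_support[OF assms(2)])
  have c: "continuous_on UNIV (\<lambda>z. f z * \<phi> z)" using assms test_fun_continuous by (intro continuous_intros) auto
  obtain C where "\<And>z. norm (f z * \<phi> z) \<le> C * indicator (cball 0 R) z"
    using continuous_compact_support_bounded[OF c, of R] R by (metis mult_zero_right)
  then show ?thesis
    by (intro integrable_bounded_support[where C=C and B="cball 0 R"] borel_measurable_continuous_onI c) auto
qed

text \<open>The y-derivative of \<open>f * \<phi>\<close> has integral 0, and the product has
  compact support.\<close>

lemma integral_by_parts_pdy: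
  assumes "continuous_on UNIV f" "continuous_on UNIV f'" "test_fun \<phi>"
    and d: "\<And>z. ((\<lambda>r. f (z + r *\<^sub>R (0, 1))) has_vector_derivative f' z) (at 0)"
  shows "(LINT z|lborel. f' z * \<phi> z) = - (LINT z|lborel. f z * pdy \<phi> z)"
proof -
  note c = assms(1,2) test_fun_continuous[OF assms(3)] test_fun_continuous[OF test_fun_pd(2)[OF assms(3)]]
  note i = integrable_continuous_mult_test_fun[OF assms(1,3)] integrable_continuous_mult_test_fun[OF assms(2,3)]
    integrable_continuous_mult_test_fun[OF assms(1) test_fun_pd(2)[OF assms(3)]]
  have "(LINT z|lborel. f z * pdy \<phi> z + f' z * \<phi> z) = 0"
  proof (rule integral_directional_derivative_eq_0[OF i(1)])
    show "((\<lambda>r. f (z + r *\<^sub>R (0, 1)) * \<phi> (z + r *\<^sub>R (0, 1))) has_vector_derivative f z * pdy \<phi> z + f' z * \<phi> z) (at 0)" for z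
      using has_vector_derivative_mult[OF d[of z] test_fun_directional(2)[OF assms(3), of z]] by (simp add: zero_prod_def[symmetric])
  qed (use i c in \<open>auto intro!: continuous_intros\<close>)
  then show ?thesis using i by simp
qed

section \<open>Classical and weak derivatives in y\<close>

text \<open>Differentiability in y alone, with continuity at each order: weak enough to follow from
  Sobolev regularity, and closed under products, so that powers of the solution inherit it.\<close>

primrec ydiff :: "nat \<Rightarrow> r2fun \<Rightarrow> bool" where
  "ydiff 0 f = continuous_on UNIV f"
| "ydiff (Suc k) f = (continuous_on UNIV f \<and>
     (\<exists>f'. (\<forall>z. ((\<lambda>r. f (z + r *\<^sub>R (0, 1))) has_vector_derivative f' z) (at 0)) \<and> ydiff k f'))"

lemma ydiff_continuous: "ydiff k f \<Longrightarrow> continuous_on UNIV f"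
  by (cases k) auto

lemma ydiff_Suc_imp: "ydiff (Suc k) f \<Longrightarrow> ydiff k f"
proof (induction k arbitrary: f)
  case (Suc k)
  then show ?case by (metis ydiff.simps(2))
qed simp

lemma ydiff_SucI:
  assumes "continuous_on UNIV f" "\<And>z. ((\<lambda>r. f (z + r *\<^sub>R (0, 1))) has_vector_derivative f' z) (at 0)" "ydiff k f'"
  shows "ydiff (Suc k) f"
  unfolding ydiff.simps by (intro conjI exI[of _ f'] allI assms)

lemma ydiff_SucE:
  assumes "ydiff (Suc k) f"
  obtains f' where "continuous_on UNIV f" "\<And>z. ((\<lambda>r. f (z + r *\<^sub>R (0, 1))) has_vector_derivative f' z) (at 0)" "ydiff k f'"
  using assms unfolding ydiff.simps by metis

lemma ydiff_add: "ydiff k f \<Longrightarrow> ydiff k g \<Longrightarrow> ydiff k (\<lambda>z. f z + g z)"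
proof (induction k arbitrary: f g)
  case (Suc k)
  from Suc.prems obtain f' where f: "continuous_on UNIV f" "\<And>z. ((\<lambda>r. f (z + r *\<^sub>R (0, 1))) has_vector_derivative f' z) (at 0)" "ydiff k f'"
    using ydiff_SucE by metis
  from Suc.prems obtain g' where g: "continuous_on UNIV g" "\<And>z. ((\<lambda>r. g (z + r *\<^sub>R (0, 1))) has_vector_derivative g' z) (at 0)" "ydiff k g'"
    using ydiff_SucE by metis
  show ?case
    by (rule ydiff_SucI[OF _ has_vector_derivative_add[OF f(2) g(2)] Suc.IH[OF f(3) g(3)]])
       (intro continuous_intros f g)
qed (auto intro: continuous_intros)

lemma ydiff_mult: "ydiff k f \<Longrightarrow> ydiff k g \<Longrightarrow> ydiff k (\<lambda>z. f z * g z)"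
proof (induction k arbitrary: f g)
  case (Suc k)
  from Suc.prems obtain f' where f: "continuous_on UNIV f" "\<And>z. ((\<lambda>r. f (z + r *\<^sub>R (0, 1))) has_vector_derivative f' z) (at 0)" "ydiff k f'"
    using ydiff_SucE by metis
  from Suc.prems obtain g' where g: "continuous_on UNIV g" "\<And>z. ((\<lambda>r. g (z + r *\<^sub>R (0, 1))) has_vector_derivative g' z) (at 0)" "ydiff k g'"
    using ydiff_SucE by metis
  have "ydiff k (\<lambda>z. f z * g' z + f' z * g z)"
    using Suc.prems[THEN ydiff_Suc_imp] f(3) g(3) by (intro ydiff_add Suc.IH)
  moreover have "((\<lambda>r. f (z + r *\<^sub>R (0, 1)) * g (z + r *\<^sub>R (0, 1))) has_vector_derivative f z * g' z + f' z * g z) (at 0)" for z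
    using has_vector_derivative_mult[OF f(2)[of z] g(2)[of z]] by (simp add: zero_prod_def[symmetric])
  ultimately show ?case
    by (intro ydiff_SucI[where f'="\<lambda>z. f z * g' z + f' z * g z"] continuous_intros f(1) g(1))
qed (auto intro: continuous_intros)

lemma ydiff_power: "ydiff k f \<Longrightarrow> ydiff k (\<lambda>z. f z ^ Suc n)"
  by (induction n) (auto intro: ydiff_mult)

lemma continuous_locally_integrable:
  fixes f :: r2fun
  assumes "continuous_on UNIV f" "compact K"
  shows "set_integrable lborel K f"
  unfolding set_integrable_def
  by (intro borel_integrable_compact assms(2) continuous_on_subset[OF assms(1)]) simp

lemma ydiff_wderiv: "ydiff k f \<Longrightarrow> \<exists>g. continuous_on UNIV g \<and> wderiv 0 k f g"
proof (induction k arbitrary: f)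
  case 0
  then show ?case
    by (intro exI[of _ f]) (auto simp: wderiv_def intro: continuous_locally_integrable borel_measurable_continuous_onI)
next
  case (Suc k)
  then obtain f' where f': "\<And>z. ((\<lambda>r. f (z + r *\<^sub>R (0, 1))) has_vector_derivative f' z) (at 0)" "ydiff k f'" and cf: "continuous_on UNIV f"
    using ydiff_SucE by metis
  obtain g where g: "continuous_on UNIV g" "wderiv 0 k f' g" using Suc.IH[OF f'(2)] by blast
  have t: "test_fun ((pdy ^^ k) \<phi>)" if "test_fun \<phi>" for \<phi>
    by (induction k) (use that test_fun_pd in auto)
  have "wderiv 0 (Suc k) f g"
    unfolding wderiv_def
  proof (intro conjI allI impI)
    fix \<phi> assume \<phi>: "test_fun \<phi>"
    have "(LINT z|lborel. g z * \<phi> z) = (-1) ^ k * (LINT z|lborel. f' z * (pdy ^^ k) \<phi> z)"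
      using g(2) \<phi> by (simp add: wderiv_def)
    also have "(LINT z|lborel. f' z * (pdy ^^ k) \<phi> z) = - (LINT z|lborel. f z * pdy ((pdy ^^ k) \<phi>) z)"
      by (rule integral_by_parts_pdy[OF cf ydiff_continuous[OF f'(2)] t[OF \<phi>] f'(1)])
    finally show "(LINT z|lborel. g z * \<phi> z) = (-1) ^ (0 + Suc k) * (LINT z|lborel. f z * (pdx ^^ 0) ((pdy ^^ Suc k) \<phi>) z)"
      by simp
  qed (use g in \<open>auto simp: wderiv_def\<close>)
  then show ?case using g(1) by blast
qed

lemma jet_scale:
  assumes "jet A"
  shows "jet (\<lambda>n x. c ^ n *\<^sub>R A n (c * x))"
  unfolding jet_def
proof (intro allI)
  fix n x
  have "((\<lambda>x. c * x) has_vector_derivative c) (at x)" by (auto intro!: derivative_eq_intros)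
  moreover have "(A n has_vector_derivative A (Suc n) (c * x)) (at (c * x))" using assms by (simp add: jet_def)
  ultimately have "((\<lambda>x. A n (c * x)) has_vector_derivative c *\<^sub>R A (Suc n) (c * x)) (at x)"
    using vector_diff_chain_at[of "\<lambda>x. c * x" c x "A n"] by (simp add: o_def)
  from bounded_linear.has_vector_derivative[OF bounded_linear_scaleR_right this, of "c ^ n"]
  show "((\<lambda>x. c ^ n *\<^sub>R A n (c * x)) has_vector_derivative c ^ Suc n *\<^sub>R A (Suc n) (c * x)) (at x)"
    by (simp add: mult.commute)
qed

lemma jet_continuous: "jet A \<Longrightarrow> continuous_on UNIV (A n)"
  unfolding jet_def by (auto intro!: continuous_at_imp_continuous_on has_vector_derivative_continuous)

lemma jet_support:
  assumes "jet A" "\<And>x. \<bar>x\<bar> > R \<Longrightarrow> A 0 x = 0"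
  shows "\<bar>x\<bar> > R \<Longrightarrow> A n x = 0"
proof (induction n arbitrary: x)
  case (Suc n)
  have "((\<lambda>_. 0) has_vector_derivative 0) (at x)" by simp
  moreover have "open {x. \<bar>x\<bar> > R}" by (intro open_Collect_less continuous_intros)
  ultimately have "(A n has_vector_derivative 0) (at x)"
    using has_vector_derivative_transform_within_open[of "\<lambda>_. 0" 0 x "{x. \<bar>x\<bar> > R}" "A n"] Suc by auto
  moreover have "(A n has_vector_derivative A (Suc n) x) (at x)" using assms(1) by (simp add: jet_def)
  ultimately show ?case using vector_derivative_unique_at by blast
qed (use assms in auto)

text \<open>Test with bumps spread out by the factor n + 1. Their y-derivatives carry (n + 1)^(-j),
  so the right-hand side vanishes in the limit, while the left-hand side tends to a nonzero multiple
  of the integral of \<open>g\<close>. If \<open>g\<close> is not integrable, its Bochner integral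
  is 0 by convention.\<close>

lemma integral_wderiv_eq_0:
  assumes f: "integrable lborel f" and j: "j > 0" and w: "wderiv 0 j f g"
  shows "(LINT z|lborel. g z) = 0"
proof (cases "integrable lborel g")
  case True
  have [measurable]: "g \<in> borel_measurable borel" "f \<in> borel_measurable borel" using True f by auto
  obtain A where A: "jet A" "A 0 = bump (-1) 1 1" using smooth1_bump unfolding smooth1_def by metis
  have Asupp: "A n x = 0" if "\<bar>x\<bar> > 1" for n x
    by (rule jet_support[OF A(1) _ that]) (auto simp: A(2) intro!: bump_support)
  have "\<exists>C. \<forall>x. norm (A n x) \<le> C" for n
  proof -
    obtain C where C: "\<And>x. norm (A n x) \<le> C * indicator (cball 0 1) x" "C \<ge> 0"
      using continuous_compact_support_bounded[OF jet_continuous[OF A(1)], of 1 n] Asupp by auto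
    have "norm (A n x) \<le> C" for x using C(1)[of x] C(2) by (cases "\<bar>x\<bar> \<le> 1") auto
    then show ?thesis by blast
  qed
  then obtain C where C: "\<And>n x. norm (A n x) \<le> C n" by metis
  define c where "c n = 1 / real (Suc n)" for n
  have c0: "c \<longlonglongrightarrow> 0" unfolding c_def[abs_def] by (rule LIMSEQ_Suc[OF lim_1_over_n])
  let ?A = "\<lambda>n i x. c n ^ i *\<^sub>R A i (c n * x)"
  let ?\<phi> = "\<lambda>n z. ?A n 0 (fst z) * ?A n 0 (snd z)"
  have t: "test_fun (?\<phi> n)" for n
  proof (rule test_fun_tensor[where R="real (Suc n)"])
    show "?A n 0 x = 0" if "\<bar>x\<bar> > real (Suc n)" for x
    proof -
      have "\<bar>c n * x\<bar> > 1" using that by (simp add: c_def abs_mult divide_simps)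
      then show ?thesis by (simp add: Asupp)
    qed
    then show "?A n 0 x = 0" if "\<bar>x\<bar> > real (Suc n)" for x using that by blast
  qed (use jet_scale[OF A(1)] in auto)
  have eq: "(LINT z|lborel. g z * ?\<phi> n z) = (-1) ^ j * (LINT z|lborel. f z * (?A n 0 (fst z) * ?A n j (snd z)))" for n
    using w t[of n] pdy_power_tensor[OF jet_scale[OF A(1), of "c n"] jet_scale[OF A(1), of "c n"], of j 0 0]
    unfolding wderiv_def by simp
  have Ac: "(\<lambda>n. A i (c n * x)) \<longlonglongrightarrow> A i 0" for i x
    by (rule continuous_on_tendsto_compose[OF jet_continuous[OF A(1)]]) (auto intro!: tendsto_eq_intros c0)
  have Am[measurable]: "A i \<in> borel_measurable borel" for i
    by (intro borel_measurable_continuous_onI jet_continuous A)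
  have mA: "(\<lambda>z. A i (c n * fst z)) \<in> borel_measurable (borel :: (real \<times> real) measure)"
    "(\<lambda>z. A i (c n * snd z)) \<in> borel_measurable (borel :: (real \<times> real) measure)" for i n
    by (rule borel_measurable_continuous_onI, rule continuous_on_compose2[OF jet_continuous[OF A(1)]],
        auto intro!: continuous_intros)+
  have C0: "C n \<ge> 0" for n using C[of n 0] norm_ge_zero order_trans by blast
  have "(\<lambda>n. LINT z|lborel. g z * ?\<phi> n z) \<longlonglongrightarrow> (LINT z|lborel. g z * (A 0 0 * A 0 0))"
  proof (rule integral_dominated_convergence)
    show "integrable lborel (\<lambda>z. C 0 * C 0 * norm (g z))" using True by simp
    show "AE z in lborel. (\<lambda>n. g z * ?\<phi> n z) \<longlonglongrightarrow> g z * (A 0 0 * A 0 0)"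
      using tendsto_mult[OF tendsto_const tendsto_mult[OF Ac Ac]] by simp
    show "AE z in lborel. norm (g z * ?\<phi> n z) \<le> C 0 * C 0 * norm (g z)" for n
    proof (rule AE_I2)
      fix z
      have "norm (?\<phi> n z) \<le> C 0 * C 0" unfolding norm_mult using C[of 0] C0[of 0] by (intro mult_mono) auto
      from mult_right_mono[OF this norm_ge_zero[of "g z"]]
      show "norm (g z * ?\<phi> n z) \<le> C 0 * C 0 * norm (g z)" by (simp add: abs_mult mult_ac)
    qed
    show "(\<lambda>z. g z * ?\<phi> n z) \<in> borel_measurable lborel" for n
      by (intro borel_measurable_times borel_measurable_scaleR borel_measurable_const) (simp_all add: mA)
  qed simp_all
  moreover have "(\<lambda>n. LINT z|lborel. f z * (?A n 0 (fst z) * ?A n j (snd z))) \<longlonglongrightarrow> (LINT z|lborel. f z * (A 0 0 * (0 ^ j * A j 0)))"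
  proof (rule integral_dominated_convergence)
    show "integrable lborel (\<lambda>z. C 0 * C j * norm (f z))" using f by simp
    show "AE z in lborel. (\<lambda>n. f z * (?A n 0 (fst z) * ?A n j (snd z))) \<longlonglongrightarrow> f z * (A 0 0 * (0 ^ j * A j 0))"
      using tendsto_mult[OF tendsto_const tendsto_mult[OF Ac tendsto_mult[OF tendsto_power[OF c0] Ac]]] by simp
    show "AE z in lborel. norm (f z * (?A n 0 (fst z) * ?A n j (snd z))) \<le> C 0 * C j * norm (f z)" for n
    proof (rule AE_I2)
      fix z :: "real \<times> real"
      have c1: "norm (c n ^ j) \<le> 1" by (simp add: c_def power_le_one abs_divide divide_le_eq)
      have "norm (?A n j (snd z)) \<le> 1 * C j"
        unfolding norm_scaleR using c1 C[of j] by (intro mult_mono) (auto simp: C0)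
      then have "norm (?A n 0 (fst z) * ?A n j (snd z)) \<le> C 0 * C j" unfolding norm_mult using C[of 0] C0 by (intro mult_mono) auto
      from mult_right_mono[OF this norm_ge_zero[of "f z"]]
      show "norm (f z * (?A n 0 (fst z) * ?A n j (snd z))) \<le> C 0 * C j * norm (f z)" by (simp add: abs_mult mult_ac)
    qed
    show "(\<lambda>z. f z * (?A n 0 (fst z) * ?A n j (snd z))) \<in> borel_measurable lborel" for n
      by (intro borel_measurable_times borel_measurable_scaleR borel_measurable_const) (simp_all add: mA)
  qed simp_all
  ultimately have "(LINT z|lborel. g z * (A 0 0 * A 0 0)) = (-1) ^ j * (LINT z|lborel. f z * (A 0 0 * (0 ^ j * A j 0)))"
    unfolding eq using tendsto_mult[OF tendsto_const] LIMSEQ_unique by blast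
  then have "(LINT z|lborel. g z) * (A 0 0 * A 0 0) = 0" using j by (simp add: power_0_left)
  \<comment> \<open>The value of the bump at its centre is exp(-1)^2.\<close>
  moreover have "A 0 0 \<noteq> 0" by (simp add: A bump_def exp_inv_def)
  ultimately show ?thesis by simp
qed (simp add: not_integrable_integral_eq)

lemma wderiv_0_AE_eq:
  assumes "wderiv 0 0 f g" and f: "f \<in> borel_measurable borel" "\<And>K. compact K \<Longrightarrow> set_integrable lborel K f"
  shows "AE z in lborel. g z = f z"
proof -
  have g: "g \<in> borel_measurable borel" "\<And>K. compact K \<Longrightarrow> set_integrable lborel K g"
    and eq: "\<And>\<phi>. test_fun \<phi> \<Longrightarrow> (LINT z|lborel. g z * \<phi> z) = (LINT z|lborel. f z * \<phi> z)"
    using assms(1) by (auto simp: wderiv_def)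
  have "AE z in lborel. g z - f z = 0"
  proof (rule du_Bois_Reymond)
    fix \<phi> assume t: "test_fun \<phi>"
    obtain C R where CR: "\<And>z. \<bar>\<phi> z\<bar> \<le> C * indicator (cball 0 R) z" using test_fun_bounded[OF t] by metis
    show "(LINT z|lborel. (g z - f z) * \<phi> z) = 0"
      using eq[OF t] integrable_mult_bounded_support[OF g test_fun_borel[OF t] CR bounded_cball]
        integrable_mult_bounded_support[OF f test_fun_borel[OF t] CR bounded_cball]
      by (simp add: algebra_simps)
  qed (use f g set_integral_diff(1) in auto)
  then show ?thesis by simp
qed

lemma wd_wderiv: "wderiv k j f g \<Longrightarrow> wderiv k j f (wd k j f)"
  unfolding wd_def by (rule someI[of "wderiv k j f"])

section \<open>Differentiating the inverse transform\<close>

text \<open>Brings derivatives into the form of limits of quotients, where sequences and dominated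
  convergence apply.\<close>

lemma has_vector_derivative_iff_quotient:
  fixes f :: "real \<Rightarrow> 'a::real_normed_vector"
  shows "(f has_vector_derivative y) (at x within S) \<longleftrightarrow> ((\<lambda>r. (f r - f x) /\<^sub>R (r - x)) \<longlongrightarrow> y) (at x within S)"
proof -
  have "(f has_vector_derivative y) (at x within S) \<longleftrightarrow>
      ((\<lambda>r. norm (f r - f x - (r - x) *\<^sub>R y) / norm (r - x)) \<longlongrightarrow> 0) (at x within S)"
    unfolding has_vector_derivative_def has_derivative_iff_norm by (simp add: bounded_linear_scaleR_left)
  also have "\<dots> \<longleftrightarrow> ((\<lambda>r. norm ((f r - f x) /\<^sub>R (r - x) - y)) \<longlongrightarrow> 0) (at x within S)"
  proof (rule Lim_cong_within[OF refl refl refl])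
    fix r assume "r \<noteq> x"
    then have "(f r - f x) /\<^sub>R (r - x) - y = (f r - f x - (r - x) *\<^sub>R y) /\<^sub>R (r - x)"
      by (simp add: scaleR_diff_right)
    then show "norm (f r - f x - (r - x) *\<^sub>R y) / norm (r - x) = norm ((f r - f x) /\<^sub>R (r - x) - y)"
      by (simp add: divide_inverse mult.commute)
  qed
  also have "\<dots> \<longleftrightarrow> ((\<lambda>r. (f r - f x) /\<^sub>R (r - x)) \<longlongrightarrow> y) (at x within S)"
    by (simp add: tendsto_norm_zero_iff LIM_zero_iff)
  finally show ?thesis .
qed

lemma norm_cis_minus_1_le: "norm (cis t - 1) \<le> \<bar>t\<bar>"
  using iexp_approx1[of t 0] by (simp add: cis_conv_exp)

text \<open>Differentiation under the integral: |cis t - 1| \<le> |t| bounds the difference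
  quotients of the phase by the integrable derivative weight.\<close>

lemma ifourier_directional_derivative:
  assumes g: "integrable lborel g" and g': "integrable lborel (\<lambda>\<zeta>. \<i> * of_real (e \<bullet> \<zeta>) * g \<zeta>)"
  shows "((\<lambda>r. ifourier g (z + r *\<^sub>R e)) has_vector_derivative ifourier (\<lambda>\<zeta>. \<i> * of_real (e \<bullet> \<zeta>) * g \<zeta>) z) (at 0)"
  unfolding has_vector_derivative_iff_quotient tendsto_at_iff_sequentially
proof (intro allI impI)
  fix X :: "nat \<Rightarrow> real" assume X: "\<forall>i. X i \<in> UNIV - {0}" "X \<longlonglongrightarrow> 0"
  have [measurable]: "g \<in> borel_measurable borel" using g by simp
  let ?q = "\<lambda>n \<zeta>. (cis (X n * (\<zeta> \<bullet> e)) - 1) /\<^sub>R X n * (cis (\<zeta> \<bullet> z) * g \<zeta>)"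
  have 1: "(\<lambda>n. LINT \<zeta>|lborel. ?q n \<zeta>) \<longlonglongrightarrow> (LINT \<zeta>|lborel. (\<i> * of_real (\<zeta> \<bullet> e)) * (cis (\<zeta> \<bullet> z) * g \<zeta>))"
  proof (rule integral_dominated_convergence)
    show "integrable lborel (\<lambda>\<zeta>. norm (\<i> * of_real (e \<bullet> \<zeta>) * g \<zeta>))" by (intro integrable_norm g')
    show "AE \<zeta> in lborel. (\<lambda>n. ?q n \<zeta>) \<longlonglongrightarrow> (\<i> * of_real (\<zeta> \<bullet> e)) * (cis (\<zeta> \<bullet> z) * g \<zeta>)"
    proof (intro AE_I2 tendsto_mult tendsto_const)
      fix \<zeta> :: "real \<times> real"
      have "((\<lambda>r. cis (r * (\<zeta> \<bullet> e))) has_vector_derivative \<i> * of_real (\<zeta> \<bullet> e)) (at 0)"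
        unfolding has_vector_derivative_def
        by (rule derivative_eq_intros | simp add: scaleR_conv_of_real mult_ac)+
      then show "(\<lambda>n. (cis (X n * (\<zeta> \<bullet> e)) - 1) /\<^sub>R X n) \<longlonglongrightarrow> \<i> * of_real (\<zeta> \<bullet> e)"
        unfolding has_vector_derivative_iff_quotient tendsto_at_iff_sequentially using X by (auto simp: o_def)
    qed
    show "AE \<zeta> in lborel. norm (?q n \<zeta>) \<le> norm (\<i> * of_real (e \<bullet> \<zeta>) * g \<zeta>)" for n
    proof (rule AE_I2)
      fix \<zeta> :: "real \<times> real"
      have "X n \<noteq> 0" using X by auto
      then have "norm ((cis (X n * (\<zeta> \<bullet> e)) - 1) /\<^sub>R X n) \<le> \<bar>\<zeta> \<bullet> e\<bar>"
        using norm_cis_minus_1_le[of "X n * (\<zeta> \<bullet> e)"]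
        by (simp only: norm_scaleR abs_inverse abs_mult) (simp add: field_simps)
      from mult_right_mono[OF this norm_ge_zero[of "g \<zeta>"]]
      show "norm (?q n \<zeta>) \<le> norm (\<i> * of_real (e \<bullet> \<zeta>) * g \<zeta>)" by (simp add: norm_mult inner_commute mult.assoc)
    qed
  qed auto
  have 2: "(ifourier g (z + X n *\<^sub>R e) - ifourier g z) /\<^sub>R X n = of_real (1 / (2 * pi)) * (LINT \<zeta>|lborel. ?q n \<zeta>)" for n
  proof -
    have "(LINT \<zeta>|lborel. cis (\<zeta> \<bullet> (z + X n *\<^sub>R e)) * g \<zeta>) - (LINT \<zeta>|lborel. cis (\<zeta> \<bullet> z) * g \<zeta>)
       = (LINT \<zeta>|lborel. cis (\<zeta> \<bullet> (z + X n *\<^sub>R e)) * g \<zeta> - cis (\<zeta> \<bullet> z) * g \<zeta>)"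
      by (rule Bochner_Integration.integral_diff[symmetric]) (intro integrable_cis_mult g, measurable)+
    also have "\<dots> = (LINT \<zeta>|lborel. of_real (X n) * ?q n \<zeta>)"
    proof (rule Bochner_Integration.integral_cong[OF refl])
      fix \<zeta> :: "real \<times> real"
      have "X n \<noteq> 0" using X by auto
      then show "cis (\<zeta> \<bullet> (z + X n *\<^sub>R e)) * g \<zeta> - cis (\<zeta> \<bullet> z) * g \<zeta> = of_real (X n) * ?q n \<zeta>"
        by (simp add: inner_add_right cis_mult[symmetric] scaleR_conv_of_real field_simps)
    qed
    also have "\<dots> = of_real (X n) * (LINT \<zeta>|lborel. ?q n \<zeta>)" by (rule integral_mult_right_zero)
    finally have eq: "(LINT \<zeta>|lborel. cis (\<zeta> \<bullet> (z + X n *\<^sub>R e)) * g \<zeta>) - (LINT \<zeta>|lborel. cis (\<zeta> \<bullet> z) * g \<zeta>)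
       = of_real (X n) * (LINT \<zeta>|lborel. ?q n \<zeta>)" .
    have "X n \<noteq> 0" using X by auto
    then show ?thesis
      unfolding ifourier_eq right_diff_distrib[symmetric] eq by (simp add: scaleR_conv_of_real)
  qed
  have 3: "ifourier (\<lambda>\<zeta>. \<i> * of_real (e \<bullet> \<zeta>) * g \<zeta>) z
      = of_real (1 / (2 * pi)) * (LINT \<zeta>|lborel. (\<i> * of_real (\<zeta> \<bullet> e)) * (cis (\<zeta> \<bullet> z) * g \<zeta>))"
    unfolding ifourier_eq by (simp add: mult_ac inner_commute)
  show "((\<lambda>r. (ifourier g (z + r *\<^sub>R e) - ifourier g (z + 0 *\<^sub>R e)) /\<^sub>R (r - 0)) \<circ> X)
      \<longlonglongrightarrow> ifourier (\<lambda>\<zeta>. \<i> * of_real (e \<bullet> \<zeta>) * g \<zeta>) z"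
    unfolding o_def diff_zero scaleR_zero_left add_0_right 2 3 by (rule tendsto_mult[OF tendsto_const 1])
qed

section \<open>Sobolev weights\<close>

lemma jbr_ge_1: "jbr \<zeta> \<ge> 1"
  by (simp add: jbr_def)

lemma jbr_borel [measurable]: "jbr \<in> borel_measurable borel"
  unfolding jbr_def[abs_def] by (intro borel_measurable_continuous_onI continuous_intros)

text \<open>The square of \<open>jbr\<close> dominates the product (1 + xi^2)(1 + eta^2), whose
  inverse is a tensor product of integrable functions. This is why integrability of a transform
  costs two powers of \<open>jbr\<close> below.\<close>

lemma integrable_jbr: "integrable lborel (\<lambda>\<zeta>. 1 / (jbr \<zeta>)\<^sup>2)"
proof (rule Bochner_Integration.integrable_bound)
  have "integrable lborel (\<lambda>x::real. inverse (1 + x\<^sup>2))"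
    using integrable_inverse_1_plus_square by (simp add: set_integrable_def einterval_def)
  then show "integrable lborel (\<lambda>z::real \<times> real. inverse (1 + (fst z)\<^sup>2) * inverse (1 + (snd z)\<^sup>2))"
    by (intro integrable_tensor2)
  show "AE \<zeta> in lborel. norm (1 / (jbr \<zeta>)\<^sup>2) \<le> norm (inverse (1 + (fst \<zeta>)\<^sup>2) * inverse (1 + (snd \<zeta>)\<^sup>2))"
  proof (rule AE_I2)
    fix \<zeta> :: "real \<times> real"
    have "(1 + (fst \<zeta>)\<^sup>2) * (1 + (snd \<zeta>)\<^sup>2) \<le> jbr \<zeta> * jbr \<zeta>"
      by (intro mult_mono) (auto simp: jbr_def)
    moreover have "0 < (1 + (fst \<zeta>)\<^sup>2) * (1 + (snd \<zeta>)\<^sup>2)"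
      by (intro mult_pos_pos) (auto simp: add_pos_nonneg)
    ultimately have "1 / (jbr \<zeta> * jbr \<zeta>) \<le> 1 / ((1 + (fst \<zeta>)\<^sup>2) * (1 + (snd \<zeta>)\<^sup>2))"
      using jbr_ge_1[of \<zeta>] by (intro divide_left_mono) auto
    then show "norm (1 / (jbr \<zeta>)\<^sup>2) \<le> norm (inverse (1 + (fst \<zeta>)\<^sup>2) * inverse (1 + (snd \<zeta>)\<^sup>2))"
      using \<open>0 < (1 + (fst \<zeta>)\<^sup>2) * (1 + (snd \<zeta>)\<^sup>2)\<close> mult_pos_pos[of "jbr \<zeta>" "jbr \<zeta>"] jbr_ge_1[of \<zeta>]
      unfolding inverse_mult_distrib[symmetric] power2_eq_square[of "jbr \<zeta>"]
      by (simp only: inverse_eq_divide real_norm_def abs_divide abs_one abs_of_pos)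
  qed
qed simp

lemma power_le_jbr_powr:
  assumes "real n \<le> s" shows "jbr \<zeta> ^ n \<le> jbr \<zeta> powr s"
  using powr_mono[OF assms jbr_ge_1[of \<zeta>]] jbr_ge_1[of \<zeta>] by (simp add: powr_realpow)

context
  fixes s :: real and g m :: "real \<times> real \<Rightarrow> complex"
  assumes g[measurable]: "g \<in> borel_measurable borel" and W: "integrable lborel (\<lambda>\<zeta>. jbr \<zeta> powr s * (norm (g \<zeta>))\<^sup>2)"
    and m[measurable]: "m \<in> borel_measurable borel"
begin

lemma L2c_weight:
  assumes le: "\<And>\<zeta>. (norm (m \<zeta>))\<^sup>2 \<le> jbr \<zeta> powr s"
  shows "L2c (\<lambda>\<zeta>. m \<zeta> * g \<zeta>)"
    and "(LINT \<zeta>|lborel. (norm (m \<zeta> * g \<zeta>))\<^sup>2) \<le> (LINT \<zeta>|lborel. jbr \<zeta> powr s * (norm (g \<zeta>))\<^sup>2)"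
proof -
  have le': "(norm (m \<zeta> * g \<zeta>))\<^sup>2 \<le> jbr \<zeta> powr s * (norm (g \<zeta>))\<^sup>2" for \<zeta>
    unfolding norm_mult power_mult_distrib by (intro mult_right_mono le) auto
  have i: "integrable lborel (\<lambda>\<zeta>. (norm (m \<zeta> * g \<zeta>))\<^sup>2)"
    by (rule Bochner_Integration.integrable_bound[OF W]) (use le' in auto)
  then show "L2c (\<lambda>\<zeta>. m \<zeta> * g \<zeta>)" by (simp add: L2c_def)
  show "(LINT \<zeta>|lborel. (norm (m \<zeta> * g \<zeta>))\<^sup>2) \<le> (LINT \<zeta>|lborel. jbr \<zeta> powr s * (norm (g \<zeta>))\<^sup>2)"
    by (rule integral_mono[OF i W]) (use le' in auto)
qed

text \<open>Cauchy-Schwarz in additive form: |m g| is split as (1 / jbr) times (jbr |m g|) and 2 a b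
  \<le> a^2 + b^2 is used pointwise. The sum on the right is what \<open>Kinf\<close>
  records.\<close>

lemma integrable_weight:
  assumes le: "\<And>\<zeta>. (jbr \<zeta>)\<^sup>2 * (norm (m \<zeta>))\<^sup>2 \<le> jbr \<zeta> powr s"
  shows "integrable lborel (\<lambda>\<zeta>. m \<zeta> * g \<zeta>)"
    and "(LINT \<zeta>|lborel. norm (m \<zeta> * g \<zeta>)) \<le> (LINT \<zeta>|lborel. 1 / (jbr \<zeta>)\<^sup>2) + (LINT \<zeta>|lborel. jbr \<zeta> powr s * (norm (g \<zeta>))\<^sup>2)"
proof -
  have le': "norm (m \<zeta> * g \<zeta>) \<le> 1 / (jbr \<zeta>)\<^sup>2 + jbr \<zeta> powr s * (norm (g \<zeta>))\<^sup>2" for \<zeta>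
  proof -
    have j: "jbr \<zeta> > 0" using jbr_ge_1[of \<zeta>] by linarith
    have "2 * (1 / jbr \<zeta>) * (jbr \<zeta> * norm (m \<zeta> * g \<zeta>)) \<le> (1 / jbr \<zeta>)\<^sup>2 + (jbr \<zeta> * norm (m \<zeta> * g \<zeta>))\<^sup>2"
      by (rule sum_squares_bound)
    then have "2 * norm (m \<zeta> * g \<zeta>) \<le> 1 / (jbr \<zeta>)\<^sup>2 + (jbr \<zeta>)\<^sup>2 * (norm (m \<zeta>))\<^sup>2 * (norm (g \<zeta>))\<^sup>2"
      using j by (simp add: power_mult_distrib norm_mult power_one_over mult.assoc)
    also have "\<dots> \<le> 1 / (jbr \<zeta>)\<^sup>2 + jbr \<zeta> powr s * (norm (g \<zeta>))\<^sup>2"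
      by (intro add_left_mono mult_right_mono le) auto
    finally show ?thesis using norm_ge_zero[of "m \<zeta> * g \<zeta>"] by linarith
  qed
  have b: "integrable lborel (\<lambda>\<zeta>. 1 / (jbr \<zeta>)\<^sup>2 + jbr \<zeta> powr s * (norm (g \<zeta>))\<^sup>2)"
    by (intro Bochner_Integration.integrable_add integrable_jbr W)
  show i: "integrable lborel (\<lambda>\<zeta>. m \<zeta> * g \<zeta>)"
    by (rule Bochner_Integration.integrable_bound[OF b _ AE_I2])
       (use le' in \<open>auto intro: order_trans[OF _ abs_ge_self]\<close>)
  have "(LINT \<zeta>|lborel. norm (m \<zeta> * g \<zeta>)) \<le> (LINT \<zeta>|lborel. 1 / (jbr \<zeta>)\<^sup>2 + jbr \<zeta> powr s * (norm (g \<zeta>))\<^sup>2)"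
    by (rule integral_mono[OF integrable_norm[OF i] b]) (use le' in auto)
  then show "(LINT \<zeta>|lborel. norm (m \<zeta> * g \<zeta>)) \<le> (LINT \<zeta>|lborel. 1 / (jbr \<zeta>)\<^sup>2) + (LINT \<zeta>|lborel. jbr \<zeta> powr s * (norm (g \<zeta>))\<^sup>2)"
    by (simp add: integrable_jbr W)
qed

end

text \<open>Transfers the weighted bound from the transform witnessing membership to the chosen
  \<open>fourierL2 f\<close>, which agrees with it almost everywhere.\<close>

lemma HsD:
  assumes "f \<in> Hs s"
  shows "is_FT (\<lambda>z. complex_of_real (f z)) (fourierL2 f)"
    and "integrable lborel (\<lambda>\<zeta>. jbr \<zeta> powr s * (cmod (fourierL2 f \<zeta>))\<^sup>2)"
    and "(Hs_norm s f)\<^sup>2 = (LINT \<zeta>|lborel. jbr \<zeta> powr s * (cmod (fourierL2 f \<zeta>))\<^sup>2)"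
proof -
  obtain g where g: "is_FT (\<lambda>z. complex_of_real (f z)) g"
      "(\<integral>\<^sup>+\<zeta>. ennreal (jbr \<zeta> powr s * (cmod (g \<zeta>))\<^sup>2) \<partial>lborel) < \<infinity>"
    using assms unfolding Hs_def by blast
  show F: "is_FT (\<lambda>z. complex_of_real (f z)) (fourierL2 f)" by (rule fourierL2_is_FT[OF g(1)])
  have [measurable]: "fourierL2 f \<in> borel_measurable borel" using is_FT_L2c(2)[OF F] by (rule L2c_borel)
  have "(\<integral>\<^sup>+\<zeta>. ennreal (jbr \<zeta> powr s * (cmod (fourierL2 f \<zeta>))\<^sup>2) \<partial>lborel)
      = (\<integral>\<^sup>+\<zeta>. ennreal (jbr \<zeta> powr s * (cmod (g \<zeta>))\<^sup>2) \<partial>lborel)"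
    using fourierL2_AE_eq[OF g(1)] by (intro nn_integral_cong_AE) (auto elim: eventually_mono)
  then show "integrable lborel (\<lambda>\<zeta>. jbr \<zeta> powr s * (cmod (fourierL2 f \<zeta>))\<^sup>2)"
    using g(2) unfolding integrable_iff_bounded by simp
  show "(Hs_norm s f)\<^sup>2 = (LINT \<zeta>|lborel. jbr \<zeta> powr s * (cmod (fourierL2 f \<zeta>))\<^sup>2)"
    unfolding Hs_norm_def by (subst real_sqrt_pow2) (auto intro!: integral_nonneg_AE)
qed

lemma XsD:
  assumes f: "f \<in> Xs s"
  shows "f \<in> Hs s"
    and "integrable lborel (\<lambda>\<zeta>. jbr \<zeta> powr s * (cmod (fourierL2 f \<zeta> / (\<i> * of_real (fst \<zeta>))))\<^sup>2)"
    and "is_FT (\<lambda>z. complex_of_real (dxinv f z)) (\<lambda>\<zeta>. fourierL2 f \<zeta> / (\<i> * of_real (fst \<zeta>)))"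
proof -
  show H: "f \<in> Hs s" using f by (simp add: Xs_def)
  note F = HsD(1)[OF H]
  have [measurable]: "fourierL2 f \<in> borel_measurable borel" using is_FT_L2c(2)[OF F] by (rule L2c_borel)
  obtain g where g: "is_FT (\<lambda>z. complex_of_real (g z)) (\<lambda>\<zeta>. fourierL2 f \<zeta> / (\<i> * of_real (fst \<zeta>)))" "g \<in> Hs s"
    using f unfolding Xs_def by blast
  have gm: "(\<lambda>\<zeta>. fourierL2 f \<zeta> / (\<i> * of_real (fst \<zeta>))) \<in> borel_measurable borel"
    using is_FT_L2c(2)[OF g(1)] by (rule L2c_borel)
  have "integrable lborel (\<lambda>\<zeta>. jbr \<zeta> powr s * (cmod (fourierL2 g \<zeta>))\<^sup>2)" by (rule HsD(2)[OF g(2)])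
  moreover have "fourierL2 g \<in> borel_measurable borel"
    using is_FT_L2c(2)[OF HsD(1)[OF g(2)]] by (rule L2c_borel)
  ultimately show "integrable lborel (\<lambda>\<zeta>. jbr \<zeta> powr s * (cmod (fourierL2 f \<zeta> / (\<i> * of_real (fst \<zeta>))))\<^sup>2)"
    using gm fourierL2_AE_eq[OF g(1)]
    by (subst integrable_cong_AE[of _ _ "\<lambda>\<zeta>. jbr \<zeta> powr s * (cmod (fourierL2 g \<zeta>))\<^sup>2"]) (auto elim: eventually_mono)
  have "is_FT (\<lambda>z. complex_of_real (g z)) (\<lambda>\<zeta>. (1 / (\<i> * of_real (fst \<zeta>))) * fourierL2 f \<zeta>)"
    using g(1) by (simp add: mult.commute)
  then have "is_FT (\<lambda>z. complex_of_real (dxinv f z)) (\<lambda>\<zeta>. (1 / (\<i> * of_real (fst \<zeta>))) * fourierL2 f \<zeta>)"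
    unfolding dxinv_def fmult_def
    by (rule someI[where P="\<lambda>g. is_FT (\<lambda>z. complex_of_real (g z)) (\<lambda>\<zeta>. (1 / (\<i> * of_real (fst \<zeta>))) * fourierL2 f \<zeta>)"])
  then show "is_FT (\<lambda>z. complex_of_real (dxinv f z)) (\<lambda>\<zeta>. fourierL2 f \<zeta> / (\<i> * of_real (fst \<zeta>)))"
    by simp
qed

section \<open>The symbol, the continuous representative and the linear terms\<close>

text \<open>With these signs the linear flow multiplies the transform by
  \<open>exp (t * symb)\<close>. On the null line xi = 0 the quotient is 0 by the convention for
  division.\<close>

definition symb :: "real \<Rightarrow> real \<Rightarrow> real \<times> real \<Rightarrow> complex" where
  "symb \<epsilon> \<nu> \<zeta> = - of_real (\<nu> * (fst \<zeta>)\<^sup>2) + \<i> * of_real ((fst \<zeta>) ^ 3 - \<epsilon> * (snd \<zeta>)\<^sup>2 / fst \<zeta>)"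

text \<open>The continuous representative of a real function whose transform is integrable; the
  discarded imaginary part is zero almost everywhere.\<close>

definition smoothed :: "r2fun \<Rightarrow> r2fun" where
  "smoothed f = (\<lambda>z. Re (ifourier (fourierL2 f) z))"

definition smoothed_x :: "r2fun \<Rightarrow> r2fun" where
  "smoothed_x f = (\<lambda>z. Re (ifourier (\<lambda>\<zeta>. \<i> * of_real (fst \<zeta>) * fourierL2 f \<zeta>) z))"

text \<open>The bound on the supremum that \<open>integrable_weight\<close> gives when
  \<open>b\<close> is the squared Sobolev norm; 1 / (2 pi) is the normalisation of the
  transform.\<close>

definition Kinf :: "real \<Rightarrow> real" where
  "Kinf b = ((LINT \<zeta>|lborel. 1 / (jbr \<zeta>)\<^sup>2) + b) / (2 * pi)"

lemma fst_borel2 [measurable]: "(fst :: real \<times> real \<Rightarrow> real) \<in> borel_measurable borel"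
  and snd_borel2 [measurable]: "(snd :: real \<times> real \<Rightarrow> real) \<in> borel_measurable borel"
  by (intro borel_measurable_continuous_onI continuous_intros)+

lemma fst_snd_sq_le_jbr: "(fst \<zeta>)\<^sup>2 \<le> jbr \<zeta>" "(snd \<zeta>)\<^sup>2 \<le> jbr \<zeta>"
  by (auto simp: jbr_def)

lemma fst_snd_power_le_jbr: "(fst \<zeta>) ^ (2 * n) \<le> jbr \<zeta> ^ n" "(snd \<zeta>) ^ (2 * n) \<le> jbr \<zeta> ^ n"
  by (simp_all add: power_mult power_mono fst_snd_sq_le_jbr)

text \<open>The squared multiplier eta^(2 i) is at most jbr^i, and integrability costs two more
  powers, whence \<open>real i + 2 \<le> s\<close>.\<close>

lemma integrable_ypower_fourierL2:
  assumes f: "f \<in> Hs s" and s: "real i + 2 \<le> s"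
  shows "integrable lborel (\<lambda>\<zeta>. (\<i> * of_real (snd \<zeta>)) ^ i * fourierL2 f \<zeta>)"
proof (rule integrable_weight(1)[OF _ HsD(2)[OF f]])
  show "fourierL2 f \<in> borel_measurable borel" using is_FT_L2c(2)[OF HsD(1)[OF f]] by (rule L2c_borel)
  fix \<zeta>
  have "(jbr \<zeta>)\<^sup>2 * (cmod ((\<i> * of_real (snd \<zeta>)) ^ i))\<^sup>2 = (jbr \<zeta>)\<^sup>2 * (snd \<zeta>) ^ (2 * i)"
    by (simp add: norm_power norm_mult power_mult[symmetric] mult.commute[of i 2])
       (simp add: power_mult)
  also have "\<dots> \<le> (jbr \<zeta>)\<^sup>2 * jbr \<zeta> ^ i"
    by (intro mult_left_mono fst_snd_power_le_jbr) auto
  also have "\<dots> \<le> jbr \<zeta> powr s"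
    using power_le_jbr_powr[of "2 + i" s \<zeta>] s by (simp add: power2_eq_square mult.assoc)
  finally show "(jbr \<zeta>)\<^sup>2 * (cmod ((\<i> * of_real (snd \<zeta>)) ^ i))\<^sup>2 \<le> jbr \<zeta> powr s" .
qed simp

lemma ydiff_smoothed:
  assumes f: "f \<in> Hs s" and s: "real k + 2 \<le> s"
  shows "ydiff k (smoothed f)"
proof -
  \<comment> \<open>Generalised over the number \<open>i\<close> of derivatives already taken; the
    total order stays below a fixed \<open>n\<close> that the regularity can afford.\<close>
  have "ydiff k (\<lambda>z. Re (ifourier (\<lambda>\<zeta>. (\<i> * of_real (snd \<zeta>)) ^ i * fourierL2 f \<zeta>) z))" if "i + k \<le> n" "real n + 2 \<le> s" for i n
    using that
  proof (induction k arbitrary: i)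
    case 0
    have "integrable lborel (\<lambda>\<zeta>. (\<i> * of_real (snd \<zeta>)) ^ i * fourierL2 f \<zeta>)"
      by (rule integrable_ypower_fourierL2[OF f]) (use 0 in auto)
    then show ?case by (auto intro!: continuous_intros continuous_ifourier)
  next
    case (Suc k)
    let ?g = "\<lambda>\<zeta>. (\<i> * of_real (snd \<zeta>)) ^ i * fourierL2 f \<zeta>"
    have i: "integrable lborel ?g"
      by (rule integrable_ypower_fourierL2[OF f]) (use Suc.prems in auto)
    have "integrable lborel (\<lambda>\<zeta>. (\<i> * of_real (snd \<zeta>)) ^ Suc i * fourierL2 f \<zeta>)"
      by (rule integrable_ypower_fourierL2[OF f]) (use Suc.prems in auto)
    then have i': "integrable lborel (\<lambda>\<zeta>. \<i> * of_real ((0, 1) \<bullet> \<zeta>) * ?g \<zeta>)"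
      by (simp add: inner_prod_def mult.assoc)
    have eq: "(\<lambda>\<zeta>. \<i> * of_real ((0, 1) \<bullet> \<zeta>) * ?g \<zeta>) = (\<lambda>\<zeta>. (\<i> * of_real (snd \<zeta>)) ^ Suc i * fourierL2 f \<zeta>)"
      by (simp add: inner_prod_def mult.assoc)
    show ?case
    proof (rule ydiff_SucI)
      show "continuous_on UNIV (\<lambda>z. Re (ifourier ?g z))"
        by (intro continuous_intros continuous_ifourier i)
      show "((\<lambda>r. Re (ifourier ?g (z + r *\<^sub>R (0, 1)))) has_vector_derivative
          Re (ifourier (\<lambda>\<zeta>. (\<i> * of_real (snd \<zeta>)) ^ Suc i * fourierL2 f \<zeta>) z)) (at 0)" for z
        using bounded_linear.has_vector_derivative[OF bounded_linear_Re ifourier_directional_derivative[OF i i', of z]]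
        unfolding eq .
      show "ydiff k (\<lambda>z. Re (ifourier (\<lambda>\<zeta>. (\<i> * of_real (snd \<zeta>)) ^ Suc i * fourierL2 f \<zeta>) z))"
        by (rule Suc.IH) (use Suc.prems in auto)
    qed
  qed
  from this[of 0 k] s show ?thesis by (simp add: smoothed_def)
qed

context
  fixes f :: r2fun and s :: real
  assumes f: "f \<in> Xs s" and s: "s \<ge> 3"
begin

lemma fourierL2_Xs_borel [measurable]: "fourierL2 f \<in> borel_measurable borel"
  using is_FT_L2c(2)[OF HsD(1)[OF XsD(1)[OF f]]] by (rule L2c_borel)

lemma Xs_borel [measurable]: "f \<in> borel_measurable borel"
proof -
  have "(\<lambda>z. Re (complex_of_real (f z))) \<in> borel_measurable borel"
    using is_FT_L2c(1)[OF HsD(1)[OF XsD(1)[OF f]], THEN L2c_borel] by measurable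
  then show ?thesis by simp
qed

lemmas F = HsD(1)[OF XsD(1)[OF f]]
lemmas W = HsD(2)[OF XsD(1)[OF f]]

lemma integrable_fourierL2: "integrable lborel (fourierL2 f)"
  and integral_fourierL2_le: "(LINT \<zeta>|lborel. norm (fourierL2 f \<zeta>)) \<le> 2 * pi * Kinf ((Hs_norm s f)\<^sup>2)"
proof -
  have le: "(jbr \<zeta>)\<^sup>2 * (norm (1 :: complex))\<^sup>2 \<le> jbr \<zeta> powr s" for \<zeta>
    using power_le_jbr_powr[of 2 s \<zeta>] s by simp
  show "integrable lborel (fourierL2 f)"
    using integrable_weight(1)[OF fourierL2_Xs_borel W _ le] by simp
  show "(LINT \<zeta>|lborel. norm (fourierL2 f \<zeta>)) \<le> 2 * pi * Kinf ((Hs_norm s f)\<^sup>2)"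
    using integrable_weight(2)[OF fourierL2_Xs_borel W _ le] HsD(3)[OF XsD(1)[OF f]]
    by (simp add: Kinf_def)
qed

lemma L2_fourierL2_le: "(LINT \<zeta>|lborel. (norm (fourierL2 f \<zeta>))\<^sup>2) \<le> (Hs_norm s f)\<^sup>2"
proof -
  have le: "(norm (1 :: complex))\<^sup>2 \<le> jbr \<zeta> powr s" for \<zeta>
    using power_le_jbr_powr[of 0 s \<zeta>] s jbr_ge_1[of \<zeta>] by simp
  show ?thesis
    using L2c_weight(2)[OF fourierL2_Xs_borel W _ le] HsD(3)[OF XsD(1)[OF f]] by simp
qed

lemma AE_eq_smoothed: "AE z in lborel. f z = smoothed f z"
  using is_FT_inversion[OF F integrable_fourierL2]
  by eventually_elim (simp add: smoothed_def complex_eq_iff)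

lemma smoothed_bound: "\<bar>smoothed f z\<bar> \<le> Kinf ((Hs_norm s f)\<^sup>2)"
proof -
  have "\<bar>smoothed f z\<bar> \<le> norm (ifourier (fourierL2 f) z)" unfolding smoothed_def by (rule abs_Re_le_cmod)
  also have "\<dots> \<le> (LINT \<zeta>|lborel. norm (fourierL2 f \<zeta>)) / (2 * pi)" by (rule norm_ifourier_le)
  also have "\<dots> \<le> Kinf ((Hs_norm s f)\<^sup>2)" using integral_fourierL2_le by (simp add: divide_le_eq mult.commute)
  finally show ?thesis .
qed

lemma continuous_smoothed: "continuous_on UNIV (smoothed f)"
  unfolding smoothed_def by (intro continuous_intros continuous_ifourier integrable_fourierL2)

lemma smoothed_borel [measurable]: "smoothed f \<in> borel_measurable borel"
  by (intro borel_measurable_continuous_onI continuous_smoothed)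

lemma integrable_square: "integrable lborel (\<lambda>z. (f z)\<^sup>2)"
  using is_FT_L2c(1)[OF F] by (simp add: L2c_def)

lemma integral_square_le: "(LINT z|lborel. (f z)\<^sup>2) \<le> (Hs_norm s f)\<^sup>2"
proof -
  have "(LINT z|lborel. (f z)\<^sup>2) = (LINT z|lborel. (norm (ifourier (fourierL2 f) z))\<^sup>2)"
  proof (rule integral_cong_AE)
    show "AE z in lborel. (f z)\<^sup>2 = (norm (ifourier (fourierL2 f) z))\<^sup>2"
      using is_FT_inversion[OF F integrable_fourierL2] by eventually_elim (metis norm_of_real power2_abs)
  qed (use integrable_fourierL2 in auto)
  also have "\<dots> \<le> (LINT z|lborel. (norm (fourierL2 f z))\<^sup>2)"
    by (rule Bessel_ifourier_real[OF integrable_fourierL2 is_FT_L2c(2)[OF F]])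
  also have "\<dots> \<le> (Hs_norm s f)\<^sup>2" by (rule L2_fourierL2_le)
  finally show ?thesis .
qed

lemma integrable_x_fourierL2: "integrable lborel (\<lambda>\<zeta>. \<i> * of_real (fst \<zeta>) * fourierL2 f \<zeta>)"
proof (rule integrable_weight(1)[OF fourierL2_Xs_borel W])
  show "(jbr \<zeta>)\<^sup>2 * (norm (\<i> * complex_of_real (fst \<zeta>)))\<^sup>2 \<le> jbr \<zeta> powr s" for \<zeta>
  proof -
    have "(jbr \<zeta>)\<^sup>2 * (fst \<zeta>)\<^sup>2 \<le> (jbr \<zeta>)\<^sup>2 * jbr \<zeta>"
      by (intro mult_left_mono fst_snd_sq_le_jbr) auto
    also have "\<dots> \<le> jbr \<zeta> powr s" using power_le_jbr_powr[of 3 s \<zeta>] s by (simp add: power3_eq_cube power2_eq_square)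
    finally show ?thesis by (simp add: norm_mult)
  qed
qed simp

text \<open>The cube of \<open>jbr\<close> is what s \<ge> 3 allows, and xi^3 from the dispersive
  term uses it fully.\<close>

lemma fmult_Xs:
  assumes m[measurable]: "m \<in> borel_measurable borel" and herm: "\<And>\<zeta>. cnj (m (- \<zeta>)) = m \<zeta>"
    and le: "\<And>\<zeta>. (norm (m \<zeta>))\<^sup>2 \<le> jbr \<zeta> ^ 3"
  shows "is_FT (\<lambda>z. complex_of_real (fmult m f z)) (\<lambda>\<zeta>. m \<zeta> * fourierL2 f \<zeta>)"
proof (rule fmult_is_FT(1)[OF F m _ herm])
  show "L2c (\<lambda>\<zeta>. m \<zeta> * fourierL2 f \<zeta>)"
  proof (rule L2c_weight(1)[OF fourierL2_Xs_borel W m])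
    show "(norm (m \<zeta>))\<^sup>2 \<le> jbr \<zeta> powr s" for \<zeta>
      using le[of \<zeta>] power_le_jbr_powr[of 3 s \<zeta>] s by simp
  qed
qed

lemma fmult_x: "is_FT (\<lambda>z. complex_of_real (fmult (\<lambda>\<zeta>. \<i> * complex_of_real (fst \<zeta>)) f z)) (\<lambda>\<zeta>. \<i> * complex_of_real (fst \<zeta>) * fourierL2 f \<zeta>)"
proof (rule fmult_Xs)
  show "(norm (\<i> * complex_of_real (fst \<zeta>)))\<^sup>2 \<le> jbr \<zeta> ^ 3" for \<zeta>
    using fst_snd_sq_le_jbr(1)[of \<zeta>] power_increasing[of 1 3 "jbr \<zeta>"] jbr_ge_1[of \<zeta>] by (simp add: norm_mult)
qed auto

lemma fmult_xx: "is_FT (\<lambda>z. complex_of_real (fmult (\<lambda>\<zeta>. (\<i> * complex_of_real (fst \<zeta>)) ^ 2) f z)) (\<lambda>\<zeta>. (\<i> * complex_of_real (fst \<zeta>)) ^ 2 * fourierL2 f \<zeta>)"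
proof (rule fmult_Xs)
  show "(norm ((\<i> * complex_of_real (fst \<zeta>)) ^ 2))\<^sup>2 \<le> jbr \<zeta> ^ 3" for \<zeta>
    using fst_snd_power_le_jbr(1)[of \<zeta> 2] power_increasing[of 2 3 "jbr \<zeta>"] jbr_ge_1[of \<zeta>]
    by (simp add: norm_mult norm_power)
qed auto

lemma fmult_xxx: "is_FT (\<lambda>z. complex_of_real (fmult (\<lambda>\<zeta>. (\<i> * complex_of_real (fst \<zeta>)) ^ 3) f z)) (\<lambda>\<zeta>. (\<i> * complex_of_real (fst \<zeta>)) ^ 3 * fourierL2 f \<zeta>)"
proof (rule fmult_Xs)
  show "(norm ((\<i> * complex_of_real (fst \<zeta>)) ^ 3))\<^sup>2 \<le> jbr \<zeta> ^ 3" for \<zeta>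
    using fst_snd_power_le_jbr(1)[of \<zeta> 3] by (simp add: norm_mult norm_power power_mult[symmetric])
  show "cnj ((\<i> * complex_of_real (fst (- \<zeta>))) ^ 3) = (\<i> * complex_of_real (fst \<zeta>)) ^ 3" for \<zeta> :: "real \<times> real"
    by (simp add: complex_cnj_power)
qed auto

text \<open>The singular factor 1/xi is attached to \<open>fourierL2 f\<close>, where the definition
  of \<open>Xs\<close> controls it with the full Sobolev weight; only the polynomial eta^2 is left
  to estimate.\<close>

lemma fmult_yy_x: "is_FT (\<lambda>z. complex_of_real (fmult (\<lambda>\<zeta>. (\<i> * complex_of_real (snd \<zeta>)) ^ 2 / (\<i> * complex_of_real (fst \<zeta>))) f z))
    (\<lambda>\<zeta>. (\<i> * complex_of_real (snd \<zeta>)) ^ 2 / (\<i> * complex_of_real (fst \<zeta>)) * fourierL2 f \<zeta>)"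
proof (rule fmult_is_FT(1)[OF F])
  let ?g = "\<lambda>\<zeta>. fourierL2 f \<zeta> / (\<i> * complex_of_real (fst \<zeta>))"
  have "L2c (\<lambda>\<zeta>. (\<i> * complex_of_real (snd \<zeta>)) ^ 2 * ?g \<zeta>)"
  proof (rule L2c_weight(1)[OF _ XsD(2)[OF f]])
    show "?g \<in> borel_measurable borel" using is_FT_L2c(2)[OF XsD(3)[OF f]] by (rule L2c_borel)
    show "(norm ((\<i> * complex_of_real (snd \<zeta>)) ^ 2))\<^sup>2 \<le> jbr \<zeta> powr s" for \<zeta>
      using fst_snd_power_le_jbr(2)[of \<zeta> 2] power_le_jbr_powr[of 2 s \<zeta>] s by (simp add: norm_mult norm_power)
  qed auto
  then show "L2c (\<lambda>\<zeta>. (\<i> * complex_of_real (snd \<zeta>)) ^ 2 / (\<i> * complex_of_real (fst \<zeta>)) * fourierL2 f \<zeta>)"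
    by (simp add: mult.commute)
qed auto

lemma fmult_x_AE: "AE z in lborel. fmult (\<lambda>\<zeta>. \<i> * complex_of_real (fst \<zeta>)) f z = smoothed_x f z"
  using is_FT_inversion[OF fmult_x integrable_x_fourierL2]
  by eventually_elim (simp add: smoothed_x_def complex_eq_iff)

lemma smoothed_derivative: "((\<lambda>r. smoothed f (z + r *\<^sub>R (1, 0))) has_vector_derivative smoothed_x f z) (at 0)"
proof -
  have eq: "(\<lambda>\<zeta>. \<i> * of_real ((1, 0) \<bullet> \<zeta>) * fourierL2 f \<zeta>) = (\<lambda>\<zeta>. \<i> * of_real (fst \<zeta>) * fourierL2 f \<zeta>)"
    by (simp add: inner_prod_def)
  show ?thesis
    using bounded_linear.has_vector_derivative[OF bounded_linear_Re
        ifourier_directional_derivative[OF integrable_fourierL2, of "(1, 0)" z]] integrable_x_fourierL2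
    unfolding eq smoothed_def smoothed_x_def by simp
qed

lemma continuous_smoothed_x: "continuous_on UNIV (smoothed_x f)"
  unfolding smoothed_x_def by (intro continuous_intros continuous_ifourier integrable_x_fourierL2)

lemma integrable_smoothed_squares: "integrable lborel (\<lambda>z. (smoothed f z)\<^sup>2)" "integrable lborel (\<lambda>z. (smoothed_x f z)\<^sup>2)"
proof -
  have [measurable]: "smoothed_x f \<in> borel_measurable borel"
    by (intro borel_measurable_continuous_onI continuous_smoothed_x)
  show "integrable lborel (\<lambda>z. (smoothed f z)\<^sup>2)"
    using integrable_square AE_eq_smoothed by (subst integrable_cong_AE[of _ _ "\<lambda>z. (f z)\<^sup>2"]) (auto elim: eventually_mono)
  have q: "L2c (\<lambda>z. complex_of_real (fmult (\<lambda>\<zeta>. \<i> * complex_of_real (fst \<zeta>)) f z))"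
    by (rule is_FT_L2c(1)[OF fmult_x])
  have "L2c (\<lambda>z. complex_of_real (smoothed_x f z))"
    by (rule L2c_bound[OF q q, where A=1 and B=0]) (use fmult_x_AE in \<open>auto elim: eventually_mono\<close>)
  then show "integrable lborel (\<lambda>z. (smoothed_x f z)\<^sup>2)" by (simp add: L2c_def)
qed

end

section \<open>The nonlinear term\<close>

text \<open>In the factorisation of the difference of powers each summand has degree p. One factor
  is kept as |a| + |b|, so that Cauchy-Schwarz with |a - b| remains possible; the other p - 1 are
  bounded by \<open>M\<close>.\<close>

lemma abs_power_diff_le:
  fixes a b :: real
  assumes "\<bar>a\<bar> \<le> M" "\<bar>b\<bar> \<le> M" "p \<ge> 1"
  shows "\<bar>a ^ (p + 1) - b ^ (p + 1)\<bar> \<le> real (p + 1) * M ^ (p - 1) * ((\<bar>a\<bar> + \<bar>b\<bar>) * \<bar>a - b\<bar>)"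
proof -
  have M: "M \<ge> 0" using assms(1) abs_ge_zero order_trans by blast
  have tm: "\<bar>b ^ (p + 1 - Suc i) * a ^ i\<bar> \<le> M ^ (p - 1) * (\<bar>a\<bar> + \<bar>b\<bar>)" if i: "i < p + 1" for i
  proof (cases i)
    case 0
    have "\<bar>b ^ p\<bar> = \<bar>b\<bar> ^ (p - 1) * \<bar>b\<bar>" using assms(3) power_minus_mult[of p "\<bar>b\<bar>"] by (simp add: power_abs)
    also have "\<dots> \<le> M ^ (p - 1) * (\<bar>a\<bar> + \<bar>b\<bar>)"
      using assms M by (intro mult_mono power_mono) auto
    finally show ?thesis using 0 by simp
  next
    case (Suc k)
    have "\<bar>b ^ (p + 1 - Suc i) * a ^ i\<bar> = \<bar>b\<bar> ^ (p - 1 - k) * (\<bar>a\<bar> ^ k * \<bar>a\<bar>)"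
      using Suc by (simp add: abs_mult power_abs mult_ac)
    also have "\<dots> \<le> M ^ (p - 1 - k) * (M ^ k * (\<bar>a\<bar> + \<bar>b\<bar>))"
      using assms M by (intro mult_mono power_mono) auto
    also have "\<dots> = M ^ (p - 1) * (\<bar>a\<bar> + \<bar>b\<bar>)"
      using i Suc by (simp add: mult.assoc[symmetric] power_add[symmetric])
    finally show ?thesis .
  qed
  have "\<bar>a ^ (p + 1) - b ^ (p + 1)\<bar> = \<bar>a - b\<bar> * \<bar>\<Sum>i<p + 1. b ^ (p + 1 - Suc i) * a ^ i\<bar>"
    unfolding power_diff_sumr2[of a "p + 1" b] abs_mult ..
  also have "\<dots> \<le> \<bar>a - b\<bar> * (\<Sum>i<p + 1. M ^ (p - 1) * (\<bar>a\<bar> + \<bar>b\<bar>))"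
    by (intro mult_left_mono order_trans[OF sum_abs] sum_mono tm) auto
  also have "\<dots> = real (p + 1) * M ^ (p - 1) * ((\<bar>a\<bar> + \<bar>b\<bar>) * \<bar>a - b\<bar>)"
    by (simp add: mult_ac)
  finally show ?thesis .
qed

lemma Kinf_mono: "a \<le> b \<Longrightarrow> Kinf a \<le> Kinf b"
  by (simp add: Kinf_def divide_right_mono)

lemma Hs_norm_nonneg: "Hs_norm s f \<ge> 0"
  unfolding Hs_norm_def by (intro real_sqrt_ge_zero integral_nonneg_AE) auto

context
  fixes f :: r2fun and s :: real and p :: nat
  assumes f: "f \<in> Xs s" and s: "s \<ge> 3" and p: "p \<ge> 2"
begin

lemma AE_Xs_bound: "AE z in lborel. \<bar>f z\<bar> \<le> Kinf ((Hs_norm s f)\<^sup>2)"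
  using AE_eq_smoothed[OF f s] by eventually_elim (simp add: smoothed_bound[OF f s])

text \<open>Two factors go into the L^2 norm and the remaining p - 1 into the supremum. The
  resulting bound is proportional to the squared Sobolev norm, which is integrable in time along a
  solution.\<close>

lemma integrable_power_Xs: "integrable lborel (\<lambda>z. f z ^ (p + 1))"
  and integral_power_Xs_le: "(LINT z|lborel. \<bar>f z ^ (p + 1)\<bar>) \<le> Kinf ((Hs_norm s f)\<^sup>2) ^ (p - 1) * (Hs_norm s f)\<^sup>2"
proof -
  note [measurable] = Xs_borel[OF f s]
  let ?M = "Kinf ((Hs_norm s f)\<^sup>2)"
  have le: "AE z in lborel. \<bar>f z ^ (p + 1)\<bar> \<le> ?M ^ (p - 1) * (f z)\<^sup>2"
    using AE_Xs_bound
  proof eventually_elim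
    case (elim z)
    have "p + 1 = (p - 1) + 2" using p by simp
    then have "f z ^ (p + 1) = f z ^ (p - 1) * (f z)\<^sup>2" by (metis power_add)
    then have "\<bar>f z ^ (p + 1)\<bar> = \<bar>f z\<bar> ^ (p - 1) * (f z)\<^sup>2" by (simp add: abs_mult power_abs)
    also have "\<dots> \<le> ?M ^ (p - 1) * (f z)\<^sup>2" by (intro mult_right_mono power_mono elim) auto
    finally show ?case .
  qed
  have i: "integrable lborel (\<lambda>z. ?M ^ (p - 1) * (f z)\<^sup>2)"
    by (intro integrable_mult_right integrable_square[OF f s])
  show I: "integrable lborel (\<lambda>z. f z ^ (p + 1))"
    by (rule Bochner_Integration.integrable_bound[OF i]) (use le in \<open>auto elim: eventually_mono\<close>)
  have "(LINT z|lborel. \<bar>f z ^ (p + 1)\<bar>) \<le> (LINT z|lborel. ?M ^ (p - 1) * (f z)\<^sup>2)"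
    by (rule integral_mono_AE[OF _ i le]) (use I in simp)
  also have "\<dots> \<le> ?M ^ (p - 1) * (Hs_norm s f)\<^sup>2"
  proof -
    have "0 \<le> ?M" using smoothed_bound[OF f s, of 0] abs_ge_zero order_trans by blast
    then show ?thesis using integral_square_le[OF f s] by (simp add: mult_left_mono)
  qed
  finally show "(LINT z|lborel. \<bar>f z ^ (p + 1)\<bar>) \<le> ?M ^ (p - 1) * (Hs_norm s f)\<^sup>2" .
qed

text \<open>For the continuous representative, u^p u_x is classically the x-derivative of u^(p+1) /
  (p+1), and both are integrable, so the derivative rule in L^1 applies. The factor i xi gained here
  matches the one in the initial datum.\<close>

lemma is_FT_nonlinearity:
  "is_FT (\<lambda>z. complex_of_real (f z ^ p * fmult (\<lambda>\<zeta>. \<i> * complex_of_real (fst \<zeta>)) f z))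
     (\<lambda>\<zeta>. \<i> * of_real (fst \<zeta>) / of_nat (p + 1) * fourier (\<lambda>z. complex_of_real (f z ^ (p + 1))) \<zeta>)"
proof -
  note [measurable] = Xs_borel[OF f s] smoothed_borel[OF f s]
  have [measurable]: "smoothed_x f \<in> borel_measurable borel"
    by (intro borel_measurable_continuous_onI continuous_smoothed_x[OF f s])
  let ?v = "smoothed f" and ?w = "smoothed_x f" and ?M = "Kinf ((Hs_norm s f)\<^sup>2)"
  have M: "\<bar>?v z\<bar> \<le> ?M" for z by (rule smoothed_bound[OF f s])
  have M0: "0 \<le> ?M" using M[of 0] abs_ge_zero order_trans by blast
  note sq = integrable_smoothed_squares[OF f s]
  have le2: "(?v z ^ p * ?w z)\<^sup>2 \<le> ?M ^ (2 * p) * (?w z)\<^sup>2" for z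
  proof -
    have "(?v z ^ p * ?w z)\<^sup>2 = \<bar>?v z\<bar> ^ (2 * p) * (?w z)\<^sup>2"
      by (simp add: power_mult_distrib power_mult[symmetric] mult.commute[of p 2] power_even_abs)
    also have "\<dots> \<le> ?M ^ (2 * p) * (?w z)\<^sup>2" by (intro mult_right_mono power_mono M) auto
    finally show ?thesis .
  qed
  have g2: "L2c (\<lambda>z. complex_of_real (?v z ^ p * ?w z))"
  proof -
    have "integrable lborel (\<lambda>z. (?v z ^ p * ?w z)\<^sup>2)"
      by (rule Bochner_Integration.integrable_bound[OF integrable_mult_right[OF sq(2), of "?M ^ (2 * p)"]])
         (use le2 M0 in auto)
    then show ?thesis unfolding L2c_def norm_of_real power2_abs by simp
  qed
  have le1: "\<bar>?v z ^ p * ?w z\<bar> \<le> ?M ^ (p - 1) * ((?v z)\<^sup>2 + (?w z)\<^sup>2)" for z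
  proof -
    have "\<bar>?v z ^ p * ?w z\<bar> = \<bar>?v z\<bar> ^ (p - 1) * (\<bar>?v z\<bar> * \<bar>?w z\<bar>)"
      using p power_minus_mult[of p "\<bar>?v z\<bar>"] by (simp add: abs_mult power_abs mult.assoc[symmetric])
    also have "\<dots> \<le> ?M ^ (p - 1) * ((?v z)\<^sup>2 + (?w z)\<^sup>2)"
    proof (intro mult_mono power_mono M)
      have "2 * (\<bar>?v z\<bar> * \<bar>?w z\<bar>) \<le> (?v z)\<^sup>2 + (?w z)\<^sup>2" using sum_squares_bound[of "\<bar>?v z\<bar>" "\<bar>?w z\<bar>"] by simp
      moreover have "0 \<le> \<bar>?v z\<bar> * \<bar>?w z\<bar>" by simp
      ultimately show "\<bar>?v z\<bar> * \<bar>?w z\<bar> \<le> (?v z)\<^sup>2 + (?w z)\<^sup>2" by linarith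
    qed (use M0 in auto)
    finally show ?thesis .
  qed
  have g1: "integrable lborel (\<lambda>z. ?v z ^ p * ?w z)"
    by (rule Bochner_Integration.integrable_bound[OF integrable_mult_right[OF Bochner_Integration.integrable_add[OF sq], of "?M ^ (p - 1)"]])
       (use le1 M0 in auto)
  have AEp: "AE z in lborel. complex_of_real (f z ^ (p + 1)) = complex_of_real (?v z ^ (p + 1))"
    using AE_eq_smoothed[OF f s] by eventually_elim simp
  have h1: "integrable lborel (\<lambda>z. complex_of_real (?v z ^ (p + 1)))"
    using integrable_power_Xs AEp
    by (subst integrable_cong_AE[of _ _ "\<lambda>z. complex_of_real (f z ^ (p + 1))"]) (auto elim: eventually_mono simp del: power_Suc of_real_power)
  \<comment> \<open>The factor p + 1 stays on the left so that the integrand is exactly the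
    derivative of the power.\<close>
  have eq: "fourier (\<lambda>z. of_nat (p + 1) * complex_of_real (?v z ^ p * ?w z)) \<zeta>
      = \<i> * of_real ((1, 0) \<bullet> \<zeta>) * fourier (\<lambda>z. complex_of_real (?v z ^ (p + 1))) \<zeta>" for \<zeta>
  proof (rule fourier_directional_derivative[OF h1])
    show "integrable lborel (\<lambda>z. of_nat (p + 1) * complex_of_real (?v z ^ p * ?w z))"
      by (intro integrable_mult_right integrable_of_real g1)
    show "continuous_on UNIV (\<lambda>z. of_nat (p + 1) * complex_of_real (?v z ^ p * ?w z))"
      by (intro continuous_intros continuous_smoothed[OF f s] continuous_smoothed_x[OF f s])
    fix z
    have "((\<lambda>r. ?v (z + r *\<^sub>R (1, 0))) has_real_derivative ?w z) (at 0)"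
      using smoothed_derivative[OF f s, of z] by (simp add: has_real_derivative_iff_has_vector_derivative)
    from DERIV_power[OF this, of "p + 1"]
    have "((\<lambda>r. ?v (z + r *\<^sub>R (1, 0)) ^ (p + 1)) has_vector_derivative real (p + 1) * (?v z ^ p * ?w z)) (at 0)"
      unfolding has_real_derivative_iff_has_vector_derivative
      by (rule has_vector_derivative_eq_rhs) (simp add: zero_prod_def[symmetric] mult_ac)
    from bounded_linear.has_vector_derivative[OF bounded_linear_of_real this]
    show "((\<lambda>r. complex_of_real (?v (z + r *\<^sub>R (1, 0)) ^ (p + 1))) has_vector_derivative of_nat (p + 1) * complex_of_real (?v z ^ p * ?w z)) (at 0)"
      by (rule has_vector_derivative_eq_rhs) simp
  qed
  have four: "fourier (\<lambda>z. complex_of_real (?v z ^ p * ?w z)) \<zeta>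
     = \<i> * of_real (fst \<zeta>) / of_nat (p + 1) * fourier (\<lambda>z. complex_of_real (f z ^ (p + 1))) \<zeta>" for \<zeta>
  proof -
    have "fourier (\<lambda>z. complex_of_real (f z ^ (p + 1))) = fourier (\<lambda>z. complex_of_real (?v z ^ (p + 1)))"
      by (rule fourier_cong_AE[OF AEp]) measurable
    moreover have "of_nat (p + 1) * fourier (\<lambda>z. complex_of_real (?v z ^ p * ?w z)) \<zeta>
      = \<i> * of_real (fst \<zeta>) * fourier (\<lambda>z. complex_of_real (?v z ^ (p + 1))) \<zeta>"
      using eq[of \<zeta>] unfolding fourier_cmult by (simp add: inner_prod_def)
    moreover have "(of_nat (p + 1) :: complex) \<noteq> 0" unfolding of_nat_eq_0_iff by simp
    ultimately show ?thesis by (simp only: times_divide_eq_left eq_divide_eq mult.commute[of _ "of_nat (p + 1)"] if_False if_True not_False_eq_True)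
  qed
  have "is_FT (\<lambda>z. complex_of_real (?v z ^ p * ?w z)) (fourier (\<lambda>z. complex_of_real (?v z ^ p * ?w z)))"
    by (rule is_FT_L1[OF integrable_of_real[OF g1] g2])
  then show ?thesis
  proof (rule is_FT_cong_AE)
    show "AE z in lborel. complex_of_real (?v z ^ p * ?w z) = complex_of_real (f z ^ p * fmult (\<lambda>\<zeta>. \<i> * complex_of_real (fst \<zeta>)) f z)"
      using AE_eq_smoothed[OF f s] fmult_x_AE[OF f s] by eventually_elim simp
    have "(\<lambda>z. Re (complex_of_real (fmult (\<lambda>\<zeta>. \<i> * complex_of_real (fst \<zeta>)) f z))) \<in> borel_measurable borel"
      using is_FT_L2c(1)[OF fmult_x[OF f s], THEN L2c_borel] by measurable
    then show "(\<lambda>z. complex_of_real (f z ^ p * fmult (\<lambda>\<zeta>. \<i> * complex_of_real (fst \<zeta>)) f z)) \<in> borel_measurable borel"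
      by simp
    have "integrable lborel (\<lambda>z. complex_of_real (f z ^ (p + 1)))" by (intro integrable_of_real integrable_power_Xs)
    from fourier_borel[OF this]
    show "(\<lambda>\<zeta>. \<i> * of_real (fst \<zeta>) / of_nat (p + 1) * fourier (\<lambda>z. complex_of_real (f z ^ (p + 1))) \<zeta>) \<in> borel_measurable borel"
      by measurable
  qed (rule AE_I2, rule four)
qed

text \<open>Collects the four terms; the three linear ones add up to minus \<open>symb\<close> times
  the transform.\<close>

lemma is_FT_Nop:
  "is_FT (\<lambda>z. complex_of_real (Nop p \<epsilon> \<nu> f z))
     (\<lambda>\<zeta>. \<i> * of_real (fst \<zeta>) / of_nat (p + 1) * fourier (\<lambda>z. complex_of_real (f z ^ (p + 1))) \<zeta> - symb \<epsilon> \<nu> \<zeta> * fourierL2 f \<zeta>)"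
proof -
  let ?NF = "fourier (\<lambda>z. complex_of_real (f z ^ (p + 1)))"
  have "is_FT (\<lambda>z. complex_of_real (f z ^ p * fmult (\<lambda>\<zeta>. \<i> * complex_of_real (fst \<zeta>)) f z)
        + complex_of_real (fmult (\<lambda>\<zeta>. (\<i> * complex_of_real (fst \<zeta>)) ^ 3) f z)
        + of_real \<epsilon> * complex_of_real (fmult (\<lambda>\<zeta>. (\<i> * complex_of_real (snd \<zeta>)) ^ 2 / (\<i> * complex_of_real (fst \<zeta>))) f z)
        - of_real \<nu> * complex_of_real (fmult (\<lambda>\<zeta>. (\<i> * complex_of_real (fst \<zeta>)) ^ 2) f z))
      (\<lambda>\<zeta>. \<i> * of_real (fst \<zeta>) / of_nat (p + 1) * ?NF \<zeta> + (\<i> * complex_of_real (fst \<zeta>)) ^ 3 * fourierL2 f \<zeta>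
        + of_real \<epsilon> * ((\<i> * complex_of_real (snd \<zeta>)) ^ 2 / (\<i> * complex_of_real (fst \<zeta>)) * fourierL2 f \<zeta>)
        - of_real \<nu> * ((\<i> * complex_of_real (fst \<zeta>)) ^ 2 * fourierL2 f \<zeta>))"
    by (intro is_FT_add is_FT_diff is_FT_cmult is_FT_nonlinearity fmult_xxx[OF f s] fmult_yy_x[OF f s] fmult_xx[OF f s])
  moreover have "\<i> * of_real (fst \<zeta>) / of_nat (p + 1) * ?NF \<zeta> + (\<i> * complex_of_real (fst \<zeta>)) ^ 3 * fourierL2 f \<zeta>
        + of_real \<epsilon> * ((\<i> * complex_of_real (snd \<zeta>)) ^ 2 / (\<i> * complex_of_real (fst \<zeta>)) * fourierL2 f \<zeta>)
        - of_real \<nu> * ((\<i> * complex_of_real (fst \<zeta>)) ^ 2 * fourierL2 f \<zeta>)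
      = \<i> * of_real (fst \<zeta>) / of_nat (p + 1) * ?NF \<zeta> - symb \<epsilon> \<nu> \<zeta> * fourierL2 f \<zeta>" for \<zeta>
  proof -
    let ?a = "complex_of_real (fst \<zeta>)" and ?b = "complex_of_real (snd \<zeta>)"
    define c where "c = ?b\<^sup>2 / ?a"
    define N where "N = \<i> * ?a / of_nat (p + 1) * ?NF \<zeta>"
    have 1: "(\<i> * ?a) ^ 3 = - (\<i> * ?a ^ 3)"
      unfolding power_mult_distrib by (simp add: power3_eq_cube)
    \<comment> \<open>For xi = 0 both sides are 0 by the convention for division.\<close>
    have 2: "(\<i> * ?b) ^ 2 / (\<i> * ?a) = \<i> * c"
      unfolding c_def by (cases "fst \<zeta> = 0") (simp_all add: power2_eq_square field_simps)
    have 3: "(\<i> * ?a) ^ 2 = - (?a ^ 2)" by (simp add: power_mult_distrib)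
    have 4: "symb \<epsilon> \<nu> \<zeta> = - (of_real \<nu> * ?a ^ 2) + \<i> * (?a ^ 3 - of_real \<epsilon> * c)"
      by (simp add: symb_def c_def)
    show ?thesis
      unfolding N_def[symmetric] 1 2 3 4 by (simp only: algebra_simps) simp
  qed
  moreover have "complex_of_real (Nop p \<epsilon> \<nu> f z) = complex_of_real (f z ^ p * fmult (\<lambda>\<zeta>. \<i> * complex_of_real (fst \<zeta>)) f z)
        + complex_of_real (fmult (\<lambda>\<zeta>. (\<i> * complex_of_real (fst \<zeta>)) ^ 3) f z)
        + of_real \<epsilon> * complex_of_real (fmult (\<lambda>\<zeta>. (\<i> * complex_of_real (snd \<zeta>)) ^ 2 / (\<i> * complex_of_real (fst \<zeta>))) f z)
        - of_real \<nu> * complex_of_real (fmult (\<lambda>\<zeta>. (\<i> * complex_of_real (fst \<zeta>)) ^ 2) f z)" for z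
    unfolding Nop_def by (simp only: of_real_add of_real_diff of_real_mult)
  ultimately show ?thesis by (simp only:)
qed

end

text \<open>Converts L^2 continuity of the solution in time into L^1 continuity of its nonlinearity:
  Cauchy-Schwarz is applied to (|f| + |g|) |f - g|, with \<open>Kinf\<close> as the bound on the
  supremum.\<close>

lemma L1_power_diff_le:
  assumes f: "f \<in> Xs s" and g: "g \<in> Xs s" and s: "s \<ge> 3" and p: "p \<ge> 2"
    and B: "Hs_norm s f \<le> B" "Hs_norm s g \<le> B"
  shows "(LINT z|lborel. \<bar>f z ^ (p + 1) - g z ^ (p + 1)\<bar>)
     \<le> real (p + 1) * Kinf (B\<^sup>2) ^ (p - 1) * (2 * B * sqrt (LINT z|lborel. (f z - g z)\<^sup>2))"
proof -
  note [measurable] = Xs_borel[OF f s] Xs_borel[OF g s]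
  let ?M = "Kinf (B\<^sup>2)"
  have B0: "0 \<le> B" using B Hs_norm_nonneg order_trans by blast
  have Mle: "Kinf ((Hs_norm s f)\<^sup>2) \<le> ?M" "Kinf ((Hs_norm s g)\<^sup>2) \<le> ?M"
    using B by (auto intro!: Kinf_mono power_mono Hs_norm_nonneg)
  have M0: "0 \<le> ?M" using smoothed_bound[OF f s, of 0] Mle(1) abs_ge_zero[of "smoothed f 0"] by linarith
  have Lf: "L2c (\<lambda>z. complex_of_real (f z))" "L2c (\<lambda>z. complex_of_real (g z))"
    using integrable_square[OF f s] integrable_square[OF g s] by (auto simp: L2c_def)
  have La: "L2c (\<lambda>z. complex_of_real (\<bar>f z\<bar> + \<bar>g z\<bar>))"
  proof (rule L2c_bound[OF Lf, where A=2 and B=2])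
    show "AE z in lborel. (norm (complex_of_real (\<bar>f z\<bar> + \<bar>g z\<bar>)))\<^sup>2 \<le> 2 * (norm (complex_of_real (f z)))\<^sup>2 + 2 * (norm (complex_of_real (g z)))\<^sup>2"
    proof (rule AE_I2)
      fix z
      show "(norm (complex_of_real (\<bar>f z\<bar> + \<bar>g z\<bar>)))\<^sup>2 \<le> 2 * (norm (complex_of_real (f z)))\<^sup>2 + 2 * (norm (complex_of_real (g z)))\<^sup>2"
        using sum_squares_bound[of "\<bar>f z\<bar>" "\<bar>g z\<bar>"] unfolding norm_of_real by (simp add: power2_sum)
    qed
  qed simp
  have Ld: "L2c (\<lambda>z. complex_of_real \<bar>f z - g z\<bar>)"
    using L2c_diff[OF Lf] unfolding of_real_diff[symmetric] L2c_def norm_of_real by simp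
  have i: "integrable lborel (\<lambda>z. (\<bar>f z\<bar> + \<bar>g z\<bar>) * \<bar>f z - g z\<bar>)"
    using integrable_Re[OF integrable_mult_L2[OF La Ld]] by simp
  have le: "AE z in lborel. \<bar>f z ^ (p + 1) - g z ^ (p + 1)\<bar> \<le> real (p + 1) * ?M ^ (p - 1) * ((\<bar>f z\<bar> + \<bar>g z\<bar>) * \<bar>f z - g z\<bar>)"
    using AE_Xs_bound[OF f s p] AE_Xs_bound[OF g s p]
  proof eventually_elim
    case (elim z)
    show ?case by (rule abs_power_diff_le) (use elim Mle p in auto)
  qed
  have "(LINT z|lborel. \<bar>f z ^ (p + 1) - g z ^ (p + 1)\<bar>) \<le> (LINT z|lborel. real (p + 1) * ?M ^ (p - 1) * ((\<bar>f z\<bar> + \<bar>g z\<bar>) * \<bar>f z - g z\<bar>))"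
    using integrable_power_Xs[OF f s p] integrable_power_Xs[OF g s p]
    by (intro integral_mono_AE le integrable_mult_right i integrable_abs Bochner_Integration.integrable_diff)
  also have "\<dots> = real (p + 1) * ?M ^ (p - 1) * (LINT z|lborel. (\<bar>f z\<bar> + \<bar>g z\<bar>) * \<bar>f z - g z\<bar>)"
    by (rule integral_mult_right_zero)
  also have "\<dots> \<le> real (p + 1) * ?M ^ (p - 1) * (2 * B * sqrt (LINT z|lborel. (f z - g z)\<^sup>2))"
  proof (rule mult_left_mono)
    have eq: "(LINT z|lborel. complex_of_real (\<bar>f z\<bar> + \<bar>g z\<bar>) * complex_of_real \<bar>f z - g z\<bar>)
        = complex_of_real (LINT z|lborel. (\<bar>f z\<bar> + \<bar>g z\<bar>) * \<bar>f z - g z\<bar>)"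
      by (simp only: of_real_mult[symmetric] integral_complex_of_real)
    have "(norm (LINT z|lborel. complex_of_real (\<bar>f z\<bar> + \<bar>g z\<bar>) * complex_of_real \<bar>f z - g z\<bar>))\<^sup>2
       \<le> (LINT z|lborel. (norm (complex_of_real (\<bar>f z\<bar> + \<bar>g z\<bar>)))\<^sup>2) * (LINT z|lborel. (norm (complex_of_real \<bar>f z - g z\<bar>))\<^sup>2)"
      by (rule Cauchy_Schwarz_real[OF La Ld])
    then have "(LINT z|lborel. (\<bar>f z\<bar> + \<bar>g z\<bar>) * \<bar>f z - g z\<bar>)\<^sup>2
       \<le> (LINT z|lborel. (\<bar>f z\<bar> + \<bar>g z\<bar>)\<^sup>2) * (LINT z|lborel. (f z - g z)\<^sup>2)"
      unfolding eq norm_of_real by (simp only: power2_abs)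
    also have "\<dots> \<le> (2 * B)\<^sup>2 * (LINT z|lborel. (f z - g z)\<^sup>2)"
    proof (intro mult_right_mono)
      have "(LINT z|lborel. (\<bar>f z\<bar> + \<bar>g z\<bar>)\<^sup>2) \<le> (LINT z|lborel. 2 * (f z)\<^sup>2 + 2 * (g z)\<^sup>2)"
      proof (rule integral_mono)
        show "integrable lborel (\<lambda>z. (\<bar>f z\<bar> + \<bar>g z\<bar>)\<^sup>2)" using La unfolding L2c_def norm_of_real by simp
        show "integrable lborel (\<lambda>z. 2 * (f z)\<^sup>2 + 2 * (g z)\<^sup>2)"
          using integrable_square[OF f s] integrable_square[OF g s] by simp
        show "(\<bar>f z\<bar> + \<bar>g z\<bar>)\<^sup>2 \<le> 2 * (f z)\<^sup>2 + 2 * (g z)\<^sup>2" for z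
          using sum_squares_bound[of "\<bar>f z\<bar>" "\<bar>g z\<bar>"] by (simp add: power2_sum)
      qed
      also have "\<dots> = 2 * (LINT z|lborel. (f z)\<^sup>2) + 2 * (LINT z|lborel. (g z)\<^sup>2)"
        using integrable_square[OF f s] integrable_square[OF g s] by simp
      also have "\<dots> \<le> 2 * B\<^sup>2 + 2 * B\<^sup>2"
        using integral_square_le[OF f s] integral_square_le[OF g s] power_mono[OF B(1) Hs_norm_nonneg, of 2] power_mono[OF B(2) Hs_norm_nonneg, of 2]
        by linarith
      finally show "(LINT z|lborel. (\<bar>f z\<bar> + \<bar>g z\<bar>)\<^sup>2) \<le> (2 * B)\<^sup>2" by (simp add: power_mult_distrib)
    qed (auto intro!: integral_nonneg_AE)
    finally have "sqrt ((LINT z|lborel. (\<bar>f z\<bar> + \<bar>g z\<bar>) * \<bar>f z - g z\<bar>)\<^sup>2) \<le> sqrt ((2 * B)\<^sup>2 * (LINT z|lborel. (f z - g z)\<^sup>2))"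
      by (rule real_sqrt_le_mono)
    then show "(LINT z|lborel. (\<bar>f z\<bar> + \<bar>g z\<bar>) * \<bar>f z - g z\<bar>) \<le> 2 * B * sqrt (LINT z|lborel. (f z - g z)\<^sup>2)"
      using B0 by (simp add: real_sqrt_mult)
  qed (use M0 in simp)
  finally show ?thesis .
qed

section \<open>The solution as a function of time\<close>

text \<open>The mean value inequality on the half-plane Re z \<le> c, which is convex and on which
  the derivative of exp has modulus at most exp c.\<close>

lemma norm_exp_diff_le:
  fixes a b :: complex
  assumes "Re a \<le> c" "Re b \<le> c"
  shows "norm (exp a - exp b) \<le> exp c * norm (a - b)"
proof (rule field_differentiable_bound[where S="{z. Re z \<le> c}" and f'=exp])
  show "convex {z. Re z \<le> c}" by (rule convex_halfspace_Re_le)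
  show "(exp has_field_derivative exp z) (at z within {z. Re z \<le> c})" for z :: complex
    by (rule DERIV_subset[OF DERIV_exp]) simp
qed (use assms in \<open>auto simp: norm_exp_eq_Re\<close>)

lemma continuous_on_sequentialI:
  fixes f :: "'a::metric_space \<Rightarrow> 'b::topological_space"
  assumes "\<And>Y t. t \<in> S \<Longrightarrow> (\<And>n. Y n \<in> S) \<Longrightarrow> Y \<longlonglongrightarrow> t \<Longrightarrow> (\<lambda>n. f (Y n)) \<longlonglongrightarrow> f t"
  shows "continuous_on S f"
  unfolding continuous_on_sequentially using assms by (auto simp: o_def)

lemma square_diff_le: "(a - b)\<^sup>2 \<le> 2 * (a\<^sup>2 + b\<^sup>2)" for a b :: real
  using zero_le_power2[of "a + b"] by (simp add: power2_sum power2_diff)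

lemma L2c_complex_of_real: "L2c (\<lambda>z. complex_of_real (h z)) \<longleftrightarrow> h \<in> borel_measurable borel \<and> integrable lborel (\<lambda>z. (h z)\<^sup>2)"
proof
  assume "L2c (\<lambda>z. complex_of_real (h z))"
  then have m: "(\<lambda>z. complex_of_real (h z)) \<in> borel_measurable borel" and i: "integrable lborel (\<lambda>z. (h z)\<^sup>2)"
    by (auto simp: L2c_def)
  have "(\<lambda>z. Re (complex_of_real (h z))) \<in> borel_measurable borel" using m by measurable
  then show "h \<in> borel_measurable borel \<and> integrable lborel (\<lambda>z. (h z)\<^sup>2)" using i by simp
qed (auto simp: L2c_def)

lemma L2c_complex_of_realD:
  assumes "L2c (\<lambda>z. complex_of_real (h z))"
  shows "h \<in> borel_measurable borel" "integrable lborel (\<lambda>z. (h z)\<^sup>2)"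
  using assms L2c_complex_of_real by blast+

text \<open>The cut-off \<open>max t 0\<close> extends the nonlinearity constantly to negative
  times, so that continuity and measurability can be stated on the whole line.\<close>

definition nl_hat :: "nat \<Rightarrow> (real \<Rightarrow> r2fun) \<Rightarrow> real \<Rightarrow> real \<times> real \<Rightarrow> complex" where
  "nl_hat p u t \<zeta> = fourier (\<lambda>z. complex_of_real (u (max t 0) z ^ (p + 1))) \<zeta>"

text \<open>The integrating-factor form, without the outer exponential and the factor i xi / (p +
  1). The factor \<open>exp (- t symb)\<close> grows in t, so bounds are available only after
  multiplication by \<open>exp (T symb)\<close>.\<close>

definition duhamel :: "nat \<Rightarrow> real \<Rightarrow> real \<Rightarrow> (real \<Rightarrow> r2fun) \<Rightarrow> real \<Rightarrow> real \<times> real \<Rightarrow> complex" where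
  "duhamel p \<epsilon> \<nu> u T \<zeta> = (LINT t|lborel. indicator {0..T} t *\<^sub>R (exp (- (of_real t * symb \<epsilon> \<nu> \<zeta>)) * nl_hat p u t \<zeta>))"

locale kp_flow =
  fixes p :: nat and \<epsilon> \<nu> s B :: real and u :: "real \<Rightarrow> r2fun"
  assumes p: "p \<ge> 2" and \<nu>: "\<nu> > 0" and s: "s \<ge> 3"
    and X: "\<And>t. t \<ge> 0 \<Longrightarrow> u t \<in> Xs s" and B: "\<And>t. t \<ge> 0 \<Longrightarrow> Hs_norm s (u t) \<le> B"
    and D: "\<And>t. t \<ge> 0 \<Longrightarrow> ((\<lambda>h. \<integral>\<^sup>+z. ennreal (((u (t + h) z - u t z) / h + Nop p \<epsilon> \<nu> (u t) z)\<^sup>2) \<partial>lborel)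
               \<longlongrightarrow> 0) (at 0 within {-t..})"
    and fin: "(\<integral>\<^sup>+t\<in>{0..}. ennreal ((Hs_norm s (u t))\<^sup>2) \<partial>lborel) < \<infinity>"
begin

abbreviation Uh :: "real \<Rightarrow> real \<times> real \<Rightarrow> complex" where "Uh t \<equiv> fourierL2 (u t)"

text \<open>The transform of \<open>Nop\<close> at the solution, hence minus the time derivative of
  \<open>Uh t\<close> in the L^2 sense.\<close>

abbreviation Nhat :: "real \<Rightarrow> real \<times> real \<Rightarrow> complex" where
  "Nhat t \<equiv> (\<lambda>\<zeta>. \<i> * of_real (fst \<zeta>) / of_nat (p + 1) * fourier (\<lambda>z. complex_of_real (u t z ^ (p + 1))) \<zeta> - symb \<epsilon> \<nu> \<zeta> * Uh t \<zeta>)"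

lemma B0: "B \<ge> 0"
  using B[of 0] Hs_norm_nonneg[of s "u 0"] by simp

lemma Uh_FT: "t \<ge> 0 \<Longrightarrow> is_FT (\<lambda>z. complex_of_real (u t z)) (Uh t)"
  using HsD(1)[OF XsD(1)[OF X]] .

lemma Uh_L2c: "t \<ge> 0 \<Longrightarrow> L2c (Uh t)"
  using is_FT_L2c(2)[OF Uh_FT] .

lemma Uh_borel: "t \<ge> 0 \<Longrightarrow> Uh t \<in> borel_measurable borel"
  using L2c_borel[OF Uh_L2c] .

lemma Nhat_L2c: "t \<ge> 0 \<Longrightarrow> L2c (Nhat t)"
  using is_FT_L2c(2)[OF is_FT_Nop[OF X s p]] .

lemma symb_borel [measurable]: "symb \<epsilon> \<nu> \<in> borel_measurable borel"
  unfolding symb_def[abs_def] by measurable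

lemma Re_symb: "Re (symb \<epsilon> \<nu> \<zeta>) = - (\<nu> * (fst \<zeta>)\<^sup>2)"
  by (simp add: symb_def)

lemma quotient_FT:
  assumes "t \<ge> 0" "r \<ge> 0"
  shows "is_FT (\<lambda>z. complex_of_real ((u r z - u t z) / (r - t) + Nop p \<epsilon> \<nu> (u t) z))
    (\<lambda>\<zeta>. 1 / of_real (r - t) * (Uh r \<zeta> - Uh t \<zeta>) + Nhat t \<zeta>)"
proof -
  have "is_FT (\<lambda>z. 1 / of_real (r - t) * (complex_of_real (u r z) - complex_of_real (u t z)) + complex_of_real (Nop p \<epsilon> \<nu> (u t) z))
    (\<lambda>\<zeta>. 1 / of_real (r - t) * (Uh r \<zeta> - Uh t \<zeta>) + Nhat t \<zeta>)"
    by (intro is_FT_add is_FT_cmult is_FT_diff Uh_FT is_FT_Nop[OF X[OF assms(1)] s p] assms)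
  then show ?thesis by (simp only: of_real_add of_real_divide of_real_diff times_divide_eq_left mult_1)
qed

lemma quotient_tendsto_0:
  assumes t: "t \<ge> 0" and Y: "Y \<longlonglongrightarrow> t" "\<And>n. Y n \<ge> 0" "\<And>n. Y n \<noteq> t"
  shows "(\<lambda>n. LINT z|lborel. ((u (Y n) z - u t z) / (Y n - t) + Nop p \<epsilon> \<nu> (u t) z)\<^sup>2) \<longlonglongrightarrow> 0"
proof -
  have "(\<lambda>n. \<integral>\<^sup>+z. ennreal (((u (t + (Y n - t)) z - u t z) / (Y n - t) + Nop p \<epsilon> \<nu> (u t) z)\<^sup>2) \<partial>lborel) \<longlonglongrightarrow> 0"
  proof -
    have "(\<lambda>n. Y n - t) \<longlonglongrightarrow> 0" using Y(1) by (rule LIM_zero)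
    moreover have "Y n - t \<in> {-t..} - {0}" for n using Y(2,3) by auto
    ultimately show ?thesis
      by (intro D[OF t, unfolded tendsto_at_iff_sequentially o_def, rule_format])
  qed
  moreover have "(\<integral>\<^sup>+z. ennreal (((u (t + (Y n - t)) z - u t z) / (Y n - t) + Nop p \<epsilon> \<nu> (u t) z)\<^sup>2) \<partial>lborel)
     = ennreal (LINT z|lborel. ((u (Y n) z - u t z) / (Y n - t) + Nop p \<epsilon> \<nu> (u t) z)\<^sup>2)" for n
    using L2c_complex_of_realD(2)[OF is_FT_L2c(1)[OF quotient_FT[OF t Y(2)]], of n]
    by (subst nn_integral_eq_integral) auto
  ultimately show ?thesis
    by (simp add: ennreal_tendsto_0_iff)
qed

text \<open>Differentiability implies continuity: the increment is (Y n - t) times the difference of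
  a quantity tending to 0 in L^2 and a fixed L^2 function.\<close>

lemma L2_continuous:
  assumes t: "t \<ge> 0" and Y: "Y \<longlonglongrightarrow> t" "\<And>n. Y n \<ge> 0" "\<And>n. Y n \<noteq> t"
  shows "(\<lambda>n. LINT z|lborel. (u (Y n) z - u t z)\<^sup>2) \<longlonglongrightarrow> 0"
proof -
  let ?d = "\<lambda>n z. (u (Y n) z - u t z) / (Y n - t) + Nop p \<epsilon> \<nu> (u t) z"
  let ?C = "LINT z|lborel. (Nop p \<epsilon> \<nu> (u t) z)\<^sup>2"
  have iN: "integrable lborel (\<lambda>z. (Nop p \<epsilon> \<nu> (u t) z)\<^sup>2)"
    by (rule L2c_complex_of_realD(2)[OF is_FT_L2c(1)[OF is_FT_Nop[OF X[OF t] s p]]])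
  have id: "integrable lborel (\<lambda>z. (?d n z)\<^sup>2)" for n
    by (rule L2c_complex_of_realD(2)[OF is_FT_L2c(1)[OF quotient_FT[OF t Y(2)]]])
  have le: "(LINT z|lborel. (u (Y n) z - u t z)\<^sup>2) \<le> 2 * (Y n - t)\<^sup>2 * ((LINT z|lborel. (?d n z)\<^sup>2) + ?C)" for n
  proof -
    have "(LINT z|lborel. (u (Y n) z - u t z)\<^sup>2) \<le> (LINT z|lborel. 2 * (Y n - t)\<^sup>2 * ((?d n z)\<^sup>2 + (Nop p \<epsilon> \<nu> (u t) z)\<^sup>2))"
    proof (rule integral_mono)
      have "is_FT (\<lambda>z. complex_of_real (u (Y n) z) - complex_of_real (u t z)) (\<lambda>z. Uh (Y n) z - Uh t z)"
        by (rule is_FT_diff[OF Uh_FT[OF Y(2)] Uh_FT[OF t]])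
      from is_FT_L2c(1)[OF this] have "L2c (\<lambda>z. complex_of_real (u (Y n) z - u t z))" by simp
      then show "integrable lborel (\<lambda>z. (u (Y n) z - u t z)\<^sup>2)" by (rule L2c_complex_of_realD)
      show "integrable lborel (\<lambda>z. 2 * (Y n - t)\<^sup>2 * ((?d n z)\<^sup>2 + (Nop p \<epsilon> \<nu> (u t) z)\<^sup>2))"
        by (intro integrable_mult_right Bochner_Integration.integrable_add id iN)
      fix z
      have "u (Y n) z - u t z = (Y n - t) * (?d n z - Nop p \<epsilon> \<nu> (u t) z)" using Y(3)[of n] by simp
      from arg_cong[OF this, of "\<lambda>x. x\<^sup>2"]
      have "(u (Y n) z - u t z)\<^sup>2 = (Y n - t)\<^sup>2 * (?d n z - Nop p \<epsilon> \<nu> (u t) z)\<^sup>2"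
        unfolding power_mult_distrib .
      also have "\<dots> \<le> (Y n - t)\<^sup>2 * (2 * ((?d n z)\<^sup>2 + (Nop p \<epsilon> \<nu> (u t) z)\<^sup>2))"
        by (intro mult_left_mono square_diff_le) simp
      finally show "(u (Y n) z - u t z)\<^sup>2 \<le> 2 * (Y n - t)\<^sup>2 * ((?d n z)\<^sup>2 + (Nop p \<epsilon> \<nu> (u t) z)\<^sup>2)"
        by (simp only: mult_ac)
    qed
    also have "\<dots> = 2 * (Y n - t)\<^sup>2 * ((LINT z|lborel. (?d n z)\<^sup>2) + ?C)"
      by (simp only: integral_mult_right_zero Bochner_Integration.integral_add[OF id iN])
    finally show ?thesis .
  qed
  have "(\<lambda>n. 2 * (Y n - t)\<^sup>2 * ((LINT z|lborel. (?d n z)\<^sup>2) + ?C)) \<longlonglongrightarrow> 2 * (t - t)\<^sup>2 * (0 + ?C)"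
    by (intro tendsto_intros Y quotient_tendsto_0[OF t Y])
  then have lim: "(\<lambda>n. 2 * (Y n - t)\<^sup>2 * ((LINT z|lborel. (?d n z)\<^sup>2) + ?C)) \<longlonglongrightarrow> 0" by simp
  show ?thesis
    by (rule Lim_null_comparison[OF always_eventually lim]) (use le in \<open>simp add: integral_nonneg_AE\<close>)
qed

lemma L1_power_continuous:
  assumes t: "t \<ge> 0" and Y: "Y \<longlonglongrightarrow> t" "\<And>n. Y n \<ge> 0"
  shows "(\<lambda>n. LINT z|lborel. \<bar>u (Y n) z ^ (p + 1) - u t z ^ (p + 1)\<bar>) \<longlonglongrightarrow> 0"
proof -
  let ?G = "\<lambda>r. LINT z|lborel. \<bar>u r z ^ (p + 1) - u t z ^ (p + 1)\<bar>"
  \<comment> \<open>\<open>L2_continuous\<close> needs sequences that avoid \<open>t\<close>. The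
    limit along these is continuity at \<open>t\<close>, which then covers sequences that may meet
    \<open>t\<close>.\<close>
  have "(?G \<longlongrightarrow> ?G t) (at t within {0..})"
    unfolding tendsto_at_iff_sequentially
  proof (intro allI impI)
    fix X' assume X': "\<forall>i. X' i \<in> {0..} - {t}" "X' \<longlonglongrightarrow> t"
    have "(\<lambda>n. real (p + 1) * Kinf (B\<^sup>2) ^ (p - 1) * (2 * B * sqrt (LINT z|lborel. (u (X' n) z - u t z)\<^sup>2)))
        \<longlonglongrightarrow> real (p + 1) * Kinf (B\<^sup>2) ^ (p - 1) * (2 * B * sqrt 0)"
      by (intro tendsto_intros L2_continuous[OF t X'(2)]) (use X' in auto)
    then have lim: "(\<lambda>n. real (p + 1) * Kinf (B\<^sup>2) ^ (p - 1) * (2 * B * sqrt (LINT z|lborel. (u (X' n) z - u t z)\<^sup>2))) \<longlonglongrightarrow> 0"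
      by simp
    have le: "?G (X' n) \<le> real (p + 1) * Kinf (B\<^sup>2) ^ (p - 1) * (2 * B * sqrt (LINT z|lborel. (u (X' n) z - u t z)\<^sup>2))" for n
      using X'(1) by (intro L1_power_diff_le[OF X X s p B B] t) auto
    have "(\<lambda>n. ?G (X' n)) \<longlonglongrightarrow> 0"
      by (rule Lim_null_comparison[OF always_eventually lim]) (use le in \<open>simp add: integral_nonneg_AE\<close>)
    then show "(?G \<circ> X') \<longlonglongrightarrow> ?G t" by (simp add: o_def)
  qed
  then have "continuous (at t within {0..}) ?G" by (simp add: continuous_within)
  from continuous_within_tendsto_compose'[OF this, of Y] Y have "(\<lambda>n. ?G (Y n)) \<longlonglongrightarrow> ?G t" by auto
  then show ?thesis by simp
qed

text \<open>The L^1 norm of the nonlinearity at time t. It bounds \<open>nl_hat\<close> at all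
  frequencies at once and is the majorant for the dominated convergence in time.\<close>

definition G :: "real \<Rightarrow> real" where
  "G t = (LINT z|lborel. \<bar>u (max t 0) z ^ (p + 1)\<bar>)"

lemma power_integrable: "t \<ge> 0 \<Longrightarrow> integrable lborel (\<lambda>z. u t z ^ (p + 1))"
  by (rule integrable_power_Xs[OF X s p])

lemma Kinf_nonneg: "t \<ge> 0 \<Longrightarrow> 0 \<le> Kinf ((Hs_norm s (u t))\<^sup>2)"
  using smoothed_bound[OF X s, of t 0] abs_ge_zero[of "smoothed (u t) 0"] by linarith

lemma G_le: "t \<ge> 0 \<Longrightarrow> G t \<le> Kinf (B\<^sup>2) ^ (p - 1) * (Hs_norm s (u t))\<^sup>2"
proof -
  assume t: "t \<ge> 0"
  have "G t \<le> Kinf ((Hs_norm s (u t))\<^sup>2) ^ (p - 1) * (Hs_norm s (u t))\<^sup>2"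
    using integral_power_Xs_le[OF X[OF t] s p] t by (simp add: G_def max_def)
  also have "\<dots> \<le> Kinf (B\<^sup>2) ^ (p - 1) * (Hs_norm s (u t))\<^sup>2"
    using Kinf_nonneg[OF t] by (intro mult_right_mono power_mono Kinf_mono B[OF t] Hs_norm_nonneg) auto
  finally show ?thesis .
qed

lemma G_nonneg: "0 \<le> G t"
  unfolding G_def by (intro integral_nonneg_AE) auto

lemma KinfB_nonneg: "0 \<le> Kinf (B\<^sup>2)"
  using Kinf_nonneg[of 0] Kinf_mono[OF power_mono[OF B[of 0] Hs_norm_nonneg, of 2]] by simp

lemma G_continuous: "continuous_on UNIV G"
proof (rule continuous_on_sequentialI)
  fix Y :: "nat \<Rightarrow> real" and t assume "Y \<longlonglongrightarrow> t"
  then have Y: "(\<lambda>n. max (Y n) 0) \<longlonglongrightarrow> max t 0" by (intro tendsto_max) auto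
  have lim: "(\<lambda>n. LINT z|lborel. \<bar>u (max (Y n) 0) z ^ (p + 1) - u (max t 0) z ^ (p + 1)\<bar>) \<longlonglongrightarrow> 0"
    by (rule L1_power_continuous[OF _ Y]) auto
  have "norm (G (Y n) - G t) \<le> (LINT z|lborel. \<bar>u (max (Y n) 0) z ^ (p + 1) - u (max t 0) z ^ (p + 1)\<bar>)" for n
  proof -
    have i: "integrable lborel (\<lambda>z. u (max (Y n) 0) z ^ (p + 1))" "integrable lborel (\<lambda>z. u (max t 0) z ^ (p + 1))"
      by (rule power_integrable, simp)+
    have "G (Y n) - G t = (LINT z|lborel. \<bar>u (max (Y n) 0) z ^ (p + 1)\<bar> - \<bar>u (max t 0) z ^ (p + 1)\<bar>)"
      unfolding G_def by (rule Bochner_Integration.integral_diff[symmetric]) (intro integrable_abs i)+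
    also have "norm \<dots> \<le> (LINT z|lborel. \<bar>u (max (Y n) 0) z ^ (p + 1) - u (max t 0) z ^ (p + 1)\<bar>)"
      by (rule Bochner_Integration.integral_norm_bound_integral)
         (intro integrable_abs Bochner_Integration.integrable_diff i, intro integrable_abs Bochner_Integration.integrable_diff i,
          simp only: real_norm_def abs_triangle_ineq3)
    finally show ?thesis .
  qed
  then have "(\<lambda>n. G (Y n) - G t) \<longlonglongrightarrow> 0"
    by (intro Lim_null_comparison[OF always_eventually lim]) auto
  then show "(\<lambda>n. G (Y n)) \<longlonglongrightarrow> G t" by (simp add: LIM_zero_iff)
qed

lemma G_borel [measurable]: "G \<in> borel_measurable borel"
  by (intro borel_measurable_continuous_onI G_continuous)

lemma G_integrable: "integrable lborel (\<lambda>t. indicator {0..} t * G t)"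
proof -
  \<comment> \<open>The constant is put on the side of \<open>G\<close>: measurability of the
    Sobolev norm in time is not at hand to pull it out of the integral. Adding 1 makes it
    positive.\<close>
  define c where "c = Kinf (B\<^sup>2) ^ (p - 1) + 1"
  have c: "c > 0" using KinfB_nonneg by (simp add: c_def add_nonneg_pos)
  have le: "G t / c \<le> (Hs_norm s (u t))\<^sup>2" if t: "t \<ge> 0" for t
  proof -
    have "G t \<le> c * (Hs_norm s (u t))\<^sup>2"
      by (rule order_trans[OF G_le[OF t]]) (simp add: c_def mult_right_mono)
    then show ?thesis using c by (simp add: divide_le_eq mult.commute)
  qed
  have "integrable lborel (\<lambda>t. indicator {0..} t * (G t / c))"
    unfolding integrable_iff_bounded
  proof
    have "(\<integral>\<^sup>+t. ennreal (norm (indicator {0..} t * (G t / c))) \<partial>lborel) \<le> (\<integral>\<^sup>+t\<in>{0..}. ennreal ((Hs_norm s (u t))\<^sup>2) \<partial>lborel)"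
    proof (rule nn_integral_mono)
      fix t :: real
      show "ennreal (norm (indicator {0..} t * (G t / c))) \<le> ennreal ((Hs_norm s (u t))\<^sup>2) * indicator {0..} t"
        using le[of t] G_nonneg[of t] c by (auto simp: indicator_def intro!: ennreal_leI)
    qed
    also have "\<dots> < \<infinity>" by (rule fin)
    finally show "(\<integral>\<^sup>+t. ennreal (norm (indicator {0..} t * (G t / c))) \<partial>lborel) < \<infinity>" .
  qed simp
  from integrable_mult_right[OF this, of c] show ?thesis using c by simp
qed

lemma nl_hat_le: "norm (nl_hat p u t \<zeta>) \<le> G t"
proof -
  have "norm (nl_hat p u t \<zeta>) \<le> (LINT z|lborel. norm (complex_of_real (u (max t 0) z ^ (p + 1)))) / (2 * pi)"
    unfolding nl_hat_def by (rule norm_fourier_le)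
  also have "\<dots> = G t / (2 * pi)" by (simp only: G_def norm_of_real)
  also have "\<dots> \<le> G t"
    using divide_left_mono[of 1 "2 * pi" "G t"] G_nonneg[of t] pi_ge_two by simp
  finally show ?thesis .
qed

text \<open>A change of time is uniform in frequency because it is measured in L^1; the frequency is
  then varied at the fixed limiting time.\<close>

lemma nl_hat_continuous: "continuous_on UNIV (\<lambda>x. nl_hat p u (fst x) (snd x))"
proof (rule continuous_on_sequentialI)
  fix Z :: "nat \<Rightarrow> real \<times> (real \<times> real)" and x assume "Z \<longlonglongrightarrow> x"
  then have Z: "(\<lambda>n. fst (Z n)) \<longlonglongrightarrow> fst x" "(\<lambda>n. snd (Z n)) \<longlonglongrightarrow> snd x"
    by (auto intro: tendsto_fst tendsto_snd)
  have i: "integrable lborel (\<lambda>z. complex_of_real (u (max t 0) z ^ (p + 1)))" for t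
    by (intro integrable_of_real power_integrable) auto
  have lim: "(\<lambda>n. LINT z|lborel. \<bar>u (max (fst (Z n)) 0) z ^ (p + 1) - u (max (fst x) 0) z ^ (p + 1)\<bar>) \<longlonglongrightarrow> 0"
    by (rule L1_power_continuous) (auto intro!: tendsto_max Z)
  have lim': "(\<lambda>n. (LINT z|lborel. \<bar>u (max (fst (Z n)) 0) z ^ (p + 1) - u (max (fst x) 0) z ^ (p + 1)\<bar>) / (2 * pi)) \<longlonglongrightarrow> 0"
    using tendsto_divide[OF lim tendsto_const[of "2 * pi"]] by simp
  have "norm (nl_hat p u (fst (Z n)) (snd (Z n)) - nl_hat p u (fst x) (snd (Z n)))
        \<le> (LINT z|lborel. \<bar>u (max (fst (Z n)) 0) z ^ (p + 1) - u (max (fst x) 0) z ^ (p + 1)\<bar>) / (2 * pi)" for n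
    unfolding nl_hat_def fourier_diff[OF i i, symmetric]
    by (rule order_trans[OF norm_fourier_le]) (simp only: of_real_diff[symmetric] norm_of_real order_refl)
  then have "(\<lambda>n. nl_hat p u (fst (Z n)) (snd (Z n)) - nl_hat p u (fst x) (snd (Z n))) \<longlonglongrightarrow> 0"
    by (intro Lim_null_comparison[OF always_eventually lim'] allI)
  moreover have "(\<lambda>n. nl_hat p u (fst x) (snd (Z n))) \<longlonglongrightarrow> nl_hat p u (fst x) (snd x)"
    unfolding nl_hat_def by (rule tendsto_fourier[OF i Z(2)])
  ultimately have "(\<lambda>n. (nl_hat p u (fst (Z n)) (snd (Z n)) - nl_hat p u (fst x) (snd (Z n))) + nl_hat p u (fst x) (snd (Z n)))
      \<longlonglongrightarrow> 0 + nl_hat p u (fst x) (snd x)"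
    by (rule tendsto_add)
  then show "(\<lambda>n. nl_hat p u (fst (Z n)) (snd (Z n))) \<longlonglongrightarrow> nl_hat p u (fst x) (snd x)" by simp
qed

lemma nl_hat_borel: "(\<lambda>x. nl_hat p u (fst x) (snd x)) \<in> borel_measurable borel"
  by (intro borel_measurable_continuous_onI nl_hat_continuous)

lemma nl_hat_tendsto:
  "Y \<longlonglongrightarrow> t \<Longrightarrow> (\<lambda>n. nl_hat p u (Y n) \<zeta>) \<longlonglongrightarrow> nl_hat p u t \<zeta>"
proof -
  assume "Y \<longlonglongrightarrow> t"
  then have "(\<lambda>n. (Y n, \<zeta>)) \<longlonglongrightarrow> (t, \<zeta>)" by (intro tendsto_Pair tendsto_const)
  from continuous_on_tendsto_compose[OF nl_hat_continuous this] show ?thesis by simp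
qed


section \<open>Duhamel's formula in frequency\<close>

text \<open>The transform is tested with the time-dependent function 1_K exp(-t symb). Its own time
  derivative cancels the linear part of the equation, so the derivative of the pairing contains only
  the nonlinearity, and the fundamental theorem of calculus applies.\<close>

lemma duhamel_tested:
  assumes K[measurable]: "K \<in> sets borel" and Kb: "bounded K" and \<Lambda>: "\<And>\<zeta>. \<zeta> \<in> K \<Longrightarrow> norm (symb \<epsilon> \<nu> \<zeta>) \<le> \<Lambda>" and T: "T \<ge> 0"
  shows "(LINT \<zeta>|lborel. indicator K \<zeta> *\<^sub>R (exp (- (of_real T * symb \<epsilon> \<nu> \<zeta>)) * Uh T \<zeta>)) - (LINT \<zeta>|lborel. indicator K \<zeta> *\<^sub>R Uh 0 \<zeta>)
    = (LINT t|lborel. indicator {0..T} t *\<^sub>R - (LINT \<zeta>|lborel. indicator K \<zeta> *\<^sub>R (exp (- (of_real t * symb \<epsilon> \<nu> \<zeta>)) * (\<i> * of_real (fst \<zeta>) / of_nat (p + 1) * nl_hat p u t \<zeta>))))"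
proof -
  have \<Lambda>0: "0 \<le> \<bar>\<Lambda>\<bar>" by simp
  let ?E = "\<lambda>t \<zeta>. exp (- (of_real t * symb \<epsilon> \<nu> \<zeta>))"
  \<comment> \<open>Bounded and supported in \<open>K\<close> because \<open>symb\<close> is bounded
    there; this makes it admissible for the extended duality.\<close>
  define \<psi> where "\<psi> t \<zeta> = indicator K \<zeta> *\<^sub>R ?E t \<zeta>" for t \<zeta>
  have \<psi>m[measurable]: "\<psi> t \<in> borel_measurable borel" for t unfolding \<psi>_def[abs_def] by measurable
  have Re_le: "Re (- (of_real t * symb \<epsilon> \<nu> \<zeta>)) \<le> \<tau> * \<bar>\<Lambda>\<bar>" if "\<zeta> \<in> K" "0 \<le> t" "t \<le> \<tau>" for t \<tau> \<zeta>
  proof -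
    have "Re (- (of_real t * symb \<epsilon> \<nu> \<zeta>)) \<le> norm (- (of_real t * symb \<epsilon> \<nu> \<zeta>))" by (rule complex_Re_le_cmod)
    also have "\<dots> = t * norm (symb \<epsilon> \<nu> \<zeta>)" using that by (simp add: norm_mult)
    also have "\<dots> \<le> \<tau> * \<bar>\<Lambda>\<bar>" using that \<Lambda>[OF that(1)] by (intro mult_mono) auto
    finally show ?thesis .
  qed
  have \<psi>le: "norm (\<psi> t \<zeta>) \<le> exp (\<tau> * \<bar>\<Lambda>\<bar>) * indicator K \<zeta>" if "0 \<le> t" "t \<le> \<tau>" for t \<tau> \<zeta>
    using Re_le[OF _ that, of \<zeta>] by (simp add: \<psi>_def indicator_def)
  have \<psi>1: "integrable lborel (\<psi> t)" if "t \<ge> 0" for t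
    by (rule integrable_bounded_support[OF \<psi>m \<psi>le[OF that order_refl] K Kb])
  have \<psi>2: "L2c (\<psi> t)" if "t \<ge> 0" for t
    by (rule L2c_bounded_support[OF \<psi>m \<psi>le[OF that order_refl] K Kb])
  have \<psi>lim: "(\<lambda>n. \<psi> (Y n) \<zeta>) \<longlonglongrightarrow> \<psi> t \<zeta>" if "Y \<longlonglongrightarrow> t" for Y t \<zeta>
    unfolding \<psi>_def by (intro tendsto_intros that)
  let ?N = "\<lambda>t \<zeta>. \<i> * of_real (fst \<zeta>) / of_nat (p + 1) * nl_hat p u t \<zeta>"
  define y where "y t = (LINT \<zeta>|lborel. Uh t \<zeta> * \<psi> t \<zeta>)" for t
  define y' where "y' t = - (LINT \<zeta>|lborel. ?N t \<zeta> * \<psi> t \<zeta>)" for t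
  obtain R where R: "\<And>\<zeta>. \<zeta> \<in> K \<Longrightarrow> norm \<zeta> \<le> R" using Kb by (auto simp: bounded_iff)
  have fstR: "\<bar>fst \<zeta>\<bar> \<le> \<bar>R\<bar>" if "\<zeta> \<in> K" for \<zeta>
    using R[OF that] norm_fst_le[of "fst \<zeta>" "snd \<zeta>"] by simp
  have nlm[measurable]: "nl_hat p u t \<in> borel_measurable borel" for t
    unfolding nl_hat_def[abs_def] by (intro fourier_borel integrable_of_real power_integrable) simp
  have N\<psi>le: "norm (?N t \<zeta> * \<psi> r \<zeta>) \<le> (\<bar>R\<bar> * M * exp (\<tau> * \<bar>\<Lambda>\<bar>)) * indicator K \<zeta>" if "0 \<le> r" "r \<le> \<tau>" "G t \<le> M" for t r \<tau> \<zeta> M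
  proof (cases "\<zeta> \<in> K")
    case True
    have "norm (?N t \<zeta>) \<le> \<bar>R\<bar> * M"
    proof -
      have "norm (?N t \<zeta>) = \<bar>fst \<zeta>\<bar> / real (p + 1) * norm (nl_hat p u t \<zeta>)"
        by (simp only: norm_mult norm_divide norm_ii norm_of_real norm_of_nat mult_1)
      also have "\<dots> \<le> \<bar>R\<bar> * M"
      proof (intro mult_mono)
        have "\<bar>fst \<zeta>\<bar> / real (p + 1) \<le> \<bar>fst \<zeta>\<bar> / 1" by (intro divide_left_mono) auto
        then show "\<bar>fst \<zeta>\<bar> / real (p + 1) \<le> \<bar>R\<bar>" using fstR[OF True] by simp
        show "norm (nl_hat p u t \<zeta>) \<le> M" using nl_hat_le[of t \<zeta>] that by simp
      qed auto
      finally show ?thesis .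
    qed
    moreover have "0 \<le> \<bar>R\<bar> * M" using G_nonneg[of t] that(3) by simp
    ultimately have "norm (?N t \<zeta>) * norm (\<psi> r \<zeta>) \<le> (\<bar>R\<bar> * M) * (exp (\<tau> * \<bar>\<Lambda>\<bar>) * indicator K \<zeta>)"
      by (intro mult_mono \<psi>le that norm_ge_zero)
    then show ?thesis by (simp only: norm_mult mult.assoc)
  qed (simp add: \<psi>_def)
  have "(y has_vector_derivative y' t) (at t within {0..T})" if t: "t \<in> {0..T}" for t
  proof -
    have t0: "t \<ge> 0" using t by simp
    show ?thesis unfolding has_vector_derivative_iff_quotient tendsto_at_iff_sequentially
    proof (intro allI impI)
      fix Y assume Y: "\<forall>i. Y i \<in> {0..T} - {t}" "Y \<longlonglongrightarrow> t"
      have Y0: "\<And>n. Y n \<ge> 0" and Yt: "\<And>n. Y n \<noteq> t" and YT: "\<And>n. Y n \<le> T" and tT: "t \<le> T" using Y(1) t by auto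
      define d where "d n z = (u (Y n) z - u t z) / (Y n - t) + Nop p \<epsilon> \<nu> (u t) z" for n z
      define Dh where "Dh n \<zeta> = 1 / of_real (Y n - t) * (Uh (Y n) \<zeta> - Uh t \<zeta>) + Nhat t \<zeta>" for n \<zeta>
      define q where "q n \<zeta> = 1 / of_real (Y n - t) * (\<psi> (Y n) \<zeta> - \<psi> t \<zeta>)" for n \<zeta>
      have FT: "is_FT (\<lambda>z. complex_of_real (d n z)) (Dh n)" for n
        unfolding d_def Dh_def by (rule quotient_FT[OF t0 Y0])
      have DhL: "L2c (Dh n)" for n by (rule is_FT_L2c(2)[OF FT])
      have qL: "L2c (q n)" for n unfolding q_def by (intro L2c_cmult L2c_diff \<psi>2 Y0 t0)
      \<comment> \<open>A product rule for difference quotients. Adding and subtracting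
        \<open>Nhat t\<close> isolates the combination that the equation makes small.\<close>
      have dec: "(y (Y n) - y t) /\<^sub>R (Y n - t) = (LINT \<zeta>|lborel. Dh n \<zeta> * \<psi> (Y n) \<zeta>) - (LINT \<zeta>|lborel. Nhat t \<zeta> * \<psi> (Y n) \<zeta>) + (LINT \<zeta>|lborel. Uh t \<zeta> * q n \<zeta>)" for n
      proof -
        have "(LINT \<zeta>|lborel. Dh n \<zeta> * \<psi> (Y n) \<zeta>) - (LINT \<zeta>|lborel. Nhat t \<zeta> * \<psi> (Y n) \<zeta>) + (LINT \<zeta>|lborel. Uh t \<zeta> * q n \<zeta>)
           = (LINT \<zeta>|lborel. Dh n \<zeta> * \<psi> (Y n) \<zeta> - Nhat t \<zeta> * \<psi> (Y n) \<zeta> + Uh t \<zeta> * q n \<zeta>)"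
          by (subst Bochner_Integration.integral_add, intro Bochner_Integration.integrable_diff integrable_mult_L2 DhL Nhat_L2c t0 \<psi>2 Y0,
              intro integrable_mult_L2 Uh_L2c t0 qL,
              subst Bochner_Integration.integral_diff, intro integrable_mult_L2 DhL \<psi>2 Y0, intro integrable_mult_L2 Nhat_L2c t0 \<psi>2 Y0, rule refl)
        also have "\<dots> = (LINT \<zeta>|lborel. 1 / of_real (Y n - t) * (Uh (Y n) \<zeta> * \<psi> (Y n) \<zeta> - Uh t \<zeta> * \<psi> t \<zeta>))"
          by (rule Bochner_Integration.integral_cong[OF refl]) (simp only: Dh_def q_def, algebra)
        also have "\<dots> = 1 / of_real (Y n - t) * (y (Y n) - y t)"
          unfolding integral_mult_right_zero y_def
          by (subst Bochner_Integration.integral_diff, intro integrable_mult_L2 Uh_L2c \<psi>2 Y0, intro integrable_mult_L2 Uh_L2c \<psi>2 t0, rule refl)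
        finally show ?thesis by (simp add: scaleR_conv_of_real divide_inverse)
      qed
      \<comment> \<open>The duality moves this term to the space side, where the equation makes
        \<open>d n\<close> small in L^2, while Bessel's inequality bounds the transform of the test
        function.\<close>
      have l1: "(\<lambda>n. LINT \<zeta>|lborel. Dh n \<zeta> * \<psi> (Y n) \<zeta>) \<longlonglongrightarrow> 0"
      proof (rule tendsto_of_norm_square_le)
        let ?c = "LINT \<zeta>|lborel. (exp (T * \<bar>\<Lambda>\<bar>))\<^sup>2 * indicator K \<zeta>"
        have ci: "integrable lborel (\<lambda>\<zeta>. (exp (T * \<bar>\<Lambda>\<bar>))\<^sup>2 * indicator K \<zeta> :: real)"
          by (rule integrable_bounded_support[of _ "(exp (T * \<bar>\<Lambda>\<bar>))\<^sup>2" K]) (use K Kb in auto)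
        have "(\<lambda>n. (LINT z|lborel. (d n z)\<^sup>2) * ?c) \<longlonglongrightarrow> 0 * ?c"
          unfolding d_def by (intro tendsto_intros quotient_tendsto_0[OF t0 Y(2) Y0 Yt])
        then show "(\<lambda>n. (LINT z|lborel. (d n z)\<^sup>2) * ?c) \<longlonglongrightarrow> 0" by simp
        fix n
        have "(norm (LINT \<zeta>|lborel. Dh n \<zeta> * \<psi> (Y n) \<zeta>))\<^sup>2 = (norm (LINT z|lborel. complex_of_real (d n z) * fourier (\<psi> (Y n)) z))\<^sup>2"
          by (simp only: is_FT_pairing[OF FT \<psi>1[OF Y0] \<psi>2[OF Y0]])
        also have "\<dots> \<le> (LINT z|lborel. (norm (complex_of_real (d n z)))\<^sup>2) * (LINT z|lborel. (norm (fourier (\<psi> (Y n)) z))\<^sup>2)"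
          by (rule Cauchy_Schwarz_real[OF is_FT_L2c(1)[OF FT] L2c_fourier[OF \<psi>1[OF Y0] \<psi>2[OF Y0]]])
        also have "\<dots> \<le> (LINT z|lborel. (d n z)\<^sup>2) * ?c"
        proof (rule mult_mono)
          have "(LINT z|lborel. (norm (fourier (\<psi> (Y n)) z))\<^sup>2) \<le> (LINT z|lborel. (norm (\<psi> (Y n) z))\<^sup>2)"
            by (rule Bessel_fourier_real[OF \<psi>1[OF Y0] \<psi>2[OF Y0]])
          also have "\<dots> \<le> ?c"
          proof (rule integral_mono[OF _ ci])
            show "integrable lborel (\<lambda>z. (norm (\<psi> (Y n) z))\<^sup>2)" using \<psi>2[OF Y0] by (simp add: L2c_def)
            show "(norm (\<psi> (Y n) z))\<^sup>2 \<le> (exp (T * \<bar>\<Lambda>\<bar>))\<^sup>2 * indicator K z" for z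
              using power_mono[OF \<psi>le[OF Y0 YT, of n z] norm_ge_zero, of 2] by (cases "z \<in> K") (simp_all add: \<psi>_def)
          qed
          finally show "(LINT z|lborel. (norm (fourier (\<psi> (Y n)) z))\<^sup>2) \<le> ?c" .
        qed (auto intro!: integral_nonneg_AE)
        finally show "(norm ((LINT \<zeta>|lborel. Dh n \<zeta> * \<psi> (Y n) \<zeta>) - 0))\<^sup>2 \<le> (LINT z|lborel. (d n z)\<^sup>2) * ?c" by simp
      qed
      have l2: "(\<lambda>n. LINT \<zeta>|lborel. Nhat t \<zeta> * \<psi> (Y n) \<zeta>) \<longlonglongrightarrow> (LINT \<zeta>|lborel. Nhat t \<zeta> * \<psi> t \<zeta>)"
      proof (rule integral_dominated_convergence)
        show "integrable lborel (\<lambda>\<zeta>. exp (T * \<bar>\<Lambda>\<bar>) * (indicator K \<zeta> * norm (Nhat t \<zeta>)))"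
          by (intro integrable_mult_right integrable_norm_L2_bounded_set Nhat_L2c t0 K Kb)
        show "AE \<zeta> in lborel. norm (Nhat t \<zeta> * \<psi> (Y n) \<zeta>) \<le> exp (T * \<bar>\<Lambda>\<bar>) * (indicator K \<zeta> * norm (Nhat t \<zeta>))" for n
        proof (rule AE_I2)
          fix \<zeta>
          show "norm (Nhat t \<zeta> * \<psi> (Y n) \<zeta>) \<le> exp (T * \<bar>\<Lambda>\<bar>) * (indicator K \<zeta> * norm (Nhat t \<zeta>))"
            using mult_left_mono[OF \<psi>le[OF Y0 YT, of n \<zeta>] norm_ge_zero[of "Nhat t \<zeta>"]] by (simp only: norm_mult mult_ac)
        qed
        show "AE \<zeta> in lborel. (\<lambda>n. Nhat t \<zeta> * \<psi> (Y n) \<zeta>) \<longlonglongrightarrow> Nhat t \<zeta> * \<psi> t \<zeta>"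
          by (intro AE_I2 tendsto_mult tendsto_const \<psi>lim Y)
        show "(\<lambda>\<zeta>. Nhat t \<zeta> * \<psi> (Y n) \<zeta>) \<in> borel_measurable lborel" "(\<lambda>\<zeta>. Nhat t \<zeta> * \<psi> t \<zeta>) \<in> borel_measurable lborel" for n
          using L2c_borel[OF Nhat_L2c[OF t0]] \<psi>m by (auto intro!: borel_measurable_times simp del: of_nat_add)
      qed
      \<comment> \<open>Differentiates only the test function; on \<open>K\<close> its difference
        quotients are bounded by the mean value inequality.\<close>
      have l3: "(\<lambda>n. LINT \<zeta>|lborel. Uh t \<zeta> * q n \<zeta>) \<longlonglongrightarrow> (LINT \<zeta>|lborel. Uh t \<zeta> * (- symb \<epsilon> \<nu> \<zeta> * \<psi> t \<zeta>))"
      proof (rule integral_dominated_convergence)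
        show "integrable lborel (\<lambda>\<zeta>. \<bar>\<Lambda>\<bar> * exp (T * \<bar>\<Lambda>\<bar>) * (indicator K \<zeta> * norm (Uh t \<zeta>)))"
          by (intro integrable_mult_right integrable_norm_L2_bounded_set Uh_L2c t0 K Kb)
        show "AE \<zeta> in lborel. norm (Uh t \<zeta> * q n \<zeta>) \<le> \<bar>\<Lambda>\<bar> * exp (T * \<bar>\<Lambda>\<bar>) * (indicator K \<zeta> * norm (Uh t \<zeta>))" for n
        proof (rule AE_I2)
          fix \<zeta>
          have "norm (q n \<zeta>) \<le> \<bar>\<Lambda>\<bar> * exp (T * \<bar>\<Lambda>\<bar>) * indicator K \<zeta>"
          proof (cases "\<zeta> \<in> K")
            case True
            have "norm (?E (Y n) \<zeta> - ?E t \<zeta>) \<le> exp (T * \<bar>\<Lambda>\<bar>) * norm (- (of_real (Y n) * symb \<epsilon> \<nu> \<zeta>) - - (of_real t * symb \<epsilon> \<nu> \<zeta>))"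
              by (rule norm_exp_diff_le[OF Re_le[OF True Y0 YT] Re_le[OF True t0 tT]])
            also have "- (of_real (Y n) * symb \<epsilon> \<nu> \<zeta>) - - (of_real t * symb \<epsilon> \<nu> \<zeta>) = - of_real (Y n - t) * symb \<epsilon> \<nu> \<zeta>"
              by (simp add: algebra_simps)
            also have "norm (- of_real (Y n - t) * symb \<epsilon> \<nu> \<zeta>) = \<bar>Y n - t\<bar> * norm (symb \<epsilon> \<nu> \<zeta>)"
              by (simp only: norm_mult norm_minus_cancel norm_of_real)
            also have "exp (T * \<bar>\<Lambda>\<bar>) * (\<bar>Y n - t\<bar> * norm (symb \<epsilon> \<nu> \<zeta>)) \<le> exp (T * \<bar>\<Lambda>\<bar>) * (\<bar>Y n - t\<bar> * \<bar>\<Lambda>\<bar>)"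
              using \<Lambda>[OF True] by (intro mult_left_mono) auto
            finally have *: "norm (?E (Y n) \<zeta> - ?E t \<zeta>) \<le> exp (T * \<bar>\<Lambda>\<bar>) * (\<bar>Y n - t\<bar> * \<bar>\<Lambda>\<bar>)" .
            have "norm (q n \<zeta>) = 1 / \<bar>Y n - t\<bar> * norm (?E (Y n) \<zeta> - ?E t \<zeta>)"
              using True unfolding q_def \<psi>_def by (simp only: norm_mult norm_divide norm_of_real norm_one indicator_simps scaleR_one)
            also have "\<dots> \<le> 1 / \<bar>Y n - t\<bar> * (exp (T * \<bar>\<Lambda>\<bar>) * (\<bar>Y n - t\<bar> * \<bar>\<Lambda>\<bar>))"
              by (intro mult_left_mono *) auto
            also have "\<dots> = \<bar>\<Lambda>\<bar> * exp (T * \<bar>\<Lambda>\<bar>)" using Yt[of n] by simp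
            finally show ?thesis using True by simp
          qed (simp add: q_def \<psi>_def)
          from mult_left_mono[OF this norm_ge_zero[of "Uh t \<zeta>"]]
          show "norm (Uh t \<zeta> * q n \<zeta>) \<le> \<bar>\<Lambda>\<bar> * exp (T * \<bar>\<Lambda>\<bar>) * (indicator K \<zeta> * norm (Uh t \<zeta>))"
            by (simp only: norm_mult mult_ac)
        qed
        show "AE \<zeta> in lborel. (\<lambda>n. Uh t \<zeta> * q n \<zeta>) \<longlonglongrightarrow> Uh t \<zeta> * (- symb \<epsilon> \<nu> \<zeta> * \<psi> t \<zeta>)"
        proof (intro AE_I2 tendsto_mult tendsto_const)
          fix \<zeta>
          have "((\<lambda>r. \<psi> r \<zeta>) has_vector_derivative - symb \<epsilon> \<nu> \<zeta> * \<psi> t \<zeta>) (at t)"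
          proof -
            have "((\<lambda>r. - (of_real r * symb \<epsilon> \<nu> \<zeta>)) has_vector_derivative - symb \<epsilon> \<nu> \<zeta>) (at t)"
              unfolding has_vector_derivative_def by (rule derivative_eq_intros | simp add: scaleR_conv_of_real)+
            from field_vector_diff_chain_at[OF this DERIV_exp]
            have "((\<lambda>r. ?E r \<zeta>) has_vector_derivative - symb \<epsilon> \<nu> \<zeta> * ?E t \<zeta>) (at t)" by (simp add: o_def)
            from bounded_linear.has_vector_derivative[OF bounded_linear_scaleR_right this, of "indicator K \<zeta>"]
            show ?thesis unfolding \<psi>_def by simp
          qed
          from has_vector_derivative_at_within[OF this, of "{0..T}"]
          have "(\<lambda>n. (\<psi> (Y n) \<zeta> - \<psi> t \<zeta>) /\<^sub>R (Y n - t)) \<longlonglongrightarrow> - symb \<epsilon> \<nu> \<zeta> * \<psi> t \<zeta>"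
            unfolding has_vector_derivative_iff_quotient tendsto_at_iff_sequentially o_def using Y by blast
          then show "(\<lambda>n. q n \<zeta>) \<longlonglongrightarrow> - symb \<epsilon> \<nu> \<zeta> * \<psi> t \<zeta>"
            by (simp add: q_def scaleR_conv_of_real divide_inverse)
        qed
        show "(\<lambda>\<zeta>. Uh t \<zeta> * q n \<zeta>) \<in> borel_measurable lborel" for n
          using Uh_borel[OF t0] L2c_borel[OF qL] by (auto intro!: borel_measurable_times)
        show "(\<lambda>\<zeta>. Uh t \<zeta> * (- symb \<epsilon> \<nu> \<zeta> * \<psi> t \<zeta>)) \<in> borel_measurable lborel"
          using Uh_borel[OF t0] by (auto intro!: borel_measurable_times)
      qed
      \<comment> \<open>The two terms with \<open>symb\<close> cancel and only the nonlinear flux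
        survives.\<close>
      have lim: "0 - (LINT \<zeta>|lborel. Nhat t \<zeta> * \<psi> t \<zeta>) + (LINT \<zeta>|lborel. Uh t \<zeta> * (- symb \<epsilon> \<nu> \<zeta> * \<psi> t \<zeta>)) = y' t"
      proof -
        have nl: "nl_hat p u t \<zeta> = fourier (\<lambda>z. complex_of_real (u t z ^ (p + 1))) \<zeta>" for \<zeta>
          using t0 by (simp only: nl_hat_def max_absorb1)
        have s\<psi>: "integrable lborel (\<lambda>\<zeta>. Uh t \<zeta> * (- symb \<epsilon> \<nu> \<zeta> * \<psi> t \<zeta>))"
        proof (rule integrable_mult_L2[OF Uh_L2c[OF t0]], rule L2c_bounded_support[of _ "\<bar>\<Lambda>\<bar> * exp (T * \<bar>\<Lambda>\<bar>)" K])
          show "norm (- symb \<epsilon> \<nu> \<zeta> * \<psi> t \<zeta>) \<le> \<bar>\<Lambda>\<bar> * exp (T * \<bar>\<Lambda>\<bar>) * indicator K \<zeta>" for \<zeta>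
            using \<psi>le[OF t0 tT, of \<zeta>] \<Lambda>[of \<zeta>]
            by (cases "\<zeta> \<in> K") (auto simp: norm_mult \<psi>_def intro!: mult_mono)
        qed (use K Kb in auto)
        have "(LINT \<zeta>|lborel. Uh t \<zeta> * (- symb \<epsilon> \<nu> \<zeta> * \<psi> t \<zeta>)) - (LINT \<zeta>|lborel. Nhat t \<zeta> * \<psi> t \<zeta>)
           = (LINT \<zeta>|lborel. Uh t \<zeta> * (- symb \<epsilon> \<nu> \<zeta> * \<psi> t \<zeta>) - Nhat t \<zeta> * \<psi> t \<zeta>)"
          by (rule Bochner_Integration.integral_diff[symmetric, OF s\<psi>]) (intro integrable_mult_L2 Nhat_L2c t0 \<psi>2)
        also have "\<dots> = (LINT \<zeta>|lborel. - (?N t \<zeta> * \<psi> t \<zeta>))"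
          by (rule Bochner_Integration.integral_cong[OF refl]) (simp only: nl, algebra)
        also have "\<dots> = y' t" unfolding y'_def by (rule Bochner_Integration.integral_minus)
        finally show ?thesis by (simp only: diff_0 uminus_add_conv_diff)
      qed
      have "(\<lambda>n. (y (Y n) - y t) /\<^sub>R (Y n - t)) \<longlonglongrightarrow> y' t"
        unfolding dec lim[symmetric] by (intro tendsto_add tendsto_diff l1 l2 l3)
      then show "((\<lambda>r. (y r - y t) /\<^sub>R (r - t)) \<circ> Y) \<longlonglongrightarrow> y' t" by (simp add: o_def)
    qed
  qed
  \<comment> \<open>Continuity of the derivative is required to integrate it back; \<open>M\<close>
    bounds \<open>G\<close> uniformly in time by means of \<open>B\<close>.\<close>
  moreover have "continuous_on {0..T} y'"
  proof (rule continuous_on_sequentialI)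
    fix Y t assume *: "t \<in> {0..T}" "\<And>n. Y n \<in> {0..T}" "Y \<longlonglongrightarrow> t"
    then have Y: "\<And>n. 0 \<le> Y n" "\<And>n. Y n \<le> T" "Y \<longlonglongrightarrow> t" by auto
    define M where "M = Kinf (B\<^sup>2) ^ (p - 1) * B\<^sup>2"
    have GM: "G r \<le> M" if "r \<ge> 0" for r
      using order_trans[OF G_le[OF that] mult_left_mono[OF power_mono[OF B[OF that] Hs_norm_nonneg]]] KinfB_nonneg by (simp add: M_def)
    have "(\<lambda>n. LINT \<zeta>|lborel. ?N (Y n) \<zeta> * \<psi> (Y n) \<zeta>) \<longlonglongrightarrow> (LINT \<zeta>|lborel. ?N t \<zeta> * \<psi> t \<zeta>)"
    proof (rule integral_dominated_convergence)
      show "integrable lborel (\<lambda>\<zeta>. (\<bar>R\<bar> * M * exp (T * \<bar>\<Lambda>\<bar>)) * indicator K \<zeta>)"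
        using K Kb emeasure_bounded_finite[OF Kb] by (intro integrable_mult_right integrable_real_indicator) auto
      show "AE \<zeta> in lborel. norm (?N (Y n) \<zeta> * \<psi> (Y n) \<zeta>) \<le> (\<bar>R\<bar> * M * exp (T * \<bar>\<Lambda>\<bar>)) * indicator K \<zeta>" for n
        by (intro AE_I2 N\<psi>le Y GM)
      show "AE \<zeta> in lborel. (\<lambda>n. ?N (Y n) \<zeta> * \<psi> (Y n) \<zeta>) \<longlonglongrightarrow> ?N t \<zeta> * \<psi> t \<zeta>"
        by (intro AE_I2 tendsto_mult tendsto_const nl_hat_tendsto \<psi>lim Y)
    qed measurable
    then show "(\<lambda>n. y' (Y n)) \<longlonglongrightarrow> y' t" unfolding y'_def by (rule tendsto_minus)
  qed
  ultimately have "(LINT t|lborel. indicator {0..T} t *\<^sub>R y' t) = y T - y 0"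
    by (intro integral_FTC_Icc T) auto
  moreover have "y T = (LINT \<zeta>|lborel. indicator K \<zeta> *\<^sub>R (?E T \<zeta> * Uh T \<zeta>))" "y 0 = (LINT \<zeta>|lborel. indicator K \<zeta> *\<^sub>R Uh 0 \<zeta>)"
    unfolding y_def \<psi>_def by (simp_all add: mult.commute)
  moreover have "y' t = - (LINT \<zeta>|lborel. indicator K \<zeta> *\<^sub>R (?E t \<zeta> * ?N t \<zeta>))" for t
    unfolding y'_def \<psi>_def by (intro arg_cong[where f=uminus] Bochner_Integration.integral_cong[OF refl])
       (simp only: scaleR_conv_of_real mult_ac)
  ultimately show ?thesis by simp
qed

end

lemma AE_fst_neq_0: "AE \<zeta> in lborel. fst (\<zeta> :: real \<times> real) \<noteq> 0"
proof (rule AE_I')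
  have "emeasure (lborel \<Otimes>\<^sub>M lborel) ({0 :: real} \<times> (UNIV :: real set)) = 0"
    by (subst lborel.emeasure_pair_measure_Times) auto
  then show "{0} \<times> UNIV \<in> null_sets (lborel :: (real \<times> real) measure)"
    unfolding lborel_prod by (intro null_setsI) (auto simp: borel_Times)
qed auto

context kp_flow
begin

text \<open>The integrand is bounded with bounded support in time and frequency jointly; this is the
  hypothesis for exchanging the two integrals.\<close>

lemma duhamel_integrand_integrable:
  assumes K[measurable]: "K \<in> sets borel" and Kb: "bounded K" and \<Lambda>: "\<And>\<zeta>. \<zeta> \<in> K \<Longrightarrow> norm (symb \<epsilon> \<nu> \<zeta>) \<le> \<Lambda>" and T: "T \<ge> 0"
  shows "integrable (lborel \<Otimes>\<^sub>M lborel) (\<lambda>(t, \<zeta>). indicator {0..T} t *\<^sub>R (indicator K \<zeta> *\<^sub>R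
     (exp (- (of_real t * symb \<epsilon> \<nu> \<zeta>)) * (\<i> * of_real (fst \<zeta>) / of_nat (p + 1) * nl_hat p u t \<zeta>))))"
proof -
  obtain R where R: "\<And>\<zeta>. \<zeta> \<in> K \<Longrightarrow> norm \<zeta> \<le> R" using Kb by (auto simp: bounded_iff)
  define M where "M = Kinf (B\<^sup>2) ^ (p - 1) * B\<^sup>2"
  have GM: "G r \<le> M" if "r \<ge> 0" for r
    using order_trans[OF G_le[OF that] mult_left_mono[OF power_mono[OF B[OF that] Hs_norm_nonneg]]] KinfB_nonneg by (simp add: M_def)
  have M0: "0 \<le> M" using GM[of 0] G_nonneg[of 0] by simp
  let ?H = "\<lambda>x. indicator {0..T} (fst x) *\<^sub>R (indicator K (snd x) *\<^sub>R
     (exp (- (of_real (fst x) * symb \<epsilon> \<nu> (snd x))) * (\<i> * of_real (fst (snd x)) / of_nat (p + 1) * nl_hat p u (fst x) (snd x))))"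
  have m1: "(\<lambda>x. nl_hat p u (fst x) (snd x)) \<in> borel_measurable (borel \<Otimes>\<^sub>M borel)"
    using nl_hat_borel by (simp only: borel_prod)
  have "?H \<in> borel_measurable (borel \<Otimes>\<^sub>M borel)"
    using m1 by measurable
  then have m: "?H \<in> borel_measurable borel" by (simp only: borel_prod)
  have le: "norm (?H x) \<le> (exp (T * \<bar>\<Lambda>\<bar>) * (\<bar>R\<bar> * M)) * indicator ({0..T} \<times> K) x" for x
  proof (cases "fst x \<in> {0..T} \<and> snd x \<in> K")
    case True
    have "Re (- (of_real (fst x) * symb \<epsilon> \<nu> (snd x))) \<le> norm (- (of_real (fst x) * symb \<epsilon> \<nu> (snd x)))" by (rule complex_Re_le_cmod)
    also have "\<dots> = \<bar>fst x\<bar> * norm (symb \<epsilon> \<nu> (snd x))" by (simp only: norm_mult norm_minus_cancel norm_of_real)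
    also have "\<dots> \<le> T * \<bar>\<Lambda>\<bar>" using True \<Lambda>[of "snd x"] by (intro mult_mono) auto
    finally have e: "norm (exp (- (of_real (fst x) * symb \<epsilon> \<nu> (snd x)))) \<le> exp (T * \<bar>\<Lambda>\<bar>)"
      by (simp only: norm_exp_eq_Re exp_le_cancel_iff)
    have "\<bar>fst (snd x)\<bar> / real (p + 1) \<le> \<bar>fst (snd x)\<bar> / 1" by (intro divide_left_mono) auto
    then have a: "\<bar>fst (snd x)\<bar> / real (p + 1) \<le> \<bar>R\<bar>"
      using R[of "snd x"] True norm_fst_le[of "fst (snd x)" "snd (snd x)"] by simp
    have b: "norm (nl_hat p u (fst x) (snd x)) \<le> M"
      using nl_hat_le[of "fst x" "snd x"] GM[of "fst x"] True by simp
    have "norm (?H x) = norm (exp (- (of_real (fst x) * symb \<epsilon> \<nu> (snd x)))) * (\<bar>fst (snd x)\<bar> / real (p + 1) * norm (nl_hat p u (fst x) (snd x)))"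
      using True by (simp only: norm_mult norm_divide norm_ii norm_of_real norm_of_nat mult_1 indicator_simps scaleR_one)
    also have "\<dots> \<le> exp (T * \<bar>\<Lambda>\<bar>) * (\<bar>R\<bar> * M)"
      using a b e M0 by (intro mult_mono) auto
    finally show ?thesis using True by (simp add: indicator_def mem_Times_iff)
  next
    case False
    then have z: "?H x = 0" by (auto simp: indicator_def)
    show ?thesis unfolding z norm_zero using M0 by (intro mult_nonneg_nonneg) auto
  qed
  have "integrable lborel ?H"
    by (rule integrable_bounded_support[OF m le]) (use Kb in \<open>auto intro!: borel_Times bounded_Times\<close>)
  then show ?thesis by (simp only: lborel_prod case_prod_unfold)
qed

text \<open>The tested identity holds with \<open>K\<close> replaced by any Borel subset, so the
  difference of the two sides has integral 0 over every Borel set.\<close>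

lemma duhamel_AE_on:
  assumes K[measurable]: "K \<in> sets borel" and Kb: "bounded K" and \<Lambda>: "\<And>\<zeta>. \<zeta> \<in> K \<Longrightarrow> norm (symb \<epsilon> \<nu> \<zeta>) \<le> \<Lambda>" and T: "T \<ge> 0"
  shows "AE \<zeta> in lborel. indicator K \<zeta> *\<^sub>R (exp (- (of_real T * symb \<epsilon> \<nu> \<zeta>)) * Uh T \<zeta> - Uh 0 \<zeta> + \<i> * of_real (fst \<zeta>) / of_nat (p + 1) * duhamel p \<epsilon> \<nu> u T \<zeta>) = 0"
proof -
  let ?E = "\<lambda>t \<zeta>. exp (- (of_real t * symb \<epsilon> \<nu> \<zeta>))" and ?c = "\<lambda>\<zeta>. \<i> * of_real (fst \<zeta>) / of_nat (p + 1)"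
  let ?D = "duhamel p \<epsilon> \<nu> u T"
  have D: "(LINT t|lborel. indicator {0..T} t *\<^sub>R (indicator J \<zeta> *\<^sub>R (?E t \<zeta> * (?c \<zeta> * nl_hat p u t \<zeta>)))) = indicator J \<zeta> *\<^sub>R (?c \<zeta> * ?D \<zeta>)" for J \<zeta>
  proof -
    have "(LINT t|lborel. indicator {0..T} t *\<^sub>R (indicator J \<zeta> *\<^sub>R (?E t \<zeta> * (?c \<zeta> * nl_hat p u t \<zeta>))))
      = (LINT t|lborel. (indicator J \<zeta> *\<^sub>R ?c \<zeta>) * (indicator {0..T} t *\<^sub>R (?E t \<zeta> * nl_hat p u t \<zeta>)))"
      by (rule Bochner_Integration.integral_cong[OF refl]) (simp only: scaleR_conv_of_real mult_ac)
    also have "\<dots> = (indicator J \<zeta> *\<^sub>R ?c \<zeta>) * ?D \<zeta>"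
      unfolding duhamel_def by (rule integral_mult_right_zero)
    finally show ?thesis by (simp only: scaleR_conv_of_real mult_ac)
  qed
  have iD: "integrable lborel (\<lambda>\<zeta>. indicator J \<zeta> *\<^sub>R (?c \<zeta> * ?D \<zeta>))" if J: "J \<in> sets borel" "J \<subseteq> K" for J
    unfolding D[symmetric]
    by (rule lborel_pair.integrable_snd[OF duhamel_integrand_integrable[OF J(1) bounded_subset[OF Kb J(2)] \<Lambda> T]]) (use J in auto)
  have iU: "integrable lborel (\<lambda>\<zeta>. indicator J \<zeta> *\<^sub>R Uh 0 \<zeta>)" if J: "J \<in> sets borel" "J \<subseteq> K" for J
    by (rule Bochner_Integration.integrable_bound[OF integrable_norm_L2_bounded_set[OF Uh_L2c[of 0] J(1) bounded_subset[OF Kb J(2)]]])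
       (use Uh_borel[of 0] J in \<open>auto intro!: borel_measurable_scaleR borel_measurable_indicator\<close>)
  have iE: "integrable lborel (\<lambda>\<zeta>. indicator J \<zeta> *\<^sub>R (?E T \<zeta> * Uh T \<zeta>))" if J: "J \<in> sets borel" "J \<subseteq> K" for J
  proof (rule Bochner_Integration.integrable_bound)
    show "integrable lborel (\<lambda>\<zeta>. exp (T * \<bar>\<Lambda>\<bar>) * (indicator J \<zeta> * norm (Uh T \<zeta>)))"
      by (intro integrable_mult_right integrable_norm_L2_bounded_set Uh_L2c T J(1) bounded_subset[OF Kb J(2)])
    show "(\<lambda>\<zeta>. indicator J \<zeta> *\<^sub>R (?E T \<zeta> * Uh T \<zeta>)) \<in> borel_measurable lborel"
      using Uh_borel[OF T] J by (auto intro!: borel_measurable_scaleR borel_measurable_indicator borel_measurable_times)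
    show "AE \<zeta> in lborel. norm (indicator J \<zeta> *\<^sub>R (?E T \<zeta> * Uh T \<zeta>)) \<le> norm (exp (T * \<bar>\<Lambda>\<bar>) * (indicator J \<zeta> * norm (Uh T \<zeta>)))"
    proof (rule AE_I2)
      fix \<zeta>
      show "norm (indicator J \<zeta> *\<^sub>R (?E T \<zeta> * Uh T \<zeta>)) \<le> norm (exp (T * \<bar>\<Lambda>\<bar>) * (indicator J \<zeta> * norm (Uh T \<zeta>)))"
      proof (cases "\<zeta> \<in> J")
        case True
        have "Re (- (of_real T * symb \<epsilon> \<nu> \<zeta>)) \<le> norm (- (of_real T * symb \<epsilon> \<nu> \<zeta>))" by (rule complex_Re_le_cmod)
        also have "\<dots> = \<bar>T\<bar> * norm (symb \<epsilon> \<nu> \<zeta>)" by (simp only: norm_mult norm_minus_cancel norm_of_real)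
        also have "\<dots> \<le> T * \<bar>\<Lambda>\<bar>" using True J T \<Lambda>[of \<zeta>] by (intro mult_mono) auto
        finally have "norm (?E T \<zeta>) \<le> exp (T * \<bar>\<Lambda>\<bar>)" by (simp only: norm_exp_eq_Re exp_le_cancel_iff)
        from mult_right_mono[OF this norm_ge_zero[of "Uh T \<zeta>"]] True show ?thesis by (simp add: norm_mult)
      qed simp
    qed
  qed
  let ?F = "\<lambda>J \<zeta>. indicator J \<zeta> *\<^sub>R (?E T \<zeta> * Uh T \<zeta>) - indicator J \<zeta> *\<^sub>R Uh 0 \<zeta> + indicator J \<zeta> *\<^sub>R (?c \<zeta> * ?D \<zeta>)"
  \<comment> \<open>Here Fubini exchanges time and frequency, so that the inner time integral
    becomes \<open>duhamel\<close>.\<close>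
  have F: "integrable lborel (?F J)" "(LINT \<zeta>|lborel. ?F J \<zeta>) = 0" if J: "J \<in> sets borel" "J \<subseteq> K" for J
  proof -
    note i = iE[OF J] iU[OF J] iD[OF J]
    show "integrable lborel (?F J)" by (intro Bochner_Integration.integrable_add Bochner_Integration.integrable_diff i)
    have Jb: "bounded J" and J\<Lambda>: "\<And>\<zeta>. \<zeta> \<in> J \<Longrightarrow> norm (symb \<epsilon> \<nu> \<zeta>) \<le> \<Lambda>"
      using bounded_subset[OF Kb J(2)] \<Lambda> J by auto
    have "(LINT \<zeta>|lborel. ?F J \<zeta>) = (LINT \<zeta>|lborel. indicator J \<zeta> *\<^sub>R (?E T \<zeta> * Uh T \<zeta>)) - (LINT \<zeta>|lborel. indicator J \<zeta> *\<^sub>R Uh 0 \<zeta>)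
        + (LINT \<zeta>|lborel. indicator J \<zeta> *\<^sub>R (?c \<zeta> * ?D \<zeta>))"
      by (simp only: Bochner_Integration.integral_add Bochner_Integration.integral_diff Bochner_Integration.integrable_diff i)
    also have "(LINT \<zeta>|lborel. indicator J \<zeta> *\<^sub>R (?E T \<zeta> * Uh T \<zeta>)) - (LINT \<zeta>|lborel. indicator J \<zeta> *\<^sub>R Uh 0 \<zeta>)
       = (LINT t|lborel. indicator {0..T} t *\<^sub>R - (LINT \<zeta>|lborel. indicator J \<zeta> *\<^sub>R (?E t \<zeta> * (?c \<zeta> * nl_hat p u t \<zeta>))))"
      by (rule duhamel_tested[OF J(1) Jb J\<Lambda> T])
    also have "\<dots> = - (LINT t|lborel. LINT \<zeta>|lborel. indicator {0..T} t *\<^sub>R (indicator J \<zeta> *\<^sub>R (?E t \<zeta> * (?c \<zeta> * nl_hat p u t \<zeta>))))"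
      by (simp only: scaleR_minus_right Bochner_Integration.integral_minus integral_scaleR_right)
    also have "(LINT t|lborel. LINT \<zeta>|lborel. indicator {0..T} t *\<^sub>R (indicator J \<zeta> *\<^sub>R (?E t \<zeta> * (?c \<zeta> * nl_hat p u t \<zeta>))))
       = (LINT \<zeta>|lborel. LINT t|lborel. indicator {0..T} t *\<^sub>R (indicator J \<zeta> *\<^sub>R (?E t \<zeta> * (?c \<zeta> * nl_hat p u t \<zeta>))))"
      by (rule lborel_pair.Fubini_integral[symmetric, OF duhamel_integrand_integrable[OF J(1) Jb J\<Lambda> T]])
    also have "\<dots> = (LINT \<zeta>|lborel. indicator J \<zeta> *\<^sub>R (?c \<zeta> * ?D \<zeta>))" by (simp only: D)
    finally show "(LINT \<zeta>|lborel. ?F J \<zeta>) = 0" by simp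
  qed
  have "AE \<zeta> in lborel. ?F K \<zeta> = 0"
  proof (rule sigma_finite_measure.density_zero[OF lborel.sigma_finite_measure_axioms])
    show "integrable lborel (?F K)" by (rule F) auto
    fix A :: "(real \<times> real) set" assume "A \<in> sets lborel"
    then have "A \<inter> K \<in> sets borel" by auto
    then have "(LINT \<zeta>|lborel. ?F (A \<inter> K) \<zeta>) = 0" by (rule F) auto
    moreover have "indicator A \<zeta> *\<^sub>R ?F K \<zeta> = ?F (A \<inter> K) \<zeta>" for \<zeta>
      by (auto simp: indicator_def)
    ultimately show "set_lebesgue_integral lborel A (?F K) = 0"
      unfolding set_lebesgue_integral_def by simp
  qed
  then show ?thesis by eventually_elim (simp only: scaleR_diff_right scaleR_add_right)
qed

text \<open>The sets \<open>K n\<close> are bounded and keep |xi| \<ge> 1 / (n + 1), hence bound the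
  singular term of \<open>symb\<close>. Their union is the set xi \<noteq> 0, whose complement is
  null.\<close>

lemma duhamel_AE:
  assumes T: "T \<ge> 0"
  shows "AE \<zeta> in lborel. Uh T \<zeta> = exp (of_real T * symb \<epsilon> \<nu> \<zeta>) * (Uh 0 \<zeta> - \<i> * of_real (fst \<zeta>) / of_nat (p + 1) * duhamel p \<epsilon> \<nu> u T \<zeta>)"
proof -
  define K where "K n = {\<zeta> :: real \<times> real. norm \<zeta> \<le> real n \<and> 1 / real (Suc n) \<le> \<bar>fst \<zeta>\<bar>}" for n
  have "AE \<zeta> in lborel. indicator (K n) \<zeta> *\<^sub>R (exp (- (of_real T * symb \<epsilon> \<nu> \<zeta>)) * Uh T \<zeta> - Uh 0 \<zeta> + \<i> * of_real (fst \<zeta>) / of_nat (p + 1) * duhamel p \<epsilon> \<nu> u T \<zeta>) = 0" for n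
  \<comment> \<open>The three summands of the bound belong to nu xi^2, xi^3 and eta^2 / xi; the last
    one pays the factor \<open>Suc n\<close> for division by xi.\<close>
  proof (rule duhamel_AE_on[OF _ _ _ T, where \<Lambda>="\<nu> * (real n)\<^sup>2 + ((real n) ^ 3 + \<bar>\<epsilon>\<bar> * ((real n)\<^sup>2 * real (Suc n)))"])
    have "K n = cball 0 (real n) \<inter> {\<zeta>. 1 / real (Suc n) \<le> \<bar>fst \<zeta>\<bar>}" by (auto simp: K_def)
    then show "K n \<in> sets borel" by (auto intro!: borel_closed closed_Collect_le continuous_intros)
    show "bounded (K n)" by (auto simp: K_def bounded_iff)
    fix \<zeta> assume \<zeta>: "\<zeta> \<in> K n"
    have n1: "\<bar>fst \<zeta>\<bar> \<le> real n" "\<bar>snd \<zeta>\<bar> \<le> real n"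
      using \<zeta> norm_fst_le[of "fst \<zeta>" "snd \<zeta>"] norm_snd_le[of "snd \<zeta>" "fst \<zeta>"] by (auto simp: K_def)
    have n2: "1 / \<bar>fst \<zeta>\<bar> \<le> real (Suc n)"
    proof -
      have a: "1 / real (Suc n) \<le> \<bar>fst \<zeta>\<bar>" using \<zeta> by (simp add: K_def)
      moreover have "0 < 1 / real (Suc n)" by simp
      ultimately have "0 < \<bar>fst \<zeta>\<bar>" by linarith
      then show ?thesis using a by (simp add: field_simps)
    qed
    have "norm (symb \<epsilon> \<nu> \<zeta>) \<le> \<bar>\<nu> * (fst \<zeta>)\<^sup>2\<bar> + \<bar>(fst \<zeta>) ^ 3 - \<epsilon> * (snd \<zeta>)\<^sup>2 / fst \<zeta>\<bar>"
      unfolding symb_def by (rule order_trans[OF norm_triangle_ineq]) (simp only: norm_minus_cancel norm_mult norm_ii norm_of_real mult_1 order_refl)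
    also have "\<bar>\<nu> * (fst \<zeta>)\<^sup>2\<bar> \<le> \<nu> * (real n)\<^sup>2"
      using \<nu> power_mono[OF n1(1), of 2] by (simp add: abs_mult)
    also have "\<bar>(fst \<zeta>) ^ 3 - \<epsilon> * (snd \<zeta>)\<^sup>2 / fst \<zeta>\<bar> \<le> \<bar>fst \<zeta>\<bar> ^ 3 + \<bar>\<epsilon>\<bar> * (\<bar>snd \<zeta>\<bar>\<^sup>2 * (1 / \<bar>fst \<zeta>\<bar>))"
      by (rule order_trans[OF abs_triangle_ineq4]) (simp add: abs_mult power_abs)
    also have "\<bar>fst \<zeta>\<bar> ^ 3 + \<bar>\<epsilon>\<bar> * (\<bar>snd \<zeta>\<bar>\<^sup>2 * (1 / \<bar>fst \<zeta>\<bar>)) \<le> (real n) ^ 3 + \<bar>\<epsilon>\<bar> * ((real n)\<^sup>2 * real (Suc n))"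
      by (intro add_mono mult_mono power_mono n1 n2 order_refl) auto
    finally show "norm (symb \<epsilon> \<nu> \<zeta>) \<le> \<nu> * (real n)\<^sup>2 + ((real n) ^ 3 + \<bar>\<epsilon>\<bar> * ((real n)\<^sup>2 * real (Suc n)))" by simp
  qed
  then have "AE \<zeta> in lborel. \<forall>n. indicator (K n) \<zeta> *\<^sub>R (exp (- (of_real T * symb \<epsilon> \<nu> \<zeta>)) * Uh T \<zeta> - Uh 0 \<zeta> + \<i> * of_real (fst \<zeta>) / of_nat (p + 1) * duhamel p \<epsilon> \<nu> u T \<zeta>) = 0"
    unfolding AE_all_countable by blast
  then show ?thesis using AE_fst_neq_0
  proof eventually_elim
    case (elim \<zeta>)
    obtain n where n: "max (norm \<zeta>) (1 / \<bar>fst \<zeta>\<bar>) \<le> real n" using real_arch_simple[of "max (norm \<zeta>) (1 / \<bar>fst \<zeta>\<bar>)"] by blast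
    have "1 / \<bar>fst \<zeta>\<bar> \<le> real (Suc n)" using n by simp
    then have "1 / real (Suc n) \<le> \<bar>fst \<zeta>\<bar>" using elim(2) by (simp add: field_simps)
    then have "\<zeta> \<in> K n" using n by (simp add: K_def)
    then have "exp (- (of_real T * symb \<epsilon> \<nu> \<zeta>)) * Uh T \<zeta> - Uh 0 \<zeta> + \<i> * of_real (fst \<zeta>) / of_nat (p + 1) * duhamel p \<epsilon> \<nu> u T \<zeta> = 0"
      using elim(1)[rule_format, of n] by (simp only: indicator_simps scaleR_one)
    then have "exp (- (of_real T * symb \<epsilon> \<nu> \<zeta>)) * Uh T \<zeta> = Uh 0 \<zeta> - \<i> * of_real (fst \<zeta>) / of_nat (p + 1) * duhamel p \<epsilon> \<nu> u T \<zeta>"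
      by algebra
    then have "exp (of_real T * symb \<epsilon> \<nu> \<zeta>) * (exp (- (of_real T * symb \<epsilon> \<nu> \<zeta>)) * Uh T \<zeta>) = exp (of_real T * symb \<epsilon> \<nu> \<zeta>) * (Uh 0 \<zeta> - \<i> * of_real (fst \<zeta>) / of_nat (p + 1) * duhamel p \<epsilon> \<nu> u T \<zeta>)"
      by (simp only:)
    then show ?case by (simp only: mult.assoc[symmetric] exp_add[symmetric] add.right_inverse exp_zero mult_1)
  qed
qed

section \<open>Uniform bounds and the scaling limit\<close>

text \<open>With the outer exponential absorbed, the exponent (T - t) symb has non-positive real
  part for t in [0, T]. The integrand is then bounded by \<open>G\<close>, uniformly in T and in
  frequency.\<close>

lemma exp_duhamel:
  "exp (of_real T * symb \<epsilon> \<nu> \<zeta>) * duhamel p \<epsilon> \<nu> u T \<zeta>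
    = (LINT t|lborel. indicator {0..T} t *\<^sub>R (exp (of_real (T - t) * symb \<epsilon> \<nu> \<zeta>) * nl_hat p u t \<zeta>))"
  unfolding duhamel_def
  by (subst integral_mult_right_zero[symmetric], rule Bochner_Integration.integral_cong[OF refl])
     (simp add: mult.assoc[symmetric] exp_add[symmetric] left_diff_distrib)

lemma norm_duhamel_integrand_le:
  "norm (indicator {0..T} t *\<^sub>R (exp (of_real (T - t) * symb \<epsilon> \<nu> \<zeta>) * nl_hat p u t \<zeta>)) \<le> indicator {0..} t * G t"
proof (cases "t \<in> {0..T}")
  case True
  have "norm (exp (of_real (T - t) * symb \<epsilon> \<nu> \<zeta>)) = exp (- ((T - t) * (\<nu> * (fst \<zeta>)\<^sup>2)))"
    unfolding norm_exp_eq_Re by (simp add: Re_symb)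
  also have "\<dots> \<le> 1" using True \<nu> by simp
  finally have "norm (exp (of_real (T - t) * symb \<epsilon> \<nu> \<zeta>)) * norm (nl_hat p u t \<zeta>) \<le> 1 * G t"
    by (intro mult_mono nl_hat_le) auto
  then show ?thesis using True by (simp add: norm_mult)
qed (use G_nonneg[of t] in simp)

lemma duhamel_integrand_borel:
  "(\<lambda>t. indicator {0..T} t *\<^sub>R (exp (of_real (T - t) * symb \<epsilon> \<nu> \<zeta>) * nl_hat p u t \<zeta>)) \<in> borel_measurable borel"
proof -
  have "continuous_on UNIV (\<lambda>t. nl_hat p u t \<zeta>)"
    by (rule continuous_on_sequentialI) (rule nl_hat_tendsto)
  then have "(\<lambda>t. nl_hat p u t \<zeta>) \<in> borel_measurable borel" by (rule borel_measurable_continuous_onI)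
  then show ?thesis by measurable
qed

lemma norm_exp_duhamel_le:
  "norm (exp (of_real T * symb \<epsilon> \<nu> \<zeta>) * duhamel p \<epsilon> \<nu> u T \<zeta>) \<le> (LINT t|lborel. indicator {0..} t * G t)"
  unfolding exp_duhamel
proof (rule Bochner_Integration.integral_norm_bound_integral[OF _ G_integrable norm_duhamel_integrand_le])
  show "integrable lborel (\<lambda>t. indicator {0..T} t *\<^sub>R (exp (of_real (T - t) * symb \<epsilon> \<nu> \<zeta>) * nl_hat p u t \<zeta>))"
  proof (rule Bochner_Integration.integrable_bound[OF G_integrable])
    show "AE t in lborel. norm (indicator {0..T} t *\<^sub>R (exp (of_real (T - t) * symb \<epsilon> \<nu> \<zeta>) * nl_hat p u t \<zeta>)) \<le> norm (indicator {0..} t * G t)"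
    proof (rule AE_I2)
      fix t
      show "norm (indicator {0..T} t *\<^sub>R (exp (of_real (T - t) * symb \<epsilon> \<nu> \<zeta>) * nl_hat p u t \<zeta>)) \<le> norm (indicator {0..} t * G t)"
        by (rule order_trans[OF norm_duhamel_integrand_le]) (simp only: real_norm_def abs_ge_self)
    qed
  qed (use duhamel_integrand_borel in simp)
qed

text \<open>These are the exponents for which t nu xi^2 and t eta^2 / xi are both invariant, while t
  xi^3 is of order t^(-1/2) and disappears in the limit \<open>lsymb\<close>.\<close>

definition zt :: "real \<Rightarrow> real \<times> real \<Rightarrow> real \<times> real" where
  "zt t \<zeta> = (t powr (-1/2) * fst \<zeta>, t powr (-3/4) * snd \<zeta>)"

definition lsymb :: "real \<times> real \<Rightarrow> complex" where
  "lsymb \<zeta> = - of_real (\<nu> * (fst \<zeta>)\<^sup>2) - \<i> * of_real (\<epsilon> * (snd \<zeta>)\<^sup>2 / fst \<zeta>)"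

lemma zt_tendsto_0: "((\<lambda>t. zt t \<zeta>) \<longlongrightarrow> 0) at_top"
proof -
  have "((\<lambda>t. (t powr (-1/2) * fst \<zeta>, t powr (-3/4) * snd \<zeta>)) \<longlongrightarrow> (0 * fst \<zeta>, 0 * snd \<zeta>)) at_top"
    by (intro tendsto_Pair tendsto_mult tendsto_const tendsto_neg_powr filterlim_ident) auto
  then show ?thesis by (simp add: zt_def zero_prod_def)
qed

lemma scaled_symb:
  assumes t: "t > 0"
  shows "of_real t * symb \<epsilon> \<nu> (zt t \<zeta>) = lsymb \<zeta> + \<i> * of_real (t powr (-1/2) * fst \<zeta> ^ 3)"
proof -
  have 1: "t * (t powr (-1/2))\<^sup>2 = 1"
    using t by (simp add: power2_eq_square powr_add[symmetric] powr_minus_divide)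
  have 2: "t * (t powr (-1/2)) ^ 3 = t powr (-1/2)"
    using 1 by (simp add: power3_eq_cube power2_eq_square mult.assoc)
  have 3: "t * ((t powr (-3/4))\<^sup>2 / t powr (-1/2)) = 1"
  proof -
    have "(t powr (-3/4))\<^sup>2 / t powr (-1/2) = t powr (-3/4 + -3/4 - -1/2)"
      by (simp only: power2_eq_square powr_add[symmetric] powr_diff[symmetric])
    also have "\<dots> = 1 / t" using t by (simp add: powr_minus_divide)
    finally show ?thesis using t by simp
  qed
  have "t * ((t powr (-1/2) * fst \<zeta>) ^ 3 - \<epsilon> * (t powr (-3/4) * snd \<zeta>)\<^sup>2 / (t powr (-1/2) * fst \<zeta>))
     = t * (t powr (-1/2)) ^ 3 * fst \<zeta> ^ 3 - t * ((t powr (-3/4))\<^sup>2 / t powr (-1/2)) * (\<epsilon> * (snd \<zeta>)\<^sup>2 / fst \<zeta>)"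
    by (simp add: power_mult_distrib algebra_simps)
  then have im: "t * ((t powr (-1/2) * fst \<zeta>) ^ 3 - \<epsilon> * (t powr (-3/4) * snd \<zeta>)\<^sup>2 / (t powr (-1/2) * fst \<zeta>))
     = t powr (-1/2) * fst \<zeta> ^ 3 - \<epsilon> * (snd \<zeta>)\<^sup>2 / fst \<zeta>"
    unfolding 2 3 by simp
  have re: "t * (\<nu> * (t powr (-1/2) * fst \<zeta>)\<^sup>2) = \<nu> * (fst \<zeta>)\<^sup>2"
    using 1 by (simp add: power_mult_distrib)
  have "of_real t * symb \<epsilon> \<nu> (zt t \<zeta>) = - of_real (t * (\<nu> * (t powr (-1/2) * fst \<zeta>)\<^sup>2))
     + \<i> * of_real (t * ((t powr (-1/2) * fst \<zeta>) ^ 3 - \<epsilon> * (t powr (-3/4) * snd \<zeta>)\<^sup>2 / (t powr (-1/2) * fst \<zeta>)))"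
    unfolding symb_def zt_def fst_conv snd_conv of_real_mult[of t] by (simp only: distrib_left mult_minus_right mult.left_commute)
  then show ?thesis unfolding im re lsymb_def by (simp only: of_real_diff algebra_simps)
qed

lemma scaled_symb_tendsto: "((\<lambda>t. of_real t * symb \<epsilon> \<nu> (zt t \<zeta>)) \<longlongrightarrow> lsymb \<zeta>) at_top"
proof (rule Lim_transform_eventually)
  have "((\<lambda>t. lsymb \<zeta> + \<i> * of_real (t powr (-1/2) * fst \<zeta> ^ 3)) \<longlongrightarrow> lsymb \<zeta> + \<i> * of_real (0 * fst \<zeta> ^ 3)) at_top"
    by (intro tendsto_intros tendsto_neg_powr filterlim_ident) auto
  then show "((\<lambda>t. lsymb \<zeta> + \<i> * of_real (t powr (-1/2) * fst \<zeta> ^ 3)) \<longlongrightarrow> lsymb \<zeta>) at_top" by simp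
  show "\<forall>\<^sub>F t in at_top. lsymb \<zeta> + \<i> * of_real (t powr (-1/2) * fst \<zeta> ^ 3) = of_real t * symb \<epsilon> \<nu> (zt t \<zeta>)"
    using eventually_gt_at_top[of 0] by eventually_elim (rule scaled_symb[symmetric])
qed

text \<open>A fixed delay is negligible: \<tau> symb is (\<tau> / t) times the convergent quantity t
  symb.\<close>

lemma scaled_symb_shift_tendsto: "((\<lambda>t. of_real (t - \<tau>) * symb \<epsilon> \<nu> (zt t \<zeta>)) \<longlongrightarrow> lsymb \<zeta>) at_top"
proof (rule Lim_transform_eventually)
  have "((\<lambda>t. of_real t * symb \<epsilon> \<nu> (zt t \<zeta>) - of_real (\<tau> * t powr (-1)) * (of_real t * symb \<epsilon> \<nu> (zt t \<zeta>))) \<longlongrightarrow> lsymb \<zeta> - of_real (\<tau> * 0) * lsymb \<zeta>) at_top"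
    by (intro tendsto_intros scaled_symb_tendsto tendsto_neg_powr filterlim_ident) auto
  then show "((\<lambda>t. of_real t * symb \<epsilon> \<nu> (zt t \<zeta>) - of_real (\<tau> * t powr (-1)) * (of_real t * symb \<epsilon> \<nu> (zt t \<zeta>))) \<longlongrightarrow> lsymb \<zeta>) at_top" by simp
  show "\<forall>\<^sub>F t in at_top. of_real t * symb \<epsilon> \<nu> (zt t \<zeta>) - of_real (\<tau> * t powr (-1)) * (of_real t * symb \<epsilon> \<nu> (zt t \<zeta>)) = of_real (t - \<tau>) * symb \<epsilon> \<nu> (zt t \<zeta>)"
    using eventually_gt_at_top[of 0]
  proof eventually_elim
    case (elim t)
    then have "\<tau> * t powr (-1) * t = \<tau>" by (simp add: powr_minus_divide)
    then have "of_real (\<tau> * t powr (-1)) * (of_real t :: complex) = of_real \<tau>" by (simp only: of_real_mult[symmetric])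
    then show ?case by (simp only: mult.assoc[symmetric] of_real_diff left_diff_distrib)
  qed
qed

text \<open>Dominated convergence in time with majorant \<open>G\<close>: the delay disappears, the
  frequency moves to 0, and the growing upper limit becomes an indicator converging
  pointwise.\<close>

lemma exp_duhamel_tendsto:
  "((\<lambda>t. exp (of_real t * symb \<epsilon> \<nu> (zt t \<zeta>)) * duhamel p \<epsilon> \<nu> u t (zt t \<zeta>)) \<longlongrightarrow>
     exp (lsymb \<zeta>) * (LINT \<tau>|lborel. indicator {0..} \<tau> *\<^sub>R nl_hat p u \<tau> 0)) at_top"
proof -
  have c: "continuous_on UNIV (nl_hat p u \<tau>)" for \<tau>
    unfolding nl_hat_def[abs_def] by (intro continuous_fourier integrable_of_real power_integrable) simp
  have nm: "(\<lambda>t. nl_hat p u t 0) \<in> borel_measurable borel"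
    by (intro borel_measurable_continuous_onI continuous_on_sequentialI nl_hat_tendsto)
  have "((\<lambda>t. LINT \<tau>|lborel. indicator {0..t} \<tau> *\<^sub>R (exp (of_real (t - \<tau>) * symb \<epsilon> \<nu> (zt t \<zeta>)) * nl_hat p u \<tau> (zt t \<zeta>))) \<longlongrightarrow>
     (LINT \<tau>|lborel. indicator {0..} \<tau> *\<^sub>R (exp (lsymb \<zeta>) * nl_hat p u \<tau> 0))) at_top"
  proof (rule integral_dominated_convergence_at_top[OF _ _ G_integrable])
    show "\<forall>\<^sub>F t in at_top. AE \<tau> in lborel. norm (indicator {0..t} \<tau> *\<^sub>R (exp (of_real (t - \<tau>) * symb \<epsilon> \<nu> (zt t \<zeta>)) * nl_hat p u \<tau> (zt t \<zeta>))) \<le> indicator {0..} \<tau> * G \<tau>"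
      by (intro always_eventually allI AE_I2 norm_duhamel_integrand_le)
    show "AE \<tau> in lborel. ((\<lambda>t. indicator {0..t} \<tau> *\<^sub>R (exp (of_real (t - \<tau>) * symb \<epsilon> \<nu> (zt t \<zeta>)) * nl_hat p u \<tau> (zt t \<zeta>))) \<longlongrightarrow> indicator {0..} \<tau> *\<^sub>R (exp (lsymb \<zeta>) * nl_hat p u \<tau> 0)) at_top"
    proof (intro AE_I2 tendsto_scaleR tendsto_mult tendsto_exp scaled_symb_shift_tendsto)
      fix \<tau> :: real
      show "((\<lambda>t. indicator {0..t} \<tau> :: real) \<longlongrightarrow> indicator {0..} \<tau>) at_top"
      proof (rule tendsto_eventually)
        show "\<forall>\<^sub>F t in at_top. indicator {0..t} \<tau> = (indicator {0..} \<tau> :: real)"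
          using eventually_ge_at_top[of \<tau>] by eventually_elim (simp add: indicator_def)
      qed
      show "((\<lambda>t. nl_hat p u \<tau> (zt t \<zeta>)) \<longlongrightarrow> nl_hat p u \<tau> 0) at_top"
        by (rule continuous_on_tendsto_compose[OF c zt_tendsto_0]) auto
    qed
  qed (use duhamel_integrand_borel nm in auto)
  moreover have "(LINT \<tau>|lborel. indicator {0..} \<tau> *\<^sub>R (exp (lsymb \<zeta>) * nl_hat p u \<tau> 0)) = exp (lsymb \<zeta>) * (LINT \<tau>|lborel. indicator {0..} \<tau> *\<^sub>R nl_hat p u \<tau> 0)"
    by (subst integral_mult_right_zero[symmetric]) simp
  ultimately show ?thesis unfolding exp_duhamel by simp
qed

end

section \<open>Complex tensor products as test functions\<close>

definition csupp :: "real \<Rightarrow> (real \<Rightarrow> 'a::zero) \<Rightarrow> bool" where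
  "csupp R f \<longleftrightarrow> (\<forall>x. \<bar>x\<bar> > R \<longrightarrow> f x = 0)"

text \<open>Complex factors are needed because the eventual test function is a modulated bump,
  whereas \<open>test_fun\<close> speaks of real functions.\<close>

definition tens :: "(real \<Rightarrow> complex) \<Rightarrow> (real \<Rightarrow> complex) \<Rightarrow> real \<times> real \<Rightarrow> complex" where
  "tens f g z = f (fst z) * g (snd z)"

lemma jet_bounded_linear:
  assumes "jet A" "bounded_linear L"
  shows "jet (\<lambda>n x. L (A n x))"
  using assms bounded_linear.has_vector_derivative unfolding jet_def by blast

lemma complex_jet_support:
  assumes "jet (A :: nat \<Rightarrow> real \<Rightarrow> complex)" "csupp R (A 0)"
  shows "csupp R (A n)"
proof -
  have "Re (A n x) = 0 \<and> Im (A n x) = 0" if "\<bar>x\<bar> > R" for x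
    using jet_support[OF jet_bounded_linear[OF assms(1) bounded_linear_Re], of R x n]
      jet_support[OF jet_bounded_linear[OF assms(1) bounded_linear_Im], of R x n] assms(2) that
    by (auto simp: csupp_def)
  then show ?thesis by (simp add: csupp_def complex_eq_iff)
qed

lemma tens_facts:
  assumes f: "continuous_on UNIV f" "csupp R f" and g: "continuous_on UNIV g" "csupp R g"
  shows tens_continuous: "continuous_on UNIV (tens f g)" and tens_integrable: "integrable lborel (tens f g)"
    and tens_L2c: "L2c (tens f g)" and tens_supp: "\<exists>R. \<forall>z. norm z > R \<longrightarrow> tens f g z = 0"
proof -
  show c: "continuous_on UNIV (tens f g)"
    unfolding tens_def[abs_def]
    by (intro continuous_intros continuous_on_compose2[OF f(1)] continuous_on_compose2[OF g(1)]) auto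
  have supp: "tens f g z = 0" if "norm z > 2 * \<bar>R\<bar>" for z
  proof -
    have "norm z \<le> \<bar>fst z\<bar> + \<bar>snd z\<bar>" using norm_Pair_le[of "fst z" "snd z"] by simp
    then have "\<bar>fst z\<bar> > R \<or> \<bar>snd z\<bar> > R" using that by linarith
    then show ?thesis using f(2) g(2) by (auto simp: tens_def csupp_def)
  qed
  then show "\<exists>R. \<forall>z. norm z > R \<longrightarrow> tens f g z = 0" by blast
  obtain C where C: "\<And>z. norm (tens f g z) \<le> C * indicator (cball 0 (2 * \<bar>R\<bar>)) z"
    using continuous_compact_support_bounded[OF c supp] by metis
  have m: "tens f g \<in> borel_measurable borel" by (rule borel_measurable_continuous_onI[OF c])
  show "integrable lborel (tens f g)" by (rule integrable_bounded_support[OF m C]) auto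
  show "L2c (tens f g)" by (rule L2c_bounded_support[OF m C]) auto
qed

context
  fixes A B :: "nat \<Rightarrow> real \<Rightarrow> complex" and R :: real
  assumes A: "jet A" "csupp R (A 0)" and B: "jet B" "csupp R (B 0)"
begin

lemmas tens_jet = tens_facts[OF jet_continuous[OF A(1)] complex_jet_support[OF A] jet_continuous[OF B(1)] complex_jet_support[OF B]]

lemma tens_directional:
  "((\<lambda>r. tens (A i) (B j) (z + r *\<^sub>R (1, 0))) has_vector_derivative tens (A (Suc i)) (B j) z) (at 0)"
  "((\<lambda>r. tens (A i) (B j) (z + r *\<^sub>R (0, 1))) has_vector_derivative tens (A i) (B (Suc j)) z) (at 0)"
proof -
  have "jet (\<lambda>n x. (A n x :: complex))" "jet (\<lambda>n x. (B n x :: complex))" using A B by auto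
  have sh: "((\<lambda>r. F n (c + r)) has_vector_derivative F (Suc n) c) (at 0)" if "jet (F :: nat \<Rightarrow> real \<Rightarrow> complex)" for F n c
  proof -
    have "((\<lambda>r. c + r) has_vector_derivative 1) (at 0)" by (auto intro!: derivative_eq_intros)
    moreover have "(F n has_vector_derivative F (Suc n) c) (at (c + 0))" using that by (simp add: jet_def)
    ultimately show ?thesis using vector_diff_chain_at[of "\<lambda>r. c + r" 1 0 "F n"] by (simp add: o_def)
  qed
  show "((\<lambda>r. tens (A i) (B j) (z + r *\<^sub>R (1, 0))) has_vector_derivative tens (A (Suc i)) (B j) z) (at 0)"
    using has_vector_derivative_mult[OF sh[OF A(1), of i "fst z"] has_vector_derivative_const[of "B j (snd z)"]] by (simp add: tens_def)
  show "((\<lambda>r. tens (A i) (B j) (z + r *\<^sub>R (0, 1))) has_vector_derivative tens (A i) (B (Suc j)) z) (at 0)"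
    using has_vector_derivative_mult[OF has_vector_derivative_const[of "A i (fst z)"] sh[OF B(1), of j "snd z"]] by (simp add: tens_def)
qed

text \<open>The inverse transform is the forward one at the reflected frequency, whence -i in place
  of i. It trades powers of frequency for derivatives, in both directions.\<close>

lemma ifourier_tens_derivative:
  "ifourier (tens (A k) (B j)) \<zeta> = (- \<i> * of_real (fst \<zeta>)) ^ k * ((- \<i> * of_real (snd \<zeta>)) ^ j * ifourier (tens (A 0) (B 0)) \<zeta>)"
proof -
  have 1: "ifourier (tens (A (Suc i)) (B j)) \<zeta> = - \<i> * of_real (fst \<zeta>) * ifourier (tens (A i) (B j)) \<zeta>" for i j
    unfolding ifourier_def
    by (subst fourier_directional_derivative[OF tens_jet(2) tens_jet(2) tens_jet(1) tens_directional(1)]) (simp add: inner_prod_def)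
  have 2: "ifourier (tens (A i) (B (Suc j))) \<zeta> = - \<i> * of_real (snd \<zeta>) * ifourier (tens (A i) (B j)) \<zeta>" for i j
    unfolding ifourier_def
    by (subst fourier_directional_derivative[OF tens_jet(2) tens_jet(2) tens_jet(1) tens_directional(2)]) (simp add: inner_prod_def)
  have 3: "ifourier (tens (A 0) (B j)) \<zeta> = (- \<i> * of_real (snd \<zeta>)) ^ j * ifourier (tens (A 0) (B 0)) \<zeta>" for j
  proof (induction j)
    case (Suc j)
    show ?case unfolding 2 Suc.IH power_Suc by (simp only: mult.assoc)
  qed simp
  show ?thesis
  proof (induction k)
    case 0
    show ?case by (subst 3) simp
  next
    case (Suc k)
    show ?case unfolding 1 Suc.IH power_Suc by (simp only: mult.assoc)
  qed
qed

text \<open>Multiplication by (1 + xi^2)(1 + eta^2) expands into four terms, each the modulus of the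
  transform of a derivative and hence bounded. Division gives an integrable majorant.\<close>

lemma integrable_power_ifourier_tens:
  "integrable lborel (\<lambda>\<zeta>. \<bar>fst \<zeta>\<bar> ^ k * norm (ifourier (tens (A 0) (B 0)) \<zeta>))"
proof -
  let ?P = "ifourier (tens (A 0) (B 0))"
  define C where "C i j = (LINT z|lborel. norm (tens (A i) (B j) z)) / (2 * pi)" for i j
  have le: "\<bar>fst \<zeta>\<bar> ^ i * (\<bar>snd \<zeta>\<bar> ^ j * norm (?P \<zeta>)) \<le> C i j" for i j \<zeta>
  proof -
    have "norm (ifourier (tens (A i) (B j)) \<zeta>) = \<bar>fst \<zeta>\<bar> ^ i * (\<bar>snd \<zeta>\<bar> ^ j * norm (?P \<zeta>))"
      by (subst ifourier_tens_derivative) (simp add: norm_mult norm_power)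
    then show ?thesis using norm_ifourier_le[of "tens (A i) (B j)" \<zeta>] by (simp only: C_def)
  qed
  let ?C = "C k 0 + C (k + 2) 0 + C k 2 + C (k + 2) 2"
  have Pm: "?P \<in> borel_measurable borel" by (rule ifourier_borel[OF tens_jet(2)])
  have m: "(\<lambda>\<zeta>. \<bar>fst \<zeta>\<bar> ^ k) \<in> borel_measurable (borel :: (real \<times> real) measure)"
    by (intro borel_measurable_continuous_onI continuous_intros)
  show ?thesis
  proof (rule Bochner_Integration.integrable_bound)
    have "integrable lborel (\<lambda>x::real. inverse (1 + x\<^sup>2))"
      using integrable_inverse_1_plus_square by (simp add: set_integrable_def einterval_def)
    then show "integrable lborel (\<lambda>z::real \<times> real. ?C * (inverse (1 + (fst z)\<^sup>2) * inverse (1 + (snd z)\<^sup>2)))"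
      by (intro integrable_mult_right integrable_tensor2)
    show "AE \<zeta> in lborel. norm (\<bar>fst \<zeta>\<bar> ^ k * norm (?P \<zeta>)) \<le> norm (?C * (inverse (1 + (fst \<zeta>)\<^sup>2) * inverse (1 + (snd \<zeta>)\<^sup>2)))"
    proof (rule AE_I2)
      fix \<zeta> :: "real \<times> real"
      let ?x = "1 + (fst \<zeta>)\<^sup>2" and ?y = "1 + (snd \<zeta>)\<^sup>2" and ?q = "\<bar>fst \<zeta>\<bar> ^ k * norm (?P \<zeta>)"
      have x: "?x > 0" and y: "?y > 0" by (auto simp: add_pos_nonneg)
      have "?q * (?x * ?y) = \<bar>fst \<zeta>\<bar> ^ k * (\<bar>snd \<zeta>\<bar> ^ 0 * norm (?P \<zeta>)) + \<bar>fst \<zeta>\<bar> ^ (k + 2) * (\<bar>snd \<zeta>\<bar> ^ 0 * norm (?P \<zeta>))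
        + \<bar>fst \<zeta>\<bar> ^ k * (\<bar>snd \<zeta>\<bar> ^ 2 * norm (?P \<zeta>)) + \<bar>fst \<zeta>\<bar> ^ (k + 2) * (\<bar>snd \<zeta>\<bar> ^ 2 * norm (?P \<zeta>))"
        unfolding power2_abs[symmetric, of "fst \<zeta>"] power2_abs[symmetric, of "snd \<zeta>"] power_add
        by (simp only: algebra_simps power_0 mult_1 mult_1_right)
      also have "\<dots> \<le> ?C" by (intro add_mono le)
      finally have "?q \<le> ?C / (?x * ?y)" using x y by (simp add: pos_le_divide_eq)
      also have "\<dots> = ?C * (inverse ?x * inverse ?y)" by (simp add: divide_inverse)
      finally have "?q \<le> ?C * (inverse ?x * inverse ?y)" .
      moreover have "0 \<le> ?q" by simp
      ultimately show "norm ?q \<le> norm (?C * (inverse ?x * inverse ?y))" unfolding real_norm_def by linarith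
    qed
  qed (use Pm m in auto)
qed

text \<open>Weak derivatives are tested with real functions. A complex tensor product consists of
  four real ones, for each of which the identity is available.\<close>

lemma wderiv_tens:
  assumes w: "wderiv l 0 f g" and f: "f \<in> borel_measurable borel" "\<And>K. compact K \<Longrightarrow> set_integrable lborel K f"
  shows "(LINT z|lborel. complex_of_real (g z) * tens (A 0) (B 0) z) = (-1) ^ l * (LINT z|lborel. complex_of_real (f z) * tens (A l) (B 0) z)"
proof -
  have g: "g \<in> borel_measurable borel" "\<And>K. compact K \<Longrightarrow> set_integrable lborel K g"
    using w by (auto simp: wderiv_def)
  have real_case: "(LINT z|lborel. g z * (a 0 (fst z) * b 0 (snd z))) = (-1) ^ l * (LINT z|lborel. f z * (a l (fst z) * b 0 (snd z)))"
    and ig: "integrable lborel (\<lambda>z. g z * (a i (fst z) * b 0 (snd z)))" and ifn: "integrable lborel (\<lambda>z. f z * (a i (fst z) * b 0 (snd z)))"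
    if a: "jet a" "csupp R (a 0)" and b: "jet b" "csupp R (b 0)" for a b :: "nat \<Rightarrow> real \<Rightarrow> real" and i
  proof -
    have t: "test_fun (\<lambda>z. a i (fst z) * b 0 (snd z))" for i
    proof -
      have "jet (\<lambda>n. a (n + i))" using a(1) by (simp add: jet_def)
      from test_fun_tensor[OF this _ b(1), of R] show ?thesis
        using jet_support[OF a(1), of R _ i] a(2) b(2) by (simp add: csupp_def)
    qed
    show "(LINT z|lborel. g z * (a 0 (fst z) * b 0 (snd z))) = (-1) ^ l * (LINT z|lborel. f z * (a l (fst z) * b 0 (snd z)))"
      using w t[of 0] pdx_power_tensor[OF a(1) b(1), of l 0 0] unfolding wderiv_def by simp
    obtain C S where CS: "\<And>z. \<bar>a i (fst z) * b 0 (snd z)\<bar> \<le> C * indicator (cball 0 S) z" using test_fun_bounded[OF t[of i]] by metis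
    show "integrable lborel (\<lambda>z. g z * (a i (fst z) * b 0 (snd z)))"
      using integrable_mult_bounded_support[OF g test_fun_borel[OF t[of i]] CS bounded_cball] by (simp add: mult.commute)
    show "integrable lborel (\<lambda>z. f z * (a i (fst z) * b 0 (snd z)))"
      using integrable_mult_bounded_support[OF f test_fun_borel[OF t[of i]] CS bounded_cball] by (simp add: mult.commute)
  qed
  let ?ar = "\<lambda>n x. Re (A n x)" and ?ai = "\<lambda>n x. Im (A n x)" and ?br = "\<lambda>n x. Re (B n x)" and ?bi = "\<lambda>n x. Im (B n x)"
  have j: "jet ?ar" "jet ?ai" "jet ?br" "jet ?bi" "csupp R (?ar 0)" "csupp R (?ai 0)" "csupp R (?br 0)" "csupp R (?bi 0)"
    using jet_bounded_linear[OF A(1) bounded_linear_Re] jet_bounded_linear[OF A(1) bounded_linear_Im]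
      jet_bounded_linear[OF B(1) bounded_linear_Re] jet_bounded_linear[OF B(1) bounded_linear_Im] A(2) B(2)
    by (auto simp: csupp_def)
  let ?I = "\<lambda>h i a b. LINT z|lborel. h z * (a i (fst z) * b 0 (snd z)) :: real"
  have split: "(LINT z|lborel. complex_of_real (h z) * tens (A i) (B 0) z)
      = Complex (?I h i ?ar ?br - ?I h i ?ai ?bi) (?I h i ?ar ?bi + ?I h i ?ai ?br)"
    if h: "\<And>a b. jet a \<Longrightarrow> csupp R (a 0) \<Longrightarrow> jet b \<Longrightarrow> csupp R (b 0) \<Longrightarrow> integrable lborel (\<lambda>z. h z * (a i (fst z) * b 0 (snd z)))" for h :: r2fun and i
  proof -
    note ii = h[OF j(1,5,3,7)] h[OF j(2,6,4,8)] h[OF j(1,5,4,8)] h[OF j(2,6,3,7)]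
    have eq: "complex_of_real (h z) * tens (A i) (B 0) z
      = complex_of_real (h z * (?ar i (fst z) * ?br 0 (snd z)) - h z * (?ai i (fst z) * ?bi 0 (snd z)))
        + \<i> * complex_of_real (h z * (?ar i (fst z) * ?bi 0 (snd z)) + h z * (?ai i (fst z) * ?br 0 (snd z)))" for z
      by (simp add: complex_eq_iff tens_def algebra_simps)
    show ?thesis
      unfolding eq using ii
      by (simp only: Bochner_Integration.integral_add integral_mult_right_zero integral_complex_of_real integrable_mult_right
          integrable_of_real Bochner_Integration.integrable_add Bochner_Integration.integrable_diff Bochner_Integration.integral_diff)
         (simp add: complex_eq_iff)
  qed
  have sg: "(LINT z|lborel. complex_of_real (g z) * tens (A 0) (B 0) z)
      = Complex (?I g 0 ?ar ?br - ?I g 0 ?ai ?bi) (?I g 0 ?ar ?bi + ?I g 0 ?ai ?br)"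
    by (rule split) (rule ig)
  have sf: "(LINT z|lborel. complex_of_real (f z) * tens (A l) (B 0) z)
      = Complex (?I f l ?ar ?br - ?I f l ?ai ?bi) (?I f l ?ar ?bi + ?I f l ?ai ?br)"
    by (rule split) (rule ifn)
  show ?thesis
    unfolding sg sf real_case[OF j(1,5,3,7)] real_case[OF j(2,6,4,8)] real_case[OF j(1,5,4,8)] real_case[OF j(2,6,3,7)]
    by (cases "even l") (simp_all add: complex_eq_iff)
qed

end

text \<open>Lebesgue measure is not zero, so the almost-everywhere filter is proper.\<close>

lemma lborel_AE_const: "(AE z in (lborel :: (real \<times> real) measure). P) \<longleftrightarrow> P"
  by (rule eventually_const) (simp add: ae_filter_eq_bot_iff emeasure_lborel_UNIV)

lemma fourier_0: "fourier (\<lambda>z. complex_of_real (f z)) 0 = complex_of_real ((LINT z|lborel. f z) / (2 * pi))"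
  unfolding fourier_eq by simp

text \<open>Fourier inversion at the origin: the damped identity at x = 0, with the damping removed
  on one side by integrability and on the other by continuity.\<close>

lemma integral_ifourier_tens:
  assumes f: "continuous_on UNIV f" "csupp R f" and g: "continuous_on UNIV g" "csupp R g"
    and P: "integrable lborel (ifourier (tens f g))"
  shows "(LINT \<zeta>|lborel. ifourier (tens f g) \<zeta>) = of_real (2 * pi) * (f 0 * g 0)"
proof -
  let ?h = "tens f g"
  note h = tens_facts[OF f g]
  have [measurable]: "?h \<in> borel_measurable borel" using h(2) by simp
  obtain R' where R': "\<And>z. norm z > R' \<Longrightarrow> ?h z = 0" using h(4) by blast
  obtain C where C: "\<And>z. norm (?h z) \<le> C * indicator (cball 0 R') z" "C \<ge> 0"
    using continuous_compact_support_bounded[OF h(1) R'] by metis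
  have Cb: "norm (?h z) \<le> C" for z using C(1)[of z] C(2) by (cases "z \<in> cball 0 R'") auto
  let ?s = "\<lambda>n. 1 / real (Suc n)"
  have "(LINT \<zeta>|lborel. gwt (?s n) \<zeta> * ifourier ?h \<zeta>) = of_real (2 * pi) * (LINT w|lborel. of_real (gauss2 w) * ?h (?s n *\<^sub>R w))" for n
    using fourier_gwt_ifourier[OF h(2), of "?s n" 0] by (simp add: fourier_eq divide_eq_eq mult.commute)
  moreover have "(\<lambda>n. LINT w|lborel. of_real (gauss2 w) * ?h (?s n *\<^sub>R w)) \<longlonglongrightarrow> (LINT w|lborel. of_real (gauss2 w) * ?h 0)"
  proof (rule integral_dominated_convergence)
    show "integrable lborel (\<lambda>w. gauss2 w * C)" using integrable_gauss2 by simp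
    show "AE w in lborel. norm (of_real (gauss2 w) * ?h (?s n *\<^sub>R w)) \<le> gauss2 w * C" for n
      using Cb by (auto simp: norm_mult gauss2_nonneg intro!: mult_left_mono)
    have "(\<lambda>n. ?h (?s n *\<^sub>R w)) \<longlonglongrightarrow> ?h (0 *\<^sub>R w)" for w :: "real \<times> real"
      by (rule continuous_on_tendsto_compose[OF h(1)]) (intro tendsto_intros LIMSEQ_Suc[OF lim_1_over_n], auto)
    then show "AE w in lborel. (\<lambda>n. of_real (gauss2 w) * ?h (?s n *\<^sub>R w)) \<longlonglongrightarrow> of_real (gauss2 w) * ?h 0"
      by (intro AE_I2 tendsto_intros) simp
  qed auto
  ultimately have "(\<lambda>n. LINT \<zeta>|lborel. gwt (?s n) \<zeta> * ifourier ?h \<zeta>) \<longlonglongrightarrow> of_real (2 * pi) * (LINT w|lborel. of_real (gauss2 w) * ?h 0)"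
    by (simp only:) (intro tendsto_mult tendsto_const)
  moreover have "(LINT w|lborel. of_real (gauss2 w) * ?h 0) = ?h 0"
    by (simp add: integral_gauss2)
  ultimately show ?thesis
    using LIMSEQ_unique[OF tendsto_integral_gwt[OF P]] by (simp add: tens_def)
qed

section \<open>The limiting profile and a test function that detects it\<close>

context kp_flow
begin

text \<open>The factor i xi comes from u = d_x of its x-primitive, (-i xi)^l from moving l
  derivatives onto the test function, and the exponential from the rescaled linear flow.\<close>

definition profile :: "nat \<Rightarrow> real \<times> real \<Rightarrow> complex" where
  "profile l \<zeta> = \<i> * of_real (fst \<zeta>) * (- \<i> * of_real (fst \<zeta>)) ^ l * exp (lsymb \<zeta>)"

lemma lsymb_borel [measurable]: "lsymb \<in> borel_measurable borel"
  unfolding lsymb_def[abs_def] by measurable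

lemma profile_borel [measurable]: "profile l \<in> borel_measurable borel"
  unfolding profile_def[abs_def] by measurable

lemma norm_exp_lsymb_le: "norm (exp (lsymb \<zeta>)) \<le> 1"
  unfolding norm_exp_eq_Re using \<nu> by (simp add: lsymb_def)

lemma norm_profile_le: "norm (profile l \<zeta>) \<le> \<bar>fst \<zeta>\<bar> ^ Suc l"
proof -
  have "norm (profile l \<zeta>) = \<bar>fst \<zeta>\<bar> ^ Suc l * norm (exp (lsymb \<zeta>))"
    unfolding profile_def by (simp add: norm_mult norm_power)
  also have "\<dots> \<le> \<bar>fst \<zeta>\<bar> ^ Suc l * 1" by (intro mult_left_mono norm_exp_lsymb_le) auto
  finally show ?thesis by simp
qed

text \<open>Modulating and dilating a fixed bump concentrates its transform at the frequency \<open>(1, 0)\<close>, where the profile does not vanish.\<close>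
lemma exists_test_profile:
  "\<exists>A B R. jet A \<and> csupp R (A 0) \<and> jet B \<and> csupp R (B 0) \<and> (LINT \<zeta>|lborel. profile l \<zeta> * ifourier (tens (A 0) (B 0)) \<zeta>) \<noteq> 0"
proof -
  let ?k = "\<lambda>x. complex_of_real (bump (-1) 1 1 x)"
  have sk: "smooth1 ?k" by (rule smooth1_bounded_linear[OF smooth1_bump bounded_linear_of_real])
  obtain K where K: "jet K" "K 0 = ?k" using sk unfolding smooth1_def by blast
  have Ks: "csupp 1 (K 0)" unfolding K(2) csupp_def by (auto intro!: bump_support)
  have kc: "continuous_on UNIV ?k" using jet_continuous[OF K(1), of 0] by (simp add: K(2))
  let ?P = "ifourier (tens ?k ?k)"
  have Pint: "integrable lborel (\<lambda>\<zeta>. \<bar>fst \<zeta>\<bar> ^ i * norm (?P \<zeta>))" for i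
    using integrable_power_ifourier_tens[OF K(1) Ks K(1) Ks, of i] by (simp add: K(2))
  have tint: "integrable lborel (tens ?k ?k)"
    using tens_integrable[OF kc _ kc, of 1] Ks by (simp add: K(2))
  have Pm[measurable]: "?P \<in> borel_measurable borel" by (rule ifourier_borel[OF tint])
  have P1: "integrable lborel ?P"
    by (rule Bochner_Integration.integrable_bound[OF Pint[of 0]]) auto
  \<comment> \<open>By inversion at the origin this integral is 2 pi times the squared value of the
    bump at its centre, which is positive.\<close>
  have IP: "(LINT \<zeta>|lborel. ?P \<zeta>) \<noteq> 0"
    using integral_ifourier_tens[OF kc _ kc _ P1, of 1] Ks by (simp add: K(2) bump_def exp_inv_def)
  define c where "c n = 1 / real (Suc n)" for n
  have c: "c n > 0" "c n \<le> 1" for n by (auto simp: c_def divide_le_eq)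
  have c0: "c \<longlonglongrightarrow> 0" unfolding c_def[abs_def] by (rule LIMSEQ_Suc[OF lim_1_over_n])
  \<comment> \<open>The phase \<open>cis (- x)\<close> shifts the inverse transform to be centred at
    xi = 1, and the dilation by \<open>c n\<close> concentrates it there; y needs no
    modulation.\<close>
  let ?f = "\<lambda>n x. cis ((-1) * x) * ?k (c n * x + 0)" and ?g = "\<lambda>n x. ?k (c n * x + 0)"
  let ?e = "(1, 0) :: real \<times> real"
  have four: "ifourier (tens (?f n) (?g n)) \<zeta> = ?P ((\<zeta> - ?e) /\<^sub>R c n) /\<^sub>R (c n)\<^sup>2" for n \<zeta>
  proof -
    let ?F = "\<lambda>w. cis (w \<bullet> ((\<zeta> - ?e) /\<^sub>R c n)) * tens ?k ?k w"
    have "(LINT z|lborel. cis (z \<bullet> \<zeta>) * tens (?f n) (?g n) z) = (LINT z|lborel. ?F (c n *\<^sub>R z))"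
    proof (rule Bochner_Integration.integral_cong[OF refl])
      fix z :: "real \<times> real"
      have "(c n *\<^sub>R z) \<bullet> ((\<zeta> - ?e) /\<^sub>R c n) = z \<bullet> (\<zeta> - ?e)"
        using c(1)[of n] by (simp only: inner_scaleR_left inner_scaleR_right) simp
      also have "\<dots> = z \<bullet> \<zeta> + (-1) * fst z" by (simp add: inner_diff_right) (simp add: inner_prod_def)
      finally have e: "cis ((c n *\<^sub>R z) \<bullet> ((\<zeta> - ?e) /\<^sub>R c n)) = cis (z \<bullet> \<zeta>) * cis ((-1) * fst z)"
        by (simp only: cis_mult)
      show "cis (z \<bullet> \<zeta>) * tens (?f n) (?g n) z = ?F (c n *\<^sub>R z)"
        unfolding e by (simp only: tens_def fst_scaleR snd_scaleR real_scaleR_def add_0_right mult.assoc)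
    qed
    also have "\<dots> = (LINT z|lborel. ?F z) /\<^sub>R (c n)\<^sup>2"
      by (rule integral_scale2) (use c(1)[of n] tint in auto)
    finally show ?thesis unfolding ifourier_eq by (simp add: scaleR_conv_of_real)
  qed
  have shift: "(LINT \<zeta>|lborel. profile l \<zeta> * ifourier (tens (?f n) (?g n)) \<zeta>) = (LINT w|lborel. profile l (?e + c n *\<^sub>R w) * ?P w)" for n
  proof -
    let ?h = "\<lambda>\<zeta>. profile l \<zeta> * ?P ((\<zeta> - ?e) /\<^sub>R c n)"
    have h: "?h \<in> borel_measurable borel" by measurable
    have "(LINT w|lborel. ?h (1 + c n * fst w, 0 + c n * snd w)) = (LINT \<zeta>|lborel. ?h \<zeta>) /\<^sub>R \<bar>c n * c n\<bar>"
      by (rule integral_affine2[OF _ _ h]) (use c(1)[of n] in auto)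
    moreover have "?h (1 + c n * fst w, 0 + c n * snd w) = profile l (?e + c n *\<^sub>R w) * ?P w" for w
    proof -
      have cn: "c n \<noteq> 0" using c(1)[of n] by linarith
      have e1: "(1 + c n * fst w, 0 + c n * snd w) = ?e + c n *\<^sub>R w" by (simp add: prod_eq_iff)
      have e2: "(?e + c n *\<^sub>R w - ?e) /\<^sub>R c n = w" 
        by (simp only: add_diff_cancel_left' scaleR_scaleR left_inverse[OF cn] scaleR_one)
      show ?thesis unfolding e1 e2 ..
    qed
    ultimately have 1: "(LINT w|lborel. profile l (?e + c n *\<^sub>R w) * ?P w) = (LINT \<zeta>|lborel. ?h \<zeta>) /\<^sub>R \<bar>c n * c n\<bar>"
      by (simp only:)
    have "(LINT \<zeta>|lborel. profile l \<zeta> * ifourier (tens (?f n) (?g n)) \<zeta>) = (LINT \<zeta>|lborel. ?h \<zeta> /\<^sub>R (c n)\<^sup>2)"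
      unfolding four by (rule Bochner_Integration.integral_cong[OF refl]) (simp only: mult_scaleR_right)
    also have "\<dots> = (LINT \<zeta>|lborel. ?h \<zeta>) /\<^sub>R (c n)\<^sup>2" by (rule integral_scaleR_right)
    finally show ?thesis unfolding 1 by (simp only: power2_eq_square abs_of_nonneg[OF zero_le_square])
  qed
  \<comment> \<open>As the dilation grows the profile is frozen at (1, 0) and factors out of the
    integral. The factor 2 ^ Suc l in the majorant comes from |1 + c n x| \<le> 2 max(1,
    |x|).\<close>
  have lim: "(\<lambda>n. LINT w|lborel. profile l (?e + c n *\<^sub>R w) * ?P w) \<longlonglongrightarrow> (LINT w|lborel. profile l ?e * ?P w)"
  proof (rule integral_dominated_convergence)
    show "integrable lborel (\<lambda>w. 2 ^ Suc l * (\<bar>fst w\<bar> ^ 0 * norm (?P w) + \<bar>fst w\<bar> ^ Suc l * norm (?P w)))"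
      by (intro integrable_mult_right Bochner_Integration.integrable_add Pint)
    show "AE w in lborel. norm (profile l (?e + c n *\<^sub>R w) * ?P w) \<le> 2 ^ Suc l * (\<bar>fst w\<bar> ^ 0 * norm (?P w) + \<bar>fst w\<bar> ^ Suc l * norm (?P w))" for n
    proof (rule AE_I2)
      fix w :: "real \<times> real"
      have "\<bar>c n * fst w\<bar> \<le> 1 * \<bar>fst w\<bar>" unfolding abs_mult using c[of n] by (intro mult_right_mono) auto
      then have "\<bar>fst (?e + c n *\<^sub>R w)\<bar> \<le> 2 * max 1 \<bar>fst w\<bar>" by simp
      then have "\<bar>fst (?e + c n *\<^sub>R w)\<bar> ^ Suc l \<le> (2 * max 1 \<bar>fst w\<bar>) ^ Suc l" by (intro power_mono) auto
      also have "\<dots> = 2 ^ Suc l * max 1 \<bar>fst w\<bar> ^ Suc l" by (rule power_mult_distrib)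
      also have "\<dots> \<le> 2 ^ Suc l * (1 + \<bar>fst w\<bar> ^ Suc l)"
        by (intro mult_left_mono) (auto simp: max_def simp del: power_Suc)
      finally have "norm (profile l (?e + c n *\<^sub>R w)) \<le> 2 ^ Suc l * (1 + \<bar>fst w\<bar> ^ Suc l)"
        using norm_profile_le[of l "?e + c n *\<^sub>R w"] by linarith
      from mult_right_mono[OF this norm_ge_zero[of "?P w"]]
      show "norm (profile l (?e + c n *\<^sub>R w) * ?P w) \<le> 2 ^ Suc l * (\<bar>fst w\<bar> ^ 0 * norm (?P w) + \<bar>fst w\<bar> ^ Suc l * norm (?P w))"
        by (simp only: norm_mult power_0 mult_1 distrib_right distrib_left mult.assoc mult_1_right)
    qed
    show "AE w in lborel. (\<lambda>n. profile l (?e + c n *\<^sub>R w) * ?P w) \<longlonglongrightarrow> profile l ?e * ?P w"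
    proof (intro AE_I2 tendsto_mult tendsto_const)
      fix w :: "real \<times> real"
      have "(\<lambda>n. 1 + c n * fst w) \<longlonglongrightarrow> 1 + 0 * fst w" "(\<lambda>n. c n * snd w) \<longlonglongrightarrow> 0 * snd w"
        by (intro tendsto_intros c0)+
      then have a: "(\<lambda>n. 1 + c n * fst w) \<longlonglongrightarrow> 1" "(\<lambda>n. c n * snd w) \<longlonglongrightarrow> 0" by simp_all
      have "(\<lambda>n. \<i> * of_real (1 + c n * fst w) * (- \<i> * of_real (1 + c n * fst w)) ^ l
          * exp (- of_real (\<nu> * (1 + c n * fst w)\<^sup>2) - \<i> * of_real (\<epsilon> * (c n * snd w)\<^sup>2 / (1 + c n * fst w))))
        \<longlonglongrightarrow> \<i> * of_real 1 * (- \<i> * of_real 1) ^ l * exp (- of_real (\<nu> * 1\<^sup>2) - \<i> * of_real (\<epsilon> * 0\<^sup>2 / 1))"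
        by (intro tendsto_intros a) auto
      then show "(\<lambda>n. profile l (?e + c n *\<^sub>R w)) \<longlonglongrightarrow> profile l ?e"
        by (simp add: profile_def lsymb_def)
    qed
  qed measurable
  have "(LINT w|lborel. profile l ?e * ?P w) \<noteq> 0"
    using IP by (simp add: profile_def)
  with lim have "\<forall>\<^sub>F n in sequentially. (LINT w|lborel. profile l (?e + c n *\<^sub>R w) * ?P w) \<noteq> 0"
    by (rule tendsto_imp_eventually_ne)
  then obtain n where n: "(LINT w|lborel. profile l (?e + c n *\<^sub>R w) * ?P w) \<noteq> 0"
    by (auto simp: eventually_sequentially)
  have sg: "smooth1 (?g n)" by (rule smooth1_affine[OF sk])
  then have sf: "smooth1 (?f n)" by (intro smooth1_mult smooth1_cis)
  obtain A B where AB: "jet A" "A 0 = ?f n" "jet B" "B 0 = ?g n" using sf sg unfolding smooth1_def by metis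
  have z: "?k (c n * x + 0) = 0" if "\<bar>x\<bar> > real (Suc n)" for x
  proof -
    have "\<bar>c n * x + 0\<bar> > 1" using that by (simp add: c_def abs_mult divide_simps)
    then show ?thesis using Ks unfolding K(2) csupp_def by blast
  qed
  have "csupp (real (Suc n)) (A 0)" "csupp (real (Suc n)) (B 0)"
    unfolding AB csupp_def using z by (simp_all del: add_0_right of_nat_Suc)
  moreover have "(LINT \<zeta>|lborel. profile l \<zeta> * ifourier (tens (A 0) (B 0)) \<zeta>) \<noteq> 0"
    unfolding AB(2,4) shift by (rule n)
  ultimately show ?thesis using AB(1,3) by blast
qed

section \<open>The rescaled pairing and the lower bound\<close>

text \<open>The transform of the solution divided by i xi. Taking this factor out leaves a function
  that is bounded in time and frequency.\<close>

definition evol :: "r2fun \<Rightarrow> real \<Rightarrow> real \<times> real \<Rightarrow> complex" where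
  "evol w0 t \<zeta> = exp (of_real t * symb \<epsilon> \<nu> \<zeta>) * fourier (\<lambda>z. complex_of_real (w0 z)) \<zeta>
     - 1 / of_nat (p + 1) * (exp (of_real t * symb \<epsilon> \<nu> \<zeta>) * duhamel p \<epsilon> \<nu> u t \<zeta>)"

lemma duhamel_borel: "duhamel p \<epsilon> \<nu> u t \<in> borel_measurable borel"
proof -
  have m1: "(\<lambda>x. nl_hat p u (fst x) (snd x)) \<in> borel_measurable (borel \<Otimes>\<^sub>M borel)"
    using nl_hat_borel by (simp only: borel_prod)
  have "(\<lambda>x :: (real \<times> real) \<times> real. (snd x, fst x)) \<in> borel \<Otimes>\<^sub>M borel \<rightarrow>\<^sub>M borel \<Otimes>\<^sub>M borel" by measurable
  from measurable_compose[OF this m1]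
  have "(\<lambda>x. nl_hat p u (snd x) (fst x)) \<in> borel_measurable (borel \<Otimes>\<^sub>M borel)" by simp
  then have "(\<lambda>(\<zeta>, t'). indicator {0..t} t' *\<^sub>R (exp (- (of_real t' * symb \<epsilon> \<nu> \<zeta>)) * nl_hat p u t' \<zeta>)) \<in> borel_measurable (borel \<Otimes>\<^sub>M lborel)"
    unfolding case_prod_unfold by measurable
  from lborel.borel_measurable_lebesgue_integral[OF this]
  show ?thesis unfolding duhamel_def[abs_def] by simp
qed

context
  fixes w0 :: r2fun
  assumes w0: "integrable lborel w0" and init: "AE \<zeta> in lborel. Uh 0 \<zeta> = \<i> * of_real (fst \<zeta>) * fourier (\<lambda>z. complex_of_real (w0 z)) \<zeta>"
begin

lemma w0_complex: "integrable lborel (\<lambda>z. complex_of_real (w0 z))"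
  using w0 by simp

lemma evol_borel [measurable]: "evol w0 t \<in> borel_measurable borel"
  using duhamel_borel[of t] fourier_borel[OF w0_complex] unfolding evol_def[abs_def] by measurable

lemma Uh_eq_evol:
  assumes "t \<ge> 0"
  shows "AE \<zeta> in lborel. Uh t \<zeta> = \<i> * of_real (fst \<zeta>) * evol w0 t \<zeta>"
  using duhamel_AE[OF assms] init
proof eventually_elim
  case (elim \<zeta>)
  show ?case unfolding elim evol_def by (simp only: algebra_simps times_divide_eq_left times_divide_eq_right mult_1 mult_1_right)
qed

text \<open>The bound depends on neither time nor frequency, as domination in the scaling limit
  requires. The factor 1 / (2 pi) of the transform is simply estimated by 1.\<close>

lemma norm_evol_le:
  assumes t: "t \<ge> 0"
  shows "norm (evol w0 t \<zeta>) \<le> (LINT z|lborel. \<bar>w0 z\<bar>) + (LINT t|lborel. indicator {0..} t * G t)"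
proof -
  have G0: "0 \<le> (LINT t|lborel. indicator {0..} t * G t)" by (intro integral_nonneg_AE AE_I2 mult_nonneg_nonneg G_nonneg) auto
  have w: "norm (fourier (\<lambda>z. complex_of_real (w0 z)) \<zeta>) \<le> (LINT z|lborel. \<bar>w0 z\<bar>)"
  proof -
    have I: "0 \<le> (LINT z|lborel. \<bar>w0 z\<bar>)" by (intro integral_nonneg_AE) auto
    have "norm (fourier (\<lambda>z. complex_of_real (w0 z)) \<zeta>) \<le> (LINT z|lborel. \<bar>w0 z\<bar>) / (2 * pi)"
      using norm_fourier_le[of "\<lambda>z. complex_of_real (w0 z)" \<zeta>] by simp
    also have "\<dots> \<le> (LINT z|lborel. \<bar>w0 z\<bar>)"
      using divide_left_mono[of 1 "2 * pi" "LINT z|lborel. \<bar>w0 z\<bar>"] I pi_ge_two by simp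
    finally show ?thesis .
  qed
  have e: "norm (exp (of_real t * symb \<epsilon> \<nu> \<zeta>)) \<le> 1"
    unfolding norm_exp_eq_Re using t \<nu> by (simp add: Re_symb)
  have "norm (evol w0 t \<zeta>) \<le> norm (exp (of_real t * symb \<epsilon> \<nu> \<zeta>)) * norm (fourier (\<lambda>z. complex_of_real (w0 z)) \<zeta>)
      + 1 / real (p + 1) * norm (exp (of_real t * symb \<epsilon> \<nu> \<zeta>) * duhamel p \<epsilon> \<nu> u t \<zeta>)"
    unfolding evol_def by (rule order_trans[OF norm_triangle_ineq4]) (simp only: norm_mult norm_divide norm_one norm_of_nat order_refl)
  also have "\<dots> \<le> 1 * (LINT z|lborel. \<bar>w0 z\<bar>) + 1 * (LINT t|lborel. indicator {0..} t * G t)"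
    by (intro add_mono mult_mono e w norm_exp_duhamel_le) (use G0 in \<open>auto simp: integral_nonneg_AE\<close>)
  finally show ?thesis by simp
qed

text \<open>The limit of the bracket at frequency 0. It is kept as a complex number built from
  transforms; the identification with \<open>Mconst\<close> comes later.\<close>

definition mass :: complex where
  "mass = fourier (\<lambda>z. complex_of_real (w0 z)) 0 - 1 / of_nat (p + 1) * (LINT \<tau>|lborel. indicator {0..} \<tau> *\<^sub>R nl_hat p u \<tau> 0)"

lemma evol_tendsto: "((\<lambda>t. evol w0 t (zt t \<zeta>)) \<longlongrightarrow> exp (lsymb \<zeta>) * mass) at_top"
proof -
  have "((\<lambda>t. fourier (\<lambda>z. complex_of_real (w0 z)) (zt t \<zeta>)) \<longlongrightarrow> fourier (\<lambda>z. complex_of_real (w0 z)) 0) at_top"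
    by (rule continuous_on_tendsto_compose[OF continuous_fourier[OF w0_complex] zt_tendsto_0]) auto
  then have "((\<lambda>t. evol w0 t (zt t \<zeta>)) \<longlongrightarrow> exp (lsymb \<zeta>) * fourier (\<lambda>z. complex_of_real (w0 z)) 0
     - 1 / of_nat (p + 1) * (exp (lsymb \<zeta>) * (LINT \<tau>|lborel. indicator {0..} \<tau> *\<^sub>R nl_hat p u \<tau> 0))) at_top"
    unfolding evol_def by (intro tendsto_diff tendsto_mult tendsto_const tendsto_exp scaled_symb_tendsto exp_duhamel_tendsto)
  then show ?thesis by (simp only: mass_def right_diff_distrib mult.left_commute)
qed

context
  fixes A Q :: "nat \<Rightarrow> real \<Rightarrow> complex" and R :: real and l :: nat
  assumes A: "jet A" "csupp R (A 0)" and Q: "jet Q" "csupp R (Q 0)"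
begin

text \<open>What remains of the pairing with the dilated test function once all powers of t have
  been taken out.\<close>

definition pairing :: "real \<Rightarrow> complex" where
  "pairing t = (LINT \<zeta>|lborel. \<i> * of_real (fst \<zeta>) * (- \<i> * of_real (fst \<zeta>)) ^ l * evol w0 t (zt t \<zeta>) * ifourier (tens (A 0) (Q 0)) \<zeta>)"

lemma ifourier_test_borel: "ifourier (tens (A i) (Q j)) \<in> borel_measurable borel"
  by (rule ifourier_borel[OF tens_jet(2)[OF A Q]])

lemma zt_borel: "zt t \<in> borel_measurable borel"
  unfolding zt_def[abs_def] borel_prod[symmetric] by measurable

lemma evol_zt_borel: "(\<lambda>\<zeta>. evol w0 t (zt t \<zeta>)) \<in> borel_measurable borel"
  by (rule measurable_compose[OF zt_borel evol_borel])

lemma pairing_tendsto: "(pairing \<longlongrightarrow> mass * (LINT \<zeta>|lborel. profile l \<zeta> * ifourier (tens (A 0) (Q 0)) \<zeta>)) at_top"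
proof -
  let ?P = "ifourier (tens (A 0) (Q 0))" and ?E = "(LINT z|lborel. \<bar>w0 z\<bar>) + (LINT t|lborel. indicator {0..} t * G t)"
  have "((\<lambda>t. LINT \<zeta>|lborel. \<i> * of_real (fst \<zeta>) * (- \<i> * of_real (fst \<zeta>)) ^ l * evol w0 t (zt t \<zeta>) * ?P \<zeta>) \<longlongrightarrow>
      (LINT \<zeta>|lborel. \<i> * of_real (fst \<zeta>) * (- \<i> * of_real (fst \<zeta>)) ^ l * (exp (lsymb \<zeta>) * mass) * ?P \<zeta>)) at_top"
  proof (rule integral_dominated_convergence_at_top)
    show "integrable lborel (\<lambda>\<zeta>. ?E * (\<bar>fst \<zeta>\<bar> ^ Suc l * norm (?P \<zeta>)))"
      by (intro integrable_mult_right integrable_power_ifourier_tens[OF A Q])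
    show "\<forall>\<^sub>F t in at_top. AE \<zeta> in lborel. norm (\<i> * of_real (fst \<zeta>) * (- \<i> * of_real (fst \<zeta>)) ^ l * evol w0 t (zt t \<zeta>) * ?P \<zeta>) \<le> ?E * (\<bar>fst \<zeta>\<bar> ^ Suc l * norm (?P \<zeta>))"
      using eventually_ge_at_top[of 0]
    proof eventually_elim
      case (elim t)
      show ?case
      proof (rule AE_I2)
        fix \<zeta> :: "real \<times> real"
        have "norm (\<i> * of_real (fst \<zeta>) * (- \<i> * of_real (fst \<zeta>)) ^ l * evol w0 t (zt t \<zeta>) * ?P \<zeta>) = norm (evol w0 t (zt t \<zeta>)) * (\<bar>fst \<zeta>\<bar> ^ Suc l * norm (?P \<zeta>))"
          by (simp add: norm_mult norm_power)
        also have "\<dots> \<le> ?E * (\<bar>fst \<zeta>\<bar> ^ Suc l * norm (?P \<zeta>))"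
          by (intro mult_right_mono norm_evol_le elim) auto
        finally show "norm (\<i> * of_real (fst \<zeta>) * (- \<i> * of_real (fst \<zeta>)) ^ l * evol w0 t (zt t \<zeta>) * ?P \<zeta>) \<le> ?E * (\<bar>fst \<zeta>\<bar> ^ Suc l * norm (?P \<zeta>))" .
      qed
    qed
    show "AE \<zeta> in lborel. ((\<lambda>t. \<i> * of_real (fst \<zeta>) * (- \<i> * of_real (fst \<zeta>)) ^ l * evol w0 t (zt t \<zeta>) * ?P \<zeta>) \<longlongrightarrow>
        \<i> * of_real (fst \<zeta>) * (- \<i> * of_real (fst \<zeta>)) ^ l * (exp (lsymb \<zeta>) * mass) * ?P \<zeta>) at_top"
      by (intro AE_I2 tendsto_mult tendsto_const evol_tendsto)
  qed (use ifourier_test_borel evol_zt_borel in \<open>auto intro!: borel_measurable_times borel_measurable_power borel_complex_of_real\<close>)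
  moreover have "(LINT \<zeta>|lborel. \<i> * of_real (fst \<zeta>) * (- \<i> * of_real (fst \<zeta>)) ^ l * (exp (lsymb \<zeta>) * mass) * ?P \<zeta>) = (LINT \<zeta>|lborel. mass * (profile l \<zeta> * ?P \<zeta>))"
    by (rule Bochner_Integration.integral_cong[OF refl]) (simp only: profile_def mult_ac)
  ultimately show ?thesis by (simp only: pairing_def[abs_def] integral_mult_right_zero)
qed

text \<open>The pairing of the weak derivative with a dilated test function is estimated by
  \<open>a\<close> times an L^1 norm, and computed exactly on the frequency side. Comparing the
  powers of t gives the rate.\<close>

lemma pairing_le:
  assumes t: "t > 0" and g: "wderiv l 0 (u t) g" and a: "AE z in lborel. \<bar>g z\<bar> \<le> a"
  shows "t powr (- 7/4 - real l / 2) * norm (pairing t) \<le> a * (LINT z|lborel. norm (tens (A 0) (Q 0) z))"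
proof -
  define b c where "b = t powr (-1/2)" and "c = t powr (-3/4)"
  have bc: "b > 0" "c > 0" using t by (auto simp: b_def c_def)
  have bc': "b \<noteq> 0" "c \<noteq> 0" using bc by auto
  have t0: "t \<ge> 0" using t by simp
  note [measurable] = Xs_borel[OF X[OF t0] s]
  \<comment> \<open>Whole jets are dilated, so that the l-th derivative automatically carries the
    factor \<open>b ^ l\<close>.\<close>
  define A' Q' where "A' = (\<lambda>n x. b ^ n *\<^sub>R A n (b * x))" and "Q' = (\<lambda>n x. c ^ n *\<^sub>R Q n (c * x))"
  have j: "jet A'" "jet Q'" unfolding A'_def Q'_def by (intro jet_scale A Q)+
  define R' where "R' = \<bar>R\<bar> / b + \<bar>R\<bar> / c"
  have supp: "csupp R' (A' 0)" "csupp R' (Q' 0)"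
  proof -
    have "\<bar>b * x\<bar> > R \<and> \<bar>c * x\<bar> > R" if "\<bar>x\<bar> > R'" for x
    proof -
      have "\<bar>x\<bar> > \<bar>R\<bar> / b" "\<bar>x\<bar> > \<bar>R\<bar> / c" using that bc unfolding R'_def
        by (smt (verit) divide_nonneg_pos abs_ge_zero)+
      then show ?thesis using bc by (auto simp: abs_mult pos_divide_less_eq mult.commute)
    qed
    then show "csupp R' (A' 0)" "csupp R' (Q' 0)" using A(2) Q(2) by (auto simp: A'_def Q'_def csupp_def)
  qed
  note T' = tens_jet[OF j(1) supp(1) j(2) supp(2)]
  have scale: "tens (A' i) (Q' 0) z = of_real (b ^ i) * tens (A i) (Q 0) (0 + b * fst z, 0 + c * snd z)" for i z
    by (simp add: tens_def A'_def Q'_def scaleR_conv_of_real)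
  have tm: "tens (A i) (Q 0) \<in> borel_measurable borel" for i
    using tens_jet(2)[OF A Q, of i 0] by simp
  have four: "ifourier (tens (A' l) (Q' 0)) \<zeta> = of_real (b ^ l / (b * c)) * ifourier (tens (A l) (Q 0)) (fst \<zeta> / b, snd \<zeta> / c)" for \<zeta>
  proof -
    let ?F = "\<lambda>w. cis (w \<bullet> (fst \<zeta> / b, snd \<zeta> / c)) * tens (A l) (Q 0) w"
    have "(LINT z|lborel. cis (z \<bullet> \<zeta>) * tens (A' l) (Q' 0) z) = (LINT z|lborel. of_real (b ^ l) * ?F (0 + b * fst z, 0 + c * snd z))"
      by (rule Bochner_Integration.integral_cong[OF refl]) (use bc in \<open>simp add: scale inner_prod_def\<close>)
    also have "\<dots> = of_real (b ^ l) * (LINT z|lborel. ?F (0 + b * fst z, 0 + c * snd z))"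
      by (rule integral_mult_right_zero)
    also have "(LINT z|lborel. ?F (0 + b * fst z, 0 + c * snd z)) = (LINT z|lborel. ?F z) /\<^sub>R \<bar>b * c\<bar>"
    proof (rule integral_affine2)
      show "?F \<in> borel_measurable borel"
        by (rule borel_measurable_times[OF borel_measurable_continuous_onI tm]) (intro continuous_intros)
    qed (use bc in auto)
    finally have e: "(LINT z|lborel. cis (z \<bullet> \<zeta>) * tens (A' l) (Q' 0) z) = of_real (b ^ l) * ((LINT z|lborel. ?F z) /\<^sub>R \<bar>b * c\<bar>)" .
    have bcp: "\<bar>b * c\<bar> = b * c" using bc by simp
    have "of_real k * (of_real m * (I /\<^sub>R d)) = of_real (m / d) * (of_real k * I)" for k m d :: real and I :: complex
      by (simp add: scaleR_conv_of_real divide_inverse mult_ac)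
    then show ?thesis unfolding ifourier_eq e bcp .
  qed
  have scale_back: "I = of_real d * I'" if "I' = I /\<^sub>R \<bar>d\<bar>" "d > 0" for d and I I' :: complex
    using that by (simp add: scaleR_conv_of_real)
  have zt_bc: "zt t \<zeta> = (b * fst \<zeta>, c * snd \<zeta>)" for \<zeta>
    unfolding zt_def b_def c_def by simp
  have loc: "set_integrable lborel K (u t)" if K: "compact K" for K
  proof -
    have Kb: "K \<in> sets borel" "bounded K" using K by (auto intro: borel_compact compact_imp_bounded)
    have L: "L2c (\<lambda>z. complex_of_real (u t z))" by (rule is_FT_L2c(1)[OF Uh_FT[OF t0]])
    show ?thesis unfolding set_integrable_def
      by (rule Bochner_Integration.integrable_bound[OF integrable_norm_L2_bounded_set[OF L Kb]])
         (use Kb in \<open>auto simp: abs_mult intro!: borel_measurable_scaleR borel_measurable_indicator\<close>)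
  qed
  have "(LINT z|lborel. complex_of_real (g z) * tens (A' 0) (Q' 0) z) = (-1) ^ l * (LINT z|lborel. complex_of_real (u t z) * tens (A' l) (Q' 0) z)"
    by (rule wderiv_tens[OF j(1) supp(1) j(2) supp(2) g _ loc]) simp
  also have "(LINT z|lborel. complex_of_real (u t z) * tens (A' l) (Q' 0) z) = (LINT \<zeta>|lborel. Uh t \<zeta> * ifourier (tens (A' l) (Q' 0)) \<zeta>)"
    by (rule is_FT_dual[OF Uh_FT[OF t0] T'(2) T'(1) T'(3) T'(4)])
  also have "\<dots> = (LINT \<zeta>|lborel. \<i> * of_real (fst \<zeta>) * evol w0 t \<zeta> * (of_real (b ^ l / (b * c)) * ifourier (tens (A l) (Q 0)) (fst \<zeta> / b, snd \<zeta> / c)))"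
  proof (rule integral_cong_AE)
    show "AE \<zeta> in lborel. Uh t \<zeta> * ifourier (tens (A' l) (Q' 0)) \<zeta> = \<i> * of_real (fst \<zeta>) * evol w0 t \<zeta> * (of_real (b ^ l / (b * c)) * ifourier (tens (A l) (Q 0)) (fst \<zeta> / b, snd \<zeta> / c))"
      using Uh_eq_evol[OF t0] by eventually_elim (simp only: four)
    have m: "ifourier (tens (A' l) (Q' 0)) \<in> borel_measurable borel" by (rule ifourier_borel[OF T'(2)])
    then show "(\<lambda>\<zeta>. Uh t \<zeta> * ifourier (tens (A' l) (Q' 0)) \<zeta>) \<in> borel_measurable lborel"
      using Uh_borel[OF t0] by simp
    show "(\<lambda>\<zeta>. \<i> * of_real (fst \<zeta>) * evol w0 t \<zeta> * (of_real (b ^ l / (b * c)) * ifourier (tens (A l) (Q 0)) (fst \<zeta> / b, snd \<zeta> / c))) \<in> borel_measurable lborel"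
      unfolding four[symmetric] using m by measurable
  qed
  \<comment> \<open>The substitution by \<open>zt t\<close> has Jacobian \<open>b * c\<close> and
    undoes the dilation in the transform of the test function.\<close>
  also have "\<dots> = of_real (b * c) * (LINT \<zeta>|lborel. \<i> * of_real (b * fst \<zeta>) * evol w0 t (zt t \<zeta>) * (of_real (b ^ l / (b * c)) * ifourier (tens (A l) (Q 0)) \<zeta>))"
  proof -
    let ?h = "\<lambda>\<zeta>. \<i> * of_real (fst \<zeta>) * evol w0 t \<zeta> * (of_real (b ^ l / (b * c)) * ifourier (tens (A l) (Q 0)) (fst \<zeta> / b, snd \<zeta> / c))"
    have m: "ifourier (tens (A' l) (Q' 0)) \<in> borel_measurable borel" by (rule ifourier_borel[OF T'(2)])
    have "?h \<in> borel_measurable borel" unfolding four[symmetric] using m by measurable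
    then have "(LINT \<zeta>|lborel. ?h (0 + b * fst \<zeta>, 0 + c * snd \<zeta>)) = (LINT \<zeta>|lborel. ?h \<zeta>) /\<^sub>R \<bar>b * c\<bar>"
      by (rule integral_affine2[rotated 2]) (use bc in auto)
    then have "(LINT \<zeta>|lborel. ?h \<zeta>) = of_real (b * c) * (LINT \<zeta>|lborel. ?h (0 + b * fst \<zeta>, 0 + c * snd \<zeta>))"
      by (rule scale_back) (use bc in simp)
    also have "(LINT \<zeta>|lborel. ?h (0 + b * fst \<zeta>, 0 + c * snd \<zeta>)) = (LINT \<zeta>|lborel. \<i> * of_real (b * fst \<zeta>) * evol w0 t (zt t \<zeta>) * (of_real (b ^ l / (b * c)) * ifourier (tens (A l) (Q 0)) \<zeta>))"
      by (rule Bochner_Integration.integral_cong[OF refl]) (use bc in \<open>simp only: zt_bc add_0_left fst_conv snd_conv nonzero_mult_div_cancel_left[OF bc'(1)] nonzero_mult_div_cancel_left[OF bc'(2)] prod.collapse\<close>)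
    finally show ?thesis .
  qed
  \<comment> \<open>One further factor \<open>b\<close> comes from i xi; the Jacobian cancels the 1
    / (b c) of the dilated transform, so \<open>b ^ Suc l\<close> remains in total.\<close>
  also have "(LINT \<zeta>|lborel. \<i> * of_real (b * fst \<zeta>) * evol w0 t (zt t \<zeta>) * (of_real (b ^ l / (b * c)) * ifourier (tens (A l) (Q 0)) \<zeta>))
     = of_real (b * (b ^ l / (b * c))) * pairing t"
    unfolding pairing_def
    by (subst integral_mult_right_zero[symmetric], rule Bochner_Integration.integral_cong[OF refl],
        subst ifourier_tens_derivative[OF A Q, of l 0]) (simp only: of_real_mult power_0 mult_1 mult_ac)
  finally have "norm (LINT z|lborel. complex_of_real (g z) * tens (A' 0) (Q' 0) z) = norm ((-1) ^ l * (of_real (b * c) * (of_real (b * (b ^ l / (b * c))) * pairing t)))"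
    by (simp only:)
  also have "\<dots> = b ^ Suc l * norm (pairing t)"
    using bc by (simp add: norm_mult norm_power norm_divide abs_mult)
  finally have eq: "norm (LINT z|lborel. complex_of_real (g z) * tens (A' 0) (Q' 0) z) = b ^ Suc l * norm (pairing t)" .
  have "norm (LINT z|lborel. complex_of_real (g z) * tens (A' 0) (Q' 0) z) \<le> (LINT z|lborel. norm (complex_of_real (g z) * tens (A' 0) (Q' 0) z))"
    by (rule integral_norm_bound)
  also have "\<dots> \<le> (LINT z|lborel. a * norm (tens (A' 0) (Q' 0) z))"
  proof (rule integral_mono_AE')
    show "integrable lborel (\<lambda>z. a * norm (tens (A' 0) (Q' 0) z))" using T'(2) by (intro integrable_mult_right integrable_norm)
    show "AE z in lborel. norm (complex_of_real (g z) * tens (A' 0) (Q' 0) z) \<le> a * norm (tens (A' 0) (Q' 0) z)"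
      using a by eventually_elim (simp add: norm_mult mult_right_mono)
    show "AE z in lborel. 0 \<le> a * norm (tens (A' 0) (Q' 0) z)"
      using a by eventually_elim (meson abs_ge_zero mult_nonneg_nonneg norm_ge_zero order_trans)
  qed
  also have "\<dots> = a * (LINT z|lborel. norm (tens (A' 0) (Q' 0) z))" by (rule integral_mult_right_zero)
  also have "(LINT z|lborel. norm (tens (A' 0) (Q' 0) z)) = (LINT z|lborel. norm (tens (A 0) (Q 0) z)) / (b * c)"
  proof -
    have "(LINT z|lborel. norm (tens (A' 0) (Q' 0) z)) = (LINT z|lborel. norm (tens (A 0) (Q 0) (0 + b * fst z, 0 + c * snd z)))"
      by (simp add: scale)
    also have "\<dots> = (LINT z|lborel. norm (tens (A 0) (Q 0) z)) /\<^sub>R \<bar>b * c\<bar>"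
    proof (rule integral_affine2)
      show "(\<lambda>z. norm (tens (A 0) (Q 0) z)) \<in> borel_measurable borel" using tm[of 0] by measurable
    qed (use bc in auto)
    finally show ?thesis using bc by (simp add: divide_inverse mult.commute abs_mult)
  qed
  finally have "b ^ Suc l * norm (pairing t) \<le> a * ((LINT z|lborel. norm (tens (A 0) (Q 0) z)) / (b * c))" unfolding eq .
  then have "(b * c) * (b ^ Suc l * norm (pairing t)) \<le> (b * c) * (a * ((LINT z|lborel. norm (tens (A 0) (Q 0) z)) / (b * c)))"
    using bc by (intro mult_left_mono) auto
  also have "\<dots> = a * (LINT z|lborel. norm (tens (A 0) (Q 0) z))" using bc by simp
  \<comment> \<open>The factor \<open>b * c\<close> compensates the L^1 norm of the dilated test
    function; the exponents add up to -1/2 - 3/4 - (l + 1)/2.\<close>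
  also have "(b * c) * (b ^ Suc l * norm (pairing t)) = t powr (- 7/4 - real l / 2) * norm (pairing t)"
  proof -
    have "b ^ Suc l = b powr real (Suc l)" by (rule powr_realpow[OF bc(1), symmetric])
    also have "\<dots> = t powr ((-1/2) * real (Suc l))" unfolding b_def by (rule powr_powr)
    finally have "b ^ Suc l = t powr ((-1/2) * real (Suc l))" .
    then have "(b * c) * b ^ Suc l = t powr (-1/2 + -3/4 + (-1/2) * real (Suc l))"
      unfolding b_def c_def by (simp only: powr_add)
    also have "-1/2 + -3/4 + (-1/2) * real (Suc l) = - 7/4 - real l / 2" by (simp add: field_simps)
    finally show ?thesis by (simp only: mult.assoc[symmetric])
  qed
  finally show ?thesis .
qed

text \<open>Eventually the pairing exceeds half the modulus of its limit. The conclusion ranges over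
  every weak derivative and every almost-everywhere bound, so that the particular choice made by
  \<open>wd\<close> cannot matter.\<close>

lemma lower_bound_of_pairing:
  assumes nz: "(LINT \<zeta>|lborel. profile l \<zeta> * ifourier (tens (A 0) (Q 0)) \<zeta>) \<noteq> 0" "mass \<noteq> 0"
  shows "\<exists>C>0. \<exists>T>0. \<forall>t\<ge>T. \<forall>g a. wderiv l 0 (u t) g \<longrightarrow> (AE z in lborel. \<bar>g z\<bar> \<le> a) \<longrightarrow> C * t powr (- 7/4 - real l / 2) \<le> a"
proof -
  define L where "L = mass * (LINT \<zeta>|lborel. profile l \<zeta> * ifourier (tens (A 0) (Q 0)) \<zeta>)"
  define N where "N = (LINT z|lborel. norm (tens (A 0) (Q 0) z))"
  have L: "norm L > 0" using nz by (simp add: L_def)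
  have N: "N \<ge> 0" unfolding N_def by (intro integral_nonneg_AE) auto
  have "((\<lambda>t. norm (pairing t)) \<longlongrightarrow> norm L) at_top" unfolding L_def by (intro tendsto_norm pairing_tendsto)
  then have "\<forall>\<^sub>F t in at_top. norm L / 2 < norm (pairing t)" by (rule order_tendstoD) (use L in simp)
  then obtain T where T: "\<And>t. t \<ge> T \<Longrightarrow> norm L / 2 < norm (pairing t)" unfolding eventually_at_top_linorder by blast
  \<comment> \<open>\<open>N + 1\<close> in place of \<open>N\<close> avoids a separate proof that
    the L^1 norm is nonzero, and T is raised to at least 1 to be positive.\<close>
  have "norm L / 2 / (N + 1) * t powr (- 7/4 - real l / 2) \<le> a"
    if t: "t \<ge> max 1 T" and g: "wderiv l 0 (u t) g" and a: "AE z in lborel. \<bar>g z\<bar> \<le> a" for t g a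
  proof -
    have "AE z in (lborel :: (real \<times> real) measure). 0 \<le> a" using a by eventually_elim linarith
    then have a0: "0 \<le> a" by (simp only: lborel_AE_const)
    let ?w = "t powr (- 7/4 - real l / 2)"
    have "?w * (norm L / 2) \<le> ?w * norm (pairing t)"
      using T[of t] t by (intro mult_left_mono) auto
    also have "\<dots> \<le> a * N" unfolding N_def by (rule pairing_le[OF _ g a]) (use t in auto)
    also have "\<dots> \<le> a * (N + 1)" using a0 by (intro mult_left_mono) auto
    finally have "?w * (norm L / 2) / (N + 1) \<le> a" using N by (simp only: pos_divide_le_eq)
    then show ?thesis by (simp only: times_divide_eq_left times_divide_eq_right mult.commute)
  qed
  moreover have "norm L / 2 / (N + 1) > 0" using L N by simp
  ultimately show ?thesis
    by (intro exI[of _ "norm L / 2 / (N + 1)"] conjI exI[of _ "max 1 T"] allI impI) auto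
qed

end

lemma lower_bound_of_mass:
  assumes "mass \<noteq> 0"
  shows "\<exists>C>0. \<exists>T>0. \<forall>t\<ge>T. \<forall>g a. wderiv l 0 (u t) g \<longrightarrow> (AE z in lborel. \<bar>g z\<bar> \<le> a) \<longrightarrow> C * t powr (- 7/4 - real l / 2) \<le> a"
proof -
  obtain A Q R where AQ: "jet A" "csupp R (A 0)" "jet Q" "csupp R (Q 0)"
    and nz: "(LINT \<zeta>|lborel. profile l \<zeta> * ifourier (tens (A 0) (Q 0)) \<zeta>) \<noteq> 0"
    using exists_test_profile[of l] by metis
  show ?thesis by (rule lower_bound_of_pairing[OF AQ nz assms])
qed

lemma mass_eq:
  "mass = complex_of_real (((LINT z|lborel. w0 z) - 1 / real (p + 1) * (LINT \<tau>|lborel. indicator {0..} \<tau> *\<^sub>R (LINT z|lborel. u \<tau> z ^ (p + 1)))) / (2 * pi))"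
proof -
  have "(LINT \<tau>|lborel. indicator {0..} \<tau> *\<^sub>R nl_hat p u \<tau> 0)
     = (LINT \<tau>|lborel. complex_of_real ((indicator {0..} \<tau> *\<^sub>R (LINT z|lborel. u \<tau> z ^ (p + 1))) / (2 * pi)))"
  proof (rule Bochner_Integration.integral_cong[OF refl])
    fix \<tau> :: real
    show "indicator {0..} \<tau> *\<^sub>R nl_hat p u \<tau> 0 = complex_of_real ((indicator {0..} \<tau> *\<^sub>R (LINT z|lborel. u \<tau> z ^ (p + 1))) / (2 * pi))"
    proof (cases "\<tau> \<ge> 0")
      case True
      then have "nl_hat p u \<tau> 0 = complex_of_real ((LINT z|lborel. u \<tau> z ^ (p + 1)) / (2 * pi))"
        unfolding nl_hat_def by (simp only: max_absorb1 fourier_0)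
      then show ?thesis using True by (simp only: indicator_simps atLeast_iff scaleR_one)
    qed simp
  qed
  also have "\<dots> = complex_of_real ((LINT \<tau>|lborel. indicator {0..} \<tau> *\<^sub>R (LINT z|lborel. u \<tau> z ^ (p + 1))) / (2 * pi))"
    by (simp only: integral_complex_of_real integral_divide_zero)
  finally have 1: "(LINT \<tau>|lborel. indicator {0..} \<tau> *\<^sub>R nl_hat p u \<tau> 0)
    = complex_of_real ((LINT \<tau>|lborel. indicator {0..} \<tau> *\<^sub>R (LINT z|lborel. u \<tau> z ^ (p + 1))) / (2 * pi))" .
  show ?thesis
    unfolding mass_def 1 fourier_0
    by (simp only: of_real_diff of_real_mult of_real_divide of_real_1 of_real_of_nat_eq diff_divide_distrib times_divide_eq_right)
qed

end

text \<open>Because the primitive of the datum is integrable, its L^2 transform agrees almost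
  everywhere with the continuous Fourier integral. Multiplying by i xi recovers the datum off the
  null line xi = 0.\<close>

lemma initial_Uh:
  assumes u0: "u0 \<in> Xs s" "AE z in lborel. u 0 z = u0 z" and w0: "integrable lborel (dxinv u0)"
  shows "AE \<zeta> in lborel. Uh 0 \<zeta> = \<i> * of_real (fst \<zeta>) * fourier (\<lambda>z. complex_of_real (dxinv u0 z)) \<zeta>"
proof -
  note F0 = HsD(1)[OF XsD(1)[OF u0(1)]] and W = XsD(3)[OF u0(1)]
  have "is_FT (\<lambda>z. complex_of_real (u0 z)) (Uh 0)"
  proof (rule is_FT_cong_AE[OF Uh_FT[of 0]])
    show "AE z in lborel. complex_of_real (u 0 z) = complex_of_real (u0 z)" using u0(2) by simp
    show "(\<lambda>z. complex_of_real (u0 z)) \<in> borel_measurable borel" by (rule borel_complex_of_real[OF Xs_borel[OF u0(1) s]])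
    show "Uh 0 \<in> borel_measurable borel" by (rule Uh_borel) simp
  qed auto
  then have 1: "AE \<zeta> in lborel. Uh 0 \<zeta> = fourierL2 u0 \<zeta>" by (rule is_FT_unique[OF _ F0])
  have "is_FT (\<lambda>z. complex_of_real (dxinv u0 z)) (fourier (\<lambda>z. complex_of_real (dxinv u0 z)))"
    by (rule is_FT_L1[OF _ is_FT_L2c(1)[OF W]]) (use w0 in simp)
  from is_FT_unique[OF W this] 1 AE_fst_neq_0 show ?thesis
  proof eventually_elim
    case (elim \<zeta>)
    show ?case unfolding elim(1)[symmetric] elim(2) using elim(3) by simp
  qed
qed

end

section \<open>Weak derivatives, the constant \<open>Mconst\<close> and the essential
  supremum\<close>

lemma wderiv_0_0:
  assumes f: "integrable lborel f"
  shows "wderiv 0 0 f f"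
proof -
  have "integrable lborel (\<lambda>x. indicator K x *\<^sub>R f x)" if "compact K" for K
    by (rule integrable_mult_indicator[OF _ f]) (use borel_compact[OF that] in simp)
  then show ?thesis using f by (auto simp: wderiv_def set_integrable_def)
qed

text \<open>At order zero the chosen weak derivative is the function itself almost everywhere, by
  the fundamental lemma.\<close>

lemma integral_wd_0_0:
  assumes f: "integrable lborel f"
  shows "(LINT z|lborel. wd 0 0 f z) = (LINT z|lborel. f z)"
proof (rule integral_cong_AE)
  have w: "wderiv 0 0 f (wd 0 0 f)" by (rule wd_wderiv[OF wderiv_0_0[OF f]])
  show "wd 0 0 f \<in> borel_measurable lborel" using w by (simp add: wderiv_def)
  show "f \<in> borel_measurable lborel" using f by simp
  show "AE z in lborel. wd 0 0 f z = f z"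
    by (rule wderiv_0_AE_eq[OF w]) (use wderiv_0_0[OF f] in \<open>auto simp: wderiv_def\<close>)
qed

lemma test_fun_pdy_power: "test_fun \<phi> \<Longrightarrow> test_fun ((pdy ^^ j) \<phi>)"
  by (induction j) (simp_all add: test_fun_pd)

lemma wderiv_cong_AE:
  assumes w: "wderiv 0 j f g" and ae: "AE z in lborel. f z = f' z"
    and m: "f \<in> borel_measurable borel" "f' \<in> borel_measurable borel"
  shows "wderiv 0 j f' g"
proof -
  have "(LINT z|lborel. f z * (pdy ^^ j) \<phi> z) = (LINT z|lborel. f' z * (pdy ^^ j) \<phi> z)" if "test_fun \<phi>" for \<phi>
  proof (rule integral_cong_AE)
    note [measurable] = m test_fun_borel[OF test_fun_pdy_power[OF that, of j]]
    show "(\<lambda>z. f z * (pdy ^^ j) \<phi> z) \<in> borel_measurable lborel" "(\<lambda>z. f' z * (pdy ^^ j) \<phi> z) \<in> borel_measurable lborel"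
      by measurable
    show "AE z in lborel. f z * (pdy ^^ j) \<phi> z = f' z * (pdy ^^ j) \<phi> z" using ae by eventually_elim simp
  qed
  then show ?thesis using w unfolding wderiv_def by simp
qed

text \<open>The power of the continuous representative is j times classically differentiable in y,
  so a weak derivative exists and \<open>wd\<close> really selects one; its integral is then
  0.\<close>

lemma integral_wd_power_eq_0:
  assumes f: "f \<in> Xs s" and s: "s \<ge> 3" and p: "p \<ge> 2" and j: "j > 0" "real j + 2 \<le> s"
  shows "(LINT z|lborel. wd 0 j (\<lambda>w. f w ^ (p + 1)) z) = 0"
proof -
  have "ydiff j (\<lambda>z. smoothed f z ^ Suc p)" by (rule ydiff_power[OF ydiff_smoothed[OF XsD(1)[OF f] j(2)]])
  then obtain g where "wderiv 0 j (\<lambda>z. smoothed f z ^ Suc p) g" using ydiff_wderiv by blast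
  then have "wderiv 0 j (\<lambda>w. f w ^ (p + 1)) g"
  proof (rule wderiv_cong_AE)
    show "AE z in lborel. smoothed f z ^ Suc p = f z ^ (p + 1)"
      using AE_eq_smoothed[OF f s] by eventually_elim simp
    show "(\<lambda>z. smoothed f z ^ Suc p) \<in> borel_measurable borel" by (rule borel_measurable_power[OF smoothed_borel[OF f s]])
    show "(\<lambda>w. f w ^ (p + 1)) \<in> borel_measurable borel" by (rule borel_measurable_power[OF Xs_borel[OF f s]])
  qed
  from integral_wderiv_eq_0[OF integrable_power_Xs[OF f s p] j(1) wd_wderiv[OF this]] show ?thesis .
qed

text \<open>Reduces the essential supremum to real bounds \<open>a\<close>. If there is no weak
  derivative or the supremum is infinite, the left-hand side is infinite and nothing is to be
  shown.\<close>

lemma Linf_deriv_geI: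
  assumes "\<And>g a. wderiv l j f g \<Longrightarrow> AE z in lborel. \<bar>g z\<bar> \<le> a \<Longrightarrow> c \<le> a"
  shows "Linf_deriv l j f \<ge> ereal c"
proof (cases "\<exists>g. wderiv l j f g")
  case True
  then have w: "wderiv l j f (wd l j f)" using wd_wderiv by blast
  then have [measurable]: "wd l j f \<in> borel_measurable lborel" by (simp add: wderiv_def)
  define e where "e = esssup lborel (\<lambda>z. ereal \<bar>wd l j f z\<bar>)"
  have ae: "AE z in lborel. ereal \<bar>wd l j f z\<bar> \<le> e" unfolding e_def by (rule esssup_AE)
  have "ereal c \<le> e"
  proof (cases e)
    case (real a)
    then have "AE z in lborel. \<bar>wd l j f z\<bar> \<le> a" using ae by simp
    from assms[OF w this] show ?thesis by (simp add: real)
  next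
    \<comment> \<open>An essential supremum of minus infinity would force a contradiction almost
      everywhere, which a nonzero measure excludes.\<close>
    case MInf
    then have "AE z in (lborel :: (real \<times> real) measure). False" using ae by simp
    then show ?thesis by (simp only: lborel_AE_const)
  qed simp
  then show ?thesis using True by (simp add: Linf_deriv_def e_def)
qed (simp add: Linf_deriv_def)

lemma Linf_deriv_nonneg: "Linf_deriv l j f \<ge> 0"
proof -
  have "Linf_deriv l j f \<ge> ereal 0"
  proof (rule Linf_deriv_geI)
    fix g and a :: real
    assume "AE z in (lborel :: (real \<times> real) measure). \<bar>g z\<bar> \<le> a"
    then have "AE z in (lborel :: (real \<times> real) measure). 0 \<le> a" by eventually_elim linarith
    then show "0 \<le> a" by (simp only: lborel_AE_const)
  qed
  then show ?thesis by (simp only: zero_ereal_def)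
qed

text \<open>Both integrals in \<open>Mconst\<close> are integrals of y-derivatives of order j > 0 of
  integrable functions, the second one at every time separately.\<close>

lemma Mconst_eq_0:
  assumes X: "\<And>t. t \<ge> 0 \<Longrightarrow> u t \<in> Xs s" and s: "s \<ge> 3" and p: "p \<ge> 2" and j: "j > 0" "real j + 2 \<le> s"
    and u0: "integrable lborel (dxinv u0)" "dxinv_dy_L1 j u0"
  shows "Mconst p j u0 u = 0"
proof -
  obtain h where "wderiv 0 j (dxinv u0) h" using u0(2) by (auto simp: dxinv_dy_L1_def)
  from integral_wderiv_eq_0[OF u0(1) j(1) wd_wderiv[OF this]]
  have 1: "(LINT z|lborel. wd 0 j (dxinv u0) z) = 0" .
  have "indicator {0..} t *\<^sub>R (LINT z|lborel. wd 0 j (\<lambda>w. u t w ^ (p + 1)) z) = 0" for t :: real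
  proof (cases "t \<ge> 0")
    case True
    show ?thesis unfolding integral_wd_power_eq_0[OF X[OF True] s p j] by (rule scaleR_zero_right)
  qed simp
  then have 2: "(LBINT t:{0..}. (LINT z|lborel. wd 0 j (\<lambda>w. (u t w) ^ (p + 1)) z)) = 0"
    unfolding set_lebesgue_integral_def by (simp only: integral_zero)
  show ?thesis unfolding Mconst_def 1 2 by simp
qed

text \<open>The denominator 2 pi is the normalisation of the transform at frequency 0.\<close>

lemma (in kp_flow) mass_Mconst:
  assumes u0: "u0 \<in> Xs s" "AE z in lborel. u 0 z = u0 z" and w0: "integrable lborel (dxinv u0)"
  shows "mass (dxinv u0) = complex_of_real (Mconst p 0 u0 u / (2 * pi))"
proof -
  have "indicator {0..} t *\<^sub>R (LINT z|lborel. wd 0 0 (\<lambda>w. u t w ^ (p + 1)) z) = indicator {0..} t *\<^sub>R (LINT z|lborel. u t z ^ (p + 1))" for t :: real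
  proof (cases "t \<ge> 0")
    case True
    show ?thesis unfolding integral_wd_0_0[OF power_integrable[OF True]] ..
  qed simp
  then show ?thesis
    unfolding mass_eq[OF w0 initial_Uh[OF u0 w0]] Mconst_def set_lebesgue_integral_def integral_wd_0_0[OF w0] by (simp only:)
qed

theorem theorem1p2:
  fixes p :: nat and \<epsilon> \<nu> s :: real
  assumes "p \<ge> 2" and "\<epsilon> = -1 \<or> \<epsilon> = 1" and "\<nu> > 0" and "s \<ge> 3"
  shows "\<exists>\<delta>>0. \<forall>(u0::r2fun) (m::nat) (j::nat) (u::real \<Rightarrow> r2fun).
     u0 \<in> Xs s \<and> integrable lborel (dxinv u0) \<and>
     m \<ge> 3 \<and> dxinv_dy_L1 m u0 \<and>
     Hs_norm 1 u0 + L2norm (fmult (\<lambda>\<zeta>. (\<i> * complex_of_real (fst \<zeta>)) ^ 2) u0)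
       + L2norm (fmult (\<lambda>\<zeta>. (\<i> * complex_of_real (snd \<zeta>)) / (\<i> * complex_of_real (fst \<zeta>))) u0) < \<delta> \<and>
     j \<le> min (nat \<lfloor>s\<rfloor>) m - 3 \<and> dxinv_dy_L1 j u0 \<and>
     is_solution p \<epsilon> \<nu> s u0 u
     \<longrightarrow> (\<forall>l::nat. \<exists>C>0. \<exists>T>0. \<forall>t\<ge>T.
           Linf_deriv l j (u t) \<ge> ereal (C * \<bar>Mconst p j u0 u\<bar> * t powr (- 7/4 - real l / 2)))"
proof -
  have main: "\<exists>C>0. \<exists>T>0. \<forall>t\<ge>T. Linf_deriv l j (u t) \<ge> ereal (C * \<bar>Mconst p j u0 u\<bar> * t powr (- 7/4 - real l / 2))"
    if u0: "u0 \<in> Xs s" and w0: "integrable lborel (dxinv u0)" and j: "j \<le> min (nat \<lfloor>s\<rfloor>) m - 3" "dxinv_dy_L1 j u0"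
      and sol: "is_solution p \<epsilon> \<nu> s u0 u" for u0 :: r2fun and m j l and u :: "real \<Rightarrow> r2fun"
  proof (cases "Mconst p j u0 u = 0")
    \<comment> \<open>Only non-negativity of the norm is asserted here, so 1 serves as both
      constants.\<close>
    case True
    have "Linf_deriv l j (u t) \<ge> ereal (1 * \<bar>Mconst p j u0 u\<bar> * t powr (- 7/4 - real l / 2))" for t
      using Linf_deriv_nonneg[of l j "u t"] by (simp add: True zero_ereal_def[symmetric])
    note le = this
    show ?thesis
    proof (intro exI conjI allI impI)
      show "(0::real) < 1" "(0::real) < 1" by (rule zero_less_one)+
      fix t show "Linf_deriv l j (u t) \<ge> ereal (1 * \<bar>Mconst p j u0 u\<bar> * t powr (- 7/4 - real l / 2))" by (rule le)
    qed
  next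
    case False
    note S = sol[unfolded is_solution_def]
    note ini = S[THEN conjunct1]
    have X: "u t \<in> Xs s" if "t \<ge> 0" for t using S[THEN conjunct2, THEN conjunct1] that by simp
    obtain B where B: "\<And>t. t \<ge> 0 \<Longrightarrow> Xs_norm s (u t) \<le> B" using S[THEN conjunct2, THEN conjunct2, THEN conjunct1] by metis
    have HB: "Hs_norm s (u t) \<le> B" if "t \<ge> 0" for t
      using B[OF that] Hs_norm_nonneg[of s "dxinv (u t)"] by (simp add: Xs_norm_def)
    note fin = S[THEN conjunct2, THEN conjunct2, THEN conjunct2, THEN conjunct2, THEN conjunct1]
    note D = S[THEN conjunct2, THEN conjunct2, THEN conjunct2, THEN conjunct2, THEN conjunct2, rule_format]
    interpret kp_flow p \<epsilon> \<nu> s B u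
      by (rule kp_flow.intro; rule assms(1) assms(3) assms(4) X HB D fin; assumption?)
    have "j = 0"
    proof (rule ccontr)
      assume j0: "j \<noteq> 0"
      \<comment> \<open>The subtraction of 3 is truncated, so this inequality depends on j being
        nonzero.\<close>
      then have "j + 3 \<le> nat \<lfloor>s\<rfloor>" using j(1) by linarith
      then have "real (j + 3) \<le> real (nat \<lfloor>s\<rfloor>)" by (rule of_nat_mono)
      moreover have "real (nat \<lfloor>s\<rfloor>) \<le> s" by (rule of_nat_floor) (use assms(4) in simp)
      ultimately have js: "real j + 2 \<le> s" by simp
      have "Mconst p j u0 u = 0"
        by (rule Mconst_eq_0[OF _ assms(4) assms(1) _ js w0 j(2)]) (rule X, assumption, use j0 in simp)
      with False show False ..
    qed
    have "mass (dxinv u0) \<noteq> 0" unfolding mass_Mconst[OF u0 ini w0] using False \<open>j = 0\<close> by simp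
    from lower_bound_of_mass[OF w0 initial_Uh[OF u0 ini w0] this, of l]
    obtain C where C: "C > 0 \<and> (\<exists>T>0. (\<forall>t\<ge>T. \<forall>g a. wderiv l 0 (u t) g \<longrightarrow> (AE z in lborel. \<bar>g z\<bar> \<le> a) \<longrightarrow> C * t powr (- 7/4 - real l / 2) \<le> a))" ..
    from C[THEN conjunct2] obtain T where T: "T > 0 \<and> (\<forall>t\<ge>T. \<forall>g a. wderiv l 0 (u t) g \<longrightarrow> (AE z in lborel. \<bar>g z\<bar> \<le> a) \<longrightarrow> C * t powr (- 7/4 - real l / 2) \<le> a)" ..
    note le = T[THEN conjunct2]
    let ?M = "\<bar>Mconst p j u0 u\<bar>"
    have M: "?M > 0" using False by simp
    \<comment> \<open>The bound obtained from the mass has no explicit factor |Mconst|; dividing its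
      constant by this positive number introduces the factor.\<close>
    have e: "C / ?M * ?M = C" using M by simp
    have ge: "Linf_deriv l j (u t) \<ge> ereal (C / ?M * ?M * t powr (- 7/4 - real l / 2))" if t: "t \<ge> T" for t
    proof -
      have "Linf_deriv l 0 (u t) \<ge> ereal (C * t powr (- 7/4 - real l / 2))"
        by (rule Linf_deriv_geI) (rule le[rule_format, OF t])
      then show ?thesis unfolding e by (simp only: \<open>j = 0\<close>)
    qed
    show ?thesis
    proof (intro exI conjI allI impI)
      show "0 < C / ?M" using C[THEN conjunct1] M by (rule divide_pos_pos)
      show "0 < T" by (rule T[THEN conjunct1])
      fix t assume "T \<le> t"
      then show "Linf_deriv l j (u t) \<ge> ereal (C / ?M * ?M * t powr (- 7/4 - real l / 2))" by (rule ge)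
    qed
  qed
  show ?thesis
  proof (rule exI[of _ 1], intro conjI allI impI, goal_cases)
    case 1
    show ?case by simp
  next
    case (2 u0 m j u l)
    from 2 have "u0 \<in> Xs s" "integrable lborel (dxinv u0)" "j \<le> min (nat \<lfloor>s\<rfloor>) m - 3" "dxinv_dy_L1 j u0" "is_solution p \<epsilon> \<nu> s u0 u"
      by (simp_all only: simp_thms)
    then show ?case by (rule main)
  qed
qed

end
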